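(* Let $\mu\ge 2$, let $\hat v\in L^\infty_\mu(\mathbb R^3)$ and suppose $$\|\hat v\|_\mu\le C<\frac{1}{c_1(\mu)+8c_6(\mu)} .$$ Assume also that $\hat v$ is continuous on $\mathbb R^3$. Let $\gamma$ be a given measurable (e.g. piecewise continuous) map $\mathbb R^3\to\mathbb S^2$ with $\gamma(p)\cdot p=0$ for all $p$, and let $$R(p)=H\Big(\tfrac p2+\tfrac{i|p|}2\gamma(p),\,p\Big),\qquad p\in\mathbb R^3 .$$ Then $$R\in L^\infty_\mu(\mathbb R^3),\qquad \|R\|_\mu\le\frac{C}{1-c_1(\mu)C},\qquad( * )$$ and $R$ uniquely determines $\hat v$ via the following reconstruction procedure $R\to H\to\hat v$. First, with $r=2C/(1-c_1(\mu)C)$, the function $H(\lambda,p)=H(k(\lambda,p),p)$ is found from $R$ as the unique solution, in $\{U\in L^\infty_\mu((\mathbb C\setminus 0)\times(\mathbb R^3\setminus\mathcal L_\nu)):\ |||U|||_\mu\le r\}$, of the nonlinear integral equation $$H(\lambda,p)=R(p)+M(H)(\lambda,p),\qquad \lambda\in\mathbb C\setminus 0,\ p\in\mathbb R^3\setminus\mathcal L_\nu,$$ this equation being solved by the method of successive approximations; second, $\hat v$ is found from $H$ by $$\hat v(p)=\lim_{\lambda\to\infty}H(\lambda,p)=R(p)-N(H)(\lambda_0(p),p),\qquad p\in\mathbb R^3\setminus\mathcal L_\nu .$$ In addition, if $R_{appr}$ is an arbitrary approximation to $R$ which also satisfies $( * )$ (that is, $R_{appr}\in L^\infty_\mu(\mathbb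 R^3)$, $\|R_{appr}\|_\mu\le C/(1-c_1(\mu)C)$), and $\hat v_{appr}$ is determined from $R_{appr}$ via the same procedure (with $R$ replaced by $R_{appr}$ and $H$ replaced by the corresponding solution $H_{appr}$), then $$\|\hat v-\hat v_{appr}\|_\mu\le\frac{1-c_1(\mu)C}{1-(c_1(\mu)+8c_6(\mu))C}\,\|R-R_{appr}\|_\mu .$$
   Context: Conventions: for $a,b\in\mathbb C^3$, $a\cdot b=\sum_j a_jb_j$ (no conjugation), $a^2=a\cdot a$; $\times$ is the vector product. $\hat v(p)=(2\pi)^{-3}\int_{\mathbb R^3}e^{ip\cdot x}v(x)\,dx$ is the Fourier transform of the potential $v$ on $\mathbb R^3$. $L^\infty_\mu(\mathbb R^3)=\{u\in L^\infty(\mathbb R^3):\|u\|_\mu<\infty\}$, $\|u\|_\mu=\operatorname{ess\,sup}_{p}(1+|p|)^\mu|u(p)|$. $\Sigma=\{k\in\mathbb C^3:k^2=0\}$. For $k\in\Sigma$ let $(A(k)U)(p)=\int_{\mathbb R^3}\frac{\hat v(p+\xi)U(-\xi)}{\xi^2+2k\cdot\xi}d\xi$. The constant $c_1(\mu)>0$ is such that $\|A(k)U\|_\mu\le c_1(\mu)\|\hat v\|_\mu\|U\|_\mu$ for all $k\in\Sigma$, $\hat v,U\in L^\infty_\mu(\mathbb R^3)$. The Faddeev function $H(k,p)$, $k\in\Sigma$, $p\in\mathbb R^3$, is defined by requiring that $H(k,\cdot)\in L^\infty_\mu(\mathbb R^3)$ is the (unique when $c_1(\mu)\|\hat v\|_\mu<1$)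 solution of $$H(k,p)=\hat v(p)-\int_{\mathbb R^3}\frac{\hat v(p+\xi)H(k,-\xi)}{\xi^2+2k\cdot\xi}\,d\xi .$$ Coordinates: fix $\nu\in\mathbb S^2$, $\mathcal L_\nu=\{t\nu:t\in\mathbb R\}$, $\Omega=\{(k,p)\in\mathbb C^3\times\mathbb R^3: k^2=0,\ p^2=2k\cdot p\}$, $\Omega_\nu=\{(k,p)\in\Omega:p\notin\mathcal L_\nu\}$. Fix smooth $\theta,\omega:\mathbb R^3\setminus\mathcal L_\nu\to\mathbb S^2$ with $\theta(p)\cdot p=0$ and $\omega(p)=p\times\theta(p)/|p|$. For $\lambda\in\mathbb C\setminus 0$, $p\in\mathbb R^3\setminus\mathcal L_\nu$, $$k(\lambda,p)=\tfrac{i|p|}4\big(\lambda+\tfrac1\lambda\big)\theta(p)+\tfrac{|p|}4\big(\lambda-\tfrac1\lambda\big)\omega(p)+\tfrac p2 ;$$ the map $(\lambda,p)\mapsto(k(\lambda,p),p)$ is a bijection onto $\Omega_\nu$ with inverse $(k,p)\mapsto(\lambda(k,p),p)$, $\lambda(k,p)=\frac{2k\cdot(\theta(p)+i\omega(p))}{i|p|}$. Let $\lambda_0(p)=\gamma(p)\cdot(\theta(p)+i\omega(p))$, so that $|\lambda_0(p)|=1$ and $k(\lambda_0(p),p)=\frac p2+\frac{i|p|}2\gamma(p)$. For $\varphi\in[-\pi,\pi]$, $\xi(\lambda,p,\varphi)=\mathrm{Re}\,k(\lambda,p)(\cos\varphi-1)+k^\perp(\lambda,p)\sin\varphi$, $k^\perp(\lambda,p)=\frac{\mathrm{Im}\,k(\lambda,p)\times\mathrm{Re}\,k(\lambda,p)}{|\mathrm{Im}\,k(\lambda,p)|}$.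 For functions $U_1',U_2'$ on $\Omega$ put $$\{U_1',U_2'\}(\lambda,p)=-\frac\pi4\int_{-\pi}^{\pi}\Big(\frac{|p|}2\frac{|\lambda|^2-1}{\bar\lambda|\lambda|}(\cos\varphi-1)-\frac{|p|}{\bar\lambda}\sin\varphi\Big)U_1'(k,-\xi)\,U_2'(k+\xi,p+\xi)\,d\varphi,$$ with $k=k(\lambda,p)$, $\xi=\xi(\lambda,p,\varphi)$. For functions $U_1,U_2,U$ on $(\mathbb C\setminus0)\times(\mathbb R^3\setminus\mathcal L_\nu)$ put $(U_1,U_2)=\{U_1',U_2'\}$ with $U_j'(k,p)=U_j(\lambda(k,p),p)$ on $\Omega_\nu$, and $$I(U_1,U_2)(\lambda,p)=-\frac1\pi\int_{\mathbb C}(U_1,U_2)(\zeta,p)\frac{d\mathrm{Re}\zeta\,d\mathrm{Im}\zeta}{\zeta-\lambda},\quad N(U)=I(U,U),\quad M(U)(\lambda,p)=N(U)(\lambda,p)-N(U)(\lambda_0(p),p).$$ $L^\infty_\mu((\mathbb C\setminus0)\times(\mathbb R^3\setminus\mathcal L_\nu))$ is the set of $U\in L^\infty$ with $|||U|||_\mu=\operatorname{ess\,sup}_{\lambda,p}(1+|p|)^\mu|U(\lambda,p)|<\infty$. The constant $c_6(\mu)>0$ is such that $|||I(U_1,U_2)|||_\mu\le c_6(\mu)|||U_1|||_\mu|||U_2|||_\mu$ for all $U_1,U_2$ in this space. Identities between $L^\infty$ functions are understood almost everywhere. Successive approximations: iterating $U\mapsto R+M(U)$ starting from $U=0$. *)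

theory Defs
  imports "HOL-Analysis.Analysis" "HOL-Probability.Essential_Supremum"
begin

section \<open>Vectors in complex three-space\<close>

definition cvec :: "real^3 \<Rightarrow> complex^3"
  where "cvec x = (\<chi> j. complex_of_real (x $ j))"

definition Re_vec :: "complex^3 \<Rightarrow> real^3"
  where "Re_vec k = (\<chi> j. Re (k $ j))"

definition Im_vec :: "complex^3 \<Rightarrow> real^3"
  where "Im_vec k = (\<chi> j. Im (k $ j))"

text \<open>The inner product of the type \<^typ>\<open>complex^3\<close> is real valued and involves a conjugation.
  The complex bilinear dot product is \<^const>\<open>scalar_product\<close>.\<close>

definition Sigma_var :: "(complex^3) set"
  where "Sigma_var = {k. scalar_product k k = 0}"


section \<open>Weighted spaces of essentially bounded functions\<close>

text \<open>The norms take values in \<^typ>\<open>ereal\<close>; they are infinite on functions that are not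
  essentially bounded (and if the weighted modulus is not measurable, since then
  \<^const>\<open>esssup\<close> is \<^term>\<open>top\<close>). Elements of the spaces are represented by functions, not by
  classes modulo null sets.\<close>

definition wnorm :: "real \<Rightarrow> (real^3 \<Rightarrow> complex) \<Rightarrow> ereal"
  where "wnorm \<mu> u = esssup lebesgue (\<lambda>p. ereal ((1 + norm p) powr \<mu> * norm (u p)))"

definition Linf :: "real \<Rightarrow> (real^3 \<Rightarrow> complex) set"
  where "Linf \<mu> = {u \<in> borel_measurable lebesgue. wnorm \<mu> u < \<infinity>}"

definition axis_line :: "real^3 \<Rightarrow> (real^3) set"
  where "axis_line \<nu> = range (\<lambda>t. t *\<^sub>R \<nu>)"

definition LP_dom :: "real^3 \<Rightarrow> (complex \<times> (real^3)) set"
  where "LP_dom \<nu> = {(l::complex, p::real^3). l \<noteq> 0 \<and> p \<notin> axis_line \<nu>}"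

definition wnorm2 :: "real \<Rightarrow> real^3 \<Rightarrow> (complex \<times> (real^3) \<Rightarrow> complex) \<Rightarrow> ereal"
  where "wnorm2 \<mu> \<nu> U =
    esssup (lebesgue_on (LP_dom \<nu>)) (\<lambda>(l::complex, p::real^3). ereal ((1 + norm p) powr \<mu> * norm (U (l, p))))"

definition Linf2 :: "real \<Rightarrow> real^3 \<Rightarrow> (complex \<times> (real^3) \<Rightarrow> complex) set"
  where "Linf2 \<mu> \<nu> = {U \<in> borel_measurable (lebesgue_on (LP_dom \<nu>)). wnorm2 \<mu> \<nu> U < \<infinity>}"


section \<open>The Faddeev function\<close>

definition A_op :: "(real^3 \<Rightarrow> complex) \<Rightarrow> complex^3 \<Rightarrow> (real^3 \<Rightarrow> complex) \<Rightarrow> real^3 \<Rightarrow> complex"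
  where "A_op v k U p =
    (LINT \<xi>|lebesgue. v (p + \<xi>) * U (- \<xi>) / (complex_of_real (\<xi> \<bullet> \<xi>) + 2 * scalar_product k (cvec \<xi>)))"

text \<open>Here \<open>v\<close> stands for the Fourier transform of the potential. The integral depends only on the
  class of \<open>h\<close> modulo null sets. Requiring the equation at every \<open>p\<close>, and not just almost
  everywhere, therefore selects one representative of the solution; for continuous \<open>v\<close> it is the
  continuous one. This gives a meaning to the values of the Faddeev function on the null set that
  enters into \<open>R_data\<close> below.\<close>

definition Faddeev :: "real \<Rightarrow> (real^3 \<Rightarrow> complex) \<Rightarrow> complex^3 \<Rightarrow> real^3 \<Rightarrow> complex"
  where "Faddeev \<mu> v k = (THE h. h \<in> Linf \<mu> \<and> (\<forall>p. h p = v p - A_op v k h p))"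

definition R_data ::
    "real \<Rightarrow> (real^3 \<Rightarrow> real^3) \<Rightarrow> (real^3 \<Rightarrow> complex) \<Rightarrow> real^3 \<Rightarrow> complex"
  where "R_data \<mu> \<gamma> v p =
    Faddeev \<mu> v (cvec ((1/2) *\<^sub>R p) + (\<i> * norm p / 2) *s cvec (\<gamma> p)) p"


section \<open>Coordinates on the zero-energy variety\<close>

text \<open>Smoothness on an open set.\<close>

primrec times_diff_on ::
    "nat \<Rightarrow> ('a::real_normed_vector \<Rightarrow> 'b::real_normed_vector) \<Rightarrow> 'a set \<Rightarrow> bool"
  where
    "times_diff_on 0 f S \<longleftrightarrow> continuous_on S f"
  | "times_diff_on (Suc n) f S \<longleftrightarrow>
       (\<forall>x\<in>S. f differentiable (at x)) \<and> (\<forall>v. times_diff_on n (\<lambda>x. frechet_derivative f (at x) v) S)"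

definition smooth_map_on ::
    "('a::real_normed_vector \<Rightarrow> 'b::real_normed_vector) \<Rightarrow> 'a set \<Rightarrow> bool"
  where "smooth_map_on f S \<longleftrightarrow> (\<forall>n. times_diff_on n f S)"

text \<open>The vector field \<open>\<theta>\<close> is only meaningful off the axis, and so is everything that depends
  on it.\<close>

definition omega :: "(real^3 \<Rightarrow> real^3) \<Rightarrow> real^3 \<Rightarrow> real^3"
  where "omega \<theta> p = (1 / norm p) *\<^sub>R cross3 p (\<theta> p)"

definition theta_i_omega :: "(real^3 \<Rightarrow> real^3) \<Rightarrow> real^3 \<Rightarrow> complex^3"
  where "theta_i_omega \<theta> p = cvec (\<theta> p) + \<i> *s cvec (omega \<theta> p)"

definition k_of :: "(real^3 \<Rightarrow> real^3) \<Rightarrow> complex \<Rightarrow> real^3 \<Rightarrow> complex^3"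
  where "k_of \<theta> l p =
    (\<i> * complex_of_real (norm p) / 4 * (l + 1 / l)) *s cvec (\<theta> p)
    + (complex_of_real (norm p) / 4 * (l - 1 / l)) *s cvec (omega \<theta> p)
    + cvec ((1/2) *\<^sub>R p)"

definition lam_of :: "(real^3 \<Rightarrow> real^3) \<Rightarrow> complex^3 \<Rightarrow> real^3 \<Rightarrow> complex"
  where "lam_of \<theta> k p = 2 * scalar_product k (theta_i_omega \<theta> p) / (\<i> * norm p)"

definition lam0 :: "(real^3 \<Rightarrow> real^3) \<Rightarrow> (real^3 \<Rightarrow> real^3) \<Rightarrow> real^3 \<Rightarrow> complex"
  where "lam0 \<theta> \<gamma> p = scalar_product (cvec (\<gamma> p)) (theta_i_omega \<theta> p)"


section \<open>The bilinear forms and the nonlinear integral operator\<close>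

definition k_perp :: "(real^3 \<Rightarrow> real^3) \<Rightarrow> complex \<Rightarrow> real^3 \<Rightarrow> real^3"
  where "k_perp \<theta> l p =
    (1 / norm (Im_vec (k_of \<theta> l p))) *\<^sub>R cross3 (Im_vec (k_of \<theta> l p)) (Re_vec (k_of \<theta> l p))"

definition xi_of :: "(real^3 \<Rightarrow> real^3) \<Rightarrow> complex \<Rightarrow> real^3 \<Rightarrow> real \<Rightarrow> real^3"
  where "xi_of \<theta> l p \<phi> = (cos \<phi> - 1) *\<^sub>R Re_vec (k_of \<theta> l p) + sin \<phi> *\<^sub>R k_perp \<theta> l p"

definition brace ::
    "(real^3 \<Rightarrow> real^3) \<Rightarrow> (complex^3 \<Rightarrow> real^3 \<Rightarrow> complex) \<Rightarrow> (complex^3 \<Rightarrow> real^3 \<Rightarrow> complex)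
      \<Rightarrow> complex \<times> (real^3) \<Rightarrow> complex"
  where "brace \<theta> U\<^sub>1 U\<^sub>2 = (\<lambda>(l::complex, p::real^3).
    - (pi / 4) * (LINT \<phi>:{-pi..pi}|lebesgue.
        (norm p / 2 * ((norm l)\<^sup>2 - 1) / (cnj l * norm l) * (cos \<phi> - 1) - norm p / cnj l * sin \<phi>)
        * U\<^sub>1 (k_of \<theta> l p) (- xi_of \<theta> l p \<phi>)
        * U\<^sub>2 (k_of \<theta> l p + cvec (xi_of \<theta> l p \<phi>)) (p + xi_of \<theta> l p \<phi>)))"

text \<open>The functions \<open>U\<^sub>j'\<close> are given by \<open>\<lambda>k p. U\<^sub>j (lam_of \<theta> k p, p)\<close>. This is
  meaningful only for \<open>p\<close> off the axis, but the circles over which \<^const>\<open>brace\<close> integrates meet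
  the axis in at most two points.\<close>

definition paren ::
    "(real^3 \<Rightarrow> real^3) \<Rightarrow> (complex \<times> (real^3) \<Rightarrow> complex) \<Rightarrow> (complex \<times> (real^3) \<Rightarrow> complex)
      \<Rightarrow> complex \<times> (real^3) \<Rightarrow> complex"
  where "paren \<theta> U\<^sub>1 U\<^sub>2 = brace \<theta> (\<lambda>k p. U\<^sub>1 (lam_of \<theta> k p, p)) (\<lambda>k p. U\<^sub>2 (lam_of \<theta> k p, p))"

definition I_op ::
    "(real^3 \<Rightarrow> real^3) \<Rightarrow> (complex \<times> (real^3) \<Rightarrow> complex) \<Rightarrow> (complex \<times> (real^3) \<Rightarrow> complex)
      \<Rightarrow> complex \<times> (real^3) \<Rightarrow> complex"
  where "I_op \<theta> U\<^sub>1 U\<^sub>2 = (\<lambda>(l::complex, p::real^3).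
    - (1 / pi) * (LINT \<zeta>::complex|lebesgue. paren \<theta> U\<^sub>1 U\<^sub>2 (\<zeta>, p) / (\<zeta> - l)))"

definition N_op ::
    "(real^3 \<Rightarrow> real^3) \<Rightarrow> (complex \<times> (real^3) \<Rightarrow> complex) \<Rightarrow> complex \<times> (real^3) \<Rightarrow> complex"
  where "N_op \<theta> U = I_op \<theta> U U"

definition M_op ::
    "(real^3 \<Rightarrow> real^3) \<Rightarrow> (real^3 \<Rightarrow> real^3) \<Rightarrow> (complex \<times> (real^3) \<Rightarrow> complex)
      \<Rightarrow> complex \<times> (real^3) \<Rightarrow> complex"
  where "M_op \<theta> \<gamma> U = (\<lambda>(l::complex, p::real^3). N_op \<theta> U (l, p) - N_op \<theta> U (lam0 \<theta> \<gamma> p, p))"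


section \<open>The reconstruction procedure\<close>

definition eq_rhs ::
    "(real^3 \<Rightarrow> real^3) \<Rightarrow> (real^3 \<Rightarrow> real^3) \<Rightarrow> (real^3 \<Rightarrow> complex)
      \<Rightarrow> (complex \<times> (real^3) \<Rightarrow> complex) \<Rightarrow> complex \<times> (real^3) \<Rightarrow> complex"
  where "eq_rhs \<theta> \<gamma> R U = (\<lambda>(l::complex, p::real^3). R p + M_op \<theta> \<gamma> U (l, p))"

definition is_solution ::
    "real \<Rightarrow> real^3 \<Rightarrow> (real^3 \<Rightarrow> real^3) \<Rightarrow> (real^3 \<Rightarrow> real^3) \<Rightarrow> real \<Rightarrow> (real^3 \<Rightarrow> complex)
      \<Rightarrow> (complex \<times> (real^3) \<Rightarrow> complex) \<Rightarrow> bool"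
  where "is_solution \<mu> \<nu> \<theta> \<gamma> r R U \<longleftrightarrow>
    U \<in> Linf2 \<mu> \<nu> \<and> wnorm2 \<mu> \<nu> U \<le> ereal r \<and>
    (AE x in lebesgue_on (LP_dom \<nu>). U x = eq_rhs \<theta> \<gamma> R U x)"

definition is_unique_solution ::
    "real \<Rightarrow> real^3 \<Rightarrow> (real^3 \<Rightarrow> real^3) \<Rightarrow> (real^3 \<Rightarrow> real^3) \<Rightarrow> real \<Rightarrow> (real^3 \<Rightarrow> complex)
      \<Rightarrow> (complex \<times> (real^3) \<Rightarrow> complex) \<Rightarrow> bool"
  where "is_unique_solution \<mu> \<nu> \<theta> \<gamma> r R U \<longleftrightarrow>
    is_solution \<mu> \<nu> \<theta> \<gamma> r R U \<and>
    (\<forall>V. is_solution \<mu> \<nu> \<theta> \<gamma> r R V \<longrightarrow> (AE x in lebesgue_on (LP_dom \<nu>). V x = U x))"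

definition successive_approx ::
    "(real^3 \<Rightarrow> real^3) \<Rightarrow> (real^3 \<Rightarrow> real^3) \<Rightarrow> (real^3 \<Rightarrow> complex) \<Rightarrow> nat
      \<Rightarrow> complex \<times> (real^3) \<Rightarrow> complex"
  where "successive_approx \<theta> \<gamma> R n = (eq_rhs \<theta> \<gamma> R ^^ n) (\<lambda>_. 0)"

definition approx_converges ::
    "real \<Rightarrow> real^3 \<Rightarrow> (real^3 \<Rightarrow> real^3) \<Rightarrow> (real^3 \<Rightarrow> real^3) \<Rightarrow> (real^3 \<Rightarrow> complex)
      \<Rightarrow> (complex \<times> (real^3) \<Rightarrow> complex) \<Rightarrow> bool"
  where "approx_converges \<mu> \<nu> \<theta> \<gamma> R U \<longleftrightarrow>
    (\<forall>n. successive_approx \<theta> \<gamma> R n \<in> Linf2 \<mu> \<nu>) \<and>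
    (\<lambda>n. wnorm2 \<mu> \<nu> (\<lambda>x. successive_approx \<theta> \<gamma> R n x - U x)) \<longlonglongrightarrow> 0"

definition v_rec ::
    "(real^3 \<Rightarrow> real^3) \<Rightarrow> (real^3 \<Rightarrow> real^3) \<Rightarrow> (real^3 \<Rightarrow> complex)
      \<Rightarrow> (complex \<times> (real^3) \<Rightarrow> complex) \<Rightarrow> real^3 \<Rightarrow> complex"
  where "v_rec \<theta> \<gamma> R U p = R p - N_op \<theta> U (lam0 \<theta> \<gamma> p, p)"

text \<open>The limit at infinity of an element of \<^const>\<open>Linf2\<close>. As such an element is only determined
  up to null sets, the limit is essential: for almost every \<open>p\<close>, a null set of values of \<open>l\<close> may
  be discarded.\<close>

definition has_ess_limit ::
    "(complex \<times> (real^3) \<Rightarrow> complex) \<Rightarrow> (real^3 \<Rightarrow> complex) \<Rightarrow> bool"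
  where "has_ess_limit U w \<longleftrightarrow>
    (AE p in lebesgue. ((\<lambda>l::complex. U (l, p)) \<longlongrightarrow> w p) (inf at_infinity (ae_filter lebesgue)))"

end

theory Submission
  imports Defs
begin

text \<open>Fix \<open>p\<close> off the axis. The points \<open>k\<close> with \<open>k\<^sup>2 = 0\<close> and \<open>p\<^sup>2 = 2 k \<cdot> p\<close> form a punctured \<open>\<lambda>\<close>-plane, and a
  generic \<open>\<xi>\<close> lies on the circles \<open>\<xi>(\<zeta>, p, \<cdot>)\<close> of exactly two parameters \<open>\<zeta>\<close>. These are the two zeros of the
  symbol \<open>\<xi>\<^sup>2 + 2 k(\<lambda>, p) \<cdot> \<xi>\<close> as a function of \<open>\<lambda>\<close>, so that a partial fraction decomposition turns
  \<open>\<integral> F(\<xi>) / (\<xi>\<^sup>2 + 2 k(\<lambda>, p) \<cdot> \<xi>) d\<xi>\<close> into a Cauchy transform over \<open>(\<zeta>, \<phi>)\<close>. Applied to the terms of the Neumann series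
  of the Faddeev function this gives \<open>H(\<lambda>, p) = v(p) + N(H)(\<lambda>, p)\<close> for every \<open>\<lambda> \<noteq> 0\<close>, which contains both the
  behaviour at infinity and the nonlinear equation. The Cauchy transforms are continuous in \<open>\<lambda>\<close>, and
  therefore the bound with \<open>c\<^sub>6\<close>, which is only given almost everywhere, holds at every \<open>\<lambda>\<close> and in particular
  on the null set \<open>\<lambda> = \<lambda>\<^sub>0(p)\<close>. Hence \<open>U \<mapsto> R + M(U)\<close> is a contraction of the ball of radius \<open>r\<close> with constant
  \<open>4 c\<^sub>6 r < 1\<close>; existence, uniqueness and the stability estimate follow.\<close>

section \<open>Substitution and signed polar coordinates\<close>

text \<open>Nothing is differentiated in conj(\<lambda>) and no asymptotics of H are assumed: the
  d-bar equation is proved directly in integrated form, one Neumann term at a time. The term of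
  index n + 1 is the sum over j <= n of the Cauchy transforms of (term j at k + \<xi>) times (term n
  - j at k). The induction rests on 1/(z' - l) - 1/(z' - z) = (l - z) / ((z' - l) (z' - z)), on
  Fubini, and on the fact that the symbol of k + \<xi> is a translate of the symbol of k when \<xi>
  is a zero of the latter. The integrals converge absolutely because the kernel decays like 1 / (1 +
  |\<zeta>|^2) at the price of a factor (1 + |\<xi>|)^2, for which \<mu> >= 2 pays. The other
  obstacle is that functions are known only up to null sets, whereas the quadratic form samples them
  along circles; the same change of variables shows that for almost every p these samples avoid a
  given null set. With A = \<open>C / (1 - c\<^sub>1 * C)\<close> and r = 2 A the condition on C
  says exactly \<open>8 * c\<^sub>6 * A < 1\<close>.\<close>

lemma SUP_mult_indicator_ennreal:
  "(SUP n. c * indicator (A n) x) = (c :: ennreal) * indicator (\<Union>n. A n) x"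
proof (cases "x \<in> (\<Union>n. A n)")
  case True
  then obtain n where n: "x \<in> A n" by auto
  have "(SUP n. c * indicator (A n) x) = c"
    by (rule antisym) (use n in \<open>auto intro!: SUP_least SUP_upper2[of n] split: split_indicator\<close>)
  then show ?thesis using True by simp
qed auto

lemma indicator_leI:
  "(x \<in> A \<Longrightarrow> x \<in> B) \<Longrightarrow> indicator A x \<le> (indicator B x :: ennreal)"
  by (auto simp: indicator_def)

text \<open>The substitution rule for compact intervals is applied on each
  \<open>{a n..b n}\<close>. The images \<open>{g (a n)..g (b n)}\<close> grow with n because g is
  monotone on S, and they fill the line by the two limit hypotheses, so that monotone convergence
  applies on both sides.\<close>

lemma nn_integral_substitution_exhaustion:
  fixes f :: "real \<Rightarrow> ennreal" and g g' :: "real \<Rightarrow> real" and a b :: "nat \<Rightarrow> real"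
  assumes f [measurable]: "f \<in> borel_measurable borel"
    and deriv: "\<And>x. x \<in> S \<Longrightarrow> (g has_real_derivative g' x) (at x)"
    and cont: "continuous_on S g'"
    and nonneg: "\<And>x. x \<in> S \<Longrightarrow> g' x \<ge> 0"
    and ab: "\<And>n. a n < b n"
    and dec: "decseq a" and inc: "incseq b"
    and S: "S = (\<Union>n. {a n..b n})"
    and lim_a: "filterlim (\<lambda>n. g (a n)) at_bot sequentially"
    and lim_b: "filterlim (\<lambda>n. g (b n)) at_top sequentially"
    and g [measurable]: "g \<in> borel_measurable borel" "g' \<in> borel_measurable borel"
  shows "(\<integral>\<^sup>+x. f x \<partial>lborel) = (\<integral>\<^sup>+x. f (g x) * ennreal (g' x) * indicator S x \<partial>lborel)"
proof -
  have sub: "{a n..b n} \<subseteq> S" for n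
    using S by auto
  have step: "(\<integral>\<^sup>+x. f x * indicator {g (a n)..g (b n)} x \<partial>lborel) =
      (\<integral>\<^sup>+x. f (g x) * ennreal (g' x) * indicator {a n..b n} x \<partial>lborel)" for n
    by (rule nn_integral_substitution_aux)
      (use sub[of n] deriv nonneg ab cont in \<open>auto intro: continuous_on_subset\<close>)
  have mono_ab: "{a m..b m} \<subseteq> {a n..b n}" if "m \<le> n" for m n
    using dec inc that by (auto simp: decseq_def incseq_def intro: order_trans)
  have g_mono: "g x \<le> g y" if "x \<le> y" "{x..y} \<subseteq> S" for x y
    using that deriv nonneg
    by (intro deriv_nonneg_imp_mono[of x y g g']) auto
  have mono_g: "{g (a m)..g (b m)} \<subseteq> {g (a n)..g (b n)}" if "m \<le> n" for m n
  proof -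
    have "a n \<le> a m" "b m \<le> b n"
      using dec inc that by (auto simp: decseq_def incseq_def)
    then have "g (a n) \<le> g (a m)" "g (b m) \<le> g (b n)"
      using sub[of n] ab[of m] by (auto intro!: g_mono)
    then show ?thesis
      by auto
  qed
  have "(\<Union>n. {g (a n)..g (b n)}) = UNIV"
  proof -
    have "\<exists>n. x \<in> {g (a n)..g (b n)}" for x
    proof -
      have "\<forall>\<^sub>F n in sequentially. g (a n) \<le> x" "\<forall>\<^sub>F n in sequentially. x \<le> g (b n)"
        using lim_a lim_b by (auto simp: filterlim_at_bot filterlim_at_top)
      then have "\<forall>\<^sub>F n in sequentially. x \<in> {g (a n)..g (b n)}"
        by eventually_elim auto
      then show ?thesis
        by (auto simp: eventually_sequentially)
    qed
    then show ?thesis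
      by blast
  qed
  then have "(\<integral>\<^sup>+x. f x \<partial>lborel) = (\<integral>\<^sup>+x. f x * indicator (\<Union>n. {g (a n)..g (b n)}) x \<partial>lborel)"
    by simp
  also have "\<dots> = (\<integral>\<^sup>+x. (SUP n. f x * indicator {g (a n)..g (b n)} x) \<partial>lborel)"
    by (simp only: SUP_mult_indicator_ennreal)
  also have "\<dots> = (SUP n. \<integral>\<^sup>+x. f x * indicator {g (a n)..g (b n)} x \<partial>lborel)"
    by (intro nn_integral_monotone_convergence_SUP)
      (auto simp: incseq_def le_fun_def intro!: mult_left_mono indicator_leI dest: mono_g[THEN subsetD])
  also have "\<dots> = (SUP n. \<integral>\<^sup>+x. f (g x) * ennreal (g' x) * indicator {a n..b n} x \<partial>lborel)"
    using step by simp
  also have "\<dots> = (\<integral>\<^sup>+x. (SUP n. f (g x) * ennreal (g' x) * indicator {a n..b n} x) \<partial>lborel)"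
    by (intro nn_integral_monotone_convergence_SUP[symmetric])
      (auto simp: incseq_def le_fun_def intro!: mult_left_mono indicator_leI dest: mono_ab[THEN subsetD])
  also have "\<dots> = (\<integral>\<^sup>+x. f (g x) * ennreal (g' x) * indicator S x \<partial>lborel)"
    unfolding S
    by (simp only: SUP_mult_indicator_ennreal)
  finally show ?thesis .
qed

lemma borel_measurable_Complex [measurable (raw)]:
  assumes [measurable]: "f \<in> borel_measurable M" "g \<in> borel_measurable M"
  shows "(\<lambda>x. Complex (f x) (g x)) \<in> borel_measurable M"
  unfolding Complex_eq by measurable

lemma lborel_complex_eq_distr:
  "(lborel :: complex measure) = distr (lborel :: (real \<times> real) measure) borel (\<lambda>(x, y). Complex x y)"
proof (rule lborel_eqI)
  have meas: "(\<lambda>(x, y). Complex x y) \<in> (borel :: (real \<times> real) measure) \<rightarrow>\<^sub>M borel"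
    unfolding case_prod_beta borel_prod[symmetric] by measurable
  fix l u :: complex
  assume le: "\<And>b. b \<in> Basis \<Longrightarrow> l \<bullet> b \<le> u \<bullet> b"
  have vim: "(\<lambda>(x, y). Complex x y) -` box l u = box (Re l, Im l) (Re u, Im u)"
    by (auto simp: box_def Basis_complex_def Basis_prod_def)
  have "Re l \<le> Re u" "Im l \<le> Im u"
    using le[of 1] le[of \<i>] by (auto simp: Basis_complex_def)
  then show "emeasure (distr lborel borel (\<lambda>(x, y). Complex x y)) (box l u) = ennreal (\<Prod>b\<in>Basis. (u - l) \<bullet> b)"
    using meas
    by (subst emeasure_distr)
      (auto simp: vim emeasure_lborel_box_eq Basis_complex_def Basis_prod_def prod.union_disjoint prod.insert
         inner_diff_left)
qed simp

lemma nn_integral_complex: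
  fixes F :: "complex \<Rightarrow> ennreal"
  assumes [measurable]: "F \<in> borel_measurable borel"
  shows "(\<integral>\<^sup>+X. F X \<partial>lborel) = (\<integral>\<^sup>+x. \<integral>\<^sup>+y. F (Complex x y) \<partial>lborel \<partial>lborel)"
proof -
  have [measurable]: "(\<lambda>(x, y). Complex x y) \<in> (borel :: (real \<times> real) measure) \<rightarrow>\<^sub>M borel"
    unfolding case_prod_beta borel_prod[symmetric] by measurable
  have "(\<integral>\<^sup>+X. F X \<partial>lborel) = (\<integral>\<^sup>+z. F (case z of (x, y) \<Rightarrow> Complex x y) \<partial>(lborel :: (real \<times> real) measure))"
    by (subst lborel_complex_eq_distr, subst nn_integral_distr) auto
  also have "\<dots> = (\<integral>\<^sup>+z. F (case z of (x, y) \<Rightarrow> Complex x y) \<partial>(lborel \<Otimes>\<^sub>M lborel))"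
    by (simp add: lborel_prod)
  also have "\<dots> = (\<integral>\<^sup>+x. \<integral>\<^sup>+y. F (Complex x y) \<partial>lborel \<partial>lborel)"
    by (subst lborel.nn_integral_fst[symmetric]) (auto simp: lborel_prod)
  finally show ?thesis .
qed

lemma nn_integral_tan:
  fixes f :: "real \<Rightarrow> ennreal"
  assumes [measurable]: "f \<in> borel_measurable borel"
  shows "(\<integral>\<^sup>+x. f x \<partial>lborel) =
    (\<integral>\<^sup>+\<alpha>. f (tan \<alpha>) * ennreal (1 / (cos \<alpha>)\<^sup>2) * indicator {-(pi/2)<..<pi/2} \<alpha> \<partial>lborel)"
\<comment> \<open>\<open>Suc n\<close> keeps the first interval nondegenerate, as
  \<open>a n < b n\<close> is required.\<close>
proof (rule nn_integral_substitution_exhaustion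
    [where a = "\<lambda>n. arctan (- real (Suc n))" and b = "\<lambda>n. arctan (real (Suc n))"])
  show "{-(pi/2)<..<pi/2} = (\<Union>n. {arctan (- real (Suc n))..arctan (real (Suc n))})"
  proof (intro equalityI subsetI)
    fix x assume x: "x \<in> {-(pi/2)<..<pi/2}"
    obtain n where n: "\<bar>tan x\<bar> \<le> real n"
      using real_arch_simple by blast
    have "arctan (tan x) = x"
      using x by (intro arctan_tan) auto
    moreover have "arctan (- real (Suc n)) \<le> arctan (tan x)" "arctan (tan x) \<le> arctan (real (Suc n))"
      using n by (auto simp: arctan_le_iff abs_le_iff)
    ultimately show "x \<in> (\<Union>n. {arctan (- real (Suc n))..arctan (real (Suc n))})"
      by auto
  next
    fix x assume "x \<in> (\<Union>n. {arctan (- real (Suc n))..arctan (real (Suc n))})"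
    then obtain n where "arctan (- real (Suc n)) \<le> x" "x \<le> arctan (real (Suc n))"
      by auto
    then show "x \<in> {-(pi/2)<..<pi/2}"
      using arctan_bounded[of "- real (Suc n)"] arctan_bounded[of "real (Suc n)"] by auto
  qed
  fix x :: real assume x: "x \<in> {-(pi/2)<..<pi/2}"
  then have "cos x > 0"
    by (intro cos_gt_zero_pi) auto
  then show "(tan has_real_derivative 1 / (cos x)\<^sup>2) (at x)"
    using DERIV_tan[of x] by (simp add: field_simps)
next
  show "continuous_on {-(pi/2)<..<pi/2} (\<lambda>x. 1 / (cos x)\<^sup>2)"
    proof (intro continuous_intros ballI)
    fix x :: real assume "x \<in> {-(pi/2)<..<pi/2}"
    then have "cos x > 0"
      by (intro cos_gt_zero_pi) auto
    then show "(cos x)\<^sup>2 \<noteq> 0"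
      by simp
  qed
  show "filterlim (\<lambda>n. tan (arctan (- real (Suc n)))) at_bot sequentially"
    unfolding tan_arctan
    using filterlim_compose[OF filterlim_real_sequentially filterlim_Suc]
    by (simp only: filterlim_uminus_at_bot minus_minus)
  show "filterlim (\<lambda>n. tan (arctan (real (Suc n)))) at_top sequentially"
    unfolding tan_arctan
    by (rule filterlim_compose[OF filterlim_real_sequentially filterlim_Suc])
  show "tan \<in> borel_measurable (borel :: real measure)"
    unfolding tan_def by measurable
qed (auto simp: decseq_def incseq_def arctan_le_iff arctan_less_iff)

text \<open>The radius y runs over the whole line and the angle over a half turn, so that every line
  through 0 is met once. This signed form fits the circles, whose coordinate \<open>yc\<close> takes
  both signs. The ordinate is written as x tan \<alpha> and then x as y cos \<alpha>; the Jacobians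
  combine to |y|.\<close>

lemma nn_integral_signed_polar:
  fixes F :: "complex \<Rightarrow> ennreal"
  assumes [measurable]: "F \<in> borel_measurable borel"
  shows "(\<integral>\<^sup>+X. F X \<partial>lborel) =
    (\<integral>\<^sup>+\<alpha>. indicator {-(pi/2)<..<pi/2} \<alpha> * (\<integral>\<^sup>+y. ennreal \<bar>y\<bar> * F (complex_of_real y * cis \<alpha>) \<partial>lborel) \<partial>lborel)"
proof -
  have [measurable]: "(\<lambda>z::real \<times> real. Complex (fst z) (snd z)) \<in> borel_measurable borel"
    unfolding borel_prod[symmetric] by measurable
  have [measurable]: "tan \<in> borel_measurable (borel :: real measure)"
    unfolding tan_def by measurable
  have [measurable]: "(\<lambda>z::real \<times> real. F (Complex (fst z) (snd z))) \<in> borel_measurable borel"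
    by measurable
  have M [measurable]: "(\<lambda>z::real \<times> real. F (Complex (fst z) (snd z))) \<in> borel_measurable (borel \<Otimes>\<^sub>M borel)"
    by (simp add: borel_prod)
  have inner: "(\<integral>\<^sup>+y. F (Complex x y) \<partial>lborel) =
      (\<integral>\<^sup>+\<alpha>. indicator {-(pi/2)<..<pi/2} \<alpha> * (ennreal \<bar>x\<bar> * ennreal (1 / (cos \<alpha>)\<^sup>2) * F (Complex x (x * tan \<alpha>))) \<partial>lborel)"
    if "x \<noteq> 0" for x
  proof -
    have "(\<integral>\<^sup>+y. F (Complex x y) \<partial>lborel) = ennreal \<bar>x\<bar> * (\<integral>\<^sup>+y. F (Complex x (x * y)) \<partial>lborel)"
      using that measurable_compose[OF _ M, of "\<lambda>y. (x, y)" borel]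
      by (subst nn_integral_real_affine[where c = x and t = 0]) (auto)
    also have "(\<integral>\<^sup>+y. F (Complex x (x * y)) \<partial>lborel) =
        (\<integral>\<^sup>+\<alpha>. F (Complex x (x * tan \<alpha>)) * ennreal (1 / (cos \<alpha>)\<^sup>2) * indicator {-(pi/2)<..<pi/2} \<alpha> \<partial>lborel)"
      by (rule nn_integral_tan) measurable
    also have "ennreal \<bar>x\<bar> * \<dots> = (\<integral>\<^sup>+\<alpha>. ennreal \<bar>x\<bar> * (F (Complex x (x * tan \<alpha>)) * ennreal (1 / (cos \<alpha>)\<^sup>2) * indicator {-(pi/2)<..<pi/2} \<alpha>) \<partial>lborel)"
      by (rule nn_integral_cmult[symmetric]) measurable
    finally show ?thesis
      by (simp add: ac_simps)
  qed
  have "(\<integral>\<^sup>+X. F X \<partial>lborel) = (\<integral>\<^sup>+x. \<integral>\<^sup>+y. F (Complex x y) \<partial>lborel \<partial>lborel)"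
    by (rule nn_integral_complex) simp
  also have "\<dots> = (\<integral>\<^sup>+x. (\<integral>\<^sup>+\<alpha>. indicator {-(pi/2)<..<pi/2} \<alpha> * (ennreal \<bar>x\<bar> * ennreal (1 / (cos \<alpha>)\<^sup>2) * F (Complex x (x * tan \<alpha>))) \<partial>lborel) \<partial>lborel)"
    by (rule nn_integral_cong_AE, use AE_lborel_singleton[of "0::real"] in eventually_elim)
      (simp add: inner)
  also have "\<dots> = (\<integral>\<^sup>+\<alpha>. (\<integral>\<^sup>+x. indicator {-(pi/2)<..<pi/2} \<alpha> * (ennreal \<bar>x\<bar> * ennreal (1 / (cos \<alpha>)\<^sup>2) * F (Complex x (x * tan \<alpha>))) \<partial>lborel) \<partial>lborel)"
    by (rule lborel_pair.Fubini') measurable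
  also have "\<dots> = (\<integral>\<^sup>+\<alpha>. indicator {-(pi/2)<..<pi/2} \<alpha> * (\<integral>\<^sup>+y. ennreal \<bar>y\<bar> * F (complex_of_real y * cis \<alpha>) \<partial>lborel) \<partial>lborel)"
  proof (rule nn_integral_cong)
    fix \<alpha> :: real
    show "(\<integral>\<^sup>+x. indicator {-(pi/2)<..<pi/2} \<alpha> * (ennreal \<bar>x\<bar> * ennreal (1 / (cos \<alpha>)\<^sup>2) * F (Complex x (x * tan \<alpha>))) \<partial>lborel) =
      indicator {-(pi/2)<..<pi/2} \<alpha> * (\<integral>\<^sup>+y. ennreal \<bar>y\<bar> * F (complex_of_real y * cis \<alpha>) \<partial>lborel)"
    proof (cases "\<alpha> \<in> {-(pi/2)<..<pi/2}")
      case True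
      then have c: "cos \<alpha> > 0"
        by (intro cos_gt_zero_pi) auto
      have "(\<integral>\<^sup>+x. ennreal \<bar>x\<bar> * ennreal (1 / (cos \<alpha>)\<^sup>2) * F (Complex x (x * tan \<alpha>)) \<partial>lborel) =
        ennreal \<bar>cos \<alpha>\<bar> * (\<integral>\<^sup>+y. ennreal \<bar>0 + cos \<alpha> * y\<bar> * ennreal (1 / (cos \<alpha>)\<^sup>2) * F (Complex (0 + cos \<alpha> * y) ((0 + cos \<alpha> * y) * tan \<alpha>)) \<partial>lborel)"
        using c by (subst nn_integral_real_affine[where c = "cos \<alpha>" and t = 0]) (auto)
      also have "\<dots> = (\<integral>\<^sup>+y. ennreal \<bar>cos \<alpha>\<bar> * (ennreal \<bar>0 + cos \<alpha> * y\<bar> * ennreal (1 / (cos \<alpha>)\<^sup>2) * F (Complex (0 + cos \<alpha> * y) ((0 + cos \<alpha> * y) * tan \<alpha>))) \<partial>lborel)"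
        by (rule nn_integral_cmult[symmetric]) measurable
      also have "\<dots> = (\<integral>\<^sup>+y. ennreal \<bar>y\<bar> * F (complex_of_real y * cis \<alpha>) \<partial>lborel)"
      proof (rule nn_integral_cong)
        fix y :: real
        have "Complex (0 + cos \<alpha> * y) ((0 + cos \<alpha> * y) * tan \<alpha>) = complex_of_real y * cis \<alpha>"
          using c by (simp add: complex_eq_iff tan_def)
        moreover have "ennreal \<bar>cos \<alpha>\<bar> * (ennreal \<bar>0 + cos \<alpha> * y\<bar> * ennreal (1 / (cos \<alpha>)\<^sup>2)) = ennreal \<bar>y\<bar>"
          using c by (simp add: ennreal_mult[symmetric] abs_mult power2_eq_square)
        ultimately show "ennreal \<bar>cos \<alpha>\<bar> * (ennreal \<bar>0 + cos \<alpha> * y\<bar> * ennreal (1 / (cos \<alpha>)\<^sup>2) * F (Complex (0 + cos \<alpha> * y) ((0 + cos \<alpha> * y) * tan \<alpha>))) = ennreal \<bar>y\<bar> * F (complex_of_real y * cis \<alpha>)"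
          by (metis mult.assoc)
      qed
      finally show ?thesis
        using True by simp
    qed simp
  qed
  finally show ?thesis .
qed

section \<open>Cauchy transforms of functions on a strip\<close>

lemma measurable_fst_borel [measurable (raw)]:
  fixes f :: "'a \<Rightarrow> 'b::second_countable_topology \<times> 'c::second_countable_topology"
  assumes "f \<in> borel_measurable M"
  shows "(\<lambda>x. fst (f x)) \<in> borel_measurable M"
  using assms by (intro borel_measurable_continuous_on[where f = fst] continuous_intros) auto

lemma measurable_snd_borel [measurable (raw)]:
  fixes f :: "'a \<Rightarrow> 'b::second_countable_topology \<times> 'c::second_countable_topology"
  assumes "f \<in> borel_measurable M"
  shows "(\<lambda>x. snd (f x)) \<in> borel_measurable M"
  using assms by (intro borel_measurable_continuous_on[where f = snd] continuous_intros) auto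

text \<open>In the plane the exponent -2 is critical: -3/2 is integrable at 0 and -5/2 at infinity.
  The margin 1/2 on either side leaves room for all exponents s between 1/2 and 3/2 in
  \<open>gker_bound\<close>.\<close>

definition gker :: "complex \<Rightarrow> real"
  where "gker u = (if norm u < 1 then norm u powr (-3/2) else norm u powr (-5/2))"

lemma gker_nonneg [simp]: "gker u \<ge> 0"
  by (simp add: gker_def)

lemma gker_measurable [measurable]: "gker \<in> borel_measurable borel"
  unfolding gker_def by measurable

lemma gker_cnv: "gker (complex_of_real y * cis \<alpha>) = (if \<bar>y\<bar> < 1 then \<bar>y\<bar> powr (-3/2) else \<bar>y\<bar> powr (-5/2))"
  by (simp add: gker_def norm_mult)

lemma nn_integral_gker_finite: "(\<integral>\<^sup>+u. ennreal (gker u) \<partial>lborel) < \<infinity>"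
proof -
  \<comment> \<open>\<open>h\<close> dominates |y| times the radial profile on the positive half
    line. Each of its two pieces has integral 2, so that both half lines together contribute at most
    8 for every angle.\<close>
  define h where "h y = indicator {0..1} y * (y powr (-1/2)) + indicator {1..} y * (y powr (-3/2))" for y :: real
  have [measurable]: "h \<in> borel_measurable borel"
    unfolding h_def by measurable
  have h0: "h y \<ge> 0" for y
    by (simp add: h_def)
  have I1: "(\<integral>\<^sup>+y. ennreal (indicator {0..1} y * (y powr (-1/2))) \<partial>lborel) = ennreal 2"
    using has_integral_powr_from_0[of "-1/2" 1]
    by (intro nn_integral_has_integral_lebesgue) auto
  have I2: "(\<integral>\<^sup>+y. ennreal (indicator {1..} y * (y powr (-3/2))) \<partial>lborel) = ennreal 2"
    using has_integral_powr_to_inf[of "-3/2" 1]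
    by (intro nn_integral_has_integral_lebesgue) auto
  have H: "(\<integral>\<^sup>+y. ennreal (h y) \<partial>lborel) = ennreal 2 + ennreal 2"
  proof -
    have "(\<integral>\<^sup>+y. ennreal (h y) \<partial>lborel) = (\<integral>\<^sup>+y. ennreal (indicator {0..1} y * (y powr (-1/2))) + ennreal (indicator {1..} y * (y powr (-3/2))) \<partial>lborel)"
      by (intro nn_integral_cong) (simp add: h_def)
    also have "\<dots> = ennreal 2 + ennreal 2"
      using I1 I2 by (subst nn_integral_add) auto
    finally show ?thesis .
  qed
  have H': "(\<integral>\<^sup>+y. ennreal (h (- y)) \<partial>lborel) = ennreal 2 + ennreal 2"
    unfolding H[symmetric] by (subst (2) nn_integral_real_affine[where c = "-1" and t = 0]) auto
  have bound: "\<bar>y\<bar> * gker (complex_of_real y * cis \<alpha>) \<le> h y + h (- y)" for y \<alpha>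
  proof (cases "y = 0")
    case False
    have pw: "x * x powr a = x powr (a + 1)" if "x > 0" for x a :: real
      using that by (simp add: powr_add)
    show ?thesis
      using False pw[of "\<bar>y\<bar>" "-3/2"] pw[of "\<bar>y\<bar>" "-5/2"]
      by (cases "y > 0"; cases "\<bar>y\<bar> < 1") (auto simp: gker_cnv h_def)
  qed (simp add: h_def)
  have inner: "(\<integral>\<^sup>+y. ennreal \<bar>y\<bar> * ennreal (gker (complex_of_real y * cis \<alpha>)) \<partial>lborel) \<le> 8" for \<alpha>
  proof -
    have "(\<integral>\<^sup>+y. ennreal \<bar>y\<bar> * ennreal (gker (complex_of_real y * cis \<alpha>)) \<partial>lborel) \<le> (\<integral>\<^sup>+y. ennreal (h y) + ennreal (h (- y)) \<partial>lborel)"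
      using bound h0
      by (intro nn_integral_mono) (auto simp: ennreal_mult[symmetric] ennreal_plus[symmetric] simp del: ennreal_plus intro!: ennreal_leI)
    also have "\<dots> = (\<integral>\<^sup>+y. ennreal (h y) \<partial>lborel) + (\<integral>\<^sup>+y. ennreal (h (- y)) \<partial>lborel)"
      by (rule nn_integral_add) measurable
    finally show ?thesis
      by (simp add: H H' ennreal_plus[symmetric] del: ennreal_plus)
  qed
  have "(\<integral>\<^sup>+u. ennreal (gker u) \<partial>lborel) \<le> (\<integral>\<^sup>+\<alpha>. indicator {-(pi/2)<..<pi/2} \<alpha> * 8 \<partial>lborel)"
    by (subst nn_integral_signed_polar) (auto intro!: nn_integral_mono mult_left_mono inner)
  also have "\<dots> = 8 * ennreal pi"
    by (subst nn_integral_multc) (auto simp: mult.commute)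
  also have "\<dots> < \<infinity>"
    by (simp add: ennreal_mult_less_top)
  finally show ?thesis .
qed

definition gconst :: real
  where "gconst = enn2real (\<integral>\<^sup>+u. ennreal (gker u) \<partial>lborel)"

lemma nn_integral_gker: "(\<integral>\<^sup>+u. ennreal (gker u) \<partial>lborel) = ennreal gconst"
  unfolding gconst_def using nn_integral_gker_finite by simp

lemma gconst_nonneg [simp]: "gconst \<ge> 0"
  by (simp add: gconst_def)

lemma nn_integral_lborel_translate:
  fixes f :: "'a::euclidean_space \<Rightarrow> ennreal"
  assumes [measurable]: "f \<in> borel_measurable borel"
  shows "(\<integral>\<^sup>+x. f (a + x) \<partial>lborel) = (\<integral>\<^sup>+x. f x \<partial>lborel)"
  by (subst (2) lborel_distr_plus[of a, symmetric]) (simp add: nn_integral_distr)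

lemma nn_integral_gker_shift: "(\<integral>\<^sup>+u. ennreal (gker (u - a)) \<partial>lborel) = ennreal gconst"
  using nn_integral_lborel_translate[of "\<lambda>u. ennreal (gker u)" "- a"] nn_integral_gker by simp

text \<open>Either factor is dominated by the kernel, depending on which of the two singular points is
  closer.\<close>

lemma gker_bound:
  assumes s: "1/2 \<le> s" "s \<le> 3/2" and z: "z \<noteq> 0" "a \<noteq> 0"
  shows "norm a powr (-s) / (1 + (norm z)\<^sup>2) \<le> gker a + gker z"
proof -
  have pos: "norm a > 0" "norm z > 0"
    using z by auto
  have *: "1 / (1 + (norm z)\<^sup>2) \<le> norm z powr (-2)" 
    using pos by (simp add: powr_minus divide_simps not_less add_nonneg_nonneg)
  have le1: "1 / (1 + (norm z)\<^sup>2) \<le> 1"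
    by (auto simp: divide_le_eq_1 add_pos_nonneg)
  consider "norm a < 1" | "norm a \<ge> 1" "norm a \<le> norm z" | "norm a \<ge> 1" "norm z < norm a" "norm z \<ge> 1" | "norm a \<ge> 1" "norm z < 1"
    by linarith
  then show ?thesis
  proof cases
    case 1
    have "norm a powr (-s) / (1 + (norm z)\<^sup>2) \<le> norm a powr (-s)"
      using mult_left_mono[OF le1, of "norm a powr (-s)"] by simp
    also have "\<dots> \<le> norm a powr (-3/2)"
      using 1 s pos by (intro powr_mono') auto
    finally show ?thesis
      using 1 by (simp add: gker_def add_increasing2)
  next
    case 2
    have "norm a powr (-s) / (1 + (norm z)\<^sup>2) \<le> norm a powr (-s) * norm z powr (-2)"
      using mult_left_mono[OF *, of "norm a powr (-s)"] by simp
    also have "\<dots> \<le> norm a powr (-s) * norm a powr (-2)"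
      using 2 pos by (intro mult_left_mono powr_mono2') auto
    also have "\<dots> = norm a powr (-s - 2)"
      by (simp add: powr_add[symmetric])
    also have "\<dots> \<le> norm a powr (-5/2)"
      using 2 s by (intro powr_mono) auto
    finally show ?thesis
      using 2 by (simp add: gker_def add_increasing2)
  next
    case 3
    have "norm a powr (-s) / (1 + (norm z)\<^sup>2) \<le> norm a powr (-s) * norm z powr (-2)"
      using mult_left_mono[OF *, of "norm a powr (-s)"] by simp
    also have "\<dots> \<le> norm z powr (-s) * norm z powr (-2)"
      using 3 pos s by (intro mult_right_mono powr_mono2') auto
    also have "\<dots> = norm z powr (-s - 2)"
      by (simp add: powr_add[symmetric])
    also have "\<dots> \<le> norm z powr (-5/2)"
      using 3 s by (intro powr_mono) auto
    finally show ?thesis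
      using 3 by (simp add: gker_def add_increasing)
  next
    case 4
    have "norm a powr (-s) / (1 + (norm z)\<^sup>2) \<le> norm a powr (-s)"
      using mult_left_mono[OF le1, of "norm a powr (-s)"] by simp
    also have "\<dots> \<le> norm a powr 0"
      using 4 s by (intro powr_mono) auto
    also have "\<dots> = norm z powr 0"
      using pos by simp
    also have "\<dots> \<le> norm z powr (-3/2)"
      using 4 pos by (intro powr_mono') auto
    finally show ?thesis
      using 4 by (simp add: gker_def add_increasing)
  qed
qed

text \<open>Companion of \<open>gker_bound\<close> for the numerator \<open>sqrt (norm z)\<close>.
  Such a term is left over when the weight \<open>sqrt (norm l)\<close> is distributed over the two
  singular points in \<open>cauchy_transform_decay\<close>. The growing numerator costs half a power
  at infinity, which the quadratic denominator can afford.\<close>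

lemma gker_bound_swap:
  assumes z: "z \<noteq> 0" "a \<noteq> 0"
  shows "sqrt (norm z) / (norm a * (1 + (norm z)\<^sup>2)) \<le> gker a + gker z"
proof -
  have pos: "norm a > 0" "norm z > 0"
    using z by auto
  have *: "1 / (1 + (norm z)\<^sup>2) \<le> norm z powr (-2)" 
    using pos by (simp add: powr_minus divide_simps not_less add_nonneg_nonneg)
  have sq: "sqrt (norm z) = norm z powr (1/2)"
    using pos by (simp add: powr_half_sqrt)
  have E: "sqrt (norm z) / (norm a * (1 + (norm z)\<^sup>2)) = norm a powr (-1) * (norm z powr (1/2) * (1 / (1 + (norm z)\<^sup>2)))"
    using pos by (simp add: sq powr_minus_divide)
  have F1: "norm z powr (1/2) * (1 / (1 + (norm z)\<^sup>2)) \<le> norm z powr (-3/2)"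
    using mult_left_mono[OF *, of "norm z powr (1/2)"] by (simp add: powr_add[symmetric])
  have F2: "norm z powr (1/2) * (1 / (1 + (norm z)\<^sup>2)) \<le> 1"
  proof (cases "norm z \<le> 1")
    case True
    have "norm z powr (1/2) \<le> 1 powr (1/2)"
      using True pos by (intro powr_mono2) auto
    moreover have "1 / (1 + (norm z)\<^sup>2) \<le> 1"
      by (auto simp: divide_le_eq_1 add_pos_nonneg)
    ultimately show ?thesis
      using mult_mono[of "norm z powr (1/2)" 1 "1 / (1 + (norm z)\<^sup>2)" 1] by simp
  next
    case False
    then have "norm z powr (-3/2) \<le> norm z powr 0"
      by (intro powr_mono) auto
    with F1 pos show ?thesis by simp
  qed
  have F0: "0 \<le> norm z powr (1/2) * (1 / (1 + (norm z)\<^sup>2))"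
    by simp
  consider "norm a < 1" | "norm a \<ge> 1" "norm a \<le> norm z" | "norm a \<ge> 1" "norm z < norm a" "norm z \<ge> 1" | "norm a \<ge> 1" "norm z < 1"
    by linarith
  then show ?thesis
  proof cases
    case 1
    have "norm a powr (-1) * (norm z powr (1/2) * (1 / (1 + (norm z)\<^sup>2))) \<le> norm a powr (-1) * 1"
      by (intro mult_left_mono F2) auto
    also have "\<dots> \<le> norm a powr (-3/2)"
      using 1 pos by (simp only: mult_1_right, intro powr_mono') auto
    finally show ?thesis
      unfolding E using 1 by (simp add: gker_def add_increasing2 del: powr_neg_one)
  next
    case 2
    have "norm a powr (-1) * (norm z powr (1/2) * (1 / (1 + (norm z)\<^sup>2))) \<le> norm a powr (-1) * norm z powr (-3/2)"
      by (intro mult_left_mono F1) auto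
    also have "\<dots> \<le> norm a powr (-1) * norm a powr (-3/2)"
      using 2 pos by (intro mult_left_mono powr_mono2') auto
    also have "\<dots> = norm a powr (-5/2)"
      by (subst powr_add[symmetric]) simp
    finally show ?thesis
      unfolding E using 2 by (simp add: gker_def add_increasing2 del: powr_neg_one)
  next
    case 3
    have "norm a powr (-1) * (norm z powr (1/2) * (1 / (1 + (norm z)\<^sup>2))) \<le> norm a powr (-1) * norm z powr (-3/2)"
      by (intro mult_left_mono F1) auto
    also have "\<dots> \<le> norm z powr (-1) * norm z powr (-3/2)"
      using 3 pos by (intro mult_right_mono powr_mono2') auto
    also have "\<dots> = norm z powr (-5/2)"
      by (subst powr_add[symmetric]) simp
    finally show ?thesis
      unfolding E using 3 by (simp add: gker_def add_increasing del: powr_neg_one)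
  next
    case 4
    have "norm a powr (-1) * (norm z powr (1/2) * (1 / (1 + (norm z)\<^sup>2))) \<le> norm a powr (-1) * norm z powr (-3/2)"
      by (intro mult_left_mono F1) auto
    also have "\<dots> \<le> norm a powr 0 * norm z powr (-3/2)"
      using 4 pos by (intro mult_right_mono powr_mono) auto
    finally show ?thesis
      unfolding E using 4 pos by (simp add: gker_def add_increasing del: powr_neg_one)
  qed
qed

lemma AE_fst_neq:
  "AE y in (lborel :: ('a::euclidean_space \<times> 'b::euclidean_space) measure). fst y \<noteq> a"
proof -
  have "AE y in (lborel \<Otimes>\<^sub>M lborel :: ('a \<times> 'b) measure). fst y \<noteq> a"
  proof (rule lborel_pair.AE_pair_measure)
    have "{y \<in> space (lborel \<Otimes>\<^sub>M lborel :: ('a \<times> 'b) measure). fst y \<noteq> a} = (- {a}) \<times> UNIV"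
      by (auto simp: space_pair_measure)
    also have "\<dots> \<in> sets (lborel \<Otimes>\<^sub>M lborel)"
      by (intro pair_measureI) auto
    finally show "{y \<in> space (lborel \<Otimes>\<^sub>M lborel :: ('a \<times> 'b) measure). fst y \<noteq> a} \<in> sets (lborel \<Otimes>\<^sub>M lborel)" .
    show "AE y in lborel. AE z in lborel. fst (y, z :: 'b) \<noteq> a"
      using AE_lborel_singleton[of a] by eventually_elim simp
  qed
  then show ?thesis
    unfolding lborel_prod .
qed

abbreviation strip :: "real \<Rightarrow> real"
  where "strip \<phi> \<equiv> indicator {-pi..pi} \<phi>"

lemma nn_integral_strip:
  fixes h :: "complex \<Rightarrow> real"
  assumes [measurable]: "h \<in> borel_measurable borel" and nonneg: "\<And>z. h z \<ge> 0"
  shows "(\<integral>\<^sup>+y. ennreal (h (fst y) * strip (snd y)) \<partial>(lborel :: (complex \<times> real) measure)) =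
    ennreal (2 * pi) * (\<integral>\<^sup>+z. ennreal (h z) \<partial>lborel)"
proof -
  have "(\<integral>\<^sup>+y. ennreal (h (fst y) * strip (snd y)) \<partial>(lborel :: (complex \<times> real) measure)) =
      (\<integral>\<^sup>+y. ennreal (h (fst y)) * indicator {-pi..pi} (snd y) \<partial>(lborel \<Otimes>\<^sub>M lborel))"
    by (subst lborel_prod, intro nn_integral_cong) (auto split: split_indicator)
  also have "\<dots> = (\<integral>\<^sup>+z. \<integral>\<^sup>+\<phi>. ennreal (h z) * indicator {-pi..pi} \<phi> \<partial>lborel \<partial>lborel)"
    by (subst lborel.nn_integral_fst[symmetric]) auto
  also have "\<dots> = (\<integral>\<^sup>+z. ennreal (h z) * ennreal (2 * pi) \<partial>lborel)"
    by (intro nn_integral_cong, subst nn_integral_cmult_indicator) auto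
  also have "\<dots> = ennreal (2 * pi) * (\<integral>\<^sup>+z. ennreal (h z) \<partial>lborel)"
    by (subst nn_integral_multc) (auto simp: mult.commute)
  finally show ?thesis .
qed

definition cconst :: real
  where "cconst = 2 * pi * (2 * gconst)"

lemma cconst_nonneg [simp]: "cconst \<ge> 0"
  by (simp add: cconst_def)

lemma nn_integral_gker_strip:
  assumes h: "\<And>y. fst y \<noteq> 0 \<Longrightarrow> fst y \<noteq> l \<Longrightarrow> h y \<le> (gker (fst y - l) + gker (fst y)) * strip (snd y)"
  shows "(\<integral>\<^sup>+y. ennreal (h y) \<partial>(lborel :: (complex \<times> real) measure)) \<le> ennreal cconst"
proof -
  have "(\<integral>\<^sup>+y. ennreal (h y) \<partial>(lborel :: (complex \<times> real) measure)) \<le>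
      (\<integral>\<^sup>+y. ennreal ((gker (fst y - l) + gker (fst y)) * strip (snd y)) \<partial>(lborel :: (complex \<times> real) measure))"
    by (rule nn_integral_mono_AE, use AE_fst_neq[of 0] AE_fst_neq[of l] in eventually_elim)
      (auto intro!: ennreal_leI h)
  also have "\<dots> = ennreal (2 * pi) * (\<integral>\<^sup>+z. ennreal (gker (z - l) + gker z) \<partial>lborel)"
    by (subst nn_integral_strip[of "\<lambda>z. gker (z - l) + gker z"]) auto
  also have "(\<integral>\<^sup>+z. ennreal (gker (z - l) + gker z) \<partial>lborel) = ennreal gconst + ennreal gconst"
    by (simp add: nn_integral_add nn_integral_gker nn_integral_gker_shift)
  also have "ennreal (2 * pi) * (ennreal gconst + ennreal gconst) = ennreal cconst"
    by (simp add: cconst_def ennreal_mult[symmetric] ennreal_plus[symmetric] del: ennreal_plus)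
  finally show ?thesis .
qed

lemma nn_integral_cauchy_kernel_powr:
  assumes "1/2 \<le> s" "s \<le> 3/2"
  shows "(\<integral>\<^sup>+y. ennreal (norm (fst y - l) powr (-s) * (strip (snd y) / (1 + (norm (fst y))\<^sup>2))) \<partial>(lborel :: (complex \<times> real) measure)) \<le> ennreal cconst"
proof (rule nn_integral_gker_strip)
  fix y :: "complex \<times> real"
  assume "fst y \<noteq> 0" "fst y \<noteq> l"
  from gker_bound[OF assms this(1), of "fst y - l"] this(2)
  show "norm (fst y - l) powr (-s) * (strip (snd y) / (1 + (norm (fst y))\<^sup>2)) \<le> (gker (fst y - l) + gker (fst y)) * strip (snd y)"
    by (auto split: split_indicator)
qed

lemma nn_integral_cauchy_kernel:
  "(\<integral>\<^sup>+y. ennreal (strip (snd y) / (1 + (norm (fst y))\<^sup>2) / norm (fst y - l)) \<partial>(lborel :: (complex \<times> real) measure)) \<le> ennreal cconst"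
proof (rule nn_integral_gker_strip)
  fix y :: "complex \<times> real"
  assume "fst y \<noteq> 0" "fst y \<noteq> l"
  then show "strip (snd y) / (1 + (norm (fst y))\<^sup>2) / norm (fst y - l) \<le> (gker (fst y - l) + gker (fst y)) * strip (snd y)"
    using gker_bound[of 1 "fst y" "fst y - l"]
    by (auto split: split_indicator simp: powr_minus_divide mult.commute)
qed

text \<open>A point is a pair (\<zeta>, \<phi>). The decay 1 / (1 + |\<zeta>|^2) is what
  \<open>jker_bound\<close> supplies, and it makes the integral against 1 / |\<zeta> - l| finite
  with a bound that does not depend on l.\<close>

definition strip_dominated :: "real \<Rightarrow> (complex \<times> real \<Rightarrow> complex) \<Rightarrow> bool"
  where "strip_dominated B K \<longleftrightarrow> K \<in> borel_measurable borel \<and> B \<ge> 0 \<and>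
    (\<forall>y. norm (K y) \<le> B * (strip (snd y) / (1 + (norm (fst y))\<^sup>2)))"

text \<open>There is no factor 1 / pi: the constants of \<open>I_op\<close>, of \<open>brace\<close>
  and of its coefficient multiply to 1 when the kernel is expressed by \<open>jker\<close>.\<close>

definition cauchy_transform :: "(complex \<times> real \<Rightarrow> complex) \<Rightarrow> complex \<Rightarrow> complex"
  where "cauchy_transform K l = (LINT y|lborel. K y / (fst y - l))"

lemma strip_dominatedD:
  assumes "strip_dominated B K"
  shows "K \<in> borel_measurable borel" "B \<ge> 0" "norm (K y) \<le> B * (strip (snd y) / (1 + (norm (fst y))\<^sup>2))"
  using assms unfolding strip_dominated_def by blast+

lemma nn_integral_strip_dominated:
  assumes K: "strip_dominated B K"
  shows "(\<integral>\<^sup>+y. ennreal (norm (K y) / norm (fst y - l)) \<partial>lborel) \<le> ennreal (B * cconst)"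
proof -
  have le: "norm (K y) / norm (fst y - l) \<le> B * (strip (snd y) / (1 + (norm (fst y))\<^sup>2) / norm (fst y - l))" for y
    using divide_right_mono[OF strip_dominatedD(3)[OF K, of y], of "norm (fst y - l)"] by simp
  note [measurable] = strip_dominatedD(1)[OF K]
  have "(\<integral>\<^sup>+y. ennreal (norm (K y) / norm (fst y - l)) \<partial>lborel) \<le>
    (\<integral>\<^sup>+y. ennreal B * ennreal (strip (snd y) / (1 + (norm (fst y))\<^sup>2) / norm (fst y - l)) \<partial>lborel)"
    using strip_dominatedD(2)[OF K]
    by (intro nn_integral_mono, subst ennreal_mult[symmetric]) (use le in \<open>simp_all add: ennreal_leI del: times_divide_eq_right\<close>)
  also have "\<dots> = ennreal B * (\<integral>\<^sup>+y. ennreal (strip (snd y) / (1 + (norm (fst y))\<^sup>2) / norm (fst y - l)) \<partial>(lborel :: (complex \<times> real) measure))"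
    by (rule nn_integral_cmult) measurable
  also have "\<dots> \<le> ennreal B * ennreal cconst"
    by (intro mult_left_mono nn_integral_cauchy_kernel) auto
  finally show ?thesis
    using strip_dominatedD(2)[OF K] by (simp add: ennreal_mult)
qed

lemma integrable_cauchy_transform:
  assumes K: "strip_dominated B K"
  shows "integrable lborel (\<lambda>y. K y / (fst y - l))"
proof -
  note [measurable] = strip_dominatedD(1)[OF K]
  have "(\<integral>\<^sup>+y. ennreal (norm (K y / (fst y - l))) \<partial>lborel) < \<infinity>"
    using nn_integral_strip_dominated[OF K, of l] by (simp add: norm_divide le_less_trans)
  then show ?thesis
    by (intro integrableI_bounded) auto
qed

lemma norm_cauchy_transform_le:
  assumes K: "strip_dominated B K"
  shows "norm (cauchy_transform K l) \<le> B * cconst"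
proof -
  note [measurable] = strip_dominatedD(1)[OF K]
  have "ennreal (norm (cauchy_transform K l)) \<le> (\<integral>\<^sup>+y. ennreal (norm (K y / (fst y - l))) \<partial>lborel)"
    unfolding cauchy_transform_def by (rule integral_norm_bound_ennreal[OF integrable_cauchy_transform[OF K]])
  also have "\<dots> \<le> ennreal (B * cconst)"
    using nn_integral_strip_dominated[OF K, of l] by (simp add: norm_divide)
  finally show ?thesis
    using strip_dominatedD(2)[OF K] by (subst (asm) ennreal_le_iff) auto
qed

text \<open>The difference is |l - m| / (a b), where a and b are the two distances. Half a power of
  |l - m| is kept; the other half is at most \<open>sqrt a + sqrt b\<close> and lowers the
  singularity to an integrable exponent.\<close>

lemma cauchy_kernel_difference:
  fixes z l m :: complex
  assumes "z \<noteq> l" "z \<noteq> m"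
  shows "norm (1 / (z - l) - 1 / (z - m)) \<le>
    sqrt (norm (l - m)) * (2 * (norm (z - l) powr (-3/2) + norm (z - m) powr (-3/2)))"
proof -
  define a b d where "a = norm (z - l)" and "b = norm (z - m)" and "d = norm (l - m)"
  have pos: "a > 0" "b > 0" "d \<ge> 0"
    using assms by (auto simp: a_def b_def d_def)
  have dab: "d \<le> a + b"
    unfolding a_def b_def d_def using norm_triangle_ineq4[of "z - m" "z - l"] by simp
  have "1 / (z - l) - 1 / (z - m) = (l - m) / ((z - l) * (z - m))"
    using assms by (simp add: field_simps)
  then have "norm (1 / (z - l) - 1 / (z - m)) = d / (a * b)"
    by (simp add: norm_divide norm_mult a_def b_def d_def)
  also have "d = sqrt d * sqrt d"
    using pos by simp
  also have "sqrt d * sqrt d / (a * b) \<le> sqrt d * (sqrt a + sqrt b) / (a * b)"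
    using pos dab sqrt_add_le_add_sqrt[of a b]
    by (intro divide_right_mono mult_left_mono) (auto intro: order_trans[OF real_sqrt_le_mono])
  also have "\<dots> = sqrt d * (a powr (-1/2) * b powr (-1) + a powr (-1) * b powr (-1/2))"
  proof -
    have E: "a powr (-1/2) = sqrt a / a" "b powr (-1/2) = sqrt b / b"
      using pos by (auto simp: powr_half_sqrt powr_minus_divide real_div_sqrt divide_simps)
    show ?thesis
      unfolding E using pos by (simp add: field_simps powr_minus_divide)
  qed
  also have "\<dots> \<le> sqrt d * (2 * (a powr (-3/2) + b powr (-3/2)))"
  proof (intro mult_left_mono)
    \<comment> \<open>Replacing both distances by the smaller one merges the mixed products into a
      single power -3/2, which is one of the two summands.\<close>
    define c where "c = min a b"
    have c: "c > 0" "c \<le> a" "c \<le> b"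
      using pos by (auto simp: c_def)
    have "a powr (-1/2) * b powr (-1) \<le> c powr (-1/2) * c powr (-1)"
      "a powr (-1) * b powr (-1/2) \<le> c powr (-1) * c powr (-1/2)"
      using c by (intro mult_mono powr_mono2'; simp)+
    moreover have "c powr (-1/2) * c powr (-1) = c powr (-3/2)" "c powr (-1) * c powr (-1/2) = c powr (-3/2)"
      by (simp_all only: powr_add[symmetric]) simp_all
    ultimately have "a powr (-1/2) * b powr (-1) + a powr (-1) * b powr (-1/2) \<le> 2 * c powr (-3/2)"
      by linarith
    also have "c powr (-3/2) \<le> a powr (-3/2) + b powr (-3/2)"
      by (auto simp: c_def min_def)
    finally show "a powr (-1/2) * b powr (-1) + a powr (-1) * b powr (-1/2) \<le> 2 * (a powr (-3/2) + b powr (-3/2))"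
      by simp
  qed (use pos in auto)
  finally show ?thesis
    by (simp add: a_def b_def d_def)
qed

lemma cauchy_transform_holder:
  assumes K: "strip_dominated B K"
  shows "norm (cauchy_transform K l - cauchy_transform K m) \<le> 4 * B * cconst * sqrt (norm (l - m))"
proof -
  note [measurable] = strip_dominatedD(1)[OF K]
  note B = strip_dominatedD(2)[OF K]
  let ?S = "\<lambda>y::complex \<times> real. strip (snd y) / (1 + (norm (fst y))\<^sup>2)"
  have "ennreal (norm (cauchy_transform K l - cauchy_transform K m)) =
      ennreal (norm (LINT y|lborel. K y / (fst y - l) - K y / (fst y - m)))"
    unfolding cauchy_transform_def by (simp add: integrable_cauchy_transform[OF K])
  also have "\<dots> \<le> (\<integral>\<^sup>+y. ennreal (norm (K y / (fst y - l) - K y / (fst y - m))) \<partial>lborel)"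
    by (intro integral_norm_bound_ennreal Bochner_Integration.integrable_diff integrable_cauchy_transform[OF K])
  also have "\<dots> \<le> (\<integral>\<^sup>+y. ennreal (2 * B * sqrt (norm (l - m))) * (ennreal (norm (fst y - l) powr (-(3/2)) * ?S y)
       + ennreal (norm (fst y - m) powr (-(3/2)) * ?S y)) \<partial>lborel)"
  proof (rule nn_integral_mono_AE, use AE_fst_neq[of l] AE_fst_neq[of m] in eventually_elim)
    case (elim y)
    have "norm (K y / (fst y - l) - K y / (fst y - m)) = norm (K y) * norm (1 / (fst y - l) - 1 / (fst y - m))"
      by (simp add: norm_mult[symmetric] right_diff_distrib)
    also have "\<dots> \<le> (B * ?S y) * (sqrt (norm (l - m)) * (2 * (norm (fst y - l) powr (-3/2) + norm (fst y - m) powr (-3/2))))"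
      using elim by (intro mult_mono strip_dominatedD(3)[OF K] cauchy_kernel_difference) (use B in auto)
    also have "\<dots> = 2 * B * sqrt (norm (l - m)) * (norm (fst y - l) powr (-(3/2)) * ?S y + norm (fst y - m) powr (-(3/2)) * ?S y)"
      by (simp add: algebra_simps add_divide_distrib)
    finally show ?case
      using B by (simp add: ennreal_plus[symmetric] ennreal_mult[symmetric] ennreal_leI del: ennreal_plus)
  qed
  also have "\<dots> = ennreal (2 * B * sqrt (norm (l - m))) * ((\<integral>\<^sup>+y. ennreal (norm (fst y - l) powr (-(3/2)) * ?S y) \<partial>lborel)
       + (\<integral>\<^sup>+y. ennreal (norm (fst y - m) powr (-(3/2)) * ?S y) \<partial>lborel))"
    by (subst nn_integral_cmult, measurable, subst nn_integral_add) auto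
  also have "\<dots> \<le> ennreal (2 * B * sqrt (norm (l - m))) * (ennreal cconst + ennreal cconst)"
    by (intro mult_left_mono add_mono nn_integral_cauchy_kernel_powr) auto
  also have "\<dots> = ennreal (4 * B * cconst * sqrt (norm (l - m)))"
    using B by (simp add: ennreal_plus[symmetric] ennreal_mult[symmetric] algebra_simps del: ennreal_plus)
  finally show ?thesis
    using B by (subst (asm) ennreal_le_iff) auto
qed

lemma isCont_cauchy_transform:
  assumes K: "strip_dominated B K"
  shows "isCont (cauchy_transform K) l"
proof -
  have "((\<lambda>m. 4 * B * cconst * sqrt (norm (m - l))) \<longlongrightarrow> 4 * B * cconst * sqrt (norm (l - l))) (at l)"
    by (intro tendsto_intros)
  then have "((\<lambda>m. cauchy_transform K m - cauchy_transform K l) \<longlongrightarrow> 0) (at l)"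
    using cauchy_transform_holder[OF K, of _ l]
    by (rule_tac Lim_null_comparison[rotated]) (auto intro!: always_eventually)
  then show ?thesis
    by (simp add: isCont_def LIM_zero_iff)
qed

text \<open>The weight is split as
  \<open>sqrt (norm l) <= sqrt (norm (z - l)) + sqrt (norm z)\<close>. The first part merely softens
  the singularity at l to the exponent -1/2, the second is the case of
  \<open>gker_bound_swap\<close>. Decay at this low rate already gives the limit at
  infinity.\<close>

lemma cauchy_transform_decay:
  assumes K: "strip_dominated B K"
  shows "sqrt (norm l) * norm (cauchy_transform K l) \<le> 2 * B * cconst"
proof -
  note [measurable] = strip_dominatedD(1)[OF K]
  note B = strip_dominatedD(2)[OF K]
  let ?S = "\<lambda>y::complex \<times> real. strip (snd y) / (1 + (norm (fst y))\<^sup>2)"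
  let ?T = "\<lambda>y::complex \<times> real. sqrt (norm (fst y)) / norm (fst y - l) * ?S y"
  have "ennreal (sqrt (norm l)) * ennreal (norm (cauchy_transform K l)) \<le> ennreal (sqrt (norm l)) * (\<integral>\<^sup>+y. ennreal (norm (K y / (fst y - l))) \<partial>lborel)"
    unfolding cauchy_transform_def
    by (intro mult_left_mono integral_norm_bound_ennreal integrable_cauchy_transform[OF K]) auto
  also have "\<dots> = (\<integral>\<^sup>+y. ennreal (sqrt (norm l)) * ennreal (norm (K y / (fst y - l))) \<partial>lborel)"
    by (rule nn_integral_cmult[symmetric]) measurable
  also have "\<dots> \<le> (\<integral>\<^sup>+y. ennreal B * (ennreal (norm (fst y - l) powr (-(1/2)) * ?S y) + ennreal (?T y)) \<partial>lborel)"
  proof (rule nn_integral_mono_AE, use AE_fst_neq[of l] in eventually_elim)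
    case (elim y)
    have pos: "norm (fst y - l) > 0"
      using elim by simp
    have sq: "sqrt (norm (fst y - l)) / norm (fst y - l) = norm (fst y - l) powr (-(1/2))"
      using pos by (simp add: powr_half_sqrt powr_minus_divide real_div_sqrt field_simps)
    have "sqrt (norm l) \<le> sqrt (norm (fst y - l)) + sqrt (norm (fst y))"
      using sqrt_add_le_add_sqrt[of "norm (fst y - l)" "norm (fst y)"] norm_triangle_ineq4[of "fst y" "fst y - l"]
      by (intro order_trans[OF real_sqrt_le_mono[of "norm l" "norm (fst y - l) + norm (fst y)"]]) auto
    then have "sqrt (norm l) * norm (K y / (fst y - l)) \<le> (sqrt (norm (fst y - l)) + sqrt (norm (fst y))) * ((B * ?S y) / norm (fst y - l))"
      unfolding norm_divide by (intro mult_mono divide_right_mono strip_dominatedD(3)[OF K]) auto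
    also have "\<dots> = B * (sqrt (norm (fst y - l)) / norm (fst y - l) * ?S y + ?T y)"
      by (simp add: algebra_simps add_divide_distrib)
    also have "\<dots> = B * (norm (fst y - l) powr (-(1/2)) * ?S y + ?T y)"
      unfolding sq ..
    finally show ?case
      using B by (simp add: ennreal_plus[symmetric] ennreal_mult[symmetric] ennreal_leI del: ennreal_plus)
  qed
  also have "\<dots> = ennreal B * ((\<integral>\<^sup>+y. ennreal (norm (fst y - l) powr (-(1/2)) * ?S y) \<partial>lborel) + (\<integral>\<^sup>+y. ennreal (?T y) \<partial>lborel))"
    by (subst nn_integral_cmult, measurable, subst nn_integral_add) auto
  also have "\<dots> \<le> ennreal B * (ennreal cconst + ennreal cconst)"
  proof (intro mult_left_mono add_mono nn_integral_cauchy_kernel_powr)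
    show "(\<integral>\<^sup>+y. ennreal (?T y) \<partial>lborel) \<le> ennreal cconst"
    proof (rule nn_integral_gker_strip)
      fix y :: "complex \<times> real"
      assume "fst y \<noteq> 0" "fst y \<noteq> l"
      then show "?T y \<le> (gker (fst y - l) + gker (fst y)) * strip (snd y)"
        using gker_bound_swap[of "fst y" "fst y - l"] by (auto split: split_indicator simp: mult.commute)
    qed
  qed auto
  also have "\<dots> = ennreal (2 * B * cconst)"
    using B by (simp add: ennreal_plus[symmetric] ennreal_mult[symmetric] algebra_simps del: ennreal_plus)
  finally show ?thesis
    using B by (subst (asm) ennreal_mult[symmetric], simp, simp, subst (asm) ennreal_le_iff) auto
qed

lemma cauchy_transform_at_infinity:
  assumes K: "strip_dominated B K"
  shows "(cauchy_transform K \<longlongrightarrow> 0) at_infinity"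
proof (rule Lim_null_comparison)
  show "\<forall>\<^sub>F l in at_infinity. norm (cauchy_transform K l) \<le> 2 * B * cconst / sqrt (norm l)"
    unfolding eventually_at_infinity
  proof (intro exI[of _ 1] allI impI)
    fix l :: complex assume "1 \<le> norm l"
    then have "sqrt (norm l) > 0" by auto
    then show "norm (cauchy_transform K l) \<le> 2 * B * cconst / sqrt (norm l)"
      using cauchy_transform_decay[OF K, of l] by (simp add: field_simps)
  qed
  show "((\<lambda>l. 2 * B * cconst / sqrt (norm l)) \<longlongrightarrow> 0) at_infinity"
    by (rule real_tendsto_divide_at_top[OF tendsto_const])
      (intro filterlim_compose[OF sqrt_at_top] filterlim_norm_at_top)
qed

section \<open>The variety and the circles\<close>

lemma cvec_simps:
  "cvec (x + y) = cvec x + cvec y" "cvec (c *\<^sub>R x) = complex_of_real c *s cvec x"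
  "cvec (x - y) = cvec x - cvec y" "cvec (- x) = - cvec x" "cvec 0 = 0"
  by (simp_all add: cvec_def vec_eq_iff)

lemma scalar_product_add_left: "scalar_product (a + b) c = scalar_product a c + scalar_product b (c :: complex^3)"
  by (simp add: scalar_product_def algebra_simps sum.distrib)

lemma scalar_product_add_right: "scalar_product a (b + c) = scalar_product a b + scalar_product a (c :: complex^3)"
  by (simp add: scalar_product_def algebra_simps sum.distrib)

lemma scalar_product_smult_left: "scalar_product (t *s a) b = t * scalar_product a (b :: complex^3)"
  by (simp add: scalar_product_def algebra_simps sum_distrib_left)

lemma scalar_product_smult_right: "scalar_product a (t *s b) = t * scalar_product a (b :: complex^3)"
  by (simp add: scalar_product_def algebra_simps sum_distrib_left)

lemma scalar_product_minus_right: "scalar_product a (- b) = - scalar_product a (b :: complex^3)"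
  by (simp add: scalar_product_def sum_negf)

lemma scalar_product_cvec: "scalar_product (cvec x) (cvec y) = complex_of_real (x \<bullet> y)"
  by (simp add: scalar_product_def cvec_def inner_vec_def)

lemma scalar_product_commute: "scalar_product a b = scalar_product b (a :: complex^3)"
  by (simp add: scalar_product_def mult.commute)

lemmas scalar_product_simps = scalar_product_add_left scalar_product_add_right
  scalar_product_smult_left scalar_product_smult_right scalar_product_minus_right scalar_product_cvec

lemma cvec_Re_Im: "k = cvec (Re_vec k) + \<i> *s cvec (Im_vec k)"
  by (simp add: vec_eq_iff cvec_def Re_vec_def Im_vec_def complex_eq_iff)

lemma Re_vec_cvec_add: "Re_vec (cvec a + \<i> *s cvec b) = a" "Im_vec (cvec a + \<i> *s cvec b) = b"
  by (simp_all add: vec_eq_iff cvec_def Re_vec_def Im_vec_def)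

text \<open>This is (k + \<xi>)^2 - k^2. For k on the variety its zeros are therefore the real
  translations that keep k on the variety, and the shift rules below are telescoping sums.\<close>

definition denom :: "complex^3 \<Rightarrow> real^3 \<Rightarrow> complex"
  where "denom k \<xi> = complex_of_real (\<xi> \<bullet> \<xi>) + 2 * scalar_product k (cvec \<xi>)"

lemma A_op_denom: "A_op v k U p = (LINT \<xi>|lebesgue. v (p + \<xi>) * U (- \<xi>) / denom k \<xi>)"
  by (simp add: A_op_def denom_def)

lemma Sigma_var_add_cvec:
  assumes "k \<in> Sigma_var" "denom k \<xi> = 0"
  shows "k + cvec \<xi> \<in> Sigma_var"
  using assms
  by (simp add: Sigma_var_def denom_def scalar_product_simps scalar_product_commute[of "cvec \<xi>"] add.commute)

lemma denom_add_cvec: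
  assumes "denom k \<xi> = 0"
  shows "denom (k + cvec \<xi>) s = denom k (s + \<xi>)"
proof -
  have "denom k (s + \<xi>) = denom (k + cvec \<xi>) s + denom k \<xi>"
    by (simp add: denom_def scalar_product_simps cvec_simps inner_add_left inner_add_right inner_commute[of \<xi> s])
  then show ?thesis
    using assms by simp
qed

lemma denom_add_uminus:
  assumes "denom k \<xi> = 0"
  shows "denom (k + cvec \<xi>) (- \<xi>) = 0"
  using denom_add_cvec[OF assms, of "- \<xi>"] by (simp add: denom_def cvec_simps scalar_product_def cvec_def)

text \<open>The condition \<open>denom k (- p) = 0\<close> says that \<open>(k, p) \<in> \<Omega>\<close>.\<close>

lemma denom_shift_variety:
  assumes "denom k \<xi> = 0" "denom k (- p) = 0"
  shows "denom (k + cvec \<xi>) (- (p + \<xi>)) = 0"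
proof -
  have "denom (k + cvec \<xi>) (- (p + \<xi>)) = denom k (- p)"
    using denom_add_cvec[OF assms(1), of "- (p + \<xi>)"] by simp
  then show ?thesis using assms by simp
qed

section \<open>The symbol as a function of \<lambda> and its two roots\<close>

definition acoef :: "(real^3 \<Rightarrow> real^3) \<Rightarrow> real^3 \<Rightarrow> real^3 \<Rightarrow> complex"
  where "acoef \<theta> p \<xi> = complex_of_real (norm p / 2) * Complex (omega \<theta> p \<bullet> \<xi>) (\<theta> p \<bullet> \<xi>)"

definition ccoef :: "real^3 \<Rightarrow> real^3 \<Rightarrow> real"
  where "ccoef p \<xi> = \<xi> \<bullet> \<xi> + p \<bullet> \<xi>"

text \<open>Since \<theta>, \<omega> and \<xi> are real, the coefficient of 1 / l is minus the
  conjugate of that of l, and the constant term is real. From this symmetry it follows that a times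
  a root is real and that the two roots are antipodal.\<close>

lemma denom_k_of:
  "denom (k_of \<theta> l p) \<xi> = acoef \<theta> p \<xi> * l - cnj (acoef \<theta> p \<xi>) / l + ccoef p \<xi>"
proof -
  define m where "m = 1 / l"
  have E: "cnj (acoef \<theta> p \<xi>) / l = cnj (acoef \<theta> p \<xi>) * m"
    by (simp add: m_def)
  show ?thesis
    unfolding denom_def k_of_def m_def[symmetric] E
    by (simp add: scalar_product_simps acoef_def ccoef_def Complex_eq cvec_simps) (simp add: field_simps)
qed

text \<open>The two roots in \<open>l\<close> of \<open>a * l - cnj a / l + c\<close>, the form of the symbol in \<open>denom_k_of\<close>. The
  sign of the square root puts \<open>root1\<close> into the right and \<open>root2\<close> into the left half plane.\<close>

definition root1 :: "real \<Rightarrow> complex \<Rightarrow> complex"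
  where "root1 c a = complex_of_real ((- c + sgn (Re a) * sqrt (c\<^sup>2 + 4 * (norm a)\<^sup>2)) / 2) / a"

definition root2 :: "real \<Rightarrow> complex \<Rightarrow> complex"
  where "root2 c a = - 1 / cnj (root1 c a)"

text \<open>With t = a z the equation reads t - conj(t) / |z|^2 + c = 0. Its imaginary part is Im t
  (1 + 1 / |z|^2) = 0, so t is real and solves a real quadratic equation.\<close>

lemma root_real:
  assumes z: "z \<noteq> 0" and eq: "a * z - cnj a / z + complex_of_real c = 0"
  shows "a * z = complex_of_real (Re (a * z))" "(Re (a * z))\<^sup>2 + c * Re (a * z) = (norm a)\<^sup>2"
    "a * z = cnj a * cnj z"
proof -
  have "cnj a / z = cnj (a * z) / complex_of_real ((norm z)\<^sup>2)"
    using z unfolding complex_norm_square[of z] by (simp add: field_simps)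
  then have E: "a * z - cnj (a * z) / complex_of_real ((norm z)\<^sup>2) + complex_of_real c = 0"
    using eq by simp
  have "Im (u - cnj u / complex_of_real r + complex_of_real c) = Im u + Im u / r" for u r
    by (simp add: Im_divide_of_real)
  from this[of "a * z" "(norm z)\<^sup>2"] have "Im (a * z) + Im (a * z) / (norm z)\<^sup>2 = 0"
    unfolding E by (simp only: zero_complex.sel)
  then have "Im (a * z) * (1 + 1 / (norm z)\<^sup>2) = 0"
    by (simp only: distrib_left times_divide_eq_right mult_1_right)
  moreover have "1 + 1 / (norm z)\<^sup>2 > 0"
    by (simp add: add_pos_nonneg)
  ultimately have I: "Im (a * z) = 0"
    by (metis less_irrefl mult_eq_0_iff)
  define t where "t = Re (a * z)"
  have R: "a * z = complex_of_real t"
    using I unfolding t_def by (simp only: complex_eq_iff Re_complex_of_real Im_complex_of_real)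
  then show "a * z = complex_of_real (Re (a * z))"
    by (simp only: t_def)
  have "cnj (a * z) = a * z"
    unfolding R by simp
  then show "a * z = cnj a * cnj z"
    by simp
  have "a * z * (a * z) - a * cnj a + complex_of_real c * (a * z) = (a * z) * (a * z - cnj a / z + complex_of_real c)"
    using z by (simp add: algebra_simps)
  then have "a * z * (a * z) - a * cnj a + complex_of_real c * (a * z) = 0"
    unfolding eq by simp
  then have "complex_of_real (t\<^sup>2 + c * t) = complex_of_real ((norm a)\<^sup>2)"
    unfolding R complex_norm_square by (simp add: power2_eq_square algebra_simps)
  then show "(Re (a * z))\<^sup>2 + c * Re (a * z) = (norm a)\<^sup>2"
    unfolding t_def of_real_eq_iff .
qed

text \<open>Ensures that a root lies in one of the open half planes and is thus returned by
  \<open>root1\<close> or \<open>root2\<close>.\<close>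

lemma root_nonzero:
  assumes a: "Re a \<noteq> 0" and z: "z \<noteq> 0" and eq: "a * z - cnj a / z + complex_of_real c = 0"
  shows "Re z \<noteq> 0"
proof
  assume "Re z = 0"
  have "Im (a * z) = 0"
    using root_real(1)[OF z eq] by (metis Im_complex_of_real)
  then have "Re a * Im z = 0"
    using \<open>Re z = 0\<close> by simp
  then show False
    using a z \<open>Re z = 0\<close> by (simp add: complex_eq_iff)
qed

text \<open>The real number t = a z satisfies t (t + c) = |a|^2 > 0, so 2 t + c has the sign of t,
  and this is the sign of \<open>Re a\<close> because Re z > 0. That decides the sign of the square
  root.\<close>

lemma root1_unique:
  assumes a: "a \<noteq> 0" and z: "Re z > 0" and eq: "a * z - cnj a / z + complex_of_real c = 0"
  shows "root1 c a = z"
proof -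
  have z0: "z \<noteq> 0"
    using z by auto
  define t where "t = Re (a * z)"
  note R = root_real[OF z0 eq, folded t_def]
  have t0: "t \<noteq> 0"
    using R(1) a z0 by auto
  have zt: "z = complex_of_real t / a"
    using R(1) a by (simp add: field_simps)
  have sq: "(2 * t + c)\<^sup>2 = c\<^sup>2 + 4 * (norm a)\<^sup>2"
    using R(2) by (simp add: power2_eq_square algebra_simps)
  have "Re z = t * Re a / (norm a)\<^sup>2"
    unfolding zt by (simp add: Re_divide norm_complex_def cmod_power2)
  then have pos: "t * Re a > 0"
    using z a by (simp add: zero_less_divide_iff not_less)
  have tc: "t * (t + c) > 0"
    using R(2) a by (simp add: power2_eq_square algebra_simps)
  have "2 * t + c = sgn (Re a) * sqrt (c\<^sup>2 + 4 * (norm a)\<^sup>2)"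
  proof (cases "t > 0")
    case True
    then have "sgn (Re a) = 1" "2 * t + c > 0"
      using pos tc by (auto simp: zero_less_mult_iff)
    then show ?thesis
      unfolding sq[symmetric] by simp
  next
    case False
    then have "sgn (Re a) = -1" "2 * t + c < 0"
      using pos tc t0 by (auto simp: zero_less_mult_iff)
    then show ?thesis
      unfolding sq[symmetric] by simp
  qed
  then have "- c + sgn (Re a) * sqrt (c\<^sup>2 + 4 * (norm a)\<^sup>2) = 2 * t"
    by simp
  then have "root1 c a = complex_of_real t / a"
    unfolding root1_def by (simp only:) simp
  then show ?thesis
    using zt by simp
qed

text \<open>The product of the two roots is - conj(a) / a. Together with a z = conj(a z) this makes
  the second root -1 / conj(z), the antipode of the first on the Riemann sphere.\<close>

lemma root_other:
  assumes z: "z \<noteq> 0" and eq: "a * z - cnj a / z + complex_of_real c = 0"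
  shows "a * (- 1 / cnj z) - cnj a / (- 1 / cnj z) + complex_of_real c = 0"
proof -
  have "a / cnj z = cnj a / z"
    using root_real(3)[OF z eq] z by (simp add: field_simps)
  then show ?thesis
    using eq root_real(3)[OF z eq] by simp
qed

lemma root2_unique:
  assumes a: "a \<noteq> 0" and z: "Re z < 0" and eq: "a * z - cnj a / z + complex_of_real c = 0"
  shows "root2 c a = z"
proof -
  have z0: "z \<noteq> 0"
    using z by auto
  have "Re (- 1 / cnj z) = - Re z / (norm z)\<^sup>2"
    by (simp add: Re_divide cmod_power2)
  then have "Re (- 1 / cnj z) > 0"
    using z z0 by (simp add: divide_neg_pos)
  from root1_unique[OF a this root_other[OF z0 eq]] show ?thesis
    by (simp add: root2_def)
qed

text \<open>Times l the symbol is the quadratic a (l - z) (l + 1 / conj(z)). The coefficient that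
  belongs to a root is the reciprocal of the derivative a + conj(a) / z^2 of the symbol there; this
  derivative is later matched with the Jacobian of the circles.\<close>

lemma partial_fractions:
  assumes a: "a \<noteq> 0" and z: "z \<noteq> 0" and eq: "a * z - cnj a / z + complex_of_real c = 0"
    and l: "l \<noteq> 0" "l \<noteq> z" "l \<noteq> - 1 / cnj z"
  shows "1 / (a * l - cnj a / l + complex_of_real c) =
    1 / (a + cnj a / z\<^sup>2) / (l - z) + 1 / (a + cnj a / (- 1 / cnj z)\<^sup>2) / (l - (- 1 / cnj z))"
proof -
  define n where "n = z * cnj z"
  have n: "n = complex_of_real ((norm z)\<^sup>2)"
    by (simp only: n_def complex_norm_square)
  have n1: "n + 1 \<noteq> 0"
  proof -
    have "Re (n + 1) > 0"
      unfolding n by (simp add: add_nonneg_pos)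
    then show ?thesis by (metis zero_complex.sel(1) less_irrefl)
  qed
  have C: "cnj a = a * z / cnj z"
    using root_real(3)[OF z eq] z by (simp add: eq_divide_eq)
  have cc: "complex_of_real c = a / cnj z - a * z"
  proof -
    have "complex_of_real c = cnj a / z - a * z"
      using eq by (simp add: algebra_simps add_eq_0_iff)
    then show ?thesis
      unfolding C using z by simp
  qed
  have Q: "a * l - cnj a / l + complex_of_real c = a * (l - z) * (l + 1 / cnj z) / l"
    unfolding C cc using l z by (simp add: divide_simps) (simp add: algebra_simps)
  \<comment> \<open>The derivatives at the two roots are a (n + 1) / n and a (n + 1), where n =
    |z|^2.\<close>
  have d1: "a + cnj a / z\<^sup>2 = a * (n + 1) / n"
    unfolding C n_def using z by (simp add: divide_simps power2_eq_square) (simp add: algebra_simps)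
  have d2: "a + cnj a / (- 1 / cnj z)\<^sup>2 = a * (n + 1)"
    unfolding C n_def using z by (simp add: divide_simps power2_eq_square) (simp add: algebra_simps)
  have l2: "l + 1 / cnj z \<noteq> 0"
    using l by (auto simp: add_eq_0_iff)
  define u where "u = l - z"
  define w where "w = l + 1 / cnj z"
  have uw: "u \<noteq> 0" "w \<noteq> 0" "w - u = (n + 1) / cnj z"
    using l l2 z by (auto simp: u_def w_def n_def add_divide_distrib algebra_simps)
  have "n / (a * (n + 1)) / u + 1 / (a * (n + 1)) / w = (n * w + u) / (a * (n + 1) * u * w)"
    using a n1 uw by (simp add: divide_simps)
  also have "n * w + u = (n + 1) * l"
    unfolding u_def w_def n_def using z by (simp add: field_simps)
  also have "(n + 1) * l / (a * (n + 1) * u * w) = l / (a * u * w)"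
    using n1 by simp
  finally show ?thesis
    unfolding Q d1 d2 using l by (simp add: u_def w_def)
qed

section \<open>The orthogonal frame \<theta>, \<omega>, p and the circles in its coordinates\<close>

locale frame =
  fixes \<theta> :: "real^3 \<Rightarrow> real^3" and p :: "real^3"
  assumes p_nonzero: "p \<noteq> 0" and theta_norm: "norm (\<theta> p) = 1" and theta_orth: "\<theta> p \<bullet> p = 0"
begin

abbreviation om :: "real^3"
  where "om \<equiv> omega \<theta> p"

lemma norm_p_pos: "norm p > 0"
  using p_nonzero by simp

lemma theta_theta: "\<theta> p \<bullet> \<theta> p = 1"
  using theta_norm by (simp add: dot_square_norm)

lemma frame_orth: "om \<bullet> p = 0" "om \<bullet> \<theta> p = 0" "om \<bullet> om = 1"
proof -
  show "om \<bullet> p = 0" "om \<bullet> \<theta> p = 0"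
    by (simp_all add: omega_def dot_cross_self)
  have "(norm (cross3 p (\<theta> p)))\<^sup>2 = (norm p)\<^sup>2"
    using norm_cross_dot[of p "\<theta> p"] theta_orth by (simp add: inner_commute theta_norm)
  then have "norm (cross3 p (\<theta> p)) = norm p"
    by simp
  then have "norm om = 1"
    using p_nonzero by (simp add: omega_def)
  then show "om \<bullet> om = 1"
    by (simp add: dot_square_norm)
qed

lemmas frame_inner = theta_theta theta_orth frame_orth
  theta_orth[unfolded inner_commute[of _ p]] frame_orth(1)[unfolded inner_commute[of _ p]]
  frame_orth(2)[unfolded inner_commute[of _ "\<theta> p"]]

lemma frame_expand: "x = (\<theta> p \<bullet> x) *\<^sub>R \<theta> p + (om \<bullet> x) *\<^sub>R om + ((p \<bullet> x) / (norm p)\<^sup>2) *\<^sub>R p"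
proof -
  let ?B = "{\<theta> p, om, p}"
  define y where "y = x - ((\<theta> p \<bullet> x) *\<^sub>R \<theta> p + (om \<bullet> x) *\<^sub>R om + ((p \<bullet> x) / (norm p)\<^sup>2) *\<^sub>R p)"
  have nz: "\<theta> p \<noteq> 0" "om \<noteq> 0"
    using theta_theta frame_orth(3) by auto
  have d: "\<theta> p \<noteq> om" "\<theta> p \<noteq> p" "om \<noteq> p"
    using theta_theta frame_orth theta_orth by auto
  have po: "pairwise orthogonal ?B"
    by (auto simp: pairwise_def orthogonal_def frame_inner)
  have "independent ?B"
    by (rule pairwise_orthogonal_independent[OF po]) (use nz p_nonzero in auto)
  moreover have "card ?B = 3"
    using d by simp
  ultimately have "UNIV \<subseteq> span ?B"
    by (intro card_ge_dim_independent) auto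
  then have "y \<in> span ?B"
    by auto
  moreover have "orthogonal y z" if "z \<in> ?B" for z
    using that p_nonzero
    by (auto simp: y_def orthogonal_def frame_inner inner_diff_left inner_add_left inner_commute[of x] power2_norm_eq_inner)
  ultimately have "orthogonal y y"
    by (rule orthogonal_to_span)
  then have "y = 0"
    by (simp add: orthogonal_def)
  then show ?thesis
    by (simp add: y_def)
qed

lemma k_of_in_Sigma:
  assumes "l \<noteq> 0"
  shows "k_of \<theta> l p \<in> Sigma_var"
proof -
  define m where "m = 1 / l"
  have "scalar_product (k_of \<theta> l p) (k_of \<theta> l p) =
    (\<i> * norm p / 4 * (l + m))\<^sup>2 + (norm p / 4 * (l - m))\<^sup>2 + complex_of_real (p \<bullet> p) / 4"
    by (simp add: k_of_def m_def[symmetric] scalar_product_simps frame_inner power2_eq_square)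
  also have "\<dots> = (norm p)\<^sup>2 / 4 * (1 - l * m)"
    unfolding dot_square_norm[of p] by (simp add: power2_eq_square field_simps)
  also have "\<dots> = 0"
    using assms by (simp add: m_def)
  finally show ?thesis
    by (simp add: Sigma_var_def)
qed

lemma denom_k_of_uminus_p: "denom (k_of \<theta> l p) (- p) = 0"
  by (simp add: denom_k_of acoef_def ccoef_def frame_inner Complex_eq)

text \<open>Let A and B be the components of k along \<theta> and \<omega>. The component along p is
  fixed by the second hypothesis, and k^2 = 0 becomes (A + iB) (A - iB) = - |p|^2 / 4. So \<lambda>
  = 2 (A + iB) / (i |p|) is nonzero, the other factor gives 1 / \<lambda> in the same way, and the
  two recover A and B.\<close>

lemma lam_of_nonzero_k_of_lam_of:
  assumes k: "k \<in> Sigma_var" and kp: "denom k (- p) = 0"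
  shows "lam_of \<theta> k p \<noteq> 0" "k_of \<theta> (lam_of \<theta> k p) p = k"
proof -
  define A B D where "A = scalar_product k (cvec (\<theta> p))" and "B = scalar_product k (cvec om)"
    and "D = scalar_product k (cvec p)"
  have D: "D = complex_of_real (p \<bullet> p) / 2"
    using kp by (simp add: denom_def D_def cvec_simps scalar_product_simps)
  have ex: "k = A *s cvec (\<theta> p) + B *s cvec om + (D / (norm p)\<^sup>2) *s cvec p"
  proof -
    have "cvec x = complex_of_real (\<theta> p \<bullet> x) *s cvec (\<theta> p) + complex_of_real (om \<bullet> x) *s cvec om
        + complex_of_real ((p \<bullet> x) / (norm p)\<^sup>2) *s cvec p" for x
      by (subst frame_expand[of x]) (simp only: cvec_simps)
    from this[of "Re_vec k"] this[of "Im_vec k"]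
    have "k = (complex_of_real (\<theta> p \<bullet> Re_vec k) + \<i> * complex_of_real (\<theta> p \<bullet> Im_vec k)) *s cvec (\<theta> p)
        + (complex_of_real (om \<bullet> Re_vec k) + \<i> * complex_of_real (om \<bullet> Im_vec k)) *s cvec om
        + ((complex_of_real (p \<bullet> Re_vec k) + \<i> * complex_of_real (p \<bullet> Im_vec k)) / (norm p)\<^sup>2) *s cvec p"
      by (subst cvec_Re_Im[of k], simp only:)
        (simp add: vec_eq_iff algebra_simps add_divide_distrib)
    moreover have "scalar_product k (cvec x) = complex_of_real (x \<bullet> Re_vec k) + \<i> * complex_of_real (x \<bullet> Im_vec k)" for x
      by (subst cvec_Re_Im[of k]) (simp add: scalar_product_simps inner_commute)
    ultimately show ?thesis
      by (simp add: A_def B_def D_def)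
  qed
  have np: "complex_of_real (norm p) \<noteq> 0"
    using p_nonzero by simp
  have "scalar_product k k = A\<^sup>2 + B\<^sup>2 + complex_of_real (p \<bullet> p) / 4"
    by (subst (1 2) ex) (use np in \<open>simp add: scalar_product_simps frame_inner power2_eq_square D dot_square_norm[of p]\<close>)
  then have "A\<^sup>2 + B\<^sup>2 + (complex_of_real (norm p))\<^sup>2 / 4 = 0"
    using k by (simp add: Sigma_var_def dot_square_norm[of p])
  then have prod: "(A + \<i> * B) * (A - \<i> * B) = - (complex_of_real (norm p))\<^sup>2 / 4"
  proof -
    have "(A + \<i> * B) * (A - \<i> * B) = A\<^sup>2 + B\<^sup>2"
      by (simp add: algebra_simps power2_eq_square)
    also have "\<dots> = - ((complex_of_real (norm p))\<^sup>2 / 4)"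
      using \<open>A\<^sup>2 + B\<^sup>2 + (complex_of_real (norm p))\<^sup>2 / 4 = 0\<close> by (simp only: eq_neg_iff_add_eq_0)
    finally show ?thesis by simp
  qed
  have lam: "lam_of \<theta> k p = 2 * (A + \<i> * B) / (\<i> * norm p)"
    by (simp add: lam_of_def theta_i_omega_def scalar_product_simps A_def B_def)
  have nz: "A + \<i> * B \<noteq> 0"
    using prod np by auto
  then show "lam_of \<theta> k p \<noteq> 0"
    unfolding lam divide_eq_0_iff mult_eq_0_iff using nz np by simp
  have inv: "1 / lam_of \<theta> k p = 2 * (A - \<i> * B) / (\<i> * norm p)"
  proof -
    have "2 * (A + \<i> * B) / (\<i> * norm p) * (2 * (A - \<i> * B) / (\<i> * norm p)) = 4 * ((A + \<i> * B) * (A - \<i> * B)) / (\<i> * norm p)\<^sup>2"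
      by (simp only: times_divide_times_eq power2_eq_square) (simp add: algebra_simps)
    also have "\<dots> = 1"
      unfolding prod using np by (simp add: power_mult_distrib)
    finally show ?thesis
      unfolding lam by (metis inverse_unique inverse_eq_divide)
  qed
  have c1: "\<i> * complex_of_real (norm p) / 4 * (lam_of \<theta> k p + 1 / lam_of \<theta> k p) = A"
    unfolding inv unfolding lam using np by (simp add: divide_simps)
  have c2: "complex_of_real (norm p) / 4 * (lam_of \<theta> k p - 1 / lam_of \<theta> k p) = B"
    unfolding inv unfolding lam using np by (simp add: divide_simps)
  have c3: "D / (norm p)\<^sup>2 = 1 / 2"
    using np by (simp add: D dot_square_norm[of p])
  show "k_of \<theta> (lam_of \<theta> k p) p = k"
    unfolding k_of_def c1 c2 cvec_simps using ex c3 by simp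
qed

text \<open>Coordinates of \<open>\<xi>\<close>-space in which the circle with parameter \<open>\<rho> * cis \<alpha>\<close> is the curve
  \<open>(yc w \<phi> * cis \<alpha>, zc w \<phi>)\<close> with \<open>w = wco \<rho>\<close>.\<close>

definition G :: "complex \<times> real \<Rightarrow> real^3"
  where "G = (\<lambda>(X, z). Re X *\<^sub>R om - Im X *\<^sub>R \<theta> p + (z / norm p) *\<^sub>R p)"

definition wco :: "real \<Rightarrow> real"
  where "wco \<rho> = norm p / 4 * (\<rho> - 1 / \<rho>)"

text \<open>The norm of Im k. The relation kappa^2 = wco^2 + (|p| / 2)^2 expresses |Im k| = |Re k|,
  the real part of k^2 = 0.\<close>

definition kappa :: "real \<Rightarrow> real"
  where "kappa \<rho> = norm p / 4 * (\<rho> + 1 / \<rho>)"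

definition yc :: "real \<Rightarrow> real \<Rightarrow> real"
  where "yc w \<phi> = w * (cos \<phi> - 1) - norm p / 2 * sin \<phi>"

definition zc :: "real \<Rightarrow> real \<Rightarrow> real"
  where "zc w \<phi> = norm p / 2 * (cos \<phi> - 1) + w * sin \<phi>"

lemma cross_frame:
  "cross3 (\<theta> p) om = (1 / norm p) *\<^sub>R p" "cross3 (\<theta> p) p = - norm p *\<^sub>R om" "cross3 om p = norm p *\<^sub>R \<theta> p"
  "cross3 om (\<theta> p) = - (1 / norm p) *\<^sub>R p"
proof -
  show 1: "cross3 (\<theta> p) om = (1 / norm p) *\<^sub>R p"
    unfolding omega_def cross_mult_right Lagrange by (simp add: frame_inner)
  show "cross3 (\<theta> p) p = - norm p *\<^sub>R om"
    using p_nonzero by (simp add: omega_def cross_skew[of "\<theta> p"])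
  have "cross3 om p = - cross3 p om"
    by (rule cross_skew)
  also have "\<dots> = - (1 / norm p) *\<^sub>R cross3 p (cross3 p (\<theta> p))"
    by (simp add: omega_def cross_mult_right)
  also have "\<dots> = norm p *\<^sub>R \<theta> p"
    unfolding Lagrange using p_nonzero by (simp add: frame_inner dot_square_norm[of p] power2_eq_square)
  finally show "cross3 om p = norm p *\<^sub>R \<theta> p" .
  show "cross3 om (\<theta> p) = - (1 / norm p) *\<^sub>R p"
    by (subst cross_skew) (simp add: 1)
qed

text \<open>For \<lambda> = \<rho> cis \<alpha> the direction of Im k depends on \<alpha> only, and
  Re k and the circle lie in the plane through 0 orthogonal to it, which contains p. The modulus
  enters the circle through \<open>wco \<rho>\<close> alone. The change of variables can therefore
  be carried out plane by plane.\<close>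

lemma xi_of_polar:
  assumes "\<rho> > 0"
  shows "Re_vec (k_of \<theta> (complex_of_real \<rho> * cis \<alpha>) p) = G (complex_of_real (wco \<rho>) * cis \<alpha>, norm p / 2)"
    and "Im_vec (k_of \<theta> (complex_of_real \<rho> * cis \<alpha>) p) = kappa \<rho> *\<^sub>R (cos \<alpha> *\<^sub>R \<theta> p + sin \<alpha> *\<^sub>R om)"
    and "k_perp \<theta> (complex_of_real \<rho> * cis \<alpha>) p = G (complex_of_real (- norm p / 2) * cis \<alpha>, wco \<rho>)"
    and "xi_of \<theta> (complex_of_real \<rho> * cis \<alpha>) p \<phi> = G (complex_of_real (yc (wco \<rho>) \<phi>) * cis \<alpha>, zc (wco \<rho>) \<phi>)"
proof -
  let ?l = "complex_of_real \<rho> * cis \<alpha>"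
  let ?e = "cos \<alpha> *\<^sub>R \<theta> p + sin \<alpha> *\<^sub>R om"
  have inv: "1 / ?l = complex_of_real (1 / \<rho>) * cis (- \<alpha>)"
    by (simp add: divide_inverse cis_inverse)
  have plus: "?l + 1 / ?l = complex_of_real ((\<rho> + 1 / \<rho>) * cos \<alpha>) + \<i> * complex_of_real ((\<rho> - 1 / \<rho>) * sin \<alpha>)"
    unfolding inv by (simp add: complex_eq_iff algebra_simps)
  have minus: "?l - 1 / ?l = complex_of_real ((\<rho> - 1 / \<rho>) * cos \<alpha>) + \<i> * complex_of_real ((\<rho> + 1 / \<rho>) * sin \<alpha>)"
    unfolding inv by (simp add: complex_eq_iff algebra_simps)
  have k: "k_of \<theta> ?l p = cvec (G (complex_of_real (wco \<rho>) * cis \<alpha>, norm p / 2)) + \<i> *s cvec (kappa \<rho> *\<^sub>R ?e)"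
    unfolding k_of_def plus minus
    using p_nonzero by (simp add: vec_eq_iff cvec_def G_def wco_def kappa_def complex_eq_iff field_simps)
  show R: "Re_vec (k_of \<theta> ?l p) = G (complex_of_real (wco \<rho>) * cis \<alpha>, norm p / 2)"
    and I: "Im_vec (k_of \<theta> ?l p) = kappa \<rho> *\<^sub>R ?e"
    unfolding k by (simp_all only: Re_vec_cvec_add)
  have kpos: "kappa \<rho> > 0"
    using assms norm_p_pos by (simp add: kappa_def add_pos_pos)
  have "?e \<bullet> ?e = 1"
    by (simp add: inner_add frame_inner power2_eq_square[symmetric])
  then have "norm ?e = 1"
    by (simp add: norm_eq_1)
  then have "norm (kappa \<rho> *\<^sub>R ?e) = kappa \<rho>"
    using kpos by simp
  then have "k_perp \<theta> ?l p = cross3 ?e (G (complex_of_real (wco \<rho>) * cis \<alpha>, norm p / 2))"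
    unfolding k_perp_def I R using kpos by (simp add: cross_mult_left)
  also have "\<dots> = (wco \<rho> * (cos \<alpha> * cos \<alpha>) / norm p + wco \<rho> * (sin \<alpha> * sin \<alpha>) / norm p) *\<^sub>R p - (norm p / 2) *\<^sub>R (cos \<alpha> *\<^sub>R om - sin \<alpha> *\<^sub>R \<theta> p)"
    unfolding G_def
    using p_nonzero
    by (simp add: cross_add_left cross_add_right cross_mult_left cross_mult_right Cross3.right_diff_distrib cross_frame
      algebra_simps power2_eq_square)
  also have "wco \<rho> * (cos \<alpha> * cos \<alpha>) / norm p + wco \<rho> * (sin \<alpha> * sin \<alpha>) / norm p = wco \<rho> / norm p"
    by (simp add: add_divide_distrib[symmetric] distrib_left[symmetric] flip: power2_eq_square)
  also have "(wco \<rho> / norm p) *\<^sub>R p - (norm p / 2) *\<^sub>R (cos \<alpha> *\<^sub>R om - sin \<alpha> *\<^sub>R \<theta> p)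
      = G (complex_of_real (- norm p / 2) * cis \<alpha>, wco \<rho>)"
    by (simp add: G_def algebra_simps)
  finally show P: "k_perp \<theta> ?l p = G (complex_of_real (- norm p / 2) * cis \<alpha>, wco \<rho>)" .
  show "xi_of \<theta> ?l p \<phi> = G (complex_of_real (yc (wco \<rho>) \<phi>) * cis \<alpha>, zc (wco \<rho>) \<phi>)"
    unfolding xi_of_def R P using p_nonzero
    by (simp add: G_def yc_def zc_def algebra_simps add_divide_distrib diff_divide_distrib)
qed

lemma inner_G:
  "om \<bullet> G (X, z) = Re X" "\<theta> p \<bullet> G (X, z) = - Im X" "p \<bullet> G (X, z) = norm p * z"
  "G (X, z) \<bullet> G (X, z) = (norm X)\<^sup>2 + z\<^sup>2"
  using p_nonzero
  by (simp_all add: G_def inner_add inner_diff frame_inner dot_square_norm[of p] power2_eq_square cmod_power2[unfolded power2_eq_square] field_simps)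

lemma acoef_G: "acoef \<theta> p (G (X, z)) = complex_of_real (norm p / 2) * cnj X"
  by (simp add: acoef_def inner_G complex_eq_iff)

lemma ccoef_G: "ccoef p (G (X, z)) = (norm X)\<^sup>2 + z\<^sup>2 + norm p * z"
  by (simp add: ccoef_def inner_G)

text \<open>The density of \<open>d\<xi>\<close> with respect to \<open>d\<zeta> d\<phi>\<close> on each of the sheets \<open>Re \<zeta> > 0\<close> and \<open>Re \<zeta> < 0\<close>.\<close>

definition jac :: "complex \<Rightarrow> real \<Rightarrow> real"
  where "jac \<zeta> \<phi> = norm p / 4 * (yc (wco (norm \<zeta>)) \<phi>)\<^sup>2 * (1 + 1 / (norm \<zeta>)\<^sup>2) / norm \<zeta>"

text \<open>The quotient of \<^term>\<open>jac\<close> by the derivative of the symbol at its root \<open>\<zeta>\<close>. It is a quarter of the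
  coefficient that occurs in \<^const>\<open>brace\<close>.\<close>

definition jker :: "complex \<times> real \<Rightarrow> complex"
  where "jker y = complex_of_real (yc (wco (norm (fst y))) (snd y)) / (2 * cnj (fst y)) * complex_of_real (strip (snd y))"

abbreviation xi :: "complex \<times> real \<Rightarrow> real^3"
  where "xi y \<equiv> xi_of \<theta> (fst y) p (snd y)"

abbreviation kk :: "complex \<times> real \<Rightarrow> complex^3"
  where "kk y \<equiv> k_of \<theta> (fst y) p"

lemma coefficient_eq:
  assumes "l \<noteq> 0"
  shows "norm p / 2 * ((norm l)\<^sup>2 - 1) / (cnj l * norm l) * (cos \<phi> - 1) - norm p / cnj l * sin \<phi> =
    2 * complex_of_real (yc (wco (norm l)) \<phi>) / cnj l"
  using assms by (simp add: yc_def wco_def field_simps power2_eq_square cos_of_real sin_of_real)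

lemma xi_polar_form:
  assumes "fst y \<noteq> 0"
  shows "xi y = G (complex_of_real (yc (wco (norm (fst y))) (snd y)) * sgn (fst y), zc (wco (norm (fst y))) (snd y))"
proof -
  have "fst y = complex_of_real (norm (fst y)) * cis (Arg (fst y))" "sgn (fst y) = cis (Arg (fst y))"
    using assms by (simp_all add: cis_Arg sgn_eq)
  then show ?thesis
    using xi_of_polar(4)[of "norm (fst y)" "Arg (fst y)" "snd y"] assms by simp
qed

text \<open>In complex notation yc + i zc = (w + i |p| / 2) (cis \<phi> - 1), so that the moduli
  multiply.\<close>

lemma yc_zc_circle: "(yc w \<phi>)\<^sup>2 + (zc w \<phi>)\<^sup>2 = 2 * (w\<^sup>2 + (norm p / 2)\<^sup>2) * (1 - cos \<phi>)"
proof -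
  have "(a * c - b * s)\<^sup>2 + (b * c + a * s)\<^sup>2 = (a\<^sup>2 + b\<^sup>2) * (c\<^sup>2 + s\<^sup>2)" for a b c s :: real
    by (simp add: power2_eq_square algebra_simps)
  then have "(yc w \<phi>)\<^sup>2 + (zc w \<phi>)\<^sup>2 = (w\<^sup>2 + (norm p / 2)\<^sup>2) * ((cos \<phi> - 1)\<^sup>2 + (sin \<phi>)\<^sup>2)"
    unfolding yc_def zc_def by blast
  also have "(cos \<phi> - 1)\<^sup>2 + (sin \<phi>)\<^sup>2 = 2 * (1 - cos \<phi>)"
    using sin_cos_squared_add[of \<phi>] by (simp add: power2_eq_square algebra_simps)
  finally show ?thesis
    by (simp only: mult_ac)
qed

lemma norm_xi: 
  assumes "fst y \<noteq> 0"
  shows "(norm (xi y))\<^sup>2 = (yc (wco (norm (fst y))) (snd y))\<^sup>2 + (zc (wco (norm (fst y))) (snd y))\<^sup>2"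
proof -
  have "(norm (xi y))\<^sup>2 = xi y \<bullet> xi y"
    by (rule power2_norm_eq_inner)
  then show ?thesis
    unfolding xi_polar_form[OF assms] inner_G(4) using assms by (simp add: norm_mult norm_sgn)
qed

lemma acoef_xi:
  assumes "fst y \<noteq> 0"
  shows "acoef \<theta> p (xi y) = complex_of_real (norm p / 2 * yc (wco (norm (fst y))) (snd y)) * cnj (sgn (fst y))"
  unfolding xi_polar_form[OF assms] acoef_G by simp

lemma ccoef_xi:
  assumes "fst y \<noteq> 0"
  shows "ccoef p (xi y) = norm p / 2 * yc (wco (norm (fst y))) (snd y) * (1 / norm (fst y) - norm (fst y))"
proof -
  let ?w = "wco (norm (fst y))"
  have "ccoef p (xi y) = (yc ?w (snd y))\<^sup>2 + (zc ?w (snd y))\<^sup>2 + norm p * zc ?w (snd y)"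
    unfolding xi_polar_form[OF assms] ccoef_G using assms by (simp add: norm_mult norm_sgn)
  also have "\<dots> = - 2 * ?w * yc ?w (snd y)"
    unfolding yc_zc_circle by (simp add: yc_def zc_def power2_eq_square field_simps)
  finally show ?thesis
    by (simp add: wco_def algebra_simps)
qed

text \<open>Geometrically, Re k + \<xi> is Re k turned by \<phi> in the plane orthogonal to Im k, so
  the real and imaginary parts of k + \<xi> are again orthogonal and of equal length, that is (k +
  \<xi>)^2 = 0. The proof verifies this through the coefficients of the symbol.\<close>

lemma denom_xi:
  assumes "fst y \<noteq> 0"
  shows "denom (kk y) (xi y) = 0"
proof -
  define r where "r = complex_of_real (norm (fst y))"
  have r: "r \<noteq> 0" "fst y = r * sgn (fst y)" "sgn (fst y) \<noteq> 0" "cnj (sgn (fst y)) = 1 / sgn (fst y)"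
  proof -
    show "r \<noteq> 0" "sgn (fst y) \<noteq> 0" using assms by (auto simp: r_def sgn_zero_iff)
    show "fst y = r * sgn (fst y)" using assms by (simp add: r_def sgn_eq)
    have "sgn (fst y) * cnj (sgn (fst y)) = 1"
      unfolding complex_norm_square[symmetric] using assms by (simp add: norm_sgn)
    then show "cnj (sgn (fst y)) = 1 / sgn (fst y)"
      using assms by (simp add: field_simps sgn_zero_iff)
  qed
  define s where "s = sgn (fst y)"
  have "denom (k_of \<theta> (r * s) p) (xi y) = 0"
    unfolding denom_k_of acoef_xi[OF assms] ccoef_xi[OF assms] 
    using r(1,3,4) assms by (simp add: s_def[symmetric] r_def[symmetric] divide_simps) (simp add: algebra_simps)
  then show ?thesis
    using r(2) by (simp add: s_def)
qed

text \<open>The first factor is the derivative in l of the symbol at its root \<open>fst y\<close>.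
  This identity is what makes the coefficient of the bilinear form appear when the partial fractions
  are integrated over a sheet.\<close>

lemma deriv_factor_xi:
  assumes "fst y \<noteq> 0"
  shows "(acoef \<theta> p (xi y) + cnj (acoef \<theta> p (xi y)) / (fst y)\<^sup>2) * jker y = complex_of_real (jac (fst y) (snd y) * strip (snd y))"
proof -
  define r where "r = complex_of_real (norm (fst y))"
  define s where "s = sgn (fst y)"
  have r: "r \<noteq> 0" "fst y = r * s" "s \<noteq> 0" "cnj s = 1 / s" "cnj r = r"
  proof -
    show "r \<noteq> 0" "s \<noteq> 0" using assms by (auto simp: r_def s_def sgn_zero_iff)
    show "fst y = r * s" using assms by (simp add: r_def s_def sgn_eq)
    have "sgn (fst y) * cnj (sgn (fst y)) = 1"
      unfolding complex_norm_square[symmetric] using assms by (simp add: norm_sgn)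
    then show "cnj s = 1 / s"
      using assms by (simp add: s_def field_simps sgn_zero_iff)
    show "cnj r = r" by (simp add: r_def)
  qed
  have cn: "cnj (fst y) = r / s" and sq: "(fst y)\<^sup>2 = r\<^sup>2 * s\<^sup>2"
    using r(4,5) by (simp_all add: r(2) power_mult_distrib)
  show ?thesis
    unfolding acoef_xi[OF assms] jker_def jac_def cn sq
    using r(1,3,4) assms by (simp add: r_def[symmetric] s_def[symmetric] divide_simps power2_eq_square) (simp add: algebra_simps)
qed

text \<open>Let k be the norm of the imaginary part and N = |\<xi>|. Then N^2 = 2 k^2 (1 - cos
  \<phi>), so both trigonometric terms of \<open>yc\<close> carry a factor 1 / k. Together with 1 /
  (2 r) from the denominator this gives 1 / (1 + r^2), because r k = |p| (1 + r^2) / 4. The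
  remaining growth (1 + N)^2 is left to the decay of the functions on the circle.\<close>

lemma jker_bound:
  "norm (jker y) \<le> (1 + 1 / norm p) * (1 + norm (xi y))\<^sup>2 * (strip (snd y) / (1 + (norm (fst y))\<^sup>2))"
proof (cases "fst y = 0 \<or> snd y \<notin> {-pi..pi}")
  case False
  define r w where "r = norm (fst y)" and "w = wco r"
  have r: "r > 0"
    using False by (simp add: r_def)
  have fy: "fst y \<noteq> 0" using False by simp
  define k where "k = kappa r"
  have k: "k > 0" "r * k = norm p / 4 * (1 + r\<^sup>2)"
    using r norm_p_pos by (simp_all add: k_def kappa_def add_pos_pos algebra_simps power2_eq_square)
  have kw: "k\<^sup>2 = w\<^sup>2 + (norm p / 2)\<^sup>2"
    using r by (simp add: k_def w_def kappa_def wco_def power2_eq_square field_simps)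
  have "w\<^sup>2 \<le> k\<^sup>2"
    by (simp add: kw)
  then have wk: "\<bar>w\<bar> \<le> k"
    using k abs_le_square_iff[of w k] by simp
  define N where "N = norm (xi y)"
  have N: "N\<^sup>2 = 2 * k\<^sup>2 * (1 - cos (snd y))"
    unfolding N_def norm_xi[OF fy] yc_zc_circle kw w_def r_def by simp
  have N0: "N \<ge> 0" by (simp add: N_def)
  have cosb: "\<bar>w * (cos (snd y) - 1)\<bar> \<le> N\<^sup>2 / (2 * k)"
  proof -
    have "\<bar>w * (cos (snd y) - 1)\<bar> = \<bar>w\<bar> * (1 - cos (snd y))"
      by (simp add: abs_mult)
    also have "\<dots> \<le> k * (1 - cos (snd y))"
      by (intro mult_right_mono wk) simp
    also have "\<dots> = N\<^sup>2 / (2 * k)"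
      unfolding N using k by (simp add: power2_eq_square)
    finally show ?thesis .
  qed
  have "(sin (snd y))\<^sup>2 \<le> 2 * (1 - cos (snd y))"
    unfolding sin_squared_eq using zero_le_power2[of "1 - cos (snd y)"]
    by (simp add: power2_eq_square algebra_simps)
  then have "k\<^sup>2 * (sin (snd y))\<^sup>2 \<le> k\<^sup>2 * (2 * (1 - cos (snd y)))"
    by (intro mult_left_mono) auto
  then have "(k * sin (snd y))\<^sup>2 \<le> N\<^sup>2"
    by (simp only: N power_mult_distrib mult_ac)
  then have "\<bar>k * sin (snd y)\<bar> \<le> N"
    using N0 abs_le_square_iff[of "k * sin (snd y)" N] by simp
  then have sinb: "\<bar>sin (snd y)\<bar> \<le> N / k"
    using k by (simp add: abs_mult field_simps)
  have "\<bar>yc w (snd y)\<bar> \<le> \<bar>w * (cos (snd y) - 1)\<bar> + \<bar>norm p / 2 * sin (snd y)\<bar>"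
    unfolding yc_def by (rule abs_triangle_ineq4)
  also have "\<dots> \<le> N\<^sup>2 / (2 * k) + norm p / 2 * (N / k)"
    unfolding abs_mult[of "norm p / 2"] using sinb by (intro add_mono cosb mult_mono) auto
  finally have yb: "\<bar>yc w (snd y)\<bar> \<le> N\<^sup>2 / (2 * k) + norm p / 2 * (N / k)" .
  have "norm (jker y) = \<bar>yc w (snd y)\<bar> / (2 * r)"
    using False by (simp add: jker_def norm_mult norm_divide w_def r_def)
  also have "\<dots> \<le> (N\<^sup>2 / (2 * k) + norm p / 2 * (N / k)) / (2 * r)"
    using r by (intro divide_right_mono yb) auto
  also have "\<dots> = (N\<^sup>2 + norm p * N) / (4 * (r * k))"
    using r k by (simp add: field_simps)
  also have "\<dots> = (N\<^sup>2 / norm p + N) / (1 + r\<^sup>2)"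
  proof -
    have "(N\<^sup>2 + norm p * N) / (4 * (norm p / 4 * D)) = (N\<^sup>2 / norm p + N) / D" if "D > 0" for D
      using that norm_p_pos by (simp add: field_simps)
    from this[of "1 + r\<^sup>2"] show ?thesis
      unfolding k by (simp only: add_pos_nonneg zero_less_one zero_le_power2)
  qed
  also have "\<dots> \<le> ((1 + 1 / norm p) * (1 + N)\<^sup>2) / (1 + r\<^sup>2)"
  proof (intro divide_right_mono)
    have "N\<^sup>2 / norm p \<le> (1 + N)\<^sup>2 / norm p" "N \<le> (1 + N)\<^sup>2"
      using N0 norm_p_pos by (simp_all add: divide_right_mono power_mono power2_sum)
    then show "N\<^sup>2 / norm p + N \<le> (1 + 1 / norm p) * (1 + N)\<^sup>2"
      by (simp add: algebra_simps)
  qed (simp add: add_nonneg_nonneg)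
  finally show ?thesis
    using False by (simp add: N_def r_def)
qed (auto simp: jker_def)

end

section \<open>The change of variables to the circles\<close>

lemma prod_Basis_vec3:
  fixes f :: "real^3 \<Rightarrow> real"
  shows "(\<Prod>b\<in>(Basis :: (real^3) set). f b) = f (axis 1 1) * f (axis 2 1) * f (axis 3 1)"
proof -
  have B: "(Basis :: (real^3) set) = (\<lambda>i. axis i 1) ` UNIV"
    by (auto simp: Basis_vec_def)
  have I: "inj (\<lambda>i::3. axis i (1::real))"
    by (auto simp: inj_on_def axis_eq_axis)
  have "prod f Basis = prod f (range (\<lambda>i::3. axis i 1))"
    by (simp only: B)
  also have "\<dots> = prod (f \<circ> (\<lambda>i. axis i 1)) (UNIV :: 3 set)"
    by (rule prod.reindex[OF I])
  also have "\<dots> = f (axis 1 1) * f (axis 2 1) * f (axis 3 1)"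
    unfolding UNIV_3 by (simp add: mult.assoc)
  finally show ?thesis .
qed

definition vec3 :: "complex \<times> real \<Rightarrow> real^3"
  where "vec3 = (\<lambda>(X, z). vector [Re X, Im X, z])"

lemma vec3_eq: "vec3 (X, z) = Re X *\<^sub>R axis 1 1 + Im X *\<^sub>R axis 2 1 + z *\<^sub>R axis 3 1"
  by (simp add: vec3_def vec_eq_iff axis_def forall_3)

lemma vec3_measurable [measurable]: "vec3 \<in> borel_measurable borel"
proof -
  have "vec3 = (\<lambda>y. Re (fst y) *\<^sub>R axis 1 1 + Im (fst y) *\<^sub>R axis 2 1 + snd y *\<^sub>R axis 3 1)"
    by (auto simp: fun_eq_iff vec3_eq)
  also have "\<dots> \<in> borel_measurable borel"
    by measurable
  finally show ?thesis .
qed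

lemma lborel_vec3: "distr lborel borel vec3 = (lborel :: (real^3) measure)"
proof (rule lborel_eqI[symmetric])
  fix l u :: "real^3"
  assume le: "\<And>b. b \<in> Basis \<Longrightarrow> l \<bullet> b \<le> u \<bullet> b"
  have le': "l $ i \<le> u $ i" for i
    using le[of "axis i 1"] by (simp add: inner_axis axis_in_Basis_iff)
  have vim: "vec3 -` box l u = box (Complex (l $ 1) (l $ 2)) (Complex (u $ 1) (u $ 2)) \<times> box (l $ 3) (u $ 3)"
    by (auto simp: mem_box_cart forall_3 vec3_def box_def[where 'a = complex] Basis_complex_def)
  have "emeasure (distr lborel borel vec3) (box l u) = emeasure (lborel :: (complex \<times> real) measure) (vec3 -` box l u)"
    by (subst emeasure_distr) auto
  also have "\<dots> = emeasure lborel (box (Complex (l $ 1) (l $ 2)) (Complex (u $ 1) (u $ 2))) * emeasure lborel (box (l $ 3) (u $ 3))"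
    unfolding vim lborel_prod[symmetric] by (subst lborel.emeasure_pair_measure_Times) auto
  also have "\<dots> = ennreal (\<Prod>b\<in>Basis. (u - l) \<bullet> b)"
    using le'[of 1] le'[of 2] le'[of 3]
    by (simp add: emeasure_lborel_box_eq Basis_complex_def prod_Basis_vec3 inner_axis ennreal_mult[symmetric])
  finally show "emeasure (distr lborel borel vec3) (box l u) = ennreal (\<Prod>b\<in>Basis. (u - l) \<bullet> b)" .
qed simp

lemma lborel_orthogonal_transformation:
  fixes T :: "real^3 \<Rightarrow> real^3"
  assumes T: "orthogonal_transformation T"
  shows "distr lborel borel T = lborel"
proof (rule lborel_eqI[symmetric])
  have lin: "linear T"
    using T by (rule orthogonal_transformation_linear)
  have [measurable]: "T \<in> borel_measurable borel"
    using lin by (intro borel_measurable_continuous_onI linear_continuous_on) (simp add: linear_conv_bounded_linear)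
  have bij: "bij T"
    using T by (rule orthogonal_transformation_bij)
  have inv: "orthogonal_transformation (inv T)"
    using T by (rule orthogonal_transformation_inv)
  fix l u :: "real^3"
  assume le: "\<And>b. b \<in> Basis \<Longrightarrow> l \<bullet> b \<le> u \<bullet> b"
  have vim: "T -` box l u = inv T ` box l u"
    using bij by (simp add: bij_vimage_eq_inv_image)
  have lm: "box l u \<in> lmeasurable"
    by simp
  have ib: "T -` box l u \<in> sets borel"
    using measurable_sets[of T borel borel "box l u"] by simp
  have "emeasure (distr lborel borel T) (box l u) = emeasure lborel (T -` box l u)"
    by (subst emeasure_distr) auto
  also have "\<dots> = emeasure lebesgue (T -` box l u)"
    using ib by simp
  also have "\<dots> = ennreal (measure lebesgue (inv T ` box l u))"
    unfolding vim by (rule emeasure_eq_measure2[symmetric, THEN sym]) (rule measurable_orthogonal_image[OF inv lm])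
  also have "measure lebesgue (inv T ` box l u) = measure lebesgue (box l u)"
    by (rule measure_orthogonal_image[OF inv lm])
  also have "ennreal (measure lebesgue (box l u)) = emeasure lborel (box l u)"
    by (simp add: emeasure_lborel_box_eq measure_def)
  also have "\<dots> = ennreal (\<Prod>b\<in>Basis. (u - l) \<bullet> b)"
    using le by (simp add: emeasure_lborel_box_eq)
  finally show "emeasure (distr lborel borel T) (box l u) = ennreal (\<Prod>b\<in>Basis. (u - l) \<bullet> b)" .
qed simp

text \<open>With n = |p| this is the passage from w = \<open>wco \<rho>\<close> to \<rho>; the map
  is increasing from the positive half line onto the whole line.\<close>

lemma nn_integral_joukowski:
  fixes f :: "real \<Rightarrow> ennreal" and n :: real
  assumes [measurable]: "f \<in> borel_measurable borel" and n: "n > 0"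
  shows "(\<integral>\<^sup>+w. f w \<partial>lborel) =
    (\<integral>\<^sup>+\<rho>. f (n / 4 * (\<rho> - 1 / \<rho>)) * ennreal (n / 4 * (1 + 1 / \<rho>\<^sup>2)) * indicator {0<..} \<rho> \<partial>lborel)"
\<comment> \<open>With \<open>k + 1\<close> in place of \<open>k + 2\<close> the first interval
  would be the single point 1.\<close>
proof (rule nn_integral_substitution_exhaustion
    [where a = "\<lambda>k. 1 / real (k + 2)" and b = "\<lambda>k. real (k + 2)"])
  show "{0<..} = (\<Union>k. {1 / real (k + 2)..real (k + 2)})"
  proof (intro equalityI subsetI)
    fix x :: real assume x: "x \<in> {0<..}"
    obtain k where k: "max x (1 / x) \<le> real k"
      using real_arch_simple by blast
    then have "x \<le> real (k + 2)" "1 / x \<le> real (k + 2)"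
      by auto
    then have "x \<in> {1 / real (k + 2)..real (k + 2)}"
      using x by (simp add: field_simps)
    then show "x \<in> (\<Union>k. {1 / real (k + 2)..real (k + 2)})"
      by blast
  next
    fix x :: real assume "x \<in> (\<Union>k. {1 / real (k + 2)..real (k + 2)})"
    then obtain k :: nat where "1 / real (k + 2) \<le> x"
      by auto
    moreover have "1 / real (k + 2) > 0"
      by simp
    ultimately show "x \<in> {0<..}"
      by (metis greaterThan_iff less_le_trans)
  qed
  show "((\<lambda>\<rho>. n / 4 * (\<rho> - 1 / \<rho>)) has_real_derivative n / 4 * (1 + 1 / x\<^sup>2)) (at x)" if "x \<in> {0<..}" for x :: real
    using that by (auto intro!: derivative_eq_intros simp: power2_eq_square)
  show "continuous_on {0<..} (\<lambda>\<rho>. n / 4 * (1 + 1 / \<rho>\<^sup>2))"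
    by (intro continuous_intros) auto
  show "0 \<le> n / 4 * (1 + 1 / x\<^sup>2)" for x
    using n by simp
  show "1 / real (k + 2) < real (k + 2)" for k
    by (simp add: field_simps add_pos_nonneg)
  show "decseq (\<lambda>k. 1 / real (k + 2))" "incseq (\<lambda>k. real (k + 2))"
    by (auto simp: decseq_def incseq_def frac_le)
  have top: "filterlim (\<lambda>k. n / 4 * (real (k + 2) - 1 / real (k + 2))) at_top sequentially"
  proof (rule filterlim_at_top_mono)
    show "filterlim (\<lambda>k. n / 4 * real k) at_top sequentially"
      using n by (intro filterlim_tendsto_pos_mult_at_top[OF tendsto_const]) (auto simp: filterlim_real_sequentially)
    show "\<forall>\<^sub>F k in sequentially. n / 4 * real k \<le> n / 4 * (real (k + 2) - 1 / real (k + 2))"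
    proof (intro always_eventually allI)
      fix k
      have "1 / (real k + 2) \<le> 1"
        by simp
      then have "real k \<le> real (k + 2) - 1 / real (k + 2)"
        unfolding of_nat_add of_nat_numeral by linarith
      then show "n / 4 * real k \<le> n / 4 * (real (k + 2) - 1 / real (k + 2))"
        using n by (intro mult_left_mono) auto
    qed
  qed
  then show "filterlim (\<lambda>k. n / 4 * (real (k + 2) - 1 / real (k + 2))) at_top sequentially" .
  have "(\<lambda>k. n / 4 * (1 / real (k + 2) - 1 / (1 / real (k + 2)))) = (\<lambda>k. - (n / 4 * (real (k + 2) - 1 / real (k + 2))))"
    by (auto simp: algebra_simps)
  then show "filterlim (\<lambda>k. n / 4 * (1 / real (k + 2) - 1 / (1 / real (k + 2)))) at_bot sequentially"
    using top by (simp only: filterlim_uminus_at_bot minus_minus)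
qed (use n in simp_all)

context frame
begin

lemma G_measurable [measurable]: "G \<in> borel_measurable borel"
proof -
  have "G = (\<lambda>y. Re (fst y) *\<^sub>R om - Im (fst y) *\<^sub>R \<theta> p + (snd y / norm p) *\<^sub>R p)"
    by (auto simp: G_def fun_eq_iff)
  also have "\<dots> \<in> borel_measurable borel"
    by measurable
  finally show ?thesis .
qed

lemma lborel_G: "distr lborel borel G = (lborel :: (real^3) measure)"
proof -
  define T where "T v = v $ 1 *\<^sub>R om - v $ 2 *\<^sub>R \<theta> p + (v $ 3 / norm p) *\<^sub>R p" for v :: "real^3"
  have TG: "T v = G (Complex (v $ 1) (v $ 2), v $ 3)" for v
    by (simp add: T_def G_def)
  have lin: "linear T"
    by (auto intro!: linearI simp: T_def algebra_simps add_divide_distrib)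
  have "norm (T v) = norm v" for v
  proof -
    have "T v \<bullet> T v = v \<bullet> v"
      unfolding TG inner_G(4) by (simp add: cmod_power2 inner_vec_def sum_3 flip: power2_eq_square)
    then show ?thesis
      by (simp add: norm_eq_sqrt_inner)
  qed
  then have T: "orthogonal_transformation T"
    using lin by (simp add: orthogonal_transformation)
  have [measurable]: "T \<in> borel_measurable borel"
    using lin by (intro borel_measurable_continuous_onI linear_continuous_on) (simp add: linear_conv_bounded_linear)
  have "G = T \<circ> vec3"
    by (auto simp: fun_eq_iff TG vec3_def)
  then have "distr lborel borel G = distr (distr lborel borel vec3) borel T"
    by (simp add: distr_distr)
  then show ?thesis
    by (simp add: lborel_vec3 lborel_orthogonal_transformation[OF T])
qed

lemma nn_integral_G:
  fixes f :: "real^3 \<Rightarrow> ennreal"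
  assumes [measurable]: "f \<in> borel_measurable borel"
  shows "(\<integral>\<^sup>+\<xi>. f \<xi> \<partial>lborel) = (\<integral>\<^sup>+z. \<integral>\<^sup>+X. f (G (X, z)) \<partial>lborel \<partial>lborel)"
proof -
  have "(\<integral>\<^sup>+\<xi>. f \<xi> \<partial>lborel) = (\<integral>\<^sup>+y. f (G y) \<partial>(lborel \<Otimes>\<^sub>M lborel))"
    by (subst lborel_G[symmetric], subst nn_integral_distr) (auto simp: lborel_prod)
  also have "\<dots> = (\<integral>\<^sup>+z. \<integral>\<^sup>+X. f (G (X, z)) \<partial>lborel \<partial>lborel)"
    by (subst lborel_pair.nn_integral_snd[symmetric]) (auto simp: lborel_prod)
  finally show ?thesis .
qed

lemma measurable_yc_zc [measurable (raw)]:
  assumes [measurable]: "f \<in> borel_measurable M" "h \<in> borel_measurable M"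
  shows "(\<lambda>x. yc (f x) (h x)) \<in> borel_measurable M" "(\<lambda>x. zc (f x) (h x)) \<in> borel_measurable M"
  unfolding yc_def zc_def by measurable

text \<open>Within one plane the circles form the pencil through the two points 0 and - p. By the
  inscribed angle theorem the point with parameter \<phi> = 2 \<beta> is seen from - p under an
  angle that depends on \<beta> and not on w. Hence \<open>tau\<close> and \<beta> are signed polar
  coordinates about - p, and for fixed \<beta> the radius \<open>tau\<close> is affine in w with
  slope 2 sin \<beta>.\<close>

lemma nn_integral_pencil:
  fixes g :: "real \<Rightarrow> real \<Rightarrow> ennreal"
  assumes g [measurable]: "(\<lambda>(y, z). g y z) \<in> borel_measurable borel"
  shows "(\<integral>\<^sup>+w. \<integral>\<^sup>+\<phi>. indicator {-pi<..<pi} \<phi> * (ennreal \<bar>yc w \<phi>\<bar> * g (yc w \<phi>) (zc w \<phi>)) \<partial>lborel \<partial>lborel) =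
    (\<integral>\<^sup>+z. \<integral>\<^sup>+y. g y z \<partial>lborel \<partial>lborel)"
proof -
  have [measurable]: "(\<lambda>(y, z). g y z) \<in> borel_measurable (borel \<Otimes>\<^sub>M borel)"
    using g by (simp add: borel_prod)
  define P where "P = norm p / 2"
  define tau where "tau w \<beta> = 2 * (w * sin \<beta> + P * cos \<beta>)" for w \<beta>
  have yt: "yc w (2 * \<beta>) = - tau w \<beta> * sin \<beta>" for w \<beta>
    unfolding yc_def tau_def P_def cos_double_sin sin_double by (simp add: power2_eq_square algebra_simps)
  have zt: "zc w (2 * \<beta>) = tau w \<beta> * cos \<beta> - 2 * P" for w \<beta>
    unfolding zc_def tau_def P_def cos_double_cos sin_double by (simp add: power2_eq_square algebra_simps)
  have [measurable]: "(\<lambda>x. g (yc (snd x) (fst x)) (zc (snd x) (fst x))) \<in> borel_measurable (borel \<Otimes>\<^sub>M borel)"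
    using measurable_compose[OF _ g, of "\<lambda>x. (yc (snd x) (fst x), zc (snd x) (fst x))" "borel \<Otimes>\<^sub>M borel"] by simp
  \<comment> \<open>\<open>F\<close> is g in coordinates centred at the second common point of the
    pencil, with \<beta> measured from the z-axis.\<close>
  define F where "F X = g (- Im X) (Re X - 2 * P)" for X
  have F [measurable]: "F \<in> borel_measurable borel"
    unfolding F_def using measurable_compose[OF _ g, of "\<lambda>X. (- Im X, Re X - 2 * P)" borel] by simp
  have inner: "(\<integral>\<^sup>+w. ennreal \<bar>yc w (2 * \<beta>)\<bar> * g (yc w (2 * \<beta>)) (zc w (2 * \<beta>)) \<partial>lborel) * 2 =
      (\<integral>\<^sup>+t. ennreal \<bar>t\<bar> * F (complex_of_real t * cis \<beta>) \<partial>lborel)"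
    if b: "\<beta> \<noteq> 0" "\<bar>\<beta>\<bar> < pi / 2" for \<beta>
  proof -
    have sb: "sin \<beta> \<noteq> 0"
    proof
      assume "sin \<beta> = 0"
      moreover have "- pi < \<beta>" "\<beta> < pi"
        using b pi_gt_zero by linarith+
      ultimately show False
        using b sin_eq_0_pi[of \<beta>] by blast
    qed
    have "(\<integral>\<^sup>+t. ennreal \<bar>t\<bar> * F (complex_of_real t * cis \<beta>) \<partial>lborel) =
      ennreal \<bar>2 * sin \<beta>\<bar> * (\<integral>\<^sup>+w. ennreal \<bar>2 * P * cos \<beta> + 2 * sin \<beta> * w\<bar> * F (complex_of_real (2 * P * cos \<beta> + 2 * sin \<beta> * w) * cis \<beta>) \<partial>lborel)"
      by (rule nn_integral_real_affine) (use sb in auto)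
    also have "\<dots> = ennreal \<bar>2 * sin \<beta>\<bar> * (\<integral>\<^sup>+w. ennreal \<bar>tau w \<beta>\<bar> * g (yc w (2 * \<beta>)) (zc w (2 * \<beta>)) \<partial>lborel)"
    proof -
      have "2 * P * cos \<beta> + 2 * sin \<beta> * w = tau w \<beta>" for w
        by (simp add: tau_def algebra_simps)
      then show ?thesis
        by (simp add: F_def yt zt)
    qed
    also have "\<dots> = (\<integral>\<^sup>+w. ennreal \<bar>2 * sin \<beta>\<bar> * (ennreal \<bar>tau w \<beta>\<bar> * g (yc w (2 * \<beta>)) (zc w (2 * \<beta>))) \<partial>lborel)"
      by (rule nn_integral_cmult[symmetric]) (simp add: tau_def)
    also have "\<dots> = (\<integral>\<^sup>+w. ennreal \<bar>yc w (2 * \<beta>)\<bar> * g (yc w (2 * \<beta>)) (zc w (2 * \<beta>)) * 2 \<partial>lborel)"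
    proof (rule nn_integral_cong)
      fix w
      have "ennreal \<bar>2 * sin \<beta>\<bar> * ennreal \<bar>tau w \<beta>\<bar> = ennreal (\<bar>yc w (2 * \<beta>)\<bar> * 2)"
        unfolding yt by (simp add: ennreal_mult[symmetric] abs_mult mult_ac)
      also have "\<dots> = ennreal \<bar>yc w (2 * \<beta>)\<bar> * 2"
        by (simp add: ennreal_mult)
      finally show "ennreal \<bar>2 * sin \<beta>\<bar> * (ennreal \<bar>tau w \<beta>\<bar> * g (yc w (2 * \<beta>)) (zc w (2 * \<beta>))) =
        ennreal \<bar>yc w (2 * \<beta>)\<bar> * g (yc w (2 * \<beta>)) (zc w (2 * \<beta>)) * 2"
        by (metis mult.assoc mult.commute)
    qed
    also have "\<dots> = (\<integral>\<^sup>+w. ennreal \<bar>yc w (2 * \<beta>)\<bar> * g (yc w (2 * \<beta>)) (zc w (2 * \<beta>)) \<partial>lborel) * 2"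
      by (rule nn_integral_multc) measurable
    finally show ?thesis ..
  qed
  have "(\<integral>\<^sup>+w. \<integral>\<^sup>+\<phi>. indicator {-pi<..<pi} \<phi> * (ennreal \<bar>yc w \<phi>\<bar> * g (yc w \<phi>) (zc w \<phi>)) \<partial>lborel \<partial>lborel) =
    (\<integral>\<^sup>+\<phi>. \<integral>\<^sup>+w. indicator {-pi<..<pi} \<phi> * (ennreal \<bar>yc w \<phi>\<bar> * g (yc w \<phi>) (zc w \<phi>)) \<partial>lborel \<partial>lborel)"
    by (rule lborel_pair.Fubini') measurable
  also have "\<dots> = (\<integral>\<^sup>+\<phi>. indicator {-pi<..<pi} \<phi> * (\<integral>\<^sup>+w. ennreal \<bar>yc w \<phi>\<bar> * g (yc w \<phi>) (zc w \<phi>) \<partial>lborel) \<partial>lborel)"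
    by (intro nn_integral_cong nn_integral_cmult) measurable
  also have "\<dots> = ennreal \<bar>2\<bar> * (\<integral>\<^sup>+\<beta>. indicator {-pi<..<pi} (0 + 2 * \<beta>) * (\<integral>\<^sup>+w. ennreal \<bar>yc w (0 + 2 * \<beta>)\<bar> * g (yc w (0 + 2 * \<beta>)) (zc w (0 + 2 * \<beta>)) \<partial>lborel) \<partial>lborel)"
    by (rule nn_integral_real_affine) auto
  also have "\<dots> = (\<integral>\<^sup>+\<beta>. ennreal \<bar>2\<bar> * (indicator {-pi<..<pi} (0 + 2 * \<beta>) * (\<integral>\<^sup>+w. ennreal \<bar>yc w (0 + 2 * \<beta>)\<bar> * g (yc w (0 + 2 * \<beta>)) (zc w (0 + 2 * \<beta>)) \<partial>lborel)) \<partial>lborel)"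
    by (rule nn_integral_cmult[symmetric]) measurable
  also have "\<dots> = (\<integral>\<^sup>+\<beta>. indicator {-(pi/2)<..<pi/2} \<beta> * (\<integral>\<^sup>+t. ennreal \<bar>t\<bar> * F (complex_of_real t * cis \<beta>) \<partial>lborel) \<partial>lborel)"
  proof (rule nn_integral_cong_AE, use AE_lborel_singleton[of "0::real"] in eventually_elim)
    case (elim \<beta>)
    have "indicator {-pi<..<pi} (0 + 2 * \<beta>) = (indicator {-(pi/2)<..<pi/2} \<beta> :: ennreal)"
      by (auto simp: indicator_def)
    moreover have "ennreal \<bar>2\<bar> * (\<integral>\<^sup>+w. ennreal \<bar>yc w (0 + 2 * \<beta>)\<bar> * g (yc w (0 + 2 * \<beta>)) (zc w (0 + 2 * \<beta>)) \<partial>lborel) =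
       (\<integral>\<^sup>+t. ennreal \<bar>t\<bar> * F (complex_of_real t * cis \<beta>) \<partial>lborel)" if "\<beta> \<in> {-(pi/2)<..<pi/2}"
    proof -
      have "\<bar>\<beta>\<bar> < pi / 2"
        using that unfolding abs_less_iff greaterThanLessThan_iff by linarith
      from inner[OF elim this] show ?thesis
        by (simp add: mult.commute)
    qed
    ultimately show ?case
      by (cases "\<beta> \<in> {-(pi/2)<..<pi/2}") (auto simp: mult.left_commute)
  qed
  also have "\<dots> = (\<integral>\<^sup>+X. F X \<partial>lborel)"
    by (rule nn_integral_signed_polar[symmetric]) measurable
  also have "\<dots> = (\<integral>\<^sup>+x. \<integral>\<^sup>+y. g (- y) (x - 2 * P) \<partial>lborel \<partial>lborel)"
    by (subst nn_integral_complex) (auto simp: F_def)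
  also have "\<dots> = (\<integral>\<^sup>+x. \<integral>\<^sup>+y. g y (x - 2 * P) \<partial>lborel \<partial>lborel)"
  proof (rule nn_integral_cong)
    fix x
    have [measurable]: "(\<lambda>y. g y (x - 2 * P)) \<in> borel_measurable borel"
      using measurable_compose[OF _ g, of "\<lambda>y. (y, x - 2 * P)" borel] by simp
    show "(\<integral>\<^sup>+y. g (- y) (x - 2 * P) \<partial>lborel) = (\<integral>\<^sup>+y. g y (x - 2 * P) \<partial>lborel)"
      by (subst (2) nn_integral_real_affine[where c = "-1" and t = 0]) auto
  qed
  also have "\<dots> = (\<integral>\<^sup>+z. \<integral>\<^sup>+y. g y z \<partial>lborel \<partial>lborel)"
    by (subst (2) nn_integral_real_affine[where c = 1 and t = "- 2 * P"]) auto
  finally show ?thesis .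
qed

lemma jac_measurable [measurable]: "(\<lambda>y. jac (fst y) (snd y)) \<in> borel_measurable borel"
  unfolding jac_def yc_def wco_def by measurable

lemma (in -) borel_measurable_cnj [measurable (raw)]:
  assumes "f \<in> borel_measurable M"
  shows "(\<lambda>x. cnj (f x)) \<in> borel_measurable M"
  using assms by (intro borel_measurable_continuous_on[where f = cnj] continuous_intros)

lemma (in -) borel_measurable_cis [measurable (raw)]:
  assumes "f \<in> borel_measurable M"
  shows "(\<lambda>x. cis (f x)) \<in> borel_measurable M"
  using assms by (intro borel_measurable_continuous_on[where f = cis] continuous_intros)

lemma jker_measurable [measurable]: "jker \<in> borel_measurable borel"
  unfolding jker_def yc_def wco_def by measurable

definition sheet :: "real \<Rightarrow> complex \<Rightarrow> real"
  where "sheet \<sigma> z = (if \<sigma> * Re z > 0 then 1 else 0)"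

lemma sheet_measurable [measurable]: "sheet \<sigma> \<in> borel_measurable borel"
  unfolding sheet_def by measurable

text \<open>Both sheets cover \<open>\<xi>\<close>-space: a generic \<open>\<xi>\<close> lies on the circles of exactly two values of
  \<open>\<zeta>\<close>, which are opposite in direction.\<close>

lemma nn_integral_sheet:
  fixes f :: "real^3 \<Rightarrow> ennreal"
  assumes f [measurable]: "f \<in> borel_measurable borel" and s: "\<sigma> = 1 \<or> \<sigma> = -1"
    and xi [measurable]: "xi \<in> borel_measurable borel"
  shows "(\<integral>\<^sup>+y. ennreal (jac (fst y) (snd y) * strip (snd y) * sheet \<sigma> (fst y)) * f (xi y) \<partial>lborel) = (\<integral>\<^sup>+\<xi>. f \<xi> \<partial>lborel)"
proof -
  let ?H = "\<lambda>y. ennreal (jac (fst y) (snd y) * strip (snd y) * sheet \<sigma> (fst y)) * f (xi y)"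
  have s0: "\<sigma> \<noteq> 0" "\<sigma> * \<sigma> = 1" "\<bar>\<sigma>\<bar> = 1"
    using s by auto
  have [measurable]: "?H \<in> borel_measurable (borel \<Otimes>\<^sub>M borel)"
    by (simp add: borel_prod)
  let ?g = "\<lambda>\<alpha> y z. ennreal \<bar>y\<bar> * f (G (complex_of_real (\<sigma> * y) * cis \<alpha>, z))"
  let ?k = "\<lambda>\<alpha> w \<phi>. ennreal \<bar>yc w \<phi>\<bar> * ?g \<alpha> (yc w \<phi>) (zc w \<phi>)"
  have [measurable]: "(\<lambda>x. G (F x, h x)) \<in> borel_measurable M" if [measurable]: "F \<in> borel_measurable M" "h \<in> borel_measurable M"
    for F :: "'z \<Rightarrow> complex" and h M
    using measurable_compose[OF _ G_measurable, of "\<lambda>x. (F x, h x)" M] by simp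
  have "(\<integral>\<^sup>+y. ?H y \<partial>lborel) = (\<integral>\<^sup>+\<zeta>. \<integral>\<^sup>+\<phi>. ?H (\<zeta>, \<phi>) \<partial>lborel \<partial>lborel)"
    unfolding lborel_prod[symmetric] by (rule lborel.nn_integral_fst[symmetric]) simp
  also have "\<dots> = (\<integral>\<^sup>+\<alpha>. indicator {-(pi/2)<..<pi/2} \<alpha> * (\<integral>\<^sup>+\<rho>. ennreal \<bar>\<rho>\<bar> * (\<integral>\<^sup>+\<phi>. ?H (complex_of_real \<rho> * cis \<alpha>, \<phi>) \<partial>lborel) \<partial>lborel) \<partial>lborel)"
    by (rule nn_integral_signed_polar) measurable
  also have "\<dots> = (\<integral>\<^sup>+\<alpha>. indicator {-(pi/2)<..<pi/2} \<alpha> * (\<integral>\<^sup>+z. \<integral>\<^sup>+y. ?g \<alpha> y z \<partial>lborel \<partial>lborel) \<partial>lborel)"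
  proof (rule nn_integral_cong)
    fix \<alpha> :: real
    show "indicator {-(pi/2)<..<pi/2} \<alpha> * (\<integral>\<^sup>+\<rho>. ennreal \<bar>\<rho>\<bar> * (\<integral>\<^sup>+\<phi>. ?H (complex_of_real \<rho> * cis \<alpha>, \<phi>) \<partial>lborel) \<partial>lborel) =
      indicator {-(pi/2)<..<pi/2} \<alpha> * (\<integral>\<^sup>+z. \<integral>\<^sup>+y. ?g \<alpha> y z \<partial>lborel \<partial>lborel)"
    proof (cases "\<alpha> \<in> {-(pi/2)<..<pi/2}")
      case True
      then have c: "cos \<alpha> > 0"
        by (intro cos_gt_zero_pi) auto
      \<comment> \<open>The sign \<sigma> is absorbed into the signed radius. The point \<sigma>
        \<rho> cis \<alpha> lies on the sheet exactly for \<rho> > 0, and its circle is that of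
        \<rho> with \<open>yc\<close> multiplied by \<sigma>.\<close>
      have "(\<integral>\<^sup>+\<rho>. ennreal \<bar>\<rho>\<bar> * (\<integral>\<^sup>+\<phi>. ?H (complex_of_real \<rho> * cis \<alpha>, \<phi>) \<partial>lborel) \<partial>lborel) =
        ennreal \<bar>\<sigma>\<bar> * (\<integral>\<^sup>+\<rho>. ennreal \<bar>0 + \<sigma> * \<rho>\<bar> * (\<integral>\<^sup>+\<phi>. ?H (complex_of_real (0 + \<sigma> * \<rho>) * cis \<alpha>, \<phi>) \<partial>lborel) \<partial>lborel)"
        by (rule nn_integral_real_affine, measurable) (rule s0)
      also have "\<dots> = (\<integral>\<^sup>+\<rho>. ennreal \<bar>\<rho>\<bar> * (\<integral>\<^sup>+\<phi>. ?H (complex_of_real (\<sigma> * \<rho>) * cis \<alpha>, \<phi>) \<partial>lborel) \<partial>lborel)"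
        by (simp add: s0 abs_mult)
      also have "\<dots> = (\<integral>\<^sup>+\<rho>. (\<integral>\<^sup>+\<phi>. indicator {-pi<..<pi} \<phi> * ?k \<alpha> (norm p / 4 * (\<rho> - 1 / \<rho>)) \<phi> \<partial>lborel) *
          ennreal (norm p / 4 * (1 + 1 / \<rho>\<^sup>2)) * indicator {0<..} \<rho> \<partial>lborel)"
      proof (rule nn_integral_cong)
        fix \<rho> :: real
        show "ennreal \<bar>\<rho>\<bar> * (\<integral>\<^sup>+\<phi>. ?H (complex_of_real (\<sigma> * \<rho>) * cis \<alpha>, \<phi>) \<partial>lborel) =
          (\<integral>\<^sup>+\<phi>. indicator {-pi<..<pi} \<phi> * ?k \<alpha> (norm p / 4 * (\<rho> - 1 / \<rho>)) \<phi> \<partial>lborel) *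
          ennreal (norm p / 4 * (1 + 1 / \<rho>\<^sup>2)) * indicator {0<..} \<rho>"
        proof (cases "\<rho> > 0")
          case False
          then have "sheet \<sigma> (complex_of_real (\<sigma> * \<rho>) * cis \<alpha>) = 0"
            using c s0 by (simp add: sheet_def mult.assoc[symmetric] mult_nonpos_nonneg not_less)
          then show ?thesis
            using False by simp
        next
          case True
          have sh: "sheet \<sigma> (complex_of_real (\<sigma> * \<rho>) * cis \<alpha>) = 1"
            using c s0 True by (simp add: sheet_def mult.assoc[symmetric])
          have nz: "norm (complex_of_real (\<sigma> * \<rho>) * cis \<alpha>) = \<rho>"
            using True s0 by (simp add: norm_mult abs_mult)
          have sg: "sgn (complex_of_real (\<sigma> * \<rho>) * cis \<alpha>) = complex_of_real \<sigma> * cis \<alpha>"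
            using True s by (auto simp: sgn_mult sgn_of_real sgn_cis)
          have xiG: "xi_of \<theta> (complex_of_real (\<sigma> * \<rho>) * cis \<alpha>) p \<phi> = G (complex_of_real (\<sigma> * yc (wco \<rho>) \<phi>) * cis \<alpha>, zc (wco \<rho>) \<phi>)" for \<phi>
            using xi_polar_form[of "(complex_of_real (\<sigma> * \<rho>) * cis \<alpha>, \<phi>)"] True s0 unfolding fst_conv snd_conv nz sg
            by (simp add: mult_ac)
          have w: "wco \<rho> = norm p / 4 * (\<rho> - 1 / \<rho>)"
            by (simp add: wco_def)
          have "ennreal \<bar>\<rho>\<bar> * (\<integral>\<^sup>+\<phi>. ?H (complex_of_real (\<sigma> * \<rho>) * cis \<alpha>, \<phi>) \<partial>lborel) = (\<integral>\<^sup>+\<phi>. ennreal \<bar>\<rho>\<bar> * ?H (complex_of_real (\<sigma> * \<rho>) * cis \<alpha>, \<phi>) \<partial>lborel)"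
            by (rule nn_integral_cmult[symmetric]) measurable
          also have "\<dots> = (\<integral>\<^sup>+\<phi>. indicator {-pi<..<pi} \<phi> * ?k \<alpha> (wco \<rho>) \<phi> * ennreal (norm p / 4 * (1 + 1 / \<rho>\<^sup>2)) \<partial>lborel)"
          proof (rule nn_integral_cong_AE, use AE_lborel_singleton[of pi] AE_lborel_singleton[of "-pi"] in eventually_elim)
            case (elim \<phi>)
            have ind: "strip \<phi> = indicator {-pi<..<pi} \<phi>"
              using elim by (auto simp: indicator_def)
            \<comment> \<open>One factor \<open>yc\<close> is the Jacobian of the pencil in its
              plane, the other that of the rotation of the plane about p. The last factor is the
              derivative of \<open>wco\<close>, and \<rho> is the polar Jacobian of \<zeta>.\<close>
            have j: "\<rho> * jac (complex_of_real (\<sigma> * \<rho>) * cis \<alpha>) \<phi> = \<bar>yc (wco \<rho>) \<phi>\<bar> * \<bar>yc (wco \<rho>) \<phi>\<bar> * (norm p / 4 * (1 + 1 / \<rho>\<^sup>2))"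
              unfolding jac_def nz using True by (simp add: power2_eq_square)
            have j0: "jac (complex_of_real (\<sigma> * \<rho>) * cis \<alpha>) \<phi> \<ge> 0"
              by (simp add: jac_def)
            have E: "ennreal \<bar>\<rho>\<bar> * ennreal (jac (complex_of_real (\<sigma> * \<rho>) * cis \<alpha>) \<phi>) =
               ennreal \<bar>yc (wco \<rho>) \<phi>\<bar> * ennreal \<bar>yc (wco \<rho>) \<phi>\<bar> * ennreal (norm p / 4 * (1 + 1 / \<rho>\<^sup>2))"
              using True j j0 by (simp only: ennreal_mult[symmetric] abs_of_pos abs_ge_zero mult_nonneg_nonneg less_imp_le)
                 (simp add: ennreal_mult[symmetric])
            have "ennreal \<bar>\<rho>\<bar> * ennreal (jac (complex_of_real (\<sigma> * \<rho>) * cis \<alpha>) \<phi>) * F =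
               ennreal \<bar>yc (wco \<rho>) \<phi>\<bar> * ennreal \<bar>yc (wco \<rho>) \<phi>\<bar> * ennreal (norm p / 4 * (1 + 1 / \<rho>\<^sup>2)) * F" for F
              unfolding E ..
            from this[of "f (G (complex_of_real (\<sigma> * yc (wco \<rho>) \<phi>) * cis \<alpha>, zc (wco \<rho>) \<phi>))"] show ?case
              unfolding fst_conv snd_conv sh xiG ind
              by (cases "\<phi> \<in> {-pi<..<pi}") (simp_all add: mult_ac)
          qed
          also have "\<dots> = (\<integral>\<^sup>+\<phi>. indicator {-pi<..<pi} \<phi> * ?k \<alpha> (wco \<rho>) \<phi> \<partial>lborel) * ennreal (norm p / 4 * (1 + 1 / \<rho>\<^sup>2))"
            by (rule nn_integral_multc) measurable
          finally show ?thesis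
            using True by (simp add: w)
        qed
      qed
      also have "\<dots> = (\<integral>\<^sup>+w. \<integral>\<^sup>+\<phi>. indicator {-pi<..<pi} \<phi> * ?k \<alpha> w \<phi> \<partial>lborel \<partial>lborel)"
        by (rule nn_integral_joukowski[symmetric]) (use norm_p_pos in auto)
      also have "\<dots> = (\<integral>\<^sup>+z. \<integral>\<^sup>+y. ?g \<alpha> y z \<partial>lborel \<partial>lborel)"
        by (rule nn_integral_pencil) (simp add: case_prod_beta)
      finally show ?thesis
        by simp
    qed simp
  qed
  also have "\<dots> = (\<integral>\<^sup>+\<alpha>. \<integral>\<^sup>+z. indicator {-(pi/2)<..<pi/2} \<alpha> * (\<integral>\<^sup>+y. ?g \<alpha> y z \<partial>lborel) \<partial>lborel \<partial>lborel)"
    by (intro nn_integral_cong nn_integral_cmult[symmetric]) measurable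
  also have "\<dots> = (\<integral>\<^sup>+z. \<integral>\<^sup>+\<alpha>. indicator {-(pi/2)<..<pi/2} \<alpha> * (\<integral>\<^sup>+y. ?g \<alpha> y z \<partial>lborel) \<partial>lborel \<partial>lborel)"
    by (rule lborel_pair.Fubini') measurable
  also have "\<dots> = (\<integral>\<^sup>+z. \<integral>\<^sup>+X. f (G (X, z)) \<partial>lborel \<partial>lborel)"
  proof (rule nn_integral_cong)
    fix z :: real
    have "(\<integral>\<^sup>+X. f (G (X, z)) \<partial>lborel) =
      (\<integral>\<^sup>+\<alpha>. indicator {-(pi/2)<..<pi/2} \<alpha> * (\<integral>\<^sup>+y. ennreal \<bar>y\<bar> * f (G (complex_of_real y * cis \<alpha>, z)) \<partial>lborel) \<partial>lborel)"
      by (rule nn_integral_signed_polar) measurable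
    also have "\<dots> = (\<integral>\<^sup>+\<alpha>. indicator {-(pi/2)<..<pi/2} \<alpha> * (\<integral>\<^sup>+y. ?g \<alpha> y z \<partial>lborel) \<partial>lborel)"
      using s0 by (subst nn_integral_real_affine[where c = \<sigma> and t = 0]) (auto simp: abs_mult)
    finally show "(\<integral>\<^sup>+\<alpha>. indicator {-(pi/2)<..<pi/2} \<alpha> * (\<integral>\<^sup>+y. ?g \<alpha> y z \<partial>lborel) \<partial>lborel) = (\<integral>\<^sup>+X. f (G (X, z)) \<partial>lborel)" ..
  qed
  also have "\<dots> = (\<integral>\<^sup>+\<xi>. f \<xi> \<partial>lborel)"
    by (rule nn_integral_G[symmetric]) measurable
  finally show ?thesis .
qed

end

section \<open>Integrals over the quadratic symbol\<close>

lemma borel_measurable_vec_nth [measurable (raw)]: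
  fixes f :: "'a \<Rightarrow> ('b::real_normed_vector) ^ 'n"
  assumes "f \<in> borel_measurable M"
  shows "(\<lambda>x. f x $ i) \<in> borel_measurable M"
  using assms by (intro borel_measurable_continuous_on[where f = "\<lambda>v. v $ i"] continuous_intros)

lemma borel_measurable_cvec [measurable (raw)]:
  assumes "f \<in> borel_measurable M"
  shows "(\<lambda>x. cvec (f x)) \<in> borel_measurable M"
  using assms unfolding cvec_def
  by (intro borel_measurable_continuous_on[where f = "\<lambda>x. \<chi> j. complex_of_real (x $ j)"] continuous_intros)

lemma borel_measurable_Re_vec [measurable (raw)]:
  assumes "f \<in> borel_measurable M"
  shows "(\<lambda>x. Re_vec (f x)) \<in> borel_measurable M"
  using assms unfolding Re_vec_def
  by (intro borel_measurable_continuous_on[where f = "\<lambda>x. \<chi> j. Re (x $ j)"] continuous_intros)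

lemma borel_measurable_Im_vec [measurable (raw)]:
  assumes "f \<in> borel_measurable M"
  shows "(\<lambda>x. Im_vec (f x)) \<in> borel_measurable M"
  using assms unfolding Im_vec_def
  by (intro borel_measurable_continuous_on[where f = "\<lambda>x. \<chi> j. Im (x $ j)"] continuous_intros)

lemma borel_measurable_cross3 [measurable (raw)]:
  assumes "f \<in> borel_measurable M" "g \<in> borel_measurable M"
  shows "(\<lambda>x. cross3 (f x) (g x)) \<in> borel_measurable M"
  by (rule borel_measurable_continuous_Pair[OF assms])
    (auto intro!: continuous_on_cross continuous_intros)

lemma borel_measurable_smult_vec [measurable (raw)]:
  fixes g :: "'a \<Rightarrow> complex^3"
  assumes "f \<in> borel_measurable M" "g \<in> borel_measurable M"
  shows "(\<lambda>x. f x *s g x) \<in> borel_measurable M"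
  unfolding vector_scalar_mult_def
  by (rule borel_measurable_continuous_Pair[OF assms]) (intro continuous_intros)

lemma borel_measurable_scalar_product [measurable (raw)]:
  fixes g :: "'a \<Rightarrow> complex^3"
  assumes [measurable]: "f \<in> borel_measurable M" "g \<in> borel_measurable M"
  shows "(\<lambda>x. scalar_product (f x) (g x)) \<in> borel_measurable M"
  unfolding scalar_product_def by measurable

lemma borel_measurable_denom [measurable (raw)]:
  assumes [measurable]: "f \<in> borel_measurable M" "g \<in> borel_measurable M"
  shows "(\<lambda>x. denom (f x) (g x)) \<in> borel_measurable M"
  unfolding denom_def by measurable

text \<open>Measurability is asked of the composite \<open>\<theta> (p x)\<close> only. In
  \<open>frame\<close> the point p is fixed and the composite is constant; for varying p the field
  is replaced by a Borel field \<open>th\<close>.\<close>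

lemma borel_measurable_omega:
  assumes [measurable]: "(\<lambda>x. \<theta> (p x)) \<in> borel_measurable M" "p \<in> borel_measurable M"
  shows "(\<lambda>x. omega \<theta> (p x)) \<in> borel_measurable M"
  unfolding omega_def by measurable

lemma borel_measurable_k_of:
  assumes [measurable]: "(\<lambda>x. \<theta> (p x)) \<in> borel_measurable M" "p \<in> borel_measurable M" "l \<in> borel_measurable M"
  shows "(\<lambda>x. k_of \<theta> (l x) (p x)) \<in> borel_measurable M"
proof -
  note [measurable] = borel_measurable_omega[OF assms(1,2)]
  show ?thesis
    unfolding k_of_def by measurable
qed

lemma borel_measurable_lam_of:
  assumes [measurable]: "(\<lambda>x. \<theta> (p x)) \<in> borel_measurable M" "p \<in> borel_measurable M" "k \<in> borel_measurable M"
  shows "(\<lambda>x. lam_of \<theta> (k x) (p x)) \<in> borel_measurable M"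
proof -
  note [measurable] = borel_measurable_omega[OF assms(1,2)]
  show ?thesis
    unfolding lam_of_def theta_i_omega_def by measurable
qed

lemma borel_measurable_xi_of:
  assumes [measurable]: "(\<lambda>x. \<theta> (p x)) \<in> borel_measurable M" "p \<in> borel_measurable M" "l \<in> borel_measurable M"
    "\<phi> \<in> borel_measurable M"
  shows "(\<lambda>x. xi_of \<theta> (l x) (p x) (\<phi> x)) \<in> borel_measurable M"
proof -
  note [measurable] = borel_measurable_k_of[OF assms(1-3)]
  show ?thesis
    unfolding xi_of_def k_perp_def by measurable
qed

lemma borel_measurable_root1 [measurable (raw)]:
  assumes [measurable]: "c \<in> borel_measurable M" "a \<in> borel_measurable M"
  shows "(\<lambda>x. root1 (c x) (a x)) \<in> borel_measurable M"
  unfolding root1_def by measurable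

lemma borel_measurable_root2 [measurable (raw)]:
  assumes [measurable]: "c \<in> borel_measurable M" "a \<in> borel_measurable M"
  shows "(\<lambda>x. root2 (c x) (a x)) \<in> borel_measurable M"
  unfolding root2_def by measurable

lemma borel_measurable_acoef:
  assumes [measurable]: "(\<lambda>x. \<theta> (p x)) \<in> borel_measurable M" "p \<in> borel_measurable M" "f \<in> borel_measurable M"
  shows "(\<lambda>x. acoef \<theta> (p x) (f x)) \<in> borel_measurable M"
proof -
  note [measurable] = borel_measurable_omega[OF assms(1,2)]
  show ?thesis
    unfolding acoef_def by measurable
qed

lemma borel_measurable_ccoef [measurable (raw)]:
  assumes [measurable]: "p \<in> borel_measurable M" "f \<in> borel_measurable M"
  shows "(\<lambda>x. ccoef (p x) (f x)) \<in> borel_measurable M"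
  unfolding ccoef_def by measurable

text \<open>With \<open>u = cis \<phi>\<close> a trigonometric polynomial of degree one becomes a quadratic polynomial.\<close>

lemma finite_trig_zeros:
  assumes "A \<noteq> 0 \<or> B \<noteq> 0"
  shows "finite {\<phi> \<in> {-pi<..pi}. A * cos \<phi> + B * sin \<phi> + C = 0}"
proof -
  define q where "q = [: Complex (A / 2) (B / 2), complex_of_real C, Complex (A / 2) (- B / 2) :]"
  have "q \<noteq> 0"
    using assms by (auto simp: q_def complex_eq_iff)
  then have "finite {u. poly q u = 0}"
    by (rule poly_roots_finite)
  moreover have "cis ` {\<phi> \<in> {-pi<..pi}. A * cos \<phi> + B * sin \<phi> + C = 0} \<subseteq> {u. poly q u = 0}"
  proof clarsimp
    fix \<phi> assume "A * cos \<phi> + B * sin \<phi> + C = 0"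
    moreover have "poly q (cis \<phi>) = cis \<phi> * complex_of_real (A * cos \<phi> + B * sin \<phi> + C)"
    proof -
      have "complex_of_real (A * cos \<phi> + B * sin \<phi> + C) =
          Complex (A / 2) (- B / 2) * cis \<phi> + Complex (A / 2) (B / 2) * cnj (cis \<phi>) + complex_of_real C"
        by (simp add: complex_eq_iff field_simps)
      moreover have "cis \<phi> * (Complex (A / 2) (B / 2) * cnj (cis \<phi>)) = Complex (A / 2) (B / 2)"
        by (simp add: cis_cnj cis_mult mult.left_commute)
      ultimately show ?thesis
        by (simp add: q_def distrib_left mult.left_commute)
    qed
    ultimately show "poly q (cis \<phi>) = 0"
      by simp
  qed
  ultimately have "finite (cis ` {\<phi> \<in> {-pi<..pi}. A * cos \<phi> + B * sin \<phi> + C = 0})"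
    using finite_subset by blast
  moreover have "inj_on cis {\<phi> \<in> {-pi<..pi}. A * cos \<phi> + B * sin \<phi> + C = 0}"
    using Arg_cis by (intro inj_on_inverseI[where g = Arg]) auto
  ultimately show ?thesis
    using finite_imageD by blast
qed

lemma AE_trig_nonzero:
  assumes "A \<noteq> 0 \<or> B \<noteq> 0"
  shows "AE \<phi> in lborel. \<phi> \<in> {-pi..pi} \<longrightarrow> A * cos \<phi> + B * sin \<phi> + C \<noteq> 0"
proof -
  \<comment> \<open>The zeros were counted on the half-open interval, where \<open>cis\<close> is
    injective; the endpoint -pi is added as one more null point.\<close>
  let ?F = "insert (-pi) {\<phi> \<in> {-pi<..pi}. A * cos \<phi> + B * sin \<phi> + C = 0}"
  have "?F \<in> null_sets lborel"
    by (intro finite_imp_null_set_lborel finite.insertI finite_trig_zeros assms)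
  then have "AE \<phi> in lborel. \<phi> \<notin> ?F"
    by (rule AE_not_in)
  then show ?thesis
    by eventually_elim auto
qed

lemma AE_Re_nonzero: "AE z in (lborel :: complex measure). Re z \<noteq> 0"
proof -
  have "(\<integral>\<^sup>+z. indicator {z. Re z = 0} z \<partial>(lborel :: complex measure)) = (\<integral>\<^sup>+x. \<integral>\<^sup>+y. indicator {0} x \<partial>(lborel :: real measure) \<partial>(lborel :: real measure))"
    by (subst nn_integral_complex) (auto intro!: nn_integral_cong simp: indicator_def)
  also have "\<dots> = (\<integral>\<^sup>+x. 0 \<partial>(lborel :: real measure))"
    by (intro nn_integral_cong_AE, use AE_lborel_singleton[of "0::real"] in eventually_elim) auto
  finally have "emeasure (lborel :: complex measure) {z. Re z = 0} = 0"
    by (subst (asm) nn_integral_indicator) auto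
  then have "{z. Re z = 0} \<in> null_sets (lborel :: complex measure)"
    by (auto simp: null_sets_def)
  from AE_not_in[OF this] show ?thesis
    by eventually_elim auto
qed

context frame
begin

lemma xi_measurable [measurable]: "xi \<in> borel_measurable borel"
  by (rule borel_measurable_xi_of) measurable

lemma kk_measurable [measurable]: "kk \<in> borel_measurable borel"
  by (rule borel_measurable_k_of) measurable

lemma acoef_measurable [measurable]: "acoef \<theta> p \<in> borel_measurable borel"
  by (rule borel_measurable_acoef) measurable

text \<open>Excluded are the line Re \<zeta> = 0 between the two sheets and, on each circle, the
  points with \<open>yc\<close> = 0. There \<open>acoef\<close> vanishes, so that the symbol no
  longer determines \<lambda>.\<close>

definition generic :: "complex \<times> real \<Rightarrow> bool"
  where "generic y \<longleftrightarrow> Re (fst y) \<noteq> 0 \<and> (snd y \<in> {-pi..pi} \<longrightarrow> yc (wco (norm (fst y))) (snd y) \<noteq> 0)"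

lemma AE_generic: "AE y in lborel. generic y"
proof -
  have "AE y in lborel \<Otimes>\<^sub>M lborel. generic y"
  proof (rule lborel_pair.AE_pair_measure)
    have "generic = (\<lambda>y. 0 < \<bar>Re (fst y)\<bar> \<and> (- pi \<le> snd y \<and> snd y \<le> pi \<longrightarrow> 0 < \<bar>yc (wco (norm (fst y))) (snd y)\<bar>))"
      by (auto simp: generic_def fun_eq_iff)
    also have "Measurable.pred (borel \<Otimes>\<^sub>M borel) \<dots>"
      unfolding wco_def by measurable
    finally have [measurable]: "Measurable.pred (borel \<Otimes>\<^sub>M borel) generic" .
    show "{y \<in> space (lborel \<Otimes>\<^sub>M lborel). generic y} \<in> sets (lborel \<Otimes>\<^sub>M lborel)"
      by measurable
    show "AE z in lborel. AE \<phi> in lborel. generic (z, \<phi>)"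
      using AE_Re_nonzero
    proof eventually_elim
      case (elim z)
      have "AE \<phi> in lborel. \<phi> \<in> {-pi..pi} \<longrightarrow> wco (norm z) * cos \<phi> + (- norm p / 2) * sin \<phi> + (- wco (norm z)) \<noteq> 0"
        using norm_p_pos by (intro AE_trig_nonzero) auto
      then show ?case
        by eventually_elim (use elim in \<open>auto simp: generic_def yc_def algebra_simps\<close>)
    qed
  qed
  then show ?thesis
    unfolding lborel_prod .
qed

lemma root_xi:
  assumes "fst y \<noteq> 0"
  shows "acoef \<theta> p (xi y) * fst y - cnj (acoef \<theta> p (xi y)) / fst y + complex_of_real (ccoef p (xi y)) = 0"
  using denom_xi[OF assms] unfolding denom_k_of .

lemma acoef_xi_nonzero:
  assumes "fst y \<noteq> 0" "yc (wco (norm (fst y))) (snd y) \<noteq> 0"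
  shows "acoef \<theta> p (xi y) \<noteq> 0"
  unfolding acoef_xi[OF assms(1)] using assms norm_p_pos by (simp add: sgn_zero_iff)

abbreviation rt1 :: "real^3 \<Rightarrow> complex"
  where "rt1 s \<equiv> root1 (ccoef p s) (acoef \<theta> p s)"

abbreviation rt2 :: "real^3 \<Rightarrow> complex"
  where "rt2 s \<equiv> root2 (ccoef p s) (acoef \<theta> p s)"

lemma rt1_xi:
  assumes "generic y" "snd y \<in> {-pi..pi}" "Re (fst y) > 0"
  shows "rt1 (xi y) = fst y"
  using assms by (intro root1_unique acoef_xi_nonzero root_xi) (auto simp: generic_def)

lemma rt2_xi:
  assumes "generic y" "snd y \<in> {-pi..pi}" "Re (fst y) < 0"
  shows "rt2 (xi y) = fst y"
  using assms by (intro root2_unique acoef_xi_nonzero root_xi) (auto simp: generic_def)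

abbreviation dens :: "real \<Rightarrow> complex \<times> real \<Rightarrow> real"
  where "dens \<sigma> y \<equiv> jac (fst y) (snd y) * strip (snd y) * sheet \<sigma> (fst y)"

lemma jac_nonneg: "jac z \<phi> \<ge> 0"
  by (simp add: jac_def)

lemma dens_nonneg: "dens \<sigma> y \<ge> 0"
  by (simp add: jac_nonneg sheet_def)

text \<open>In the form of an image measure the change of variables serves Bochner integrals and
  null sets as well.\<close>

lemma lborel_sheet:
  assumes "\<sigma> = 1 \<or> \<sigma> = -1"
  shows "distr (density lborel (\<lambda>y. ennreal (dens \<sigma> y))) borel xi = lborel"
proof (rule measure_eqI)
  fix A assume "A \<in> sets (distr (density lborel (\<lambda>y. ennreal (dens \<sigma> y))) borel xi)"
  then have [measurable]: "A \<in> sets borel"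
    by simp
  have [measurable]: "xi -` A \<in> sets borel"
    using measurable_sets[OF xi_measurable, of A] by simp
  have "emeasure (distr (density lborel (\<lambda>y. ennreal (dens \<sigma> y))) borel xi) A =
      (\<integral>\<^sup>+y. ennreal (dens \<sigma> y) * indicator A (xi y) \<partial>lborel)"
    by (subst emeasure_distr, simp, simp, subst emeasure_density, simp, simp)
      (auto intro!: nn_integral_cong simp: indicator_def)
  also have "\<dots> = (\<integral>\<^sup>+\<xi>. indicator A \<xi> \<partial>lborel)"
    by (rule nn_integral_sheet) (use assms in auto)
  finally show "emeasure (distr (density lborel (\<lambda>y. ennreal (dens \<sigma> y))) borel xi) A = emeasure lborel A"
    by simp
qed simp

lemma dens_pos:
  assumes "generic y" "snd y \<in> {-pi..pi}" "\<sigma> * Re (fst y) > 0"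
  shows "dens \<sigma> y > 0"
proof -
  have "fst y \<noteq> 0"
    using assms by auto
  then have "1 + 1 / (norm (fst y))\<^sup>2 > 0"
    by (simp add: add_pos_nonneg)
  then show ?thesis
    using assms norm_p_pos \<open>fst y \<noteq> 0\<close> by (auto simp: jac_def sheet_def generic_def)
qed

text \<open>On each sheet the density is positive at generic points, so null sets of \<xi>-space are
  carried back. Both sheets are used, in order to reach almost every (\<zeta>, \<phi>).\<close>

lemma AE_xiD:
  assumes "AE \<xi> in lborel. Q \<xi>"
  shows "AE y in lborel. snd y \<in> {-pi..pi} \<longrightarrow> Q (xi y)"
proof -
  have *: "AE y in lborel. 0 < ennreal (dens \<sigma> y) \<longrightarrow> Q (xi y)" if "\<sigma> = 1 \<or> \<sigma> = -1" for \<sigma>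
  proof -
    have "AE \<xi> in distr (density lborel (\<lambda>y. ennreal (dens \<sigma> y))) borel xi. Q \<xi>"
      unfolding lborel_sheet[OF that] by (rule assms)
    then have "AE y in density lborel (\<lambda>y. ennreal (dens \<sigma> y)). Q (xi y)"
      by (rule AE_distrD[rotated]) simp
    then show ?thesis
      by (subst (asm) AE_density) auto
  qed
  show ?thesis
    using *[of 1, simplified] *[of "-1", simplified] AE_generic
  proof eventually_elim
    case (elim y)
    show ?case
    proof
      assume "snd y \<in> {-pi..pi}"
      moreover have "1 * Re (fst y) > 0 \<or> -1 * Re (fst y) > 0"
        using elim by (auto simp: generic_def)
      ultimately show "Q (xi y)"
        using dens_pos[of y 1] dens_pos[of y "-1"] elim by auto
    qed
  qed
qed

text \<open>For this direction one sheet is enough, since it already covers almost all of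
  \<xi>-space.\<close>

lemma AE_xiI:
  assumes s: "\<sigma> = 1 \<or> \<sigma> = -1" and Q: "{\<xi>. Q \<xi>} \<in> sets borel"
    and AE: "AE y in lborel. generic y \<longrightarrow> snd y \<in> {-pi..pi} \<longrightarrow> \<sigma> * Re (fst y) > 0 \<longrightarrow> Q (xi y)"
  shows "AE \<xi> in lborel. Q \<xi>"
proof -
  have "AE y in density lborel (\<lambda>y. ennreal (dens \<sigma> y)). Q (xi y)"
  proof (subst AE_density)
    show "AE y in lborel. 0 < ennreal (dens \<sigma> y) \<longrightarrow> Q (xi y)"
      using AE AE_generic by eventually_elim (auto simp: sheet_def indicator_def split: if_splits)
  qed simp
  then have "AE \<xi> in distr (density lborel (\<lambda>y. ennreal (dens \<sigma> y))) borel xi. Q \<xi>"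
    using Q by (subst AE_distr_iff) auto
  then show ?thesis
    unfolding lborel_sheet[OF s] .
qed

abbreviation qd :: "complex \<Rightarrow> real^3 \<Rightarrow> complex"
  where "qd z s \<equiv> acoef \<theta> p s + cnj (acoef \<theta> p s) / z\<^sup>2"

text \<open>Checked on the sheet Re \<zeta> > 0, where \<open>rt1\<close> is \<zeta> and
  \<open>rt2\<close> its antipode. The cases in which l is itself a root are \<zeta> = l and \<zeta>
  = -1 / conj(l), a null set.\<close>

lemma partial_fractions_AE:
  assumes l: "l \<noteq> 0"
  shows "AE s in lborel. 1 / denom (k_of \<theta> l p) s = 1 / qd (rt1 s) s / (l - rt1 s) + 1 / qd (rt2 s) s / (l - rt2 s)"
proof (rule AE_xiI[of 1])
  show "{s. 1 / denom (k_of \<theta> l p) s = 1 / qd (rt1 s) s / (l - rt1 s) + 1 / qd (rt2 s) s / (l - rt2 s)} \<in> sets borel"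
  proof -
    let ?f = "\<lambda>s. 1 / denom (k_of \<theta> l p) s - (1 / qd (rt1 s) s / (l - rt1 s) + 1 / qd (rt2 s) s / (l - rt2 s))"
    have "?f \<in> borel_measurable borel"
      by measurable
    then have "?f -` {0} \<inter> space borel \<in> sets borel"
      by (rule measurable_sets) simp
    then show ?thesis
      by (simp only: vimage_def singleton_iff right_minus_eq space_borel Int_UNIV_right)
  qed
  show "AE y in lborel. generic y \<longrightarrow> snd y \<in> {-pi..pi} \<longrightarrow> 1 * Re (fst y) > 0 \<longrightarrow>
     1 / denom (k_of \<theta> l p) (xi y) = 1 / qd (rt1 (xi y)) (xi y) / (l - rt1 (xi y)) + 1 / qd (rt2 (xi y)) (xi y) / (l - rt2 (xi y))"
    using AE_fst_neq[of l] AE_fst_neq[of "- 1 / cnj l"]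
  proof eventually_elim
    case (elim y)
    show ?case
    proof (intro impI)
      assume y: "generic y" "snd y \<in> {-pi..pi}" "1 * Re (fst y) > 0"
      have z: "fst y \<noteq> 0"
        using y by auto
      have r1: "rt1 (xi y) = fst y"
        using y by (intro rt1_xi) auto
      have r2: "rt2 (xi y) = - 1 / cnj (fst y)"
        using r1 by (simp add: root2_def)
      have l2: "l \<noteq> - 1 / cnj (fst y)"
      proof
        assume "l = - 1 / cnj (fst y)"
        then have "- 1 / cnj l = fst y"
          by simp
        then show False
          using elim(2) by simp
      qed
      show "1 / denom (k_of \<theta> l p) (xi y) = 1 / qd (rt1 (xi y)) (xi y) / (l - rt1 (xi y)) + 1 / qd (rt2 (xi y)) (xi y) / (l - rt2 (xi y))"
        unfolding denom_k_of r1 r2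
        using y by (intro partial_fractions acoef_xi_nonzero z root_xi l l2 elim(1)[symmetric]) (auto simp: generic_def)
    qed
  qed
qed simp

text \<open>The order 2 is exactly the growth in \<xi> that \<open>jker_bound\<close> leaves
  over.\<close>

definition decay2 :: "real \<Rightarrow> (real^3 \<Rightarrow> complex) \<Rightarrow> bool"
  where "decay2 B F \<longleftrightarrow> F \<in> borel_measurable borel \<and> B \<ge> 0 \<and> (\<forall>s. norm (F s) \<le> B / (1 + norm s)\<^sup>2)"

definition pconst :: real
  where "pconst = 1 + 1 / norm p"

lemma pconst_pos: "pconst > 0"
  by (simp add: pconst_def add_pos_nonneg)

lemma strip_dominated_jker_mult:
  assumes [measurable]: "g \<in> borel_measurable borel" and B: "B \<ge> 0"
    and g: "\<And>y. fst y \<noteq> 0 \<Longrightarrow> norm (g y) \<le> B / (1 + norm (xi y))\<^sup>2"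
  shows "strip_dominated (B * pconst) (\<lambda>y. jker y * g y)"
  unfolding strip_dominated_def
proof (intro conjI allI)
  show "(\<lambda>y. jker y * g y) \<in> borel_measurable borel"
    by measurable
  show "0 \<le> B * pconst"
    using B pconst_pos by simp
  fix y
  show "norm (jker y * g y) \<le> B * pconst * (strip (snd y) / (1 + (norm (fst y))\<^sup>2))"
  proof (cases "fst y = 0")
    case True
    then show ?thesis
      using B pconst_pos by (simp add: jker_def)
  next
    case False
    have "norm (jker y * g y) \<le> (pconst * (1 + norm (xi y))\<^sup>2 * (strip (snd y) / (1 + (norm (fst y))\<^sup>2))) * (B / (1 + norm (xi y))\<^sup>2)"
      unfolding norm_mult pconst_def
      using g[OF False] by (intro mult_mono jker_bound) (auto intro!: mult_nonneg_nonneg add_nonneg_nonneg)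
    also have "\<dots> = B * pconst * (strip (snd y) / (1 + (norm (fst y))\<^sup>2))"
    proof -
      have "(1 + norm (xi y))\<^sup>2 \<noteq> 0"
        using norm_ge_zero[of "xi y"] by (simp add: add_nonneg_eq_0_iff)
      then show ?thesis
        by simp
    qed
    finally show ?thesis .
  qed
qed

lemma strip_dominated_jker:
  assumes "decay2 B F"
  shows "strip_dominated (B * pconst) (\<lambda>y. jker y * F (xi y))"
proof (rule strip_dominated_jker_mult)
  have [measurable]: "F \<in> borel_measurable borel"
    using assms by (simp add: decay2_def)
  show "(\<lambda>y. F (xi y)) \<in> borel_measurable borel"
    by measurable
qed (use assms in \<open>auto simp: decay2_def\<close>)

abbreviation rt :: "real \<Rightarrow> real^3 \<Rightarrow> complex"
  where "rt \<sigma> s \<equiv> (if \<sigma> > 0 then rt1 s else rt2 s)"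

text \<open>The residue term of a root is pulled back by the sheet on which that root is \<zeta>.
  There the density divided by the derivative of the symbol is \<open>jker\<close>; on the other
  sheet and outside the strip both sides vanish.\<close>

lemma dens_root:
  assumes s: "\<sigma> = 1 \<or> \<sigma> = -1" and y: "generic y"
  shows "complex_of_real (dens \<sigma> y) * (F (xi y) * (1 / qd (rt \<sigma> (xi y)) (xi y) / (l - rt \<sigma> (xi y)))) =
    complex_of_real (sheet \<sigma> (fst y)) * (jker y * F (xi y) / (l - fst y))"
proof (cases "\<sigma> * Re (fst y) > 0 \<and> snd y \<in> {-pi..pi}")
  case True
  then have z: "fst y \<noteq> 0"
    by auto
  have r: "rt \<sigma> (xi y) = fst y"
    using s True rt1_xi[OF y] rt2_xi[OF y] by auto
  have j: "qd (fst y) (xi y) * jker y = complex_of_real (jac (fst y) (snd y) * strip (snd y))"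
    by (rule deriv_factor_xi[OF z])
  have "dens \<sigma> y > 0"
    using True by (intro dens_pos y) auto
  then have "jac (fst y) (snd y) * strip (snd y) \<noteq> 0"
    by auto
  then have q: "qd (fst y) (xi y) \<noteq> 0"
    using j by (metis mult_zero_left of_real_eq_0_iff)
  have D: "complex_of_real (dens \<sigma> y) = complex_of_real (sheet \<sigma> (fst y)) * (qd (fst y) (xi y) * jker y)"
    unfolding j by simp
  show ?thesis
    unfolding r D using q by simp
next
  case False
  then have "dens \<sigma> y = 0" "sheet \<sigma> (fst y) = 0 \<or> jker y = 0"
    by (auto simp: sheet_def jker_def indicator_def)
  then show ?thesis
    by auto
qed

lemma sheet_nonneg: "sheet \<sigma> z \<ge> 0"
  by (simp add: sheet_def)

lemma sheet_sum:
  assumes "generic y"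
  shows "sheet 1 (fst y) + sheet (-1) (fst y) = 1"
  using assms by (auto simp: sheet_def generic_def)

text \<open>Each of the two partial fractions is integrable by itself and is integrated over its own
  sheet. The sheets complement each other, so that the two integrals over half planes add up to one
  Cauchy transform. The minus sign comes from l - \<zeta> against \<zeta> - l.\<close>

lemma
  assumes F: "decay2 B F" and l: "l \<noteq> 0"
  shows nn_integral_over_denom: "(\<integral>\<^sup>+s. ennreal (norm (F s) / norm (denom (k_of \<theta> l p) s)) \<partial>lborel) \<le> ennreal (B * pconst * cconst)"
    and integrable_over_denom: "integrable lborel (\<lambda>s. F s / denom (k_of \<theta> l p) s)"
    and integral_over_denom: "(LINT s|lborel. F s / denom (k_of \<theta> l p) s) = - cauchy_transform (\<lambda>y. jker y * F (xi y)) l"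
proof -
  have [measurable]: "F \<in> borel_measurable borel"
    using F by (simp add: decay2_def)
  note K = strip_dominated_jker[OF F]
  define h where "h \<sigma> s = F s * (1 / qd (rt \<sigma> s) s / (l - rt \<sigma> s))" for \<sigma> s
  have h [measurable]: "h \<sigma> \<in> borel_measurable borel" for \<sigma>
    unfolding h_def by measurable
  have sum: "AE s in lborel. F s / denom (k_of \<theta> l p) s = h 1 s + h (-1) s"
    using partial_fractions_AE[OF l]
  proof eventually_elim
    case (elim s)
    have "F s / denom (k_of \<theta> l p) s = F s * (1 / denom (k_of \<theta> l p) s)"
      by simp
    then show ?case
      unfolding elim by (simp add: h_def distrib_left)
  qed
  have nn: "(\<integral>\<^sup>+s. ennreal (norm (h \<sigma> s)) \<partial>lborel) = (\<integral>\<^sup>+y. ennreal (sheet \<sigma> (fst y) * (norm (jker y * F (xi y)) / norm (fst y - l))) \<partial>lborel)"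
    if "\<sigma> = 1 \<or> \<sigma> = -1" for \<sigma>
  proof -
    have "(\<integral>\<^sup>+s. ennreal (norm (h \<sigma> s)) \<partial>lborel) = (\<integral>\<^sup>+y. ennreal (dens \<sigma> y) * ennreal (norm (h \<sigma> (xi y))) \<partial>lborel)"
      by (rule nn_integral_sheet[OF _ that, symmetric]) measurable
    also have "\<dots> = (\<integral>\<^sup>+y. ennreal (sheet \<sigma> (fst y) * (norm (jker y * F (xi y)) / norm (fst y - l))) \<partial>lborel)"
    proof (rule nn_integral_cong_AE, use AE_generic in eventually_elim)
      case (elim y)
      have "dens \<sigma> y * norm (h \<sigma> (xi y)) = norm (complex_of_real (dens \<sigma> y) * h \<sigma> (xi y))"
        by (simp only: norm_mult norm_of_real abs_of_nonneg[OF dens_nonneg])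
      also have "\<dots> = sheet \<sigma> (fst y) * (norm (jker y * F (xi y)) / norm (fst y - l))"
        unfolding h_def dens_root[OF that elim]
        by (simp add: norm_mult norm_divide sheet_def norm_minus_commute)
      finally show ?case
        by (simp only: ennreal_mult[OF dens_nonneg norm_ge_zero, symmetric])
    qed
    finally show ?thesis .
  qed
  have nn_sum: "(\<integral>\<^sup>+s. ennreal (norm (h 1 s)) \<partial>lborel) + (\<integral>\<^sup>+s. ennreal (norm (h (-1) s)) \<partial>lborel) =
     (\<integral>\<^sup>+y. ennreal (norm (jker y * F (xi y)) / norm (fst y - l)) \<partial>lborel)"
  proof -
    have "(\<integral>\<^sup>+s. ennreal (norm (h 1 s)) \<partial>lborel) + (\<integral>\<^sup>+s. ennreal (norm (h (-1) s)) \<partial>lborel) =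
      (\<integral>\<^sup>+y. ennreal (sheet 1 (fst y) * (norm (jker y * F (xi y)) / norm (fst y - l))) +
             ennreal (sheet (-1) (fst y) * (norm (jker y * F (xi y)) / norm (fst y - l))) \<partial>lborel)"
      by (subst nn_integral_add) (auto simp: nn)
    also have "\<dots> = (\<integral>\<^sup>+y. ennreal (norm (jker y * F (xi y)) / norm (fst y - l)) \<partial>lborel)"
    proof (rule nn_integral_cong_AE, use AE_generic in eventually_elim)
      case (elim y)
      have "sheet 1 (fst y) * c + sheet (-1) (fst y) * c = c" for c
        using sheet_sum[OF elim] by (simp add: distrib_right[symmetric])
      then show ?case
        by (subst ennreal_plus[symmetric]) (simp_all only: sheet_nonneg mult_nonneg_nonneg divide_nonneg_nonneg norm_ge_zero)
    qed
    finally show ?thesis .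
  qed
  show bound: "(\<integral>\<^sup>+s. ennreal (norm (F s) / norm (denom (k_of \<theta> l p) s)) \<partial>lborel) \<le> ennreal (B * pconst * cconst)"
  proof -
    have "(\<integral>\<^sup>+s. ennreal (norm (F s) / norm (denom (k_of \<theta> l p) s)) \<partial>lborel) \<le> (\<integral>\<^sup>+s. ennreal (norm (h 1 s)) + ennreal (norm (h (-1) s)) \<partial>lborel)"
    proof (rule nn_integral_mono_AE, use sum in eventually_elim)
      case (elim s)
      have "norm (F s) / norm (denom (k_of \<theta> l p) s) \<le> norm (h 1 s) + norm (h (-1) s)"
        unfolding norm_divide[symmetric] elim by (rule norm_triangle_ineq)
      then show ?case
        by (simp add: ennreal_plus[symmetric] ennreal_leI del: ennreal_plus)
    qed
    also have "\<dots> = (\<integral>\<^sup>+y. ennreal (norm (jker y * F (xi y)) / norm (fst y - l)) \<partial>lborel)"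
      by (subst nn_integral_add) (auto simp: nn_sum)
    also have "\<dots> \<le> ennreal (B * pconst * cconst)"
      by (rule nn_integral_strip_dominated[OF K])
    finally show ?thesis .
  qed
  show "integrable lborel (\<lambda>s. F s / denom (k_of \<theta> l p) s)"
    using bound by (intro integrableI_bounded) (auto simp: norm_divide intro: le_less_trans)
  have int: "integrable lborel (h \<sigma>)" if "\<sigma> = 1 \<or> \<sigma> = -1" for \<sigma>
  proof (rule integrableI_bounded)
    have "(\<integral>\<^sup>+s. ennreal (norm (h \<sigma> s)) \<partial>lborel) \<le> (\<integral>\<^sup>+s. ennreal (norm (h 1 s)) \<partial>lborel) + (\<integral>\<^sup>+s. ennreal (norm (h (-1) s)) \<partial>lborel)"
      using that by auto
    also have "\<dots> \<le> ennreal (B * pconst * cconst)"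
      unfolding nn_sum by (rule nn_integral_strip_dominated[OF K])
    also have "\<dots> < \<infinity>"
      by simp
    finally show "(\<integral>\<^sup>+s. ennreal (norm (h \<sigma> s)) \<partial>lborel) < \<infinity>" .
  qed measurable
  have Lint: "(LINT s|lborel. h \<sigma> s) = (LINT y|lborel. complex_of_real (sheet \<sigma> (fst y)) * (jker y * F (xi y) / (l - fst y)))"
    if "\<sigma> = 1 \<or> \<sigma> = -1" for \<sigma>
  proof -
    have "(LINT s|lborel. h \<sigma> s) = (LINT s|distr (density lborel (\<lambda>y. ennreal (dens \<sigma> y))) borel xi. h \<sigma> s)"
      unfolding lborel_sheet[OF that] ..
    also have "\<dots> = (LINT y|density lborel (\<lambda>y. ennreal (dens \<sigma> y)). h \<sigma> (xi y))"
      by (rule integral_distr) measurable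
    also have "\<dots> = (LINT y|lborel. dens \<sigma> y *\<^sub>R h \<sigma> (xi y))"
      by (rule integral_density) (auto simp: dens_nonneg)
    also have "\<dots> = (LINT y|lborel. complex_of_real (sheet \<sigma> (fst y)) * (jker y * F (xi y) / (l - fst y)))"
    proof (rule integral_cong_AE)
      show "AE y in lborel. dens \<sigma> y *\<^sub>R h \<sigma> (xi y) = complex_of_real (sheet \<sigma> (fst y)) * (jker y * F (xi y) / (l - fst y))"
        using AE_generic
        by eventually_elim (simp only: h_def scaleR_conv_of_real dens_root[OF that])
    qed measurable
    finally show ?thesis .
  qed
  have int_y: "integrable lborel (\<lambda>y. jker y * F (xi y) / (l - fst y))"
  proof -
    have "integrable lborel (\<lambda>y. - (jker y * F (xi y) / (fst y - l)))"
      by (intro integrable_minus integrable_cauchy_transform[OF K])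
    then show ?thesis
      by (simp add: minus_divide_right)
  qed
  have int_s: "integrable lborel (\<lambda>y. complex_of_real (sheet \<sigma> (fst y)) * (jker y * F (xi y) / (l - fst y)))" for \<sigma>
    by (rule Bochner_Integration.integrable_bound[OF int_y]) (auto simp: norm_mult sheet_def)
  have "(LINT s|lborel. F s / denom (k_of \<theta> l p) s) = (LINT s|lborel. h 1 s + h (-1) s)"
    by (intro integral_cong_AE sum) measurable
  also have "\<dots> = (LINT s|lborel. h 1 s) + (LINT s|lborel. h (-1) s)"
    by (intro Bochner_Integration.integral_add int) auto
  also have "\<dots> = (LINT y|lborel. complex_of_real (sheet 1 (fst y)) * (jker y * F (xi y) / (l - fst y)) + complex_of_real (sheet (-1) (fst y)) * (jker y * F (xi y) / (l - fst y)))"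
    by (subst Bochner_Integration.integral_add[OF int_s int_s]) (simp add: Lint)
  also have "\<dots> = (LINT y|lborel. - (jker y * F (xi y) / (fst y - l)))"
  proof (rule integral_cong_AE)
    show "AE y in lborel. complex_of_real (sheet 1 (fst y)) * (jker y * F (xi y) / (l - fst y)) + complex_of_real (sheet (-1) (fst y)) * (jker y * F (xi y) / (l - fst y))
        = - (jker y * F (xi y) / (fst y - l))"
      using AE_generic
    proof eventually_elim
      case (elim y)
      have "complex_of_real (sheet 1 (fst y)) * c + complex_of_real (sheet (-1) (fst y)) * c = c" for c
        using sheet_sum[OF elim] by (simp add: distrib_right[symmetric] of_real_add[symmetric] del: of_real_add)
      then show ?case
        by (simp only: minus_divide_right minus_diff_eq)
    qed
  qed measurable
  also have "\<dots> = - cauchy_transform (\<lambda>y. jker y * F (xi y)) l"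
    unfolding cauchy_transform_def by simp
  finally show "(LINT s|lborel. F s / denom (k_of \<theta> l p) s) = - cauchy_transform (\<lambda>y. jker y * F (xi y)) l" .
qed

end

section \<open>Borel representatives and almost everywhere statements\<close>

lemma lebesgue_borel_representative:
  fixes f :: "'a::euclidean_space \<Rightarrow> complex"
  assumes "f \<in> borel_measurable lebesgue"
  obtains g where "g \<in> borel_measurable borel" "AE x in lborel. f x = g x"
proof -
  have "(\<lambda>x. Re (f x)) \<in> borel_measurable (completion lborel)" "(\<lambda>x. Im (f x)) \<in> borel_measurable (completion lborel)"
    using assms by measurable
  then obtain a b where ab: "a \<in> borel_measurable lborel" "AE x in lborel. Re (f x) = a x"
    "b \<in> borel_measurable lborel" "AE x in lborel. Im (f x) = b x"
    using completion_ex_borel_measurable_real by metis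
  show thesis
  proof (rule that)
    show "(\<lambda>x. Complex (a x) (b x)) \<in> borel_measurable borel"
      using ab by simp
    show "AE x in lborel. f x = Complex (a x) (b x)"
      using ab(2,4) by eventually_elim (simp add: complex_eq_iff)
  qed
qed

lemma AE_lborel_affine:
  fixes a :: "'a::euclidean_space"
  assumes ae: "AE x in lborel. P x" and c: "c \<noteq> 0"
  shows "AE x in lborel. P (a + c *\<^sub>R x)"
proof -
  have "AE x in density (distr lborel borel (\<lambda>x. a + c *\<^sub>R x)) (\<lambda>_. ennreal (\<bar>c\<bar> ^ DIM('a))). P x"
    by (subst lborel_affine[OF c, of a, symmetric]) (rule ae)
  then have "AE x in distr lborel borel (\<lambda>x. a + c *\<^sub>R x). P x"
    using c by (subst (asm) AE_density) auto
  then show ?thesis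
    by (rule AE_distrD[rotated]) simp
qed

lemma AE_lborel_uminus:
  fixes P :: "'a::euclidean_space \<Rightarrow> bool"
  assumes "AE x in lborel. P x"
  shows "AE x in lborel. P (- x)"
  using AE_lborel_affine[OF assms, of "-1" 0] by simp

lemma AE_lborel_shift:
  fixes P :: "'a::euclidean_space \<Rightarrow> bool"
  assumes "AE x in lborel. P x"
  shows "AE x in lborel. P (a + x)"
  using AE_lborel_affine[OF assms, of 1 a] by simp

lemma AE_lborel_dense:
  fixes P :: "'a::euclidean_space \<Rightarrow> bool"
  assumes "AE x in lborel. P x" and "e > 0"
  obtains y where "P y" "dist y x < e"
proof -
  have "\<exists>y. P y \<and> dist y x < e"
  proof (rule ccontr)
    assume "\<not> ?thesis"
    then have "ball x e \<subseteq> {y. \<not> P y}"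
      by (auto simp: dist_commute)
    moreover obtain N where "N \<in> null_sets lborel" "{y. \<not> P y} \<subseteq> N"
      using assms(1) by (auto elim: AE_E3 simp: eventually_ae_filter)
    ultimately have "ball x e \<subseteq> N"
      by auto
    then have "negligible (ball x e)"
      using \<open>N \<in> null_sets lborel\<close> negligible_iff_null_sets negligible_subset null_sets_completionI by blast
    then show False
      using open_not_negligible[of "ball x e"] \<open>e > 0\<close> by auto
  qed
  then show thesis
    using that by blast
qed

lemma AE_lborel_sequence:
  fixes P :: "'a::euclidean_space \<Rightarrow> bool"
  assumes "AE x in lborel. P x"
  obtains y where "\<And>n. P (y n)" "y \<longlonglongrightarrow> x"
proof -
  have "\<exists>y. P y \<and> dist y x < 1 / real (Suc n)" for n
    using AE_lborel_dense[OF assms, of "1 / real (Suc n)" x] by auto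
  then obtain y where y: "\<And>n. P (y n)" "\<And>n. dist (y n) x < 1 / real (Suc n)"
    by metis
  have "(\<lambda>n. dist (y n) x) \<longlonglongrightarrow> 0"
    by (rule tendsto_sandwich[OF _ _ tendsto_const LIMSEQ_inverse_real_of_nat])
      (use y(2) in \<open>auto simp: inverse_eq_divide intro!: always_eventually less_imp_le\<close>)
  then show thesis
    using that y(1) tendsto_dist_iff by blast
qed

lemma AE_lborel_closed:
  fixes f :: "'a::euclidean_space \<Rightarrow> real"
  assumes "AE x in lborel. f x \<le> g x" "continuous_on UNIV f" "continuous_on UNIV g"
  shows "f x \<le> g x"
proof -
  obtain y where y: "\<And>n. f (y n) \<le> g (y n)" and lim: "y \<longlonglongrightarrow> x"
    using AE_lborel_sequence[OF assms(1)] by metis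
  have "(\<lambda>n. f (y n)) \<longlonglongrightarrow> f x" "(\<lambda>n. g (y n)) \<longlonglongrightarrow> g x"
    using assms(2,3) lim by (auto intro: continuous_on_tendsto_compose)
  then show ?thesis
    by (rule LIMSEQ_le) (auto intro: y)
qed

section \<open>Weighted norms\<close>

text \<open>Norm bounds are handled in the form |u| <= B wt, with a real constant B in place of an
  extended real norm.\<close>

definition wt :: "real \<Rightarrow> real^3 \<Rightarrow> real"
  where "wt \<mu> p = (1 + norm p) powr (-\<mu>)"

lemma wt_pos [simp]: "wt \<mu> p > 0"
proof -
  have "1 + norm p > 0"
    by (simp add: add_pos_nonneg)
  then show ?thesis
    by (simp add: wt_def)
qed

lemma wt_nonneg [simp]: "wt \<mu> p \<ge> 0"
  using wt_pos[of \<mu> p] by linarith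

lemma wt_uminus [simp]: "wt \<mu> (- p) = wt \<mu> p"
  by (simp add: wt_def)

lemma continuous_on_wt: "continuous_on S (wt \<mu>)"
proof -
  have "1 + norm x \<noteq> 0" for x :: "real^3"
    by (metis add_pos_nonneg less_irrefl norm_ge_zero zero_less_one)
  then show ?thesis
    unfolding wt_def by (intro continuous_intros) auto
qed

lemma wt_measurable [measurable]: "wt \<mu> \<in> borel_measurable borel"
  unfolding wt_def by measurable

lemma weight_le_iff: "(1 + norm p) powr \<mu> * x \<le> B \<longleftrightarrow> x \<le> B * wt \<mu> p"
proof -
  have "1 + norm p > 0"
    by (simp add: add_pos_nonneg)
  then show ?thesis
    by (simp add: wt_def powr_minus divide_simps mult.commute)
qed

lemma wt_le_square:
  assumes "\<mu> \<ge> 2"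
  shows "wt \<mu> p \<le> 1 / (1 + norm p)\<^sup>2"
proof -
  have "wt \<mu> p \<le> (1 + norm p) powr (- 2)"
    unfolding wt_def using assms by (intro powr_mono) auto
  also have "\<dots> = 1 / (1 + norm p)\<^sup>2"
    by (simp add: powr_minus_divide)
  finally show ?thesis .
qed

lemma wt_le_1:
  assumes "\<mu> \<ge> 0"
  shows "wt \<mu> p \<le> 1"
proof -
  have "wt \<mu> p \<le> (1 + norm p) powr 0"
    unfolding wt_def using assms by (intro powr_mono) auto
  also have "\<dots> = 1"
    using add_pos_nonneg[of 1 "norm p"] by simp
  finally show ?thesis .
qed

lemma square_shift_bound: "1 / (1 + norm (a + s))\<^sup>2 \<le> (1 + norm a)\<^sup>2 / (1 + norm s)\<^sup>2"
  for a s :: "'a::real_normed_vector"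
proof -
  have pos: "1 + norm s > 0" "1 + norm (a + s) > 0"
    by (simp_all add: add_pos_nonneg)
  have "norm s \<le> norm (a + s) + norm a"
    using norm_triangle_ineq4[of "a + s" a] by simp
  moreover have "(1 + norm a) * (1 + norm (a + s)) = 1 + norm a + norm (a + s) + norm a * norm (a + s)"
    by (simp add: algebra_simps)
  moreover have "0 \<le> norm a * norm (a + s)"
    by simp
  ultimately have "1 + norm s \<le> (1 + norm a) * (1 + norm (a + s))"
    by linarith
  then have "(1 + norm s)\<^sup>2 \<le> ((1 + norm a) * (1 + norm (a + s)))\<^sup>2"
    using pos by (intro power_mono) auto
  then show ?thesis
    using pos by (simp add: divide_simps power_mult_distrib)
qed

lemma wnorm_nonneg: "wnorm \<mu> u \<ge> 0"
proof (cases "(\<lambda>p. ereal ((1 + norm p) powr \<mu> * norm (u p))) \<in> borel_measurable lebesgue")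
  case True
  have "0 = esssup (lebesgue :: (real^3) measure) (\<lambda>p. 0 :: ereal)"
    by (rule esssup_const[symmetric]) simp
  also have "\<dots> \<le> wnorm \<mu> u"
    unfolding wnorm_def by (rule esssup_mono) auto
  finally show ?thesis .
\<comment> \<open>If the weighted modulus is not measurable, \<open>esssup\<close> is
  \<open>top\<close>.\<close>
qed (simp add: wnorm_def esssup_def)

lemma wnorm_le:
  assumes "u \<in> borel_measurable lebesgue" "AE p in lborel. norm (u p) \<le> B * wt \<mu> p"
  shows "wnorm \<mu> u \<le> ereal B"
  unfolding wnorm_def
proof (rule esssup_I)
  have "(\<lambda>p::real^3. (1 + norm p) powr \<mu>) \<in> borel_measurable lebesgue"
    by (rule measurable_completion) measurable
  then show "(\<lambda>p. ereal ((1 + norm p) powr \<mu> * norm (u p))) \<in> borel_measurable lebesgue"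
    using assms(1) by measurable
  show "AE p in lebesgue. ereal ((1 + norm p) powr \<mu> * norm (u p)) \<le> ereal B"
    using assms(2) by (intro AE_completion) (simp add: weight_le_iff)
qed

lemma wnorm_leD:
  assumes "wnorm \<mu> u \<le> ereal B"
  shows "AE p in lborel. norm (u p) \<le> B * wt \<mu> p"
proof -
  have "AE p in lebesgue. ereal ((1 + norm p) powr \<mu> * norm (u p)) \<le> wnorm \<mu> u"
    unfolding wnorm_def by (rule esssup_AE)
  then have "AE p in lborel. ereal ((1 + norm p) powr \<mu> * norm (u p)) \<le> wnorm \<mu> u"
    by (simp add: AE_completion_iff)
  then show ?thesis
  proof eventually_elim
    case (elim p)
    then have "ereal ((1 + norm p) powr \<mu> * norm (u p)) \<le> ereal B"
      using assms by (rule order_trans)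
    then show ?case
      by (simp add: weight_le_iff)
  qed
qed

lemma LinfI:
  assumes "u \<in> borel_measurable lebesgue" "AE p in lborel. norm (u p) \<le> B * wt \<mu> p"
  shows "u \<in> Linf \<mu>"
  unfolding Linf_def using assms wnorm_le[OF assms] by (auto intro: le_less_trans)

lemma LinfE:
  assumes "u \<in> Linf \<mu>"
  obtains B where "B \<ge> 0" "wnorm \<mu> u = ereal B"
  using assms wnorm_nonneg[of \<mu> u] unfolding Linf_def by (cases "wnorm \<mu> u") auto

lemma Linf_representative:
  assumes "u \<in> Linf \<mu>"
  obtains g B where "g \<in> borel_measurable borel" "B \<ge> 0" "\<And>p. norm (g p) \<le> B * wt \<mu> p" "AE p in lborel. u p = g p"
proof -
  obtain B where B: "B \<ge> 0" "wnorm \<mu> u = ereal B"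
    using assms by (rule LinfE)
  obtain g where g [measurable]: "g \<in> borel_measurable borel" and ug: "AE p in lborel. u p = g p"
    using assms lebesgue_borel_representative by (auto simp: Linf_def)
  \<comment> \<open>Truncation makes the bound hold at every point and changes g on a null set
    only.\<close>
  define g' where "g' p = (if norm (g p) \<le> B * wt \<mu> p then g p else 0)" for p
  show thesis
  proof (rule that)
    show "g' \<in> borel_measurable borel"
      unfolding g'_def by measurable
    show "B \<ge> 0" by (rule B)
    show "norm (g' p) \<le> B * wt \<mu> p" for p
      using B by (simp add: g'_def)
    show "AE p in lborel. u p = g' p"
      using ug wnorm_leD[of \<mu> u B] B by (auto simp: g'_def)
  qed
qed

text \<open>\<open>A_op\<close> sees only the class of U, so that U may be replaced by a Borel
  function and the completed measure by \<open>lborel\<close>.\<close>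

lemma A_op_cong:
  assumes "AE p in lborel. U p = U' p" and "U' \<in> borel_measurable borel" and "w \<in> borel_measurable borel"
  shows "A_op w k U p = (LINT \<xi>|lborel. w (p + \<xi>) * U' (- \<xi>) / denom k \<xi>)"
proof -
  note [measurable] = assms(2,3)
  have m: "(\<lambda>\<xi>. w (p + \<xi>) * U' (- \<xi>) / denom k \<xi>) \<in> borel_measurable borel"
    by measurable
  have ae: "AE \<xi> in lebesgue. w (p + \<xi>) * U' (- \<xi>) / denom k \<xi> = w (p + \<xi>) * U (- \<xi>) / denom k \<xi>"
    by (rule AE_completion) (use AE_lborel_uminus[OF assms(1)] in eventually_elim, simp)
  have m1: "(\<lambda>\<xi>. w (p + \<xi>) * U' (- \<xi>) / denom k \<xi>) \<in> borel_measurable lebesgue"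
    using m by (intro measurable_completion) simp
  have m2: "(\<lambda>\<xi>. w (p + \<xi>) * U (- \<xi>) / denom k \<xi>) \<in> borel_measurable lebesgue"
    using m1 ae by (rule borel_measurable_AE)
  have "A_op w k U p = (LINT \<xi>|lebesgue. w (p + \<xi>) * U' (- \<xi>) / denom k \<xi>)"
    unfolding A_op_denom by (rule integral_cong_AE[OF m1 m2 ae, symmetric])
  also have "\<dots> = (LINT \<xi>|lborel. w (p + \<xi>) * U' (- \<xi>) / denom k \<xi>)"
    using m by (intro integral_completion) simp
  finally show ?thesis .
qed

lemma A_op_lborel:
  assumes "U \<in> borel_measurable borel" "w \<in> borel_measurable borel"
  shows "A_op w k U p = (LINT \<xi>|lborel. w (p + \<xi>) * U (- \<xi>) / denom k \<xi>)"
  by (rule A_op_cong) (use assms in auto)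

section \<open>The Faddeev function\<close>

locale faddeev =
  fixes \<mu> C c\<^sub>1 :: real and v :: "real^3 \<Rightarrow> complex"
  assumes mu: "\<mu> \<ge> 2" and c1_pos: "c\<^sub>1 > 0" and C_nonneg: "C \<ge> 0" and small: "c\<^sub>1 * C < 1"
    and c1: "\<And>k w U. k \<in> Sigma_var \<Longrightarrow> w \<in> Linf \<mu> \<Longrightarrow> U \<in> Linf \<mu> \<Longrightarrow>
               wnorm \<mu> (A_op w k U) \<le> ereal c\<^sub>1 * wnorm \<mu> w * wnorm \<mu> U"
    and v_norm: "wnorm \<mu> v \<le> ereal C" and v_cont: "continuous_on UNIV v"
begin

lemma v_measurable [measurable]: "v \<in> borel_measurable borel"
  using v_cont by (rule borel_measurable_continuous_onI)

lemma v_bound: "norm (v p) \<le> C * wt \<mu> p"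
  by (rule AE_lborel_closed[OF wnorm_leD[OF v_norm]])
    (intro continuous_on_norm v_cont continuous_intros continuous_on_wt)+

text \<open>The hypothesis \<open>c1\<close> bounds the modulus of an integral. Giving \<open>U\<close> the phase of the symbol turns it
  into a bound for the integral of the modulus; the truncation makes the integrand integrable.\<close>

lemma A_truncated_bound:
  fixes m :: nat
  assumes k: "k \<in> Sigma_var" and U [measurable]: "U \<in> borel_measurable borel" and B: "B \<ge> 0" "\<And>p. norm (U p) \<le> B * wt \<mu> p"
  shows "AE p in lborel. (\<integral>\<^sup>+\<xi>. ennreal (norm (v (p + \<xi>)) * norm (U (- \<xi>)) / norm (denom k \<xi>)) *
     indicator {\<xi>. norm (denom k \<xi>) \<ge> 1 / real (Suc m) \<and> norm \<xi> \<le> real m} \<xi> \<partial>lborel) \<le> ennreal (c\<^sub>1 * C * B * wt \<mu> p)"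
proof -
  define S where "S = {\<xi>. norm (denom k \<xi>) \<ge> 1 / real (Suc m) \<and> norm \<xi> \<le> real m}"
  have [measurable]: "S \<in> sets borel"
    unfolding S_def by measurable
  define w where "w p = complex_of_real (norm (v p))" for p
  define V where "V x = complex_of_real (norm (U x) * indicator S (- x)) * sgn (denom k (- x))" for x
  have [measurable]: "w \<in> borel_measurable borel" "V \<in> borel_measurable borel"
    unfolding w_def V_def sgn_div_norm by measurable
  have wl: "wnorm \<mu> w \<le> ereal C"
    by (rule wnorm_le) (auto simp: w_def v_bound intro!: measurable_completion)
  have V_le: "norm (V p) \<le> B * wt \<mu> p" for p
  proof -
    have "norm (V p) \<le> norm (U p)"
      by (simp add: V_def norm_mult norm_sgn indicator_def)
    then show ?thesis
      using B(2)[of p] by linarith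
  qed
  have Vl: "wnorm \<mu> V \<le> ereal B"
    by (rule wnorm_le) (auto simp: V_le intro!: measurable_completion)
  have "wnorm \<mu> (A_op w k V) \<le> ereal c\<^sub>1 * wnorm \<mu> w * wnorm \<mu> V"
    by (rule c1[OF k]; rule LinfI[of _ "max B C"])
      (auto simp: V_le w_def intro!: measurable_completion order_trans[OF v_bound] order_trans[OF V_le] mult_right_mono)
  also have "\<dots> \<le> ereal c\<^sub>1 * ereal C * ereal B"
    using wl Vl wnorm_nonneg c1_pos C_nonneg
    by (intro ereal_mult_mono mult_nonneg_nonneg) auto
  also have "\<dots> = ereal (c\<^sub>1 * C * B)"
    by simp
  finally have "AE p in lborel. norm (A_op w k V p) \<le> c\<^sub>1 * C * B * wt \<mu> p"
    by (rule wnorm_leD)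
  then show ?thesis
  proof eventually_elim
    case (elim p)
    define f where "f \<xi> = norm (v (p + \<xi>)) * norm (U (- \<xi>)) / norm (denom k \<xi>) * indicator S \<xi>" for \<xi>
    have f0: "f \<xi> \<ge> 0" for \<xi>
      by (simp add: f_def)
    have [measurable]: "f \<in> borel_measurable borel"
      unfolding f_def by measurable
    have integrand: "w (p + \<xi>) * V (- \<xi>) / denom k \<xi> = complex_of_real (f \<xi>)" for \<xi>
    proof (cases "denom k \<xi> = 0")
      case False
      have "sgn (denom k \<xi>) / denom k \<xi> = complex_of_real (1 / norm (denom k \<xi>))"
        using False by (simp add: sgn_eq)
      moreover have "w (p + \<xi>) * V (- \<xi>) / denom k \<xi> =
          complex_of_real (norm (v (p + \<xi>)) * (norm (U (- \<xi>)) * indicator S \<xi>)) * (sgn (denom k \<xi>) / denom k \<xi>)"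
        by (simp add: w_def V_def)
      ultimately show ?thesis
        by (simp add: f_def)
    qed (simp add: f_def)
    have f_le: "f \<xi> \<le> (C * B * real (Suc m)) * indicator (cball 0 (real m)) \<xi>" for \<xi>
    proof (cases "\<xi> \<in> S")
      case True
      then have d: "norm (denom k \<xi>) \<ge> 1 / real (Suc m)" "norm \<xi> \<le> real m"
        by (auto simp: S_def)
      have w1: "wt \<mu> x \<le> 1" for x
        using mu by (intro wt_le_1) simp
      have "norm (v (p + \<xi>)) \<le> C" "norm (U (- \<xi>)) \<le> B"
        using v_bound[of "p + \<xi>"] B(2)[of "- \<xi>"] mult_left_mono[OF w1[of "p + \<xi>"] C_nonneg]
          mult_left_mono[OF w1[of "- \<xi>"] B(1)] by linarith+
      then have "norm (v (p + \<xi>)) * norm (U (- \<xi>)) \<le> C * B"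
        using B C_nonneg by (intro mult_mono) auto
      then have "norm (v (p + \<xi>)) * norm (U (- \<xi>)) / norm (denom k \<xi>) \<le> (C * B) / (1 / real (Suc m))"
        using d B C_nonneg by (intro frac_le) auto
      then show ?thesis
        using True d by (simp add: f_def)
    qed (use B C_nonneg in \<open>simp add: f_def indicator_def\<close>)
    have int: "integrable lborel f"
    proof (rule Bochner_Integration.integrable_bound)
      show "integrable lborel (\<lambda>\<xi>::real^3. (C * B * real (Suc m)) * indicator (cball 0 (real m)) \<xi>)"
      proof (rule integrable_mult_right, rule integrable_real_indicator)
        show "emeasure lborel (cball (0 :: real^3) (real m)) < \<infinity>"
          by (rule emeasure_bounded_finite) simp
      qed simp
      show "AE \<xi> in lborel. norm (f \<xi>) \<le> norm ((C * B * real (Suc m)) * indicator (cball 0 (real m)) \<xi>)"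
        using f_le f0 by (intro always_eventually allI) (metis abs_ge_self abs_of_nonneg order_trans real_norm_def)
    qed simp
    have "A_op w k V p = (LINT \<xi>|lborel. complex_of_real (f \<xi>))"
      by (subst A_op_lborel) (simp_all add: integrand)
    also have "\<dots> = complex_of_real (LINT \<xi>|lborel. f \<xi>)"
      by (rule integral_complex_of_real)
    finally have "(LINT \<xi>|lborel. f \<xi>) \<le> c\<^sub>1 * C * B * wt \<mu> p"
      using elim by (simp add: abs_le_iff)
    moreover have "(\<integral>\<^sup>+\<xi>. ennreal (f \<xi>) \<partial>lborel) = ennreal (LINT \<xi>|lborel. f \<xi>)"
      by (rule nn_integral_eq_integral[OF int]) (simp add: f0)
    ultimately have "(\<integral>\<^sup>+\<xi>. ennreal (f \<xi>) \<partial>lborel) \<le> ennreal (c\<^sub>1 * C * B * wt \<mu> p)"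
      by (simp add: ennreal_leI)
    moreover have "ennreal (f \<xi>) = ennreal (norm (v (p + \<xi>)) * norm (U (- \<xi>)) / norm (denom k \<xi>)) * indicator S \<xi>" for \<xi>
      by (simp add: f_def indicator_def)
    ultimately show ?case
      by (simp add: S_def)
  qed
qed

lemma A_absolute_bound_AE:
  assumes k: "k \<in> Sigma_var" and U [measurable]: "U \<in> borel_measurable borel" and B: "B \<ge> 0" "\<And>p. norm (U p) \<le> B * wt \<mu> p"
  shows "AE p in lborel. (\<integral>\<^sup>+\<xi>. ennreal (norm (v (p + \<xi>)) * norm (U (- \<xi>)) / norm (denom k \<xi>)) \<partial>lborel) \<le> ennreal (c\<^sub>1 * C * B * wt \<mu> p)"
proof -
  define S where "S m = {\<xi>. norm (denom k \<xi>) \<ge> 1 / real (Suc m) \<and> norm \<xi> \<le> real m}" for m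
  have S [measurable]: "S m \<in> sets borel" for m
    unfolding S_def by measurable
  have mono: "S m \<subseteq> S n" if "m \<le> n" for m n
  proof -
    have "1 / real (Suc n) \<le> 1 / real (Suc m)" "real m \<le> real n"
      using that by (auto intro!: frac_le)
    then show ?thesis
      by (auto simp: S_def)
  qed
  have un: "\<xi> \<in> (\<Union>m. S m)" if nz: "denom k \<xi> \<noteq> 0" for \<xi>
  proof -
    obtain a where a: "1 / real (Suc a) < norm (denom k \<xi>)"
      using nat_approx_posE[of "norm (denom k \<xi>)"] nz zero_less_norm_iff by blast
    obtain b where b: "norm \<xi> \<le> real b"
      using real_arch_simple by blast
    have "1 / real (Suc (max a b)) \<le> 1 / real (Suc a)"
      by (intro frac_le) auto
    then have "\<xi> \<in> S (max a b)"
      using a b by (simp add: S_def)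
    then show ?thesis
      by blast
  qed
  have "AE p in lborel. \<forall>m. (\<integral>\<^sup>+\<xi>. ennreal (norm (v (p + \<xi>)) * norm (U (- \<xi>)) / norm (denom k \<xi>)) *
     indicator (S m) \<xi> \<partial>lborel) \<le> ennreal (c\<^sub>1 * C * B * wt \<mu> p)"
    unfolding AE_all_countable S_def by (intro allI A_truncated_bound[OF k U B])
  then show ?thesis
  proof eventually_elim
    case (elim p)
    let ?f = "\<lambda>\<xi>. ennreal (norm (v (p + \<xi>)) * norm (U (- \<xi>)) / norm (denom k \<xi>))"
    have "?f \<xi> = (SUP m. ?f \<xi> * indicator (S m) \<xi>)" for \<xi>
      unfolding SUP_mult_indicator_ennreal using un[of \<xi>] by (cases "denom k \<xi> = 0") auto
    then have "(\<integral>\<^sup>+\<xi>. ?f \<xi> \<partial>lborel) = (\<integral>\<^sup>+\<xi>. (SUP m. ?f \<xi> * indicator (S m) \<xi>) \<partial>lborel)"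
      by simp
    also have "\<dots> = (SUP m. \<integral>\<^sup>+\<xi>. ?f \<xi> * indicator (S m) \<xi> \<partial>lborel)"
      by (intro nn_integral_monotone_convergence_SUP)
        (auto simp: incseq_def le_fun_def intro!: mult_left_mono indicator_leI dest: mono[THEN subsetD])
    also have "\<dots> \<le> ennreal (c\<^sub>1 * C * B * wt \<mu> p)"
      by (intro SUP_least) (use elim in auto)
    finally show ?case .
  qed
qed

text \<open>Continuity of \<open>v\<close> and Fatou's lemma turn the bound for almost every \<open>p\<close> into one for every \<open>p\<close>.\<close>

lemma A_absolute_bound:
  assumes k: "k \<in> Sigma_var" and U [measurable]: "U \<in> borel_measurable borel" and B: "B \<ge> 0" "\<And>p. norm (U p) \<le> B * wt \<mu> p"
  shows "(\<integral>\<^sup>+\<xi>. ennreal (norm (v (p + \<xi>) * U (- \<xi>) / denom k \<xi>)) \<partial>lborel) \<le> ennreal (c\<^sub>1 * C * B * wt \<mu> p)"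
proof -
  let ?f = "\<lambda>p \<xi>. ennreal (norm (v (p + \<xi>)) * norm (U (- \<xi>)) / norm (denom k \<xi>))"
  note ae = A_absolute_bound_AE[OF assms]
  obtain q where q: "\<And>n. (\<integral>\<^sup>+\<xi>. ?f (q n) \<xi> \<partial>lborel) \<le> ennreal (c\<^sub>1 * C * B * wt \<mu> (q n))" and lim: "q \<longlonglongrightarrow> p"
    by (rule AE_lborel_sequence[OF ae, of p]) (rule that)
  have vlim: "(\<lambda>n. v (q n + \<xi>)) \<longlonglongrightarrow> v (p + \<xi>)" for \<xi>
    by (rule continuous_on_tendsto_compose[OF v_cont tendsto_add[OF lim tendsto_const]]) simp_all
  have flim: "(\<lambda>n. ?f (q n) \<xi>) \<longlonglongrightarrow> ?f p \<xi>" for \<xi>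
    unfolding divide_inverse by (intro tendsto_ennrealI tendsto_mult tendsto_norm vlim tendsto_const)
  have "(\<integral>\<^sup>+\<xi>. ?f p \<xi> \<partial>lborel) = (\<integral>\<^sup>+\<xi>. liminf (\<lambda>n. ?f (q n) \<xi>) \<partial>lborel)"
    by (intro nn_integral_cong) (simp add: lim_imp_Liminf[OF _ flim])
  also have "\<dots> \<le> liminf (\<lambda>n. \<integral>\<^sup>+\<xi>. ?f (q n) \<xi> \<partial>lborel)"
    by (rule nn_integral_liminf) measurable
  also have "\<dots> \<le> liminf (\<lambda>n. ennreal (c\<^sub>1 * C * B * wt \<mu> (q n)))"
    by (intro Liminf_mono always_eventually allI q)
  also have "\<dots> = ennreal (c\<^sub>1 * C * B * wt \<mu> p)"
  proof (rule lim_imp_Liminf)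
    have "(\<lambda>n. wt \<mu> (q n)) \<longlonglongrightarrow> wt \<mu> p"
      by (rule continuous_on_tendsto_compose[OF continuous_on_wt[of UNIV] lim]) simp_all
    then show "(\<lambda>n. ennreal (c\<^sub>1 * C * B * wt \<mu> (q n))) \<longlonglongrightarrow> ennreal (c\<^sub>1 * C * B * wt \<mu> p)"
      by (intro tendsto_ennrealI tendsto_mult tendsto_const)
  qed simp
  finally show ?thesis
    by (simp add: norm_mult norm_divide)
qed

lemma A_integrable:
  assumes k: "k \<in> Sigma_var" and U [measurable]: "U \<in> borel_measurable borel" and B: "B \<ge> 0" "\<And>p. norm (U p) \<le> B * wt \<mu> p"
  shows "integrable lborel (\<lambda>\<xi>. v (p + \<xi>) * U (- \<xi>) / denom k \<xi>)"
  by (rule integrableI_bounded, measurable) (rule le_less_trans[OF A_absolute_bound[OF assms]], simp)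

lemma A_bound:
  assumes k: "k \<in> Sigma_var" and U [measurable]: "U \<in> borel_measurable borel" and B: "B \<ge> 0" "\<And>p. norm (U p) \<le> B * wt \<mu> p"
  shows "norm (A_op v k U p) \<le> c\<^sub>1 * C * B * wt \<mu> p"
proof -
  have "ennreal (norm (A_op v k U p)) \<le> (\<integral>\<^sup>+\<xi>. ennreal (norm (v (p + \<xi>) * U (- \<xi>) / denom k \<xi>)) \<partial>lborel)"
    unfolding A_op_lborel[OF U v_measurable]
    by (rule integral_norm_bound_ennreal[OF A_integrable[OF assms]])
  also have "\<dots> \<le> ennreal (c\<^sub>1 * C * B * wt \<mu> p)"
    by (rule A_absolute_bound[OF assms])
  finally show ?thesis
    using c1_pos C_nonneg B by (subst (asm) ennreal_le_iff) auto
qed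

section \<open>The Neumann series\<close>

fun Hn :: "nat \<Rightarrow> complex^3 \<Rightarrow> real^3 \<Rightarrow> complex"
  where
    "Hn 0 k p = v p"
  | "Hn (Suc n) k p = - A_op v k (Hn n k) p"

lemma Hn_measurable2: "(\<lambda>x. Hn n (fst x) (snd x)) \<in> borel_measurable borel"
proof (induction n)
  case 0
  then show ?case by simp
next
  case (Suc n)
  have [measurable]: "Hn n k \<in> borel_measurable borel" for k
    using measurable_compose[OF _ Suc, of "\<lambda>p. (k, p)" borel] by simp
  have [measurable]: "(\<lambda>z. Hn n (fst (fst z)) (- snd z)) \<in> borel_measurable (borel \<Otimes>\<^sub>M borel :: (((complex^3) \<times> (real^3)) \<times> (real^3)) measure)"
  proof -
    have "(\<lambda>z. (fst (fst z), - snd z)) \<in> borel_measurable (borel \<Otimes>\<^sub>M borel :: (((complex^3) \<times> (real^3)) \<times> (real^3)) measure)"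
      by (intro borel_measurable_Pair) measurable
    from measurable_compose[OF this Suc] show ?thesis
      by simp
  qed
  have "(\<lambda>z. v (snd (fst z) + snd z) * Hn n (fst (fst z)) (- snd z) / denom (fst (fst z)) (snd z))
      \<in> borel_measurable (borel \<Otimes>\<^sub>M borel :: (((complex^3) \<times> (real^3)) \<times> (real^3)) measure)"
    by measurable
  then have "(\<lambda>x. LINT \<xi>|lborel. v (snd x + \<xi>) * Hn n (fst x) (- \<xi>) / denom (fst x) \<xi>) \<in> borel_measurable (borel :: ((complex^3) \<times> (real^3)) measure)"
    by (intro lborel.borel_measurable_lebesgue_integral) (simp add: case_prod_beta)
  then show ?case
    by (simp add: A_op_lborel)
qed

lemma Hn_measurable [measurable (raw)]:
  assumes [measurable]: "k \<in> borel_measurable M" "p \<in> borel_measurable M"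
  shows "(\<lambda>x. Hn n (k x) (p x)) \<in> borel_measurable M"
  using measurable_compose[OF _ Hn_measurable2, of "\<lambda>x. (k x, p x)" M n] by simp

lemma Hn_measurable1 [measurable]: "Hn n k \<in> borel_measurable borel"
  by measurable

lemma Hn_bound:
  assumes k: "k \<in> Sigma_var"
  shows "norm (Hn n k p) \<le> (c\<^sub>1 * C) ^ n * C * wt \<mu> p"
proof (induction n arbitrary: p)
  case 0
  then show ?case by (simp add: v_bound)
next
  case (Suc n)
  have "norm (Hn (Suc n) k p) \<le> c\<^sub>1 * C * ((c\<^sub>1 * C) ^ n * C) * wt \<mu> p"
    using A_bound[OF k Hn_measurable1 _ Suc] c1_pos C_nonneg by simp
  then show ?case
    by (simp add: mult.assoc)
qed

definition Hsum :: "complex^3 \<Rightarrow> real^3 \<Rightarrow> complex"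
  where "Hsum k p = (\<Sum>n. Hn n k p)"

definition Hbound :: real
  where "Hbound = C / (1 - c\<^sub>1 * C)"

lemma Hbound_nonneg: "Hbound \<ge> 0"
  using C_nonneg small by (simp add: Hbound_def)

lemma Hsum_measurable [measurable (raw)]:
  assumes [measurable]: "k \<in> borel_measurable M" "p \<in> borel_measurable M"
  shows "(\<lambda>x. Hsum (k x) (p x)) \<in> borel_measurable M"
  unfolding Hsum_def by measurable

lemma geom_sums: "(\<lambda>n. (c\<^sub>1 * C) ^ n * C * x) sums (Hbound * x)"
proof -
  have "(\<lambda>n. (c\<^sub>1 * C) ^ n * (C * x)) sums (1 / (1 - c\<^sub>1 * C) * (C * x))"
    using c1_pos C_nonneg small by (intro sums_mult2 geometric_sums) auto
  then show ?thesis
    by (simp add: Hbound_def mult.assoc)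
qed

lemma Hn_summable_norm:
  assumes "k \<in> Sigma_var"
  shows "summable (\<lambda>n. norm (Hn n k p))"
  by (rule summable_comparison_test'[OF sums_summable[OF geom_sums[of "wt \<mu> p"]], of 0])
    (use Hn_bound[OF assms] in auto)

lemma suminf_norm_Hn_le:
  assumes "k \<in> Sigma_var"
  shows "(\<Sum>n. norm (Hn n k p)) \<le> Hbound * wt \<mu> p"
proof -
  have "(\<Sum>n. norm (Hn n k p)) \<le> (\<Sum>n. (c\<^sub>1 * C) ^ n * C * wt \<mu> p)"
    by (intro suminf_le Hn_bound Hn_summable_norm assms sums_summable[OF geom_sums])
  then show ?thesis
    using sums_unique[OF geom_sums[of "wt \<mu> p"]] by simp
qed

lemma Hsum_bound:
  assumes "k \<in> Sigma_var"
  shows "norm (Hsum k p) \<le> Hbound * wt \<mu> p"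
  unfolding Hsum_def
  using summable_norm[OF Hn_summable_norm[OF assms]] suminf_norm_Hn_le[OF assms] by (rule order_trans)

lemma Hn_sums:
  assumes "k \<in> Sigma_var"
  shows "(\<lambda>n. Hn n k p) sums Hsum k p"
  unfolding Hsum_def by (rule summable_sums[OF summable_norm_cancel[OF Hn_summable_norm[OF assms]]])

text \<open>Summation under the integral is justified by \<open>A_absolute_bound\<close>, which
  bounds the integrals of the moduli by a geometric series of ratio \<open>c\<^sub>1 * C\<close>.
  The bound holds at every p, and so does the equation.\<close>

lemma Hsum_equation:
  assumes k: "k \<in> Sigma_var"
  shows "Hsum k p = v p - A_op v k (Hsum k) p"
proof -
  define f where "f n \<xi> = v (p + \<xi>) * Hn n k (- \<xi>) / denom k \<xi>" for n \<xi>
  have [measurable]: "f n \<in> borel_measurable borel" for n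
    unfolding f_def by measurable
  have int: "integrable lborel (f n)" for n
    unfolding f_def by (rule A_integrable[OF k Hn_measurable1 _ Hn_bound[OF k]]) (use c1_pos C_nonneg in auto)
  have nn: "(\<integral>\<^sup>+\<xi>. ennreal (norm (f n \<xi>)) \<partial>lborel) \<le> ennreal ((c\<^sub>1 * C) ^ n * C * (c\<^sub>1 * C * wt \<mu> p))" for n
    using A_absolute_bound[OF k Hn_measurable1[of n k] _ Hn_bound[OF k, of n], of p] c1_pos C_nonneg
    unfolding f_def by (simp add: mult_ac)
  have sums_f: "(\<lambda>n. f n \<xi>) sums (v (p + \<xi>) * Hsum k (- \<xi>) / denom k \<xi>)" for \<xi>
    unfolding f_def by (intro sums_divide sums_mult Hn_sums[OF k])
  have "(\<lambda>n. LINT \<xi>|lborel. f n \<xi>) sums (LINT \<xi>|lborel. (\<Sum>n. f n \<xi>))"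
  proof (rule sums_integral[OF int])
    show "AE \<xi> in lborel. summable (\<lambda>n. norm (f n \<xi>))"
    proof (intro always_eventually allI)
      fix \<xi>
      have "summable (\<lambda>n. norm (v (p + \<xi>)) * norm (Hn n k (- \<xi>)) / norm (denom k \<xi>))"
        by (intro summable_divide summable_mult Hn_summable_norm[OF k])
      then show "summable (\<lambda>n. norm (f n \<xi>))"
        by (simp add: f_def norm_mult norm_divide)
    qed
    show "summable (\<lambda>n. LINT \<xi>|lborel. norm (f n \<xi>))"
    proof (rule summable_comparison_test'[OF sums_summable[OF geom_sums[of "c\<^sub>1 * C * wt \<mu> p"]], of 0])
      fix n
      have "ennreal (LINT \<xi>|lborel. norm (f n \<xi>)) = (\<integral>\<^sup>+\<xi>. ennreal (norm (f n \<xi>)) \<partial>lborel)"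
        by (rule nn_integral_eq_integral[symmetric]) (auto intro: int integrable_norm)
      also note nn
      finally show "norm (LINT \<xi>|lborel. norm (f n \<xi>)) \<le> (c\<^sub>1 * C) ^ n * C * (c\<^sub>1 * C * wt \<mu> p)"
        using c1_pos C_nonneg by (subst (asm) ennreal_le_iff) auto
    qed
  qed
  moreover have "(\<Sum>n. f n \<xi>) = v (p + \<xi>) * Hsum k (- \<xi>) / denom k \<xi>" for \<xi>
    by (rule sums_unique[OF sums_f, symmetric])
  ultimately have "(\<lambda>n. LINT \<xi>|lborel. f n \<xi>) sums A_op v k (Hsum k) p"
    by (simp add: A_op_lborel)
  then have "(\<lambda>n. Hn (Suc n) k p) sums (- A_op v k (Hsum k) p)"
    using sums_minus by (auto simp: f_def A_op_lborel)
  moreover have "(\<lambda>n. Hn (Suc n) k p) sums (Hsum k p - Hn 0 k p)"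
    using Hn_sums[OF k, of p] by (subst sums_Suc_iff[of "\<lambda>n. Hn n k p"]) simp
  ultimately have "- A_op v k (Hsum k) p = Hsum k p - Hn 0 k p"
    by (rule sums_unique2)
  then show ?thesis
    by (simp add: algebra_simps)
qed

lemma Hsum_Linf:
  assumes "k \<in> Sigma_var"
  shows "Hsum k \<in> Linf \<mu>"
  by (rule LinfI[of _ Hbound]) (auto intro!: measurable_completion Hsum_bound[OF assms])

text \<open>The difference d of the two solutions satisfies d = - A d at every point, so its
  weighted bound may be multiplied by \<open>c\<^sub>1 * C\<close> any number of times. At first h
  is only Lebesgue measurable and essentially bounded; its own equation shows that it is Borel and
  bounded at every point.\<close>

lemma Faddeev_unique:
  assumes k: "k \<in> Sigma_var" and h: "h \<in> Linf \<mu>" "\<And>p. h p = v p - A_op v k h p"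
  shows "h = Hsum k"
proof -
  obtain g B where g [measurable]: "g \<in> borel_measurable borel" and B: "B \<ge> 0" "\<And>p. norm (g p) \<le> B * wt \<mu> p"
    and hg: "AE p in lborel. h p = g p"
    using Linf_representative[OF h(1)] by metis
  have Ag: "A_op v k h p = A_op v k g p" for p
    using A_op_cong[OF hg g v_measurable, of k p] A_op_lborel[OF g v_measurable, of k p] by simp
  have h_eq: "h p = v p - A_op v k g p" for p
    using h(2)[of p] Ag by simp
  have [measurable]: "h \<in> borel_measurable borel"
  proof -
    have "(\<lambda>z. v (fst z + snd z) * g (- snd z) / denom k (snd z)) \<in> borel_measurable (borel \<Otimes>\<^sub>M borel :: ((real^3) \<times> (real^3)) measure)"
      by measurable
    then have "(\<lambda>p. LINT \<xi>|lborel. v (p + \<xi>) * g (- \<xi>) / denom k \<xi>) \<in> borel_measurable (borel :: (real^3) measure)"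
      by (intro lborel.borel_measurable_lebesgue_integral) (simp add: case_prod_beta)
    then have "(\<lambda>p. v p - A_op v k g p) \<in> borel_measurable borel"
      by (simp add: A_op_lborel)
    moreover have "h = (\<lambda>p. v p - A_op v k g p)"
      by (rule ext) (rule h_eq)
    ultimately show ?thesis
      by (simp only:)
  qed
  define D where "D = C + c\<^sub>1 * C * B + Hbound"
  define d where "d p = h p - Hsum k p" for p
  have [measurable]: "d \<in> borel_measurable borel"
    unfolding d_def by measurable
  have hb: "norm (h p) \<le> (C + c\<^sub>1 * C * B) * wt \<mu> p" for p
  proof -
    have "norm (h p) \<le> norm (v p) + norm (A_op v k g p)"
      unfolding h_eq by (rule norm_triangle_ineq4)
    then show ?thesis
      using v_bound[of p] A_bound[OF k g B, of p] by (simp add: algebra_simps)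
  qed
  have D0: "D \<ge> 0"
    using C_nonneg c1_pos B Hbound_nonneg by (simp add: D_def)
  have d_bound: "norm (d p) \<le> (c\<^sub>1 * C) ^ n * D * wt \<mu> p" for n p
  proof (induction n arbitrary: p)
    case 0
    have "norm (d p) \<le> norm (h p) + norm (Hsum k p)"
      unfolding d_def by (rule norm_triangle_ineq4)
    then show ?case
      using hb[of p] Hsum_bound[OF k, of p] by (simp add: D_def algebra_simps)
  next
    case (Suc n)
    have hB: "C + c\<^sub>1 * C * B \<ge> 0"
      using C_nonneg c1_pos B by simp
    have "d p = - A_op v k d p"
    proof -
      have "A_op v k d p = (LINT \<xi>|lborel. v (p + \<xi>) * h (- \<xi>) / denom k \<xi> - v (p + \<xi>) * Hsum k (- \<xi>) / denom k \<xi>)"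
        by (subst A_op_lborel) (simp_all add: d_def right_diff_distrib diff_divide_distrib)
      also have "\<dots> = A_op v k h p - A_op v k (Hsum k) p"
        by (subst Bochner_Integration.integral_diff)
          (auto simp: A_op_lborel intro!: A_integrable[OF k _ hB hb] A_integrable[OF k _ Hbound_nonneg Hsum_bound[OF k]])
      finally show ?thesis
        using h(2)[of p] Hsum_equation[OF k, of p] by (simp add: d_def)
    qed
    then have "norm (d p) \<le> c\<^sub>1 * C * ((c\<^sub>1 * C) ^ n * D) * wt \<mu> p"
      using A_bound[OF k _ _ Suc, of p] c1_pos C_nonneg D0 by simp
    then show ?case
      by (simp add: mult.assoc)
  qed
  have "d p = 0" for p
  proof -
    have "(\<lambda>n. (c\<^sub>1 * C) ^ n * D * wt \<mu> p) \<longlonglongrightarrow> 0 * D * wt \<mu> p"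
      using c1_pos C_nonneg small
      by (intro tendsto_mult[OF tendsto_mult[OF LIMSEQ_power_zero tendsto_const] tendsto_const]) simp
    then have "norm (d p) \<le> 0"
      using d_bound[of p] by (intro LIMSEQ_le_const[where X = "\<lambda>n. (c\<^sub>1 * C) ^ n * D * wt \<mu> p"]) auto
    then show ?thesis
      by simp
  qed
  then show ?thesis
    by (auto simp: d_def fun_eq_iff)
qed

lemma Faddeev_eq_Hsum:
  assumes k: "k \<in> Sigma_var"
  shows "Faddeev \<mu> v k = Hsum k"
  unfolding Faddeev_def
proof (rule the_equality)
  show "Hsum k \<in> Linf \<mu> \<and> (\<forall>p. Hsum k p = v p - A_op v k (Hsum k) p)"
    using Hsum_Linf[OF k] Hsum_equation[OF k] by blast
qed (use Faddeev_unique[OF k] in blast)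

end

section \<open>The d-bar equation in integrated form\<close>

text \<open>The singular point \<open>z x\<close> of the Cauchy kernel may move with the other
  variable, because the integral bound for strip-dominated functions is uniform in it. It then
  suffices that the weight a is integrable.\<close>

lemma
  fixes f :: "'a::euclidean_space \<Rightarrow> complex \<times> real \<Rightarrow> complex"
  assumes f [measurable]: "(\<lambda>(x, y). f x y) \<in> borel_measurable (borel \<Otimes>\<^sub>M borel)"
    and a [measurable]: "a \<in> borel_measurable borel" and a0: "\<And>x. a x \<ge> 0" and a_fin: "(\<integral>\<^sup>+x. ennreal (a x) \<partial>lborel) < \<infinity>"
    and g: "strip_dominated B g" and le: "\<And>x y. norm (f x y) \<le> a x * (norm (g y) / norm (fst y - z x))"
  shows Fubini_strip_dominated: "(LINT x|lborel. LINT y|lborel. f x y) = (LINT y|lborel. LINT x|lborel. f x y)"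
    and integrable_strip_dominated: "integrable lborel (\<lambda>y. LINT x|lborel. f x y)"
proof -
  note [measurable] = strip_dominatedD(1)[OF g]
  have int: "integrable (lborel \<Otimes>\<^sub>M lborel) (\<lambda>(x, y). f x y)"
  proof (rule integrableI_bounded)
    show "(\<lambda>(x, y). f x y) \<in> borel_measurable (lborel \<Otimes>\<^sub>M lborel)"
      by measurable
    have "(\<integral>\<^sup>+w. ennreal (norm (case w of (x, y) \<Rightarrow> f x y)) \<partial>(lborel \<Otimes>\<^sub>M lborel)) =
        (\<integral>\<^sup>+x. \<integral>\<^sup>+y. ennreal (norm (f x y)) \<partial>lborel \<partial>lborel)"
      by (subst lborel.nn_integral_fst[symmetric]) auto
    also have "\<dots> \<le> (\<integral>\<^sup>+x. \<integral>\<^sup>+y. ennreal (a x) * ennreal (norm (g y) / norm (fst y - z x)) \<partial>lborel \<partial>lborel)"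
      using le a0 by (intro nn_integral_mono) (simp add: ennreal_mult[symmetric] ennreal_leI del: times_divide_eq_right)
    also have "\<dots> = (\<integral>\<^sup>+x. ennreal (a x) * (\<integral>\<^sup>+y. ennreal (norm (g y) / norm (fst y - z x)) \<partial>lborel) \<partial>lborel)"
      by (intro nn_integral_cong nn_integral_cmult) measurable
    also have "\<dots> \<le> (\<integral>\<^sup>+x. ennreal (a x) * ennreal (B * cconst) \<partial>lborel)"
      by (intro nn_integral_mono mult_left_mono nn_integral_strip_dominated[OF g]) auto
    also have "\<dots> = (\<integral>\<^sup>+x. ennreal (a x) \<partial>lborel) * ennreal (B * cconst)"
      by (rule nn_integral_multc) measurable
    also have "\<dots> < \<infinity>"
      using a_fin by (simp add: ennreal_mult_less_top)
    finally show "(\<integral>\<^sup>+w. ennreal (norm (case w of (x, y) \<Rightarrow> f x y)) \<partial>(lborel \<Otimes>\<^sub>M lborel)) < \<infinity>" .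
  qed
  show "(LINT x|lborel. LINT y|lborel. f x y) = (LINT y|lborel. LINT x|lborel. f x y)"
    by (rule lborel_pair.Fubini_integral[OF int, symmetric])
  show "integrable lborel (\<lambda>y. LINT x|lborel. f x y)"
    by (rule lborel_pair.integrable_snd[OF int])
qed

lemma integral_lborel_translate:
  fixes f :: "'a::euclidean_space \<Rightarrow> complex"
  assumes [measurable]: "f \<in> borel_measurable borel"
  shows "(LINT x|lborel. f (a + x)) = (LINT x|lborel. f x)"
  by (subst (2) lborel_distr_plus[of a, symmetric]) (simp add: integral_distr)

locale faddeev_frame = faddeev \<mu> C c\<^sub>1 v + frame \<theta> p
  for \<mu> C c\<^sub>1 :: real and v :: "real^3 \<Rightarrow> complex" and \<theta> :: "real^3 \<Rightarrow> real^3" and p :: "real^3"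
begin

abbreviation kk' :: "complex \<times> real \<Rightarrow> complex^3"
  where "kk' y \<equiv> kk y + cvec (xi y)"

text \<open>On the circle of p the first factor is evaluated at \<eta> + \<xi> instead of p + \<xi>.
  The argument \<eta> is separated from p because the induction needs the identity at \<eta> = - s,
  while p continues to parametrize k.\<close>

definition prodn :: "nat \<Rightarrow> nat \<Rightarrow> real^3 \<Rightarrow> complex \<times> real \<Rightarrow> complex"
  where "prodn j m \<eta> y = Hn j (kk' y) (\<eta> + xi y) * Hn m (kk y) (- xi y)"

definition hb :: "nat \<Rightarrow> real"
  where "hb n = (c\<^sub>1 * C) ^ n * C"

lemma hb_nonneg [simp]: "hb n \<ge> 0"
  using c1_pos C_nonneg by (simp add: hb_def)

lemma kk'_Sigma: "fst y \<noteq> 0 \<Longrightarrow> kk' y \<in> Sigma_var"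
  by (intro Sigma_var_add_cvec k_of_in_Sigma denom_xi)

lemma Hn_le:
  assumes "k \<in> Sigma_var"
  shows "norm (Hn n k q) \<le> hb n" "norm (Hn n k q) \<le> hb n / (1 + norm q)\<^sup>2"
proof -
  have "hb n * wt \<mu> q \<le> hb n * 1"
    using mu by (intro mult_left_mono wt_le_1) auto
  then show "norm (Hn n k q) \<le> hb n"
    using Hn_bound[OF assms, of n q] by (simp add: hb_def)
  have "hb n * wt \<mu> q \<le> hb n * (1 / (1 + norm q)\<^sup>2)"
    using mu by (intro mult_left_mono wt_le_square) auto
  then show "norm (Hn n k q) \<le> hb n / (1 + norm q)\<^sup>2"
    using Hn_bound[OF assms, of n q] by (simp add: hb_def)
qed

lemma v_le: "norm (v q) \<le> C" "norm (v q) \<le> C / (1 + norm q)\<^sup>2"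
proof -
  have "C * wt \<mu> q \<le> C * 1"
    using mu C_nonneg by (intro mult_left_mono wt_le_1) auto
  then show "norm (v q) \<le> C"
    using v_bound[of q] by simp
  have "C * wt \<mu> q \<le> C * (1 / (1 + norm q)\<^sup>2)"
    using mu C_nonneg by (intro mult_left_mono wt_le_square) auto
  then show "norm (v q) \<le> C / (1 + norm q)\<^sup>2"
    using v_bound[of q] by simp
qed

lemma decay2_v_shift: "decay2 (C * (1 + norm \<eta>)\<^sup>2) (\<lambda>s. v (\<eta> + s))"
  unfolding decay2_def
proof (intro conjI allI)
  show "(\<lambda>s. v (\<eta> + s)) \<in> borel_measurable borel"
    by measurable
  show "0 \<le> C * (1 + norm \<eta>)\<^sup>2"
    using C_nonneg by simp
  fix s
  have "norm (v (\<eta> + s)) \<le> C * (1 / (1 + norm (\<eta> + s))\<^sup>2)"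
    using v_le(2)[of "\<eta> + s"] by simp
  also have "\<dots> \<le> C * ((1 + norm \<eta>)\<^sup>2 / (1 + norm s)\<^sup>2)"
    by (intro mult_left_mono square_shift_bound C_nonneg)
  finally show "norm (v (\<eta> + s)) \<le> C * (1 + norm \<eta>)\<^sup>2 / (1 + norm s)\<^sup>2"
    by simp
qed

lemma decay2_mult_bounded:
  assumes F: "decay2 B F" and [measurable]: "g \<in> borel_measurable borel" and g: "\<And>s. norm (g s) \<le> D"
  shows "decay2 (B * D) (\<lambda>s. F s * g s)"
proof -
  have D: "D \<ge> 0"
    using norm_ge_zero[of "g 0"] g[of 0] by linarith
  have [measurable]: "F \<in> borel_measurable borel"
    using F by (simp add: decay2_def)
  have "norm (F s * g s) \<le> B * D / (1 + norm s)\<^sup>2" for s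
  proof -
    have "norm (F s * g s) \<le> (B / (1 + norm s)\<^sup>2) * D"
      unfolding norm_mult using F D by (intro mult_mono g) (auto simp: decay2_def)
    then show ?thesis by simp
  qed
  then show ?thesis
    using F D by (simp add: decay2_def)
qed

lemma prodn_measurable [measurable (raw)]:
  assumes [measurable]: "e \<in> borel_measurable M" "y \<in> borel_measurable M"
  shows "(\<lambda>x. prodn j m (e x) (y x)) \<in> borel_measurable M"
proof -
  have [measurable]: "(\<lambda>x. xi (y x)) \<in> borel_measurable M" "(\<lambda>x. kk (y x)) \<in> borel_measurable M"
    using measurable_compose[OF assms(2) xi_measurable] measurable_compose[OF assms(2) kk_measurable] by auto
  show ?thesis
    unfolding prodn_def by measurable
qed

lemma prodn_bound:
  assumes "fst y \<noteq> 0"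
  shows "norm (prodn j m \<eta> y) \<le> hb j * hb m / (1 + norm (xi y))\<^sup>2"
proof -
  have "norm (prodn j m \<eta> y) \<le> hb j * (hb m / (1 + norm (- xi y))\<^sup>2)"
    unfolding prodn_def norm_mult
    by (intro mult_mono Hn_le kk'_Sigma assms k_of_in_Sigma) auto
  then show ?thesis
    by simp
qed

lemma strip_dominated_prodn: "strip_dominated (hb j * hb m * pconst) (\<lambda>y. jker y * prodn j m \<eta> y)"
  by (rule strip_dominated_jker_mult) (auto intro: prodn_bound)

lemma strip_dominated_Hn: "strip_dominated (hb m * pconst) (\<lambda>y. jker y * Hn m (kk y) (- xi y))"
  by (rule strip_dominated_jker_mult) (use Hn_le(2)[OF k_of_in_Sigma, of _ m "- xi _"] in auto)

text \<open>As \<xi> is a zero of the symbol of k, the symbol of k + \<xi> is that of k translated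
  by \<xi>. Translating the integral leads back to the symbol with parameter \<open>fst y\<close>,
  for which \<open>integral_over_denom\<close> is available. Its minus sign agrees with the one in
  the recursion of \<open>Hn\<close>.\<close>

lemma shifted_kernel_at_root:
  assumes z: "fst y \<noteq> 0"
  shows "cauchy_transform (\<lambda>y'. jker y' * (v (\<eta> + xi y') * Hn j (kk' y) (xi y - xi y'))) (fst y) = Hn (Suc j) (kk' y) (\<eta> + xi y)"
proof -
  let ?F = "\<lambda>s. v (\<eta> + s) * Hn j (kk' y) (xi y - s)"
  have dec: "decay2 (C * (1 + norm \<eta>)\<^sup>2 * hb j) ?F"
    by (intro decay2_mult_bounded decay2_v_shift Hn_le kk'_Sigma z) measurable
  have "A_op v (kk' y) (Hn j (kk' y)) (\<eta> + xi y) = (LINT s|lborel. v ((\<eta> + xi y) + s) * Hn j (kk' y) (- s) / denom (kk' y) s)"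
    by (rule A_op_lborel) measurable
  also have "\<dots> = (LINT s|lborel. ?F (xi y + s) / denom (kk y) (xi y + s))"
    by (simp add: denom_add_cvec[OF denom_xi[OF z]] add_ac)
  also have "\<dots> = (LINT s|lborel. ?F s / denom (kk y) s)"
    by (rule integral_lborel_translate[of "\<lambda>s. ?F s / denom (kk y) s"]) measurable
  also have "\<dots> = - cauchy_transform (\<lambda>y'. jker y' * ?F (xi y')) (fst y)"
    by (rule integral_over_denom[OF dec z])
  finally show ?thesis
    by simp
qed

text \<open>The integral over \<open>s\<close> of the product of the two kernels is a divided difference of Cauchy
  transforms, between \<open>l\<close> and the root \<open>fst y\<close>. At the root, translating by \<open>xi y\<close> gives the next term
  of the Neumann series for \<open>k + \<xi>\<close>.\<close>

lemma dbar_step: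
  assumes l: "l \<noteq> 0"
  shows "(LINT s|lborel. v (\<eta> + s) * cauchy_transform (\<lambda>y. jker y * prodn j m (- s) y) l / denom (k_of \<theta> l p) s) =
    - cauchy_transform (\<lambda>y. jker y * prodn (Suc j) m \<eta> y) l
    - (LINT y'|lborel. jker y' * (v (\<eta> + xi y') * cauchy_transform (\<lambda>y. jker y * prodn j m (- xi y') y) (fst y')) / (fst y' - l))"
proof -
  let ?q = "\<lambda>s. denom (k_of \<theta> l p) s"
  define g where "g y = jker y * Hn m (kk y) (- xi y)" for y
  have g [measurable]: "g \<in> borel_measurable borel"
    unfolding g_def by measurable
  define F where "F y s = v (\<eta> + s) * Hn j (kk' y) (xi y - s)" for y s
  define Cv where "Cv = C * (1 + norm \<eta>)\<^sup>2"
  have dec: "decay2 (Cv * hb j) (F y)" if "fst y \<noteq> 0" for y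
    unfolding F_def Cv_def using that by (intro decay2_mult_bounded decay2_v_shift Hn_le kk'_Sigma) measurable
  have g0: "g y = 0" if "fst y = 0" for y
    using that by (simp add: g_def jker_def)
  have gF: "norm (g y * F y s) \<le> norm (g y) * (norm (v (\<eta> + s)) * hb j)" for y s
  proof (cases "fst y = 0")
    case False
    then show ?thesis
      unfolding F_def norm_mult by (intro mult_left_mono Hn_le kk'_Sigma) auto
  qed (simp add: g0)
  have gK: "strip_dominated (hb m * pconst) g"
    using strip_dominated_Hn[of m] unfolding g_def[abs_def] .
  have F_meas [measurable (raw)]: "(\<lambda>x. F (a x) (b x)) \<in> borel_measurable M"
    if [measurable]: "a \<in> borel_measurable M" "b \<in> borel_measurable M" for a :: "'z \<Rightarrow> complex \<times> real" and b M
  proof -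
    have [measurable]: "(\<lambda>x. xi (a x)) \<in> borel_measurable M" "(\<lambda>x. kk (a x)) \<in> borel_measurable M"
      using measurable_compose[OF that(1) xi_measurable] measurable_compose[OF that(1) kk_measurable] by auto
    show ?thesis
      unfolding F_def by measurable
  qed
  have v_over: "(\<integral>\<^sup>+s. ennreal (norm (v (\<eta> + s)) / norm (?q s)) \<partial>lborel) \<le> ennreal (Cv * pconst * cconst)"
    unfolding Cv_def by (rule nn_integral_over_denom[OF decay2_v_shift l])
  \<comment> \<open>The doubly singular kernel produced by the divided difference. It is absolutely
    integrable in both variables, since the singularity at \<open>fst y = fst y'\<close> obeys a
    bound uniform in y'.\<close>
  define f where "f y' y = g y * (jker y' * F y (xi y') / ((fst y' - l) * (fst y' - fst y)))" for y' y
  have f_le: "norm (f y' y) \<le> hb j * (norm (jker y' * v (\<eta> + xi y')) / norm (fst y' - l)) * (norm (g y) / norm (fst y - fst y'))" for y' y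
  proof -
    have "norm (f y' y) = norm (jker y') * norm (g y * F y (xi y')) / (norm (fst y' - l) * norm (fst y - fst y'))"
      by (simp add: f_def norm_mult norm_divide norm_minus_commute[of "fst y'" "fst y"] mult_ac)
    also have "\<dots> \<le> norm (jker y') * (norm (g y) * (norm (v (\<eta> + xi y')) * hb j)) / (norm (fst y' - l) * norm (fst y - fst y'))"
      by (intro divide_right_mono mult_left_mono gF) auto
    finally show ?thesis
      by (simp add: norm_mult mult_ac)
  qed
  have f_meas: "(\<lambda>(y', y). f y' y) \<in> borel_measurable (borel \<Otimes>\<^sub>M (borel :: (complex \<times> real) measure))"
    unfolding f_def by measurable
  have a_fin: "(\<integral>\<^sup>+y'. ennreal (hb j * (norm (jker y' * v (\<eta> + xi y')) / norm (fst y' - l))) \<partial>lborel) < \<infinity>"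
  proof -
    have K: "strip_dominated (Cv * pconst) (\<lambda>y'. jker y' * v (\<eta> + xi y'))"
      unfolding Cv_def by (rule strip_dominated_jker[OF decay2_v_shift])
    have "(\<integral>\<^sup>+y'. ennreal (hb j * (norm (jker y' * v (\<eta> + xi y')) / norm (fst y' - l))) \<partial>lborel) =
      ennreal (hb j) * (\<integral>\<^sup>+y'. ennreal (norm (jker y' * v (\<eta> + xi y')) / norm (fst y' - l)) \<partial>lborel)"
      by (subst nn_integral_cmult[symmetric]) (auto simp: ennreal_mult[symmetric])
    also have "\<dots> < \<infinity>"
      using nn_integral_strip_dominated[OF K, of l] by (simp add: ennreal_mult_less_top le_less_trans)
    finally show ?thesis .
  qed
  have swap: "(LINT y'|lborel. LINT y|lborel. f y' y) = (LINT y|lborel. LINT y'|lborel. f y' y)"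
    and int: "integrable lborel (\<lambda>y. LINT y'|lborel. f y' y)"
    by (rule Fubini_strip_dominated[OF f_meas _ _ a_fin gK f_le] integrable_strip_dominated[OF f_meas _ _ a_fin gK f_le]; simp)+
  have "(LINT s|lborel. v (\<eta> + s) * cauchy_transform (\<lambda>y. jker y * prodn j m (- s) y) l / ?q s) =
    (LINT s|lborel. LINT y|lborel. g y / (fst y - l) * (F y s / ?q s))"
  proof (rule Bochner_Integration.integral_cong[OF refl])
    fix s
    have "v (\<eta> + s) * cauchy_transform (\<lambda>y. jker y * prodn j m (- s) y) l / ?q s =
      (v (\<eta> + s) / ?q s) * (LINT y|lborel. jker y * prodn j m (- s) y / (fst y - l))"
      by (simp add: cauchy_transform_def)
    also have "\<dots> = (LINT y|lborel. (v (\<eta> + s) / ?q s) * (jker y * prodn j m (- s) y / (fst y - l)))"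
      by (rule integral_mult_right_zero[symmetric])
    also have "\<dots> = (LINT y|lborel. g y / (fst y - l) * (F y s / ?q s))"
      by (intro Bochner_Integration.integral_cong refl) (simp add: g_def F_def prodn_def mult_ac add.commute)
    finally show "v (\<eta> + s) * cauchy_transform (\<lambda>y. jker y * prodn j m (- s) y) l / ?q s = (LINT y|lborel. g y / (fst y - l) * (F y s / ?q s))" .
  qed
  also have "\<dots> = (LINT y|lborel. LINT s|lborel. g y / (fst y - l) * (F y s / ?q s))"
  proof (rule Fubini_strip_dominated[OF _ _ _ _ gK])
    show "(\<lambda>(s, y). g y / (fst y - l) * (F y s / ?q s)) \<in> borel_measurable (borel \<Otimes>\<^sub>M borel)"
      by measurable
    have "(\<integral>\<^sup>+s. ennreal (norm (v (\<eta> + s)) / norm (?q s) * hb j) \<partial>lborel) =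
      (\<integral>\<^sup>+s. ennreal (norm (v (\<eta> + s)) / norm (?q s)) \<partial>lborel) * ennreal (hb j)"
      by (subst nn_integral_multc[symmetric]) (auto simp: ennreal_mult[symmetric])
    also have "\<dots> < \<infinity>"
      using v_over by (simp add: ennreal_mult_less_top le_less_trans)
    finally show "(\<integral>\<^sup>+s. ennreal (norm (v (\<eta> + s)) / norm (?q s) * hb j) \<partial>lborel) < \<infinity>" .
    fix s y
    have "norm (g y / (fst y - l) * (F y s / ?q s)) = norm (g y * F y s) / (norm (fst y - l) * norm (?q s))"
      by (simp add: norm_mult norm_divide)
    also have "\<dots> \<le> norm (g y) * (norm (v (\<eta> + s)) * hb j) / (norm (fst y - l) * norm (?q s))"
      by (intro divide_right_mono gF) auto
    finally show "norm (g y / (fst y - l) * (F y s / ?q s)) \<le> norm (v (\<eta> + s)) / norm (?q s) * hb j * (norm (g y) / norm (fst y - l))"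
      by (simp add: mult_ac)
  qed simp_all
  also have "\<dots> = (LINT y|lborel. - (jker y * prodn (Suc j) m \<eta> y / (fst y - l)) +
      (LINT y'|lborel. f y' y))"
  proof (rule integral_cong_AE)
    show "AE y in lborel. (LINT s|lborel. g y / (fst y - l) * (F y s / ?q s)) =
      - (jker y * prodn (Suc j) m \<eta> y / (fst y - l)) +
      (LINT y'|lborel. f y' y)"
      using AE_fst_neq[of 0] AE_fst_neq[of l]
    proof eventually_elim
      case (elim y)
      define K where "K y' = jker y' * F y (xi y')" for y'
      have sd: "strip_dominated (Cv * hb j * pconst) K"
        unfolding K_def[abs_def] by (rule strip_dominated_jker[OF dec[OF elim(1)]])
      have at: "cauchy_transform K (fst y) = Hn (Suc j) (kk' y) (\<eta> + xi y)"
        unfolding K_def F_def by (rule shifted_kernel_at_root[OF elim(1)])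
      \<comment> \<open>The factor l - \<open>fst y\<close> produced by the partial fractions
        cancels, up to sign, against the Cauchy kernel 1 / (\<open>fst y\<close> - l) that stands in
        front.\<close>
      have "cauchy_transform K l - cauchy_transform K (fst y) = (LINT y'|lborel. K y' / (fst y' - l) - K y' / (fst y' - fst y))"
        unfolding cauchy_transform_def by (simp add: integrable_cauchy_transform[OF sd])
      also have "\<dots> = (LINT y'|lborel. (l - fst y) * (K y' / ((fst y' - l) * (fst y' - fst y))))"
      proof (rule integral_cong_AE)
        show "AE y' in lborel. K y' / (fst y' - l) - K y' / (fst y' - fst y) = (l - fst y) * (K y' / ((fst y' - l) * (fst y' - fst y)))"
          using AE_fst_neq[of l] AE_fst_neq[of "fst y"]
        proof eventually_elim
          case (elim y')
          then have n: "fst y' - l \<noteq> 0" "fst y' - fst y \<noteq> 0"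
            by auto
          have "K y' / (fst y' - l) - K y' / (fst y' - fst y) = K y' * ((fst y' - fst y) - (fst y' - l)) / ((fst y' - l) * (fst y' - fst y))"
            by (subst diff_frac_eq[OF n]) (simp add: right_diff_distrib)
          then show ?case
            by simp
        qed
      qed (use strip_dominatedD(1)[OF sd] in measurable)
      also have "\<dots> = (l - fst y) * (LINT y'|lborel. K y' / ((fst y' - l) * (fst y' - fst y)))"
        by (rule integral_mult_right_zero)
      finally have diff: "cauchy_transform K l = Hn (Suc j) (kk' y) (\<eta> + xi y) + (l - fst y) * (LINT y'|lborel. K y' / ((fst y' - l) * (fst y' - fst y)))"
        by (simp add: at algebra_simps)
      have n: "fst y - l \<noteq> 0"
        using elim by simp
      have "(LINT s|lborel. g y / (fst y - l) * (F y s / ?q s)) = g y / (fst y - l) * (LINT s|lborel. F y s / ?q s)"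
        by (rule integral_mult_right_zero)
      also have "\<dots> = g y / (fst y - l) * (- cauchy_transform K l)"
        unfolding K_def by (subst integral_over_denom[OF dec[OF elim(1)] l]) simp
      also have "\<dots> = - (g y * Hn (Suc j) (kk' y) (\<eta> + xi y) / (fst y - l)) + g y * (LINT y'|lborel. K y' / ((fst y' - l) * (fst y' - fst y)))"
      proof -
        have "g / d * - (h + - d * i) = - (g * h / d) + g * i" if "d \<noteq> 0" for g d h i :: complex
          using that by (simp add: field_simps)
        from this[OF n] show ?thesis
          unfolding diff by (simp only: minus_diff_eq)
      qed
      also have "g y * Hn (Suc j) (kk' y) (\<eta> + xi y) = jker y * prodn (Suc j) m \<eta> y"
        by (simp add: g_def prodn_def mult_ac)
      also have "g y * (LINT y'|lborel. K y' / ((fst y' - l) * (fst y' - fst y))) = (LINT y'|lborel. g y * (K y' / ((fst y' - l) * (fst y' - fst y))))"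
        by (rule integral_mult_right_zero[symmetric])
      finally show ?case
        by (simp only: K_def f_def)
    qed
    have m1: "(\<lambda>(y, s). g y / (fst y - l) * (F y s / ?q s)) \<in> borel_measurable (borel \<Otimes>\<^sub>M (lborel :: (real^3) measure))"
    proof -
      have "(\<lambda>z. g (snd z) / (fst (snd z) - l) * (F (snd z) (fst z) / ?q (fst z))) \<in> borel_measurable (borel \<Otimes>\<^sub>M borel)"
        by measurable
      from measurable_compose[OF measurable_pair_swap' this] show ?thesis
        by (simp add: case_prod_beta cong: measurable_cong_sets)
    qed
    show "(\<lambda>y. LINT s|lborel. g y / (fst y - l) * (F y s / ?q s)) \<in> borel_measurable lborel"
      using m1 by (intro lborel.borel_measurable_lebesgue_integral) simp
    have "(\<lambda>y. LINT y'|lborel. f y' y) \<in> borel_measurable lborel"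
      using int by (rule borel_measurable_integrable)
    then show "(\<lambda>y. - (jker y * prodn (Suc j) m \<eta> y / (fst y - l)) +
      (LINT y'|lborel. f y' y)) \<in> borel_measurable lborel"
      by measurable
  qed
  also have "\<dots> = (LINT y|lborel. - (jker y * prodn (Suc j) m \<eta> y / (fst y - l))) +
      (LINT y|lborel. LINT y'|lborel. f y' y)"
    by (intro Bochner_Integration.integral_add int integrable_minus integrable_cauchy_transform[OF strip_dominated_prodn])
  also have "(LINT y|lborel. LINT y'|lborel. f y' y) =
    (LINT y'|lborel. LINT y|lborel. f y' y)"
    by (rule swap[symmetric])
  \<comment> \<open>In the other order the inner integral is again a Cauchy transform in y, now at
    the point \<open>fst y'\<close>. In this form the induction hypothesis of
    \<open>dbar_terms\<close> can be applied to it.\<close>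
  also have "\<dots> = (LINT y'|lborel. - (jker y' * (v (\<eta> + xi y') * cauchy_transform (\<lambda>y. jker y * prodn j m (- xi y') y) (fst y')) / (fst y' - l)))"
  proof (rule Bochner_Integration.integral_cong[OF refl])
    fix y' :: "complex \<times> real"
    have "(LINT y|lborel. f y' y) =
      (LINT y|lborel. (- (jker y' * v (\<eta> + xi y') / (fst y' - l))) * (jker y * prodn j m (- xi y') y / (fst y - fst y')))"
    proof (rule Bochner_Integration.integral_cong[OF refl])
      fix y :: "complex \<times> real"
      have "- (a / (z' - l)) * (b / (z - z')) = a * b / ((z' - l) * (z' - z))" for a b z z' :: complex
      proof -
        have E: "z - z' = - (z' - z)" by simp
        show ?thesis
          by (simp only: E divide_minus_right minus_mult_minus times_divide_times_eq)
      qed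
      note this[of "jker y' * v (\<eta> + xi y')" "fst y'" "jker y * prodn j m (- xi y') y" "fst y"]
      then show "f y' y =
        (- (jker y' * v (\<eta> + xi y') / (fst y' - l))) * (jker y * prodn j m (- xi y') y / (fst y - fst y'))"
        by (simp add: f_def g_def F_def prodn_def mult_ac)
    qed
    also have "\<dots> = (- (jker y' * v (\<eta> + xi y') / (fst y' - l))) * cauchy_transform (\<lambda>y. jker y * prodn j m (- xi y') y) (fst y')"
      unfolding cauchy_transform_def by (rule integral_mult_right_zero)
    finally show "(LINT y|lborel. f y' y) =
      - (jker y' * (v (\<eta> + xi y') * cauchy_transform (\<lambda>y. jker y * prodn j m (- xi y') y) (fst y')) / (fst y' - l))"
      by (simp add: mult_ac)
  qed
  finally show ?thesis
    by (simp add: cauchy_transform_def)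
qed

text \<open>The indices of the two factors add up to one less than the index on the left. In the
  step from n to n + 1 the first parts of \<open>dbar_step\<close> supply the products with first
  index at least 1. The double integrals that remain are summed over j and contracted by the
  induction hypothesis, at \<lambda> = \<open>fst y'\<close> and \<eta> = - \<xi>, into the product
  with first index 0. Hence l and \<eta> are arbitrary in the induction.\<close>

lemma dbar_terms:
  assumes "l \<noteq> 0"
  shows "Hn (Suc n) (k_of \<theta> l p) \<eta> = (\<Sum>j\<le>n. cauchy_transform (\<lambda>y. jker y * prodn j (n - j) \<eta> y) l)"
  using assms
proof (induction n arbitrary: l \<eta>)
  case 0
  have dec: "decay2 (C * C) (\<lambda>s. v (- s) * v (\<eta> + s))"
  proof (rule decay2_mult_bounded)
    show "decay2 C (\<lambda>s. v (- s))"
      using v_le(2)[of "- _"] C_nonneg by (auto simp: decay2_def)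
  qed (auto intro: v_le)
  have "Hn (Suc 0) (k_of \<theta> l p) \<eta> = - (LINT s|lborel. v (- s) * v (\<eta> + s) / denom (k_of \<theta> l p) s)"
    by (simp add: A_op_lborel mult.commute)
  also have "\<dots> = cauchy_transform (\<lambda>y. jker y * (v (- xi y) * v (\<eta> + xi y))) l"
    by (subst integral_over_denom[OF dec 0]) simp
  also have "(\<lambda>y. jker y * (v (- xi y) * v (\<eta> + xi y))) = (\<lambda>y. jker y * prodn 0 0 \<eta> y)"
    by (simp add: prodn_def mult.commute)
  finally show ?case
    by simp
next
  case (Suc n)
  let ?k = "k_of \<theta> l p"
  let ?J = "\<lambda>j y'. jker y' * (v (\<eta> + xi y') * cauchy_transform (\<lambda>y. jker y * prodn j (n - j) (- xi y') y) (fst y')) / (fst y' - l)"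
  have k: "?k \<in> Sigma_var"
    using Suc.prems by (rule k_of_in_Sigma)
  have ct_bound: "norm (cauchy_transform (\<lambda>y. jker y * prodn j (n - j) e y) z) \<le> hb j * hb (n - j) * pconst * cconst" for j e z
    by (rule norm_cauchy_transform_le[OF strip_dominated_prodn])
  have ct_meas: "(\<lambda>x. cauchy_transform (\<lambda>y. jker y * prodn j m (e x) y) (z x)) \<in> borel_measurable borel"
    if [measurable]: "e \<in> borel_measurable borel" "z \<in> borel_measurable borel"
    for j m and e :: "'z::euclidean_space \<Rightarrow> real^3" and z
  proof -
    have "(\<lambda>(x, y). jker y * prodn j m (e x) y / (fst y - z x)) \<in> borel_measurable (borel \<Otimes>\<^sub>M borel)"
      by measurable
    then show ?thesis
      unfolding cauchy_transform_def by (intro lborel.borel_measurable_lebesgue_integral) simp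
  qed
  have int1: "integrable lborel (\<lambda>s. v (\<eta> + s) * cauchy_transform (\<lambda>y. jker y * prodn j (n - j) (- s) y) l / denom ?k s)" for j
    by (rule integrable_over_denom[OF decay2_mult_bounded[OF decay2_v_shift _ ct_bound] Suc.prems])
      (rule ct_meas; measurable)
  have int2: "integrable lborel (?J j)" for j
  proof (rule integrable_cauchy_transform)
    show "strip_dominated (C * (1 + norm \<eta>)\<^sup>2 * (hb j * hb (n - j) * pconst * cconst) * pconst)
      (\<lambda>y'. jker y' * (v (\<eta> + xi y') * cauchy_transform (\<lambda>y. jker y * prodn j (n - j) (- xi y') y) (fst y')))"
    proof (rule strip_dominated_jker_mult)
      show "(\<lambda>y'. v (\<eta> + xi y') * cauchy_transform (\<lambda>y. jker y * prodn j (n - j) (- xi y') y) (fst y')) \<in> borel_measurable borel"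
        by (intro borel_measurable_times ct_meas) measurable
      show "0 \<le> C * (1 + norm \<eta>)\<^sup>2 * (hb j * hb (n - j) * pconst * cconst)"
        using C_nonneg pconst_pos by simp
      fix y'
      have "norm (v (\<eta> + xi y')) \<le> C * (1 + norm \<eta>)\<^sup>2 / (1 + norm (xi y'))\<^sup>2"
        using decay2_v_shift[of \<eta>] by (simp add: decay2_def)
      then have "norm (v (\<eta> + xi y') * cauchy_transform (\<lambda>y. jker y * prodn j (n - j) (- xi y') y) (fst y'))
         \<le> C * (1 + norm \<eta>)\<^sup>2 / (1 + norm (xi y'))\<^sup>2 * (hb j * hb (n - j) * pconst * cconst)"
        unfolding norm_mult using C_nonneg by (intro mult_mono ct_bound) auto
      then show "norm (v (\<eta> + xi y') * cauchy_transform (\<lambda>y. jker y * prodn j (n - j) (- xi y') y) (fst y'))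
         \<le> C * (1 + norm \<eta>)\<^sup>2 * (hb j * hb (n - j) * pconst * cconst) / (1 + norm (xi y'))\<^sup>2"
        by simp
    qed
  qed
  have "Hn (Suc (Suc n)) ?k \<eta> = - (LINT s|lborel. v (\<eta> + s) * Hn (Suc n) ?k (- s) / denom ?k s)"
    unfolding Hn.simps(2)[of "Suc n"] by (subst A_op_lborel) (rule Hn_measurable1 v_measurable refl)+
  also have "\<dots> = - (LINT s|lborel. (\<Sum>j\<le>n. v (\<eta> + s) * cauchy_transform (\<lambda>y. jker y * prodn j (n - j) (- s) y) l / denom ?k s))"
    unfolding Suc.IH[OF Suc.prems] by (simp add: sum_distrib_left sum_divide_distrib)
  also have "\<dots> = - (\<Sum>j\<le>n. LINT s|lborel. v (\<eta> + s) * cauchy_transform (\<lambda>y. jker y * prodn j (n - j) (- s) y) l / denom ?k s)"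
    by (subst Bochner_Integration.integral_sum) (auto intro: int1)
  also have "\<dots> = - (\<Sum>j\<le>n. - cauchy_transform (\<lambda>y. jker y * prodn (Suc j) (n - j) \<eta> y) l - (LINT y'|lborel. ?J j y'))"
    by (simp only: dbar_step[OF Suc.prems])
  also have "\<dots> = (\<Sum>j\<le>n. cauchy_transform (\<lambda>y. jker y * prodn (Suc j) (n - j) \<eta> y) l) + (\<Sum>j\<le>n. LINT y'|lborel. ?J j y')"
    by (simp add: sum_subtractf sum_negf)
  also have "(\<Sum>j\<le>n. LINT y'|lborel. ?J j y') = (LINT y'|lborel. (\<Sum>j\<le>n. ?J j y'))"
    by (rule Bochner_Integration.integral_sum[symmetric]) (rule int2)
  also have "\<dots> = cauchy_transform (\<lambda>y. jker y * prodn 0 (Suc n) \<eta> y) l"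
    unfolding cauchy_transform_def[of _ l]
  proof (rule integral_cong_AE)
    show "AE y' in lborel. (\<Sum>j\<le>n. ?J j y') = jker y' * prodn 0 (Suc n) \<eta> y' / (fst y' - l)"
      using AE_fst_neq[of 0]
    proof eventually_elim
      case (elim y')
      have "(\<Sum>j\<le>n. ?J j y') = jker y' * (v (\<eta> + xi y') * (\<Sum>j\<le>n. cauchy_transform (\<lambda>y. jker y * prodn j (n - j) (- xi y') y) (fst y'))) / (fst y' - l)"
        by (simp add: sum_distrib_left sum_divide_distrib)
      then show ?case
        unfolding Suc.IH[OF elim, symmetric] by (simp add: prodn_def del: Hn.simps(2))
    qed
    show "(\<lambda>y'. \<Sum>j\<le>n. ?J j y') \<in> borel_measurable lborel"
      by (intro borel_measurable_sum borel_measurable_integrable[OF int2])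
  qed measurable
  finally have "Hn (Suc (Suc n)) ?k \<eta> = (\<Sum>j\<le>n. cauchy_transform (\<lambda>y. jker y * prodn (Suc j) (n - j) \<eta> y) l) +
     cauchy_transform (\<lambda>y. jker y * prodn 0 (Suc n) \<eta> y) l" .
  then show ?case
    by (simp add: sum.atMost_Suc_shift add.commute del: Hn.simps(2) sum.atMost_Suc)
qed

definition prodh :: "real^3 \<Rightarrow> complex \<times> real \<Rightarrow> complex"
  where "prodh \<eta> y = Hsum (kk' y) (\<eta> + xi y) * Hsum (kk y) (- xi y)"

lemma summable_hb: "summable hb"
  using sums_summable[OF geom_sums[of 1]] by (simp add: hb_def[abs_def])

text \<open>Summing over n turns the convolutions into the Cauchy product of two Neumann series. The
  interchange with the integral is dominated by the Cauchy product of the geometric series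
  \<open>hb\<close> with itself, which converges since \<open>c\<^sub>1 * C < 1\<close>.\<close>

lemma dbar_equation:
  assumes l: "l \<noteq> 0"
  shows "Hsum (k_of \<theta> l p) \<eta> = v \<eta> + cauchy_transform (\<lambda>y. jker y * prodh \<eta> y) l"
proof -
  let ?k = "k_of \<theta> l p"
  have k: "?k \<in> Sigma_var"
    using l by (rule k_of_in_Sigma)
  define f where "f n y = (\<Sum>j\<le>n. jker y * prodn j (n - j) \<eta> y / (fst y - l))" for n y
  define b where "b n = (\<Sum>j\<le>n. hb j * hb (n - j))" for n
  have b: "summable b"
    unfolding b_def using summable_Cauchy_product[of hb hb] summable_hb by (simp add: summable_norm_cancel)
  have int_term: "integrable lborel (\<lambda>y. jker y * prodn j m \<eta> y / (fst y - l))" for j m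
    by (rule integrable_cauchy_transform[OF strip_dominated_prodn])
  have int: "integrable lborel (f n)" for n
    unfolding f_def by (intro Bochner_Integration.integrable_sum int_term)
  have f_int: "(LINT y|lborel. f n y) = Hn (Suc n) ?k \<eta>" for n
    unfolding f_def dbar_terms[OF l] cauchy_transform_def
    by (rule Bochner_Integration.integral_sum) (rule int_term)
  have dom: "strip_dominated (b n * pconst) (\<lambda>y. jker y * (\<Sum>j\<le>n. prodn j (n - j) \<eta> y))" for n
  proof (rule strip_dominated_jker_mult)
    fix y :: "complex \<times> real" assume y: "fst y \<noteq> 0"
    have "norm (\<Sum>j\<le>n. prodn j (n - j) \<eta> y) \<le> (\<Sum>j\<le>n. hb j * hb (n - j) / (1 + norm (xi y))\<^sup>2)"
      by (intro sum_norm_le prodn_bound y)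
    then show "norm (\<Sum>j\<le>n. prodn j (n - j) \<eta> y) \<le> b n / (1 + norm (xi y))\<^sup>2"
      by (simp add: b_def sum_divide_distrib)
  qed (auto simp: b_def sum_nonneg)
  have f_eq: "f n y = jker y * (\<Sum>j\<le>n. prodn j (n - j) \<eta> y) / (fst y - l)" for n y
    by (simp add: f_def sum_distrib_left sum_divide_distrib)
  have nn: "(\<integral>\<^sup>+y. ennreal (norm (f n y)) \<partial>lborel) \<le> ennreal (b n * pconst * cconst)" for n
    using nn_integral_strip_dominated[OF dom[of n], of l] by (simp add: f_eq norm_divide)
  have cauchy: "(\<lambda>n. \<Sum>j\<le>n. prodn j (n - j) \<eta> y) sums prodh \<eta> y"
    and cauchy_abs: "summable (\<lambda>n. norm (\<Sum>j\<le>n. prodn j (n - j) \<eta> y))" if y: "fst y \<noteq> 0" for y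
  proof -
    note s1 = Hn_summable_norm[OF kk'_Sigma[OF y], of "\<eta> + xi y"]
    note s2 = Hn_summable_norm[OF k_of_in_Sigma[OF y], of "- xi y"]
    show "(\<lambda>n. \<Sum>j\<le>n. prodn j (n - j) \<eta> y) sums prodh \<eta> y"
      unfolding prodn_def prodh_def Hsum_def by (rule Cauchy_product_sums[OF s1 s2])
    have "summable (\<lambda>n. \<Sum>j\<le>n. norm (Hn j (kk' y) (\<eta> + xi y)) * norm (Hn (n - j) (kk y) (- xi y)))"
      by (rule summable_Cauchy_product) (use s1 s2 in simp_all)
    then show "summable (\<lambda>n. norm (\<Sum>j\<le>n. prodn j (n - j) \<eta> y))"
      by (rule summable_comparison_test'[where N = 0])
        (auto simp: prodn_def norm_mult intro!: sum_norm_le)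
  qed
  have "(\<lambda>n. LINT y|lborel. f n y) sums (LINT y|lborel. (\<Sum>n. f n y))"
  proof (rule sums_integral[OF int])
    show "AE y in lborel. summable (\<lambda>n. norm (f n y))"
      using AE_fst_neq[of 0]
    proof eventually_elim
      case (elim y)
      have "summable (\<lambda>n. norm (jker y) * norm (\<Sum>j\<le>n. prodn j (n - j) \<eta> y) / norm (fst y - l))"
        by (intro summable_divide summable_mult cauchy_abs elim)
      then show ?case
        by (simp add: f_eq norm_mult norm_divide)
    qed
    show "summable (\<lambda>n. LINT y|lborel. norm (f n y))"
    proof (rule summable_comparison_test'[where N = 0])
      show "summable (\<lambda>n. b n * pconst * cconst)"
        by (intro summable_mult2 b)
      fix n
      have "ennreal (LINT y|lborel. norm (f n y)) = (\<integral>\<^sup>+y. ennreal (norm (f n y)) \<partial>lborel)"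
        by (rule nn_integral_eq_integral[symmetric]) (auto intro: int integrable_norm)
      also note nn
      finally show "norm (LINT y|lborel. norm (f n y)) \<le> b n * pconst * cconst"
        using pconst_pos by (subst (asm) ennreal_le_iff) (auto simp: b_def sum_nonneg)
    qed
  qed
  also have "(LINT y|lborel. (\<Sum>n. f n y)) = cauchy_transform (\<lambda>y. jker y * prodh \<eta> y) l"
    unfolding cauchy_transform_def
  proof (rule integral_cong_AE)
    show "AE y in lborel. (\<Sum>n. f n y) = jker y * prodh \<eta> y / (fst y - l)"
      using AE_fst_neq[of 0]
    proof eventually_elim
      case (elim y)
      have "(\<lambda>n. f n y) sums (jker y * prodh \<eta> y / (fst y - l))"
        unfolding f_eq by (intro sums_divide sums_mult cauchy elim)
      then show ?case
        by (rule sums_unique[symmetric])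
    qed
    show "(\<lambda>y. \<Sum>n. f n y) \<in> borel_measurable lborel"
      using int by (intro borel_measurable_suminf) auto
    show "(\<lambda>y. jker y * prodh \<eta> y / (fst y - l)) \<in> borel_measurable lborel"
      unfolding prodh_def by measurable
  qed
  finally have "(\<lambda>n. Hn (Suc n) ?k \<eta>) sums cauchy_transform (\<lambda>y. jker y * prodh \<eta> y) l"
    by (simp only: f_int)
  then have "(\<lambda>n. Hn n ?k \<eta>) sums (cauchy_transform (\<lambda>y. jker y * prodh \<eta> y) l + Hn 0 ?k \<eta>)"
    by (subst (asm) sums_Suc_iff[of "\<lambda>n. Hn n ?k \<eta>"])
  with Hn_sums[OF k, of \<eta>] have "Hsum ?k \<eta> = cauchy_transform (\<lambda>y. jker y * prodh \<eta> y) l + Hn 0 ?k \<eta>"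
    by (rule sums_unique2)
  then show ?thesis
    by simp
qed

end

section \<open>The bilinear form and null sets\<close>

lemma lebesgue_integral_eq_lborel:
  fixes f g :: "'a::euclidean_space \<Rightarrow> complex"
  assumes ae: "AE x in lborel. f x = g x" and g: "g \<in> borel_measurable borel"
  shows "(LINT x|lebesgue. f x) = (LINT x|lborel. g x)"
proof -
  have g1: "g \<in> borel_measurable lebesgue"
    using g by (intro measurable_completion) simp
  have ae1: "AE x in lebesgue. g x = f x"
    by (rule AE_completion) (use ae in eventually_elim, simp)
  have f1: "f \<in> borel_measurable lebesgue"
    using g1 ae1 by (rule borel_measurable_AE)
  have "(LINT x|lebesgue. f x) = (LINT x|lebesgue. g x)"
    by (rule integral_cong_AE[OF g1 f1 ae1, symmetric])
  also have "\<dots> = (LINT x|lborel. g x)"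
    using g by (intro integral_completion) simp
  finally show ?thesis .
qed

lemma AE_lborel_prod_swap:
  fixes P :: "'a::euclidean_space \<Rightarrow> 'b::euclidean_space \<Rightarrow> bool"
  assumes meas: "{z. P (fst z) (snd z)} \<in> sets (borel \<Otimes>\<^sub>M borel)" and ae: "AE x in lborel. AE y in lborel. P x y"
  shows "AE y in lborel. AE x in lborel. P x y"
proof -
  have "AE z in lborel \<Otimes>\<^sub>M lborel. P (fst z) (snd z)"
    by (rule lborel_pair.AE_pair_measure) (use meas ae in \<open>simp_all add: space_pair_measure\<close>)
  then have "AE z in distr (lborel \<Otimes>\<^sub>M lborel) (lborel \<Otimes>\<^sub>M lborel) (\<lambda>(x, y). (y, x)). P (fst z) (snd z)"
    by (subst lborel_pair.distr_pair_swap[symmetric])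
  then have "AE z in lborel \<Otimes>\<^sub>M lborel. P (fst (case z of (x, y) \<Rightarrow> (y, x))) (snd (case z of (x, y) \<Rightarrow> (y, x)))"
    by (rule AE_distrD[rotated]) measurable
  then have "AE z in lborel \<Otimes>\<^sub>M lborel. P (snd z) (fst z)"
    by (simp add: case_prod_beta)
  from lborel_pair.AE_pair[OF this] show ?thesis
    by simp
qed

lemma AE_prodD:
  fixes P :: "'a::euclidean_space \<times> 'b::euclidean_space \<Rightarrow> bool"
  assumes "AE z in lborel. P z"
  shows "AE x in lborel. AE y in lborel. P (x, y)" "AE y in lborel. AE x in lborel. P (x, y)"
proof -
  have ae: "AE z in lborel \<Otimes>\<^sub>M lborel. P z"
    using assms unfolding lborel_prod .
  show "AE x in lborel. AE y in lborel. P (x, y)"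
    by (rule lborel_pair.AE_pair[OF ae])
  have "AE z in distr (lborel \<Otimes>\<^sub>M lborel) (lborel \<Otimes>\<^sub>M lborel) (\<lambda>(x, y). (y, x)). P z"
    using ae by (subst lborel_pair.distr_pair_swap[symmetric])
  then have "AE z in lborel \<Otimes>\<^sub>M lborel. P (case z of (x, y) \<Rightarrow> (y, x))"
    by (rule AE_distrD[rotated]) measurable
  from lborel_pair.AE_pair[OF this] show "AE y in lborel. AE x in lborel. P (x, y)"
    by simp
qed

text \<open>The exceptional set lies in the product of the whole space with a null set, so that P
  itself may fail to be measurable.\<close>

lemma AE_snd_I:
  fixes P :: "'a::euclidean_space \<times> 'b::euclidean_space \<Rightarrow> bool"
  assumes "AE y in lborel. \<forall>x. P (x, y)"
  shows "AE z in lborel. P z"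
proof -
  obtain N where N: "N \<in> null_sets lborel" "{y. \<not> (\<forall>x. P (x, y))} \<subseteq> N"
    using assms by (auto elim: AE_E3 simp: eventually_ae_filter)
  have "UNIV \<times> N \<in> null_sets (lborel \<Otimes>\<^sub>M lborel)"
    using N(1) by (intro lborel.times_in_null_sets2) auto
  then have "UNIV \<times> N \<in> null_sets lborel"
    unfolding lborel_prod .
  then have "AE z in lborel. z \<notin> UNIV \<times> N"
    by (rule AE_not_in)
  then show ?thesis
    by eventually_elim (use N(2) in auto)
qed

section \<open>The excluded axis and the coordinates off the axis\<close>

lemma closed_axis_line: "closed (axis_line \<nu>)"
  unfolding axis_line_def span_singleton[symmetric] by (rule closed_span)

lemma axis_line_borel [measurable]: "axis_line \<nu> \<in> sets borel"
  using closed_axis_line by (rule borel_closed)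

lemma zero_in_axis_line: "0 \<in> axis_line \<nu>"
  unfolding axis_line_def by (auto intro: image_eqI[where x = 0])

lemma AE_not_axis: "AE p in lborel. p \<notin> axis_line \<nu>"
proof -
  have "dim (axis_line \<nu>) \<le> card {\<nu>}"
    unfolding axis_line_def span_singleton[symmetric] dim_span by (rule dim_le_card') simp
  then have "negligible (axis_line \<nu>)"
    by (intro negligible_lowdim) auto
  then have "axis_line \<nu> \<in> null_sets lebesgue"
    by (simp add: negligible_iff_null_sets)
  then have "axis_line \<nu> \<in> null_sets lborel"
    using axis_line_borel by (simp add: null_sets_completion_iff)
  then show ?thesis
    by (rule AE_not_in)
qed

lemma coordinates_cong:
  assumes "\<theta> p = \<theta>' p"
  shows "omega \<theta> p = omega \<theta>' p" "theta_i_omega \<theta> p = theta_i_omega \<theta>' p" "k_of \<theta> l p = k_of \<theta>' l p"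
    "lam_of \<theta> k p = lam_of \<theta>' k p" "xi_of \<theta> l p \<phi> = xi_of \<theta>' l p \<phi>" "acoef \<theta> p s = acoef \<theta>' p s"
  using assms
  by (simp_all add: omega_def theta_i_omega_def k_of_def lam_of_def xi_of_def k_perp_def acoef_def)

text \<open>\<open>jker\<close> written without the frame at p, so that p can vary in statements of
  joint measurability.\<close>

definition jker_at :: "real^3 \<Rightarrow> complex \<times> real \<Rightarrow> complex"
  where "jker_at p y = complex_of_real (norm p / 4 * (norm (fst y) - 1 / norm (fst y)) * (cos (snd y) - 1) - norm p / 2 * sin (snd y)) /
    (2 * cnj (fst y)) * complex_of_real (strip (snd y))"

lemma jker_at_measurable [measurable (raw)]:
  assumes [measurable]: "p \<in> borel_measurable M" "y \<in> borel_measurable M"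
  shows "(\<lambda>x. jker_at (p x) (y x)) \<in> borel_measurable M"
  unfolding jker_at_def by measurable

lemma (in frame) jker_eq_jker_at: "jker y = jker_at p y"
  by (simp add: jker_def jker_at_def yc_def wco_def)

locale coordinates =
  fixes \<nu> :: "real^3" and \<theta> :: "real^3 \<Rightarrow> real^3"
  assumes theta_cont: "continuous_on (UNIV - axis_line \<nu>) \<theta>"
    and theta: "\<And>p. p \<notin> axis_line \<nu> \<Longrightarrow> norm (\<theta> p) = 1 \<and> \<theta> p \<bullet> p = 0"
begin

lemma frame: "p \<notin> axis_line \<nu> \<Longrightarrow> frame \<theta> p"
  using theta[of p] zero_in_axis_line[of \<nu>] by unfold_locales auto

text \<open>Nothing is assumed about the values of \<open>\<theta>\<close> on the axis, so that it need not be a Borel function.\<close>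

definition th :: "real^3 \<Rightarrow> real^3"
  where "th p = indicator (UNIV - axis_line \<nu>) p *\<^sub>R \<theta> p"

lemma th_measurable [measurable]: "th \<in> borel_measurable borel"
  unfolding th_def by (rule borel_measurable_continuous_on_indicator) (use theta_cont in auto)

lemma th_eq: "p \<notin> axis_line \<nu> \<Longrightarrow> \<theta> p = th p"
  by (simp add: th_def)

lemma th_raw [measurable (raw)]:
  assumes "p \<in> borel_measurable M"
  shows "(\<lambda>x. th (p x)) \<in> borel_measurable M"
  using measurable_compose[OF assms th_measurable] .

lemma k_of_th_measurable [measurable (raw)]:
  assumes "p \<in> borel_measurable M" "l \<in> borel_measurable M"
  shows "(\<lambda>x. k_of th (l x) (p x)) \<in> borel_measurable M"
  using assms by (intro borel_measurable_k_of th_raw)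

lemma lam_of_th_measurable [measurable (raw)]:
  assumes "p \<in> borel_measurable M" "k \<in> borel_measurable M"
  shows "(\<lambda>x. lam_of th (k x) (p x)) \<in> borel_measurable M"
  using assms by (intro borel_measurable_lam_of th_raw)

lemma xi_of_th_measurable [measurable (raw)]:
  assumes "p \<in> borel_measurable M" "l \<in> borel_measurable M" "\<phi> \<in> borel_measurable M"
  shows "(\<lambda>x. xi_of th (l x) (p x) (\<phi> x)) \<in> borel_measurable M"
  using assms by (intro borel_measurable_xi_of th_raw)

lemma acoef_th_measurable [measurable (raw)]:
  assumes "p \<in> borel_measurable M" "s \<in> borel_measurable M"
  shows "(\<lambda>x. acoef th (p x) (s x)) \<in> borel_measurable M"
  using assms by (intro borel_measurable_acoef th_raw)

text \<open>For \<open>x = - p\<close> the two roots are the possible values at \<open>s\<close> of the coordinate of a point \<open>k\<close> with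
  \<open>p\<^sup>2 = 2 k \<cdot> p\<close>.\<close>

definition good :: "(complex \<times> (real^3)) set \<Rightarrow> real^3 \<Rightarrow> real^3 \<Rightarrow> bool"
  where "good N s x \<longleftrightarrow> s \<notin> axis_line \<nu> \<longrightarrow> Re (acoef th s x) \<noteq> 0 \<and>
    (root1 (ccoef s x) (acoef th s x), s) \<notin> N \<and> (root2 (ccoef s x) (acoef th s x), s) \<notin> N"

lemma good_measurable:
  assumes [measurable]: "N \<in> sets borel" "s \<in> borel_measurable M" "x \<in> borel_measurable M"
  shows "Measurable.pred M (\<lambda>z. good N (s z) (x z))"
proof -
  have "good N (s z) (x z) \<longleftrightarrow> (s z \<notin> axis_line \<nu> \<longrightarrow> 0 < \<bar>Re (acoef th (s z) (x z))\<bar> \<and>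
    (root1 (ccoef (s z) (x z)) (acoef th (s z) (x z)), s z) \<notin> N \<and> (root2 (ccoef (s z) (x z)) (acoef th (s z) (x z)), s z) \<notin> N)" for z
    by (simp add: good_def)
  moreover have "Measurable.pred M (\<lambda>z. (s z \<notin> axis_line \<nu> \<longrightarrow> 0 < \<bar>Re (acoef th (s z) (x z))\<bar> \<and>
    (root1 (ccoef (s z) (x z)) (acoef th (s z) (x z)), s z) \<notin> N \<and> (root2 (ccoef (s z) (x z)) (acoef th (s z) (x z)), s z) \<notin> N))"
    by measurable
  ultimately show ?thesis
    by simp
qed

lemma good_set:
  assumes "N \<in> sets borel" "f \<in> borel_measurable borel" "g \<in> borel_measurable borel"
  shows "{z::'z::topological_space. good N (f z) (g z)} \<in> sets borel"
  using good_measurable[OF assms] by (simp add: pred_def)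

text \<open>Along the circles based at s the root functions return the parameter \<zeta> itself. For
  almost every s the section of N in \<zeta> is null, and the change of variables turns this into a
  null set of x, one sheet for each root.\<close>

lemma AE_good:
  assumes N: "N \<in> null_sets lborel"
  shows "AE s in lborel. AE x in lborel. good N s x"
proof -
  have Nb [measurable]: "N \<in> sets borel"
    using N by auto
  have "AE z in lborel. z \<notin> N"
    using N by (rule AE_not_in)
  from AE_prodD(2)[OF this] show ?thesis
  proof eventually_elim
    case (elim s)
    show ?case
    proof (cases "s \<in> axis_line \<nu>")
      case False
      interpret F: frame \<theta> s
        using False by (rule frame)
      have ac: "acoef th s = acoef \<theta> s"
        using coordinates_cong(6)[of \<theta> s th] th_eq[OF False] by auto
      define Q where "Q a x \<longleftrightarrow> Re (acoef \<theta> s x) \<noteq> 0 \<and> (a x, s) \<notin> N" for a :: "real^3 \<Rightarrow> complex" and x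
      have Qset: "{x. Q a x} \<in> sets borel" if [measurable]: "a \<in> borel_measurable borel" for a
      proof -
        have "Q a x \<longleftrightarrow> 0 < \<bar>Re (acoef \<theta> s x)\<bar> \<and> (a x, s) \<notin> N" for x
          by (simp add: Q_def)
        moreover have "Measurable.pred borel (\<lambda>x. 0 < \<bar>Re (acoef \<theta> s x)\<bar> \<and> (a x, s) \<notin> N)"
          by measurable
        ultimately show ?thesis
          by (simp add: pred_def)
      qed
      have AEy: "AE y in (lborel :: (complex \<times> real) measure). (fst y, s) \<notin> N"
      proof -
        have "AE y in (lborel \<Otimes>\<^sub>M lborel :: (complex \<times> real) measure). (fst y, s) \<notin> N"
        proof (rule lborel_pair.AE_pair_measure)
          have "Measurable.pred (borel \<Otimes>\<^sub>M borel :: (complex \<times> real) measure) (\<lambda>y. (fst y, s) \<notin> N)"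
            by measurable
          then show "{y \<in> space (lborel \<Otimes>\<^sub>M lborel :: (complex \<times> real) measure). (fst y, s) \<notin> N} \<in> sets (lborel \<Otimes>\<^sub>M lborel)"
            by measurable
          show "AE z in lborel. AE \<phi> in lborel. (fst (z, \<phi> :: real), s) \<notin> N"
            using elim by eventually_elim simp
        qed
        then show ?thesis
          unfolding lborel_prod .
      qed
      have Rex: "Re (acoef \<theta> s (F.xi y)) \<noteq> 0" if "F.generic y" "snd y \<in> {-pi..pi}" for y
      proof -
        have "fst y \<noteq> 0"
          using that by (auto simp: F.generic_def)
        then show ?thesis
          unfolding F.acoef_xi[OF \<open>fst y \<noteq> 0\<close>] using that F.norm_p_pos
          by (simp add: F.generic_def sgn_div_norm)
      qed
      have "AE x in lborel. Q F.rt1 x"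
      proof (rule F.AE_xiI[of 1])
        show "{x. Q F.rt1 x} \<in> sets borel"
          by (rule Qset) measurable
        show "AE y in lborel. F.generic y \<longrightarrow> snd y \<in> {-pi..pi} \<longrightarrow> 1 * Re (fst y) > 0 \<longrightarrow> Q F.rt1 (F.xi y)"
          using AEy by eventually_elim (use F.rt1_xi Rex in \<open>auto simp: Q_def\<close>)
      qed simp
      moreover have "AE x in lborel. Q F.rt2 x"
      proof (rule F.AE_xiI[of "-1"])
        show "{x. Q F.rt2 x} \<in> sets borel"
          by (rule Qset) measurable
        show "AE y in lborel. F.generic y \<longrightarrow> snd y \<in> {-pi..pi} \<longrightarrow> -1 * Re (fst y) > 0 \<longrightarrow> Q F.rt2 (F.xi y)"
          using AEy by eventually_elim (use F.rt2_xi Rex in \<open>auto simp: Q_def\<close>)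
      qed simp
      ultimately show ?thesis
        by eventually_elim (simp add: good_def Q_def ac)
    qed (simp add: good_def)
  qed
qed

text \<open>The symbol of k vanishes at x. Read in the coordinates based at s, this says that
  \<lambda>(k, s) is one of the two roots attached to x, and \<open>good\<close> keeps both of them
  away from N.\<close>

lemma root_avoids:
  assumes good: "good N s x" and s: "s \<notin> axis_line \<nu>"
    and k: "k \<in> Sigma_var" "denom k (- s) = 0" "denom k x = 0"
  shows "(lam_of \<theta> k s, s) \<notin> N"
proof -
  interpret F: frame \<theta> s
    using s by (rule frame)
  let ?l = "lam_of \<theta> k s"
  have l: "?l \<noteq> 0" "k_of \<theta> ?l s = k"
    using F.lam_of_nonzero_k_of_lam_of[OF k(1,2)] by auto
  have ac: "acoef th s x = acoef \<theta> s x"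
    using coordinates_cong(6)[of \<theta> s th] th_eq[OF s] by auto
  have g: "Re (acoef \<theta> s x) \<noteq> 0" "(root1 (ccoef s x) (acoef \<theta> s x), s) \<notin> N" "(root2 (ccoef s x) (acoef \<theta> s x), s) \<notin> N"
    using good s by (auto simp: good_def ac)
  then have a: "acoef \<theta> s x \<noteq> 0"
    by auto
  have eq: "acoef \<theta> s x * ?l - cnj (acoef \<theta> s x) / ?l + complex_of_real (ccoef s x) = 0"
    using k(3) denom_k_of[of \<theta> ?l s x] unfolding l(2) by simp
  have "Re ?l \<noteq> 0"
    by (rule root_nonzero[OF g(1) l(1) eq])
  then have "root1 (ccoef s x) (acoef \<theta> s x) = ?l \<or> root2 (ccoef s x) (acoef \<theta> s x) = ?l"
    using root1_unique[OF a _ eq] root2_unique[OF a _ eq] by linarith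
  then show ?thesis
    using g by auto
qed

lemma AE_circle_off_axis:
  assumes p: "p \<notin> axis_line \<nu>"
  shows "AE y in lborel. snd y \<in> {-pi..pi} \<longrightarrow> - xi_of \<theta> (fst y) p (snd y) \<notin> axis_line \<nu> \<and> p + xi_of \<theta> (fst y) p (snd y) \<notin> axis_line \<nu>"
proof -
  interpret F: frame \<theta> p
    using p by (rule frame)
  have "AE \<xi> in lborel. - \<xi> \<notin> axis_line \<nu> \<and> p + \<xi> \<notin> axis_line \<nu>"
    using AE_lborel_uminus[OF AE_not_axis[of \<nu>]] AE_lborel_shift[OF AE_not_axis[of \<nu>], of p]
    by eventually_elim auto
  from F.AE_xiD[OF this] show ?thesis .
qed

text \<open>The two pairs of base points at which the bilinear form evaluates its arguments avoid any given
  null set, for almost all \<open>p\<close> and almost everywhere on the circles. The reason is the symmetry of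
  the two constraints \<open>s\<^sup>2 = 2 k \<cdot> s\<close> and \<open>p\<^sup>2 = 2 k \<cdot> p\<close> on \<open>k\<close>: in the coordinates based at \<open>s\<close>
  the point \<open>k\<close> is one of the two roots attached to \<open>- p\<close>.\<close>

lemma AE_circle_avoids:
  assumes N: "N \<in> null_sets lborel"
  shows "AE p in lborel. p \<notin> axis_line \<nu> \<longrightarrow> (AE y in lborel. snd y \<in> {-pi..pi} \<longrightarrow>
    (lam_of \<theta> (k_of \<theta> (fst y) p) (- xi_of \<theta> (fst y) p (snd y)), - xi_of \<theta> (fst y) p (snd y)) \<notin> N \<and>
    (lam_of \<theta> (k_of \<theta> (fst y) p + cvec (xi_of \<theta> (fst y) p (snd y))) (p + xi_of \<theta> (fst y) p (snd y)), p + xi_of \<theta> (fst y) p (snd y)) \<notin> N)"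
proof -
  have Nb [measurable]: "N \<in> sets borel"
    using N by auto
  have A1: "AE p in lborel. AE s in lborel. good N s (- p)"
  proof (rule AE_lborel_prod_swap)
    show "{z. good N (fst z) (- snd z)} \<in> sets (borel \<Otimes>\<^sub>M borel)"
      unfolding borel_prod by (rule good_set) measurable
    show "AE s in lborel. AE p in lborel. good N s (- p)"
      using AE_good[OF N] by eventually_elim (rule AE_lborel_uminus)
  qed
  have A2: "AE p in lborel. AE s in lborel. good N s (p - s)"
  proof (rule AE_lborel_prod_swap)
    show "{z. good N (fst z) (snd z - fst z)} \<in> sets (borel \<Otimes>\<^sub>M borel)"
      unfolding borel_prod by (rule good_set) measurable
    show "AE s in lborel. AE p in lborel. good N s (p - s)"
      using AE_good[OF N]
    proof eventually_elim
      case (elim s)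
      from AE_lborel_shift[OF elim, of "- s"] show ?case by simp
    qed
  qed
  from A1 A2 show ?thesis
  proof eventually_elim
    case (elim p)
    show ?case
    proof
      assume p: "p \<notin> axis_line \<nu>"
      interpret F: frame \<theta> p
        using p by (rule frame)
      \<comment> \<open>The first base point is s = - \<xi> with x = - p, the second is s = p +
        \<xi> with x = p - s = - \<xi>. In the second case the point on the variety is k + \<xi>,
        whose symbol vanishes at - \<xi>.\<close>
      have "AE \<xi> in lborel. good N (- \<xi>) (- p) \<and> good N (p + \<xi>) (- \<xi>)"
        using AE_lborel_uminus[OF elim(1)] AE_lborel_shift[OF elim(2), of p]
        by eventually_elim simp
      from F.AE_xiD[OF this] AE_circle_off_axis[OF p] AE_fst_neq[of 0]
      show "AE y in lborel. snd y \<in> {-pi..pi} \<longrightarrow>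
        (lam_of \<theta> (F.kk y) (- F.xi y), - F.xi y) \<notin> N \<and> (lam_of \<theta> (F.kk y + cvec (F.xi y)) (p + F.xi y), p + F.xi y) \<notin> N"
      proof eventually_elim
        case (elim y)
        show ?case
        proof (intro impI conjI)
          assume y: "snd y \<in> {-pi..pi}"
          have k: "F.kk y \<in> Sigma_var" "denom (F.kk y) (F.xi y) = 0" "denom (F.kk y) (- p) = 0"
            using elim(3) by (auto intro: F.k_of_in_Sigma F.denom_xi F.denom_k_of_uminus_p)
          show "(lam_of \<theta> (F.kk y) (- F.xi y), - F.xi y) \<notin> N"
            by (rule root_avoids[of N _ "- p"]) (use elim y k in auto)
          show "(lam_of \<theta> (F.kk y + cvec (F.xi y)) (p + F.xi y), p + F.xi y) \<notin> N"
            using elim y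
            by (intro root_avoids[OF _ _ Sigma_var_add_cvec[OF k(1,2)] denom_shift_variety[OF k(2,3)] denom_add_uminus[OF k(2)]]) auto
        qed
      qed
    qed
  qed
qed

text \<open>The arguments enter only through their values almost everywhere on the circles, so K may
  be any dominated function that agrees with the integrand there. The constants -1 / pi and -pi / 4
  and the factor 4 between the coefficient of \<open>brace\<close> and \<open>jker\<close>
  cancel.\<close>

lemma I_op_eq_cauchy_transform:
  assumes p: "p \<notin> axis_line \<nu>" and K: "strip_dominated B K"
    and eq: "AE y in lborel. snd y \<in> {-pi..pi} \<longrightarrow> K y = jker_at p y *
      (U\<^sub>1 (lam_of \<theta> (k_of \<theta> (fst y) p) (- xi_of \<theta> (fst y) p (snd y)), - xi_of \<theta> (fst y) p (snd y)) *
       U\<^sub>2 (lam_of \<theta> (k_of \<theta> (fst y) p + cvec (xi_of \<theta> (fst y) p (snd y))) (p + xi_of \<theta> (fst y) p (snd y)), p + xi_of \<theta> (fst y) p (snd y)))"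
  shows "I_op \<theta> U\<^sub>1 U\<^sub>2 (l, p) = cauchy_transform K l"
proof -
  interpret F: frame \<theta> p
    using p by (rule frame)
  note [measurable] = strip_dominatedD(1)[OF K]
  have [measurable]: "K \<in> borel_measurable (borel \<Otimes>\<^sub>M borel)"
    by (simp add: borel_prod)
  define g where "g z = (LINT \<phi>|lborel. K (z, \<phi>))" for z
  have [measurable]: "g \<in> borel_measurable borel"
  proof -
    have "(\<lambda>(z, \<phi>). K (z, \<phi>)) \<in> borel_measurable (borel \<Otimes>\<^sub>M (lborel :: real measure))"
      by simp
    then show ?thesis
      unfolding g_def[abs_def] by (intro lborel.borel_measurable_lebesgue_integral)
  qed
  have K0: "K y = 0" if "snd y \<notin> {-pi..pi}" for y
    using strip_dominatedD(3)[OF K, of y] that by simp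
  have paren: "AE z in lborel. paren \<theta> U\<^sub>1 U\<^sub>2 (z, p) = - pi * g z"
    using AE_prodD(1)[OF eq] AE_lborel_singleton[of "0::complex"]
  proof eventually_elim
    case (elim z)
    let ?f = "\<lambda>\<phi>. (norm p / 2 * ((norm z)\<^sup>2 - 1) / (cnj z * norm z) * (cos \<phi> - 1) - norm p / cnj z * sin \<phi>)
        * U\<^sub>1 (lam_of \<theta> (k_of \<theta> z p) (- xi_of \<theta> z p \<phi>), - xi_of \<theta> z p \<phi>)
        * U\<^sub>2 (lam_of \<theta> (k_of \<theta> z p + cvec (xi_of \<theta> z p \<phi>)) (p + xi_of \<theta> z p \<phi>), p + xi_of \<theta> z p \<phi>)"
    have "(LINT \<phi>:{-pi..pi}|lebesgue. ?f \<phi>) = (LINT \<phi>|lborel. 4 * K (z, \<phi>))"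
      unfolding set_lebesgue_integral_def
    proof (rule lebesgue_integral_eq_lborel)
      show "AE \<phi> in lborel. indicator {-pi..pi} \<phi> *\<^sub>R ?f \<phi> = 4 * K (z, \<phi>)"
        using elim(1)
      proof eventually_elim
        case (elim \<phi>)
        show ?case
        proof (cases "\<phi> \<in> {-pi..pi}")
          case True
          have "4 * jker_at p (z, \<phi>) = 2 * complex_of_real (F.yc (F.wco (norm z)) \<phi>) / cnj z"
            using True by (simp add: F.jker_eq_jker_at[symmetric] F.jker_def)
          then show ?thesis
            using elim True F.coefficient_eq[OF \<open>z \<noteq> 0\<close>, of \<phi>] by (simp add: mult.assoc[symmetric])
        qed (simp add: K0)
      qed
    qed measurable
    moreover have "paren \<theta> U\<^sub>1 U\<^sub>2 (z, p) = - (pi / 4) * (LINT \<phi>:{-pi..pi}|lebesgue. ?f \<phi>)"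
      by (simp add: paren_def brace_def cos_of_real sin_of_real)
    ultimately show ?case
      by (simp add: g_def)
  qed
  have "(LINT z|lebesgue. paren \<theta> U\<^sub>1 U\<^sub>2 (z, p) / (z - l)) = (LINT z|lborel. - pi * g z / (z - l))"
    by (rule lebesgue_integral_eq_lborel) (use paren in \<open>eventually_elim, simp\<close>, measurable)
  also have "\<dots> = - pi * (LINT z|lborel. g z / (z - l))"
    by (simp add: integral_mult_right_zero[symmetric] del: integral_mult_right_zero)
  also have "(LINT z|lborel. g z / (z - l)) = (LINT z|lborel. LINT \<phi>|lborel. K (z, \<phi>) / (z - l))"
    by (simp add: g_def)
  also have "\<dots> = cauchy_transform K l"
  proof -
    have "integrable (lborel \<Otimes>\<^sub>M lborel) (\<lambda>y. K y / (fst y - l))"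
      unfolding lborel_prod by (rule integrable_cauchy_transform[OF K])
    from lborel_pair.integral_fst'[OF this] show ?thesis
      by (simp add: cauchy_transform_def lborel_prod)
  qed
  finally show ?thesis
    by (simp add: I_op_def)
qed

end

section \<open>The nonlinear operator\<close>

lemma LP_dom_borel: "LP_dom \<nu> \<in> sets borel"
proof -
  have "LP_dom \<nu> = (UNIV - {0}) \<times> (UNIV - axis_line \<nu>)"
    by (auto simp: LP_dom_def)
  also have "\<dots> \<in> sets (borel \<Otimes>\<^sub>M borel)"
    by (intro pair_measureI) auto
  finally show ?thesis
    unfolding borel_prod .
qed

lemma AE_LP_dom: "AE x in lborel. x \<in> LP_dom \<nu>"
proof -
  have "AE x in (lborel :: (complex \<times> (real^3)) measure). snd x \<notin> axis_line \<nu>"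
    by (rule AE_snd_I) (use AE_not_axis[of \<nu>] in simp)
  then show ?thesis
    using AE_fst_neq[of "0::complex"] by eventually_elim (auto simp: LP_dom_def)
qed

lemma AE_lebesgue_on_LP_dom: "(AE x in lebesgue_on (LP_dom \<nu>). P x) \<longleftrightarrow> (AE x in lborel. P x)"
proof -
  have "LP_dom \<nu> \<inter> space lebesgue \<in> sets lebesgue"
    using LP_dom_borel[of \<nu>] by simp
  then have "(AE x in lebesgue_on (LP_dom \<nu>). P x) \<longleftrightarrow> (AE x in lebesgue. x \<in> LP_dom \<nu> \<longrightarrow> P x)"
    by (rule AE_restrict_space_iff)
  also have "\<dots> \<longleftrightarrow> (AE x in lborel. x \<in> LP_dom \<nu> \<longrightarrow> P x)"
    by (rule AE_completion_iff)
  also have "\<dots> \<longleftrightarrow> (AE x in lborel. P x)"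
    using AE_LP_dom[of \<nu>] by (auto elim: eventually_elim2)
  finally show ?thesis .
qed

lemma measurable_lebesgue_on_LP_dom:
  fixes U :: "complex \<times> (real^3) \<Rightarrow> complex"
  shows "U \<in> borel_measurable (lebesgue_on (LP_dom \<nu>)) \<longleftrightarrow> U \<in> borel_measurable lebesgue"
proof
  assume "U \<in> borel_measurable (lebesgue_on (LP_dom \<nu>))"
  then have "(\<lambda>x. if x \<in> LP_dom \<nu> then U x else 0) \<in> borel_measurable lebesgue"
    using LP_dom_borel[of \<nu>] by (intro borel_measurable_if_I) auto
  moreover have "AE x in lebesgue. (if x \<in> LP_dom \<nu> then U x else 0) = U x"
    by (rule AE_completion) (use AE_LP_dom[of \<nu>] in eventually_elim, simp)
  ultimately show "U \<in> borel_measurable lebesgue"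
    by (rule borel_measurable_AE)
qed (rule measurable_restrict_space1)

definition ess_wbounded :: "real \<Rightarrow> real \<Rightarrow> (complex \<times> (real^3) \<Rightarrow> complex) \<Rightarrow> bool"
  where "ess_wbounded \<mu> B U \<longleftrightarrow> U \<in> borel_measurable lebesgue \<and> B \<ge> 0 \<and> (AE x in lborel. norm (U x) \<le> B * wt \<mu> (snd x))"

lemma ess_wbounded_mono: "ess_wbounded \<mu> B U \<Longrightarrow> B \<le> B' \<Longrightarrow> ess_wbounded \<mu> B' U"
  unfolding ess_wbounded_def by (auto elim!: eventually_mono intro: order_trans mult_right_mono)

lemma ess_wbounded_diff: "ess_wbounded \<mu> B U \<Longrightarrow> ess_wbounded \<mu> B' U' \<Longrightarrow> ess_wbounded \<mu> (B + B') (\<lambda>x. U x - U' x)"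
proof -
  assume U: "ess_wbounded \<mu> B U" and U': "ess_wbounded \<mu> B' U'"
  then have "AE x in lborel. norm (U x) \<le> B * wt \<mu> (snd x)" "AE x in lborel. norm (U' x) \<le> B' * wt \<mu> (snd x)"
    by (auto simp: ess_wbounded_def)
  then have "AE x in lborel. norm (U x - U' x) \<le> (B + B') * wt \<mu> (snd x)"
    by eventually_elim (simp add: distrib_right norm_triangle_le_diff)
  moreover have "(\<lambda>x. U x - U' x) \<in> borel_measurable lebesgue"
    using U U' by (intro borel_measurable_diff) (auto simp: ess_wbounded_def)
  ultimately show ?thesis
    using U U' by (simp add: ess_wbounded_def)
qed

lemma wnorm2_measurable:
  assumes "U \<in> borel_measurable lebesgue"
  shows "(\<lambda>(l::complex, p::real^3). ereal ((1 + norm p) powr \<mu> * norm (U (l, p)))) \<in> borel_measurable (lebesgue_on (LP_dom \<nu>))"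
proof -
  have "(\<lambda>x::complex \<times> (real^3). (1 + norm (snd x)) powr \<mu>) \<in> borel_measurable lebesgue"
    by (rule measurable_completion) measurable
  then have "(\<lambda>x. ereal ((1 + norm (snd x)) powr \<mu> * norm (U x))) \<in> borel_measurable lebesgue"
    using assms by measurable
  then show ?thesis
    by (intro measurable_restrict_space1) (simp add: case_prod_beta')
qed

lemma wnorm2_nonneg: "wnorm2 \<mu> \<nu> U \<ge> 0"
proof (cases "(\<lambda>(l::complex, p::real^3). ereal ((1 + norm p) powr \<mu> * norm (U (l, p)))) \<in> borel_measurable (lebesgue_on (LP_dom \<nu>))")
  case True
  \<comment> \<open>The essential supremum of the constant 0 is 0 only for a measure that is not
    zero; this is ruled out by density of sets of full measure.\<close>
  have "\<not> (AE x in lebesgue_on (LP_dom \<nu>). False)"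
    unfolding AE_lebesgue_on_LP_dom using AE_lborel_dense[of "\<lambda>_. False" 1 "0 :: complex \<times> (real^3)"] by auto
  then have "emeasure (lebesgue_on (LP_dom \<nu>)) (space (lebesgue_on (LP_dom \<nu>))) \<noteq> 0"
    using ae_filter_eq_bot_iff[of "lebesgue_on (LP_dom \<nu>)"] by (auto simp: trivial_limit_def)
  then have "0 = esssup (lebesgue_on (LP_dom \<nu>)) (\<lambda>p. 0 :: ereal)"
    by (rule esssup_const[symmetric])
  also have "\<dots> \<le> wnorm2 \<mu> \<nu> U"
    unfolding wnorm2_def by (rule esssup_mono) auto
  finally show ?thesis .
qed (simp add: wnorm2_def esssup_def)

lemma wnorm2_leD:
  assumes "wnorm2 \<mu> \<nu> U \<le> ereal B"
  shows "AE x in lborel. norm (U x) \<le> B * wt \<mu> (snd x)"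
proof -
  have "AE x in lebesgue_on (LP_dom \<nu>). (case x of (l, p) \<Rightarrow> ereal ((1 + norm p) powr \<mu> * norm (U (l, p)))) \<le> wnorm2 \<mu> \<nu> U"
    unfolding wnorm2_def by (rule esssup_AE)
  then have "AE x in lborel. (case x of (l, p) \<Rightarrow> ereal ((1 + norm p) powr \<mu> * norm (U (l, p)))) \<le> wnorm2 \<mu> \<nu> U"
    by (simp add: AE_lebesgue_on_LP_dom)
  then show ?thesis
  proof eventually_elim
    case (elim x)
    then have "ereal ((1 + norm (snd x)) powr \<mu> * norm (U x)) \<le> ereal B"
      by (intro order_trans[OF _ assms]) (simp add: case_prod_beta)
    then show ?case
      by (simp add: weight_le_iff)
  qed
qed

lemma wnorm2_le:
  assumes "ess_wbounded \<mu> B U"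
  shows "wnorm2 \<mu> \<nu> U \<le> ereal B"
  unfolding wnorm2_def
proof (rule esssup_I)
  show "(\<lambda>(l::complex, p::real^3). ereal ((1 + norm p) powr \<mu> * norm (U (l, p)))) \<in> borel_measurable (lebesgue_on (LP_dom \<nu>))"
    using assms by (intro wnorm2_measurable) (simp add: ess_wbounded_def)
  show "AE x in lebesgue_on (LP_dom \<nu>). (case x of (l, p) \<Rightarrow> ereal ((1 + norm p) powr \<mu> * norm (U (l, p)))) \<le> ereal B"
    unfolding AE_lebesgue_on_LP_dom using assms by (auto simp: ess_wbounded_def weight_le_iff case_prod_beta)
qed

lemma ess_wbounded_Linf2: "ess_wbounded \<mu> B U \<Longrightarrow> U \<in> Linf2 \<mu> \<nu>"
  using wnorm2_le[of \<mu> B U \<nu>] unfolding Linf2_def ess_wbounded_def measurable_lebesgue_on_LP_dom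
  by (auto intro: le_less_trans)

lemma ess_wboundedI:
  assumes "U \<in> Linf2 \<mu> \<nu>" "wnorm2 \<mu> \<nu> U \<le> ereal B"
  shows "ess_wbounded \<mu> B U"
proof -
  have "0 \<le> ereal B"
    using wnorm2_nonneg assms(2) by (rule order_trans)
  then show ?thesis
    using assms wnorm2_leD[OF assms(2)] by (simp add: ess_wbounded_def Linf2_def measurable_lebesgue_on_LP_dom)
qed

text \<open>The bilinear form samples its arguments along circles, where a bound off a null set says
  nothing. Hence representatives with a bound at every point.\<close>

definition wbounded :: "real \<Rightarrow> real \<Rightarrow> (complex \<times> (real^3) \<Rightarrow> complex) \<Rightarrow> bool"
  where "wbounded \<mu> B U \<longleftrightarrow> U \<in> borel_measurable borel \<and> B \<ge> 0 \<and> (\<forall>x. norm (U x) \<le> B * wt \<mu> (snd x))"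

lemma wboundedD: "wbounded \<mu> B U \<Longrightarrow> norm (U x) \<le> B * wt \<mu> (snd x)"
  unfolding wbounded_def by blast

lemma wbounded_representative:
  assumes "ess_wbounded \<mu> B U"
  obtains V where "wbounded \<mu> B V" "AE x in lborel. U x = V x"
proof -
  obtain g where g [measurable]: "g \<in> borel_measurable borel" and Ug: "AE x in lborel. U x = g x"
    using assms lebesgue_borel_representative unfolding ess_wbounded_def by blast
  define V where "V x = (if norm (g x) \<le> B * wt \<mu> (snd x) then g x else 0)" for x
  have B: "B \<ge> 0" "AE x in lborel. norm (U x) \<le> B * wt \<mu> (snd x)"
    using assms by (auto simp: ess_wbounded_def)
  show thesis
  proof (rule that)
    have "V \<in> borel_measurable borel"
      unfolding V_def by measurable
    then show "wbounded \<mu> B V"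
      using B(1) by (auto simp: wbounded_def V_def)
    show "AE x in lborel. U x = V x"
      using Ug B(2) by eventually_elim (auto simp: V_def)
  qed
qed

lemma wbounded_diff:
  assumes "wbounded \<mu> B U" "wbounded \<mu> B' U'"
  shows "wbounded \<mu> (B + B') (\<lambda>x. U x - U' x)"
proof -
  have "norm (U x - U' x) \<le> (B + B') * wt \<mu> (snd x)" for x
  proof -
    have "norm (U x - U' x) \<le> norm (U x) + norm (U' x)"
      by (rule norm_triangle_ineq4)
    also have "\<dots> \<le> B * wt \<mu> (snd x) + B' * wt \<mu> (snd x)"
      using assms by (intro add_mono wboundedD)
    finally show ?thesis
      by (simp add: distrib_right)
  qed
  moreover have "(\<lambda>x. U x - U' x) \<in> borel_measurable borel"
    using assms by (intro borel_measurable_diff) (auto simp: wbounded_def)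
  ultimately show ?thesis
    using assms by (simp add: wbounded_def)
qed

section \<open>The bilinear operator on classes of functions\<close>

locale reconstruction = coordinates \<nu> \<theta> for \<nu> \<theta> +
  fixes \<mu> c\<^sub>6 :: real
  assumes mu: "\<mu> \<ge> 2" and c6_pos: "c\<^sub>6 > 0"
    and c6: "\<And>U\<^sub>1 U\<^sub>2. U\<^sub>1 \<in> Linf2 \<mu> \<nu> \<Longrightarrow> U\<^sub>2 \<in> Linf2 \<mu> \<nu> \<Longrightarrow>
               wnorm2 \<mu> \<nu> (I_op \<theta> U\<^sub>1 U\<^sub>2) \<le> ereal c\<^sub>6 * wnorm2 \<mu> \<nu> U\<^sub>1 * wnorm2 \<mu> \<nu> U\<^sub>2"
begin

text \<open>Written with the Borel field \<open>th\<close>, so as to be jointly measurable in p and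
  y; off the axis \<open>th\<close> coincides with \<theta>.\<close>

definition circle_product ::
    "(complex \<times> (real^3) \<Rightarrow> complex) \<Rightarrow> (complex \<times> (real^3) \<Rightarrow> complex) \<Rightarrow> real^3 \<Rightarrow> complex \<times> real \<Rightarrow> complex"
  where "circle_product U\<^sub>1 U\<^sub>2 p y =
      U\<^sub>1 (lam_of th (k_of th (fst y) p) (- xi_of th (fst y) p (snd y)), - xi_of th (fst y) p (snd y)) *
      U\<^sub>2 (lam_of th (k_of th (fst y) p + cvec (xi_of th (fst y) p (snd y))) (p + xi_of th (fst y) p (snd y)), p + xi_of th (fst y) p (snd y))"

lemma circle_product_measurable [measurable (raw)]:
  assumes U: "U\<^sub>1 \<in> borel_measurable borel" "U\<^sub>2 \<in> borel_measurable borel"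
    and [measurable]: "p \<in> borel_measurable M" "y \<in> borel_measurable M"
  shows "(\<lambda>x. circle_product U\<^sub>1 U\<^sub>2 (p x) (y x)) \<in> borel_measurable M"
proof -
  have a1: "(\<lambda>x. (lam_of th (k_of th (fst (y x)) (p x)) (- xi_of th (fst (y x)) (p x) (snd (y x))), - xi_of th (fst (y x)) (p x) (snd (y x)))) \<in> borel_measurable M"
    by (rule borel_measurable_Pair) measurable
  have a2: "(\<lambda>x. (lam_of th (k_of th (fst (y x)) (p x) + cvec (xi_of th (fst (y x)) (p x) (snd (y x)))) (p x + xi_of th (fst (y x)) (p x) (snd (y x))), p x + xi_of th (fst (y x)) (p x) (snd (y x)))) \<in> borel_measurable M"
    by (rule borel_measurable_Pair) measurable
  show ?thesis
    unfolding circle_product_def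
    by (rule borel_measurable_times[OF measurable_compose[OF a1 U(1)] measurable_compose[OF a2 U(2)]])
qed

definition paren_kernel :: "(complex \<times> (real^3) \<Rightarrow> complex) \<Rightarrow> (complex \<times> (real^3) \<Rightarrow> complex) \<Rightarrow> real^3 \<Rightarrow> complex \<times> real \<Rightarrow> complex"
  where "paren_kernel U\<^sub>1 U\<^sub>2 p y = jker_at p y * circle_product U\<^sub>1 U\<^sub>2 p y"

lemma paren_kernel_dominated:
  assumes p: "p \<notin> axis_line \<nu>" and U: "wbounded \<mu> B\<^sub>1 U\<^sub>1" "wbounded \<mu> B\<^sub>2 U\<^sub>2"
  shows "strip_dominated (B\<^sub>1 * B\<^sub>2 * (1 + 1 / norm p)) (paren_kernel U\<^sub>1 U\<^sub>2 p)"
proof -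
  interpret F: frame \<theta> p
    using p by (rule frame)
  have B: "B\<^sub>1 \<ge> 0" "B\<^sub>2 \<ge> 0"
    using U by (auto simp: wbounded_def)
  have xi: "xi_of th l p \<phi> = xi_of \<theta> l p \<phi>" for l \<phi>
    using coordinates_cong(5)[of \<theta> p th] th_eq[OF p] by simp
  have [measurable]: "U\<^sub>1 \<in> borel_measurable borel" "U\<^sub>2 \<in> borel_measurable borel"
    using U by (auto simp: wbounded_def)
  have bound: "norm (circle_product U\<^sub>1 U\<^sub>2 p y) \<le> B\<^sub>1 * B\<^sub>2 / (1 + norm (F.xi y))\<^sup>2" for y
  proof -
    have b1: "norm (U\<^sub>1 (a, - F.xi y)) \<le> B\<^sub>1 * (1 / (1 + norm (F.xi y))\<^sup>2)" for a
    proof -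
      have "norm (U\<^sub>1 (a, - F.xi y)) \<le> B\<^sub>1 * wt \<mu> (- F.xi y)"
        using wboundedD[OF U(1), of "(a, - F.xi y)"] by simp
      also have "\<dots> \<le> B\<^sub>1 * (1 / (1 + norm (- F.xi y))\<^sup>2)"
        using mu B by (intro mult_left_mono wt_le_square) auto
      finally show ?thesis by simp
    qed
    have b2: "norm (U\<^sub>2 x) \<le> B\<^sub>2" for x
    proof -
      have "norm (U\<^sub>2 x) \<le> B\<^sub>2 * wt \<mu> (snd x)"
        by (rule wboundedD[OF U(2)])
      also have "\<dots> \<le> B\<^sub>2 * 1"
        using mu B by (intro mult_left_mono wt_le_1) auto
      finally show ?thesis by simp
    qed
    have "norm (circle_product U\<^sub>1 U\<^sub>2 p y) \<le> (B\<^sub>1 * (1 / (1 + norm (F.xi y))\<^sup>2)) * B\<^sub>2"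
      unfolding circle_product_def xi norm_mult using B by (intro mult_mono b1 b2) auto
    then show ?thesis
      by simp
  qed
  have "strip_dominated (B\<^sub>1 * B\<^sub>2 * F.pconst) (\<lambda>y. F.jker y * circle_product U\<^sub>1 U\<^sub>2 p y)"
    using B bound by (intro F.strip_dominated_jker_mult) auto
  moreover have "paren_kernel U\<^sub>1 U\<^sub>2 p = (\<lambda>y. F.jker y * circle_product U\<^sub>1 U\<^sub>2 p y)"
    by (simp add: fun_eq_iff paren_kernel_def F.jker_eq_jker_at)
  ultimately show ?thesis
    by (simp add: F.pconst_def)
qed

text \<open>For almost every p the circles avoid the null set where either argument differs from its
  representative. So \<open>I_op\<close> is well defined on classes, and the formula holds for all l
  at once.\<close>

lemma I_op_eq_paren_kernel:
  assumes V: "wbounded \<mu> B\<^sub>1 V\<^sub>1" "wbounded \<mu> B\<^sub>2 V\<^sub>2" and eq: "AE x in lborel. U\<^sub>1 x = V\<^sub>1 x" "AE x in lborel. U\<^sub>2 x = V\<^sub>2 x"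
  shows "AE p in lborel. p \<notin> axis_line \<nu> \<and> (\<forall>l. I_op \<theta> U\<^sub>1 U\<^sub>2 (l, p) = cauchy_transform (paren_kernel V\<^sub>1 V\<^sub>2 p) l)"
proof -
  have "AE x in lborel. U\<^sub>1 x = V\<^sub>1 x \<and> U\<^sub>2 x = V\<^sub>2 x"
    using eq by eventually_elim simp
  then obtain N where N: "N \<in> null_sets lborel" and UV: "\<And>x. x \<notin> N \<Longrightarrow> U\<^sub>1 x = V\<^sub>1 x \<and> U\<^sub>2 x = V\<^sub>2 x"
    by (rule AE_E3) auto
  from AE_circle_avoids[OF N] AE_not_axis[of \<nu>] show ?thesis
  proof eventually_elim
    case (elim p)
    note p = elim(2)
    show ?case
    proof (intro conjI allI p)
      fix l
      have c: "k_of th l' p = k_of \<theta> l' p" "xi_of th l' p \<phi> = xi_of \<theta> l' p \<phi>" for l' \<phi>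
        using coordinates_cong(3,5)[of \<theta> p th] th_eq[OF p] by simp_all
      have cl: "lam_of th k s = lam_of \<theta> k s" if "s \<notin> axis_line \<nu>" for k s
        using coordinates_cong(4)[of \<theta> s th] th_eq[OF that] by simp
      show "I_op \<theta> U\<^sub>1 U\<^sub>2 (l, p) = cauchy_transform (paren_kernel V\<^sub>1 V\<^sub>2 p) l"
      proof (rule I_op_eq_cauchy_transform[OF p paren_kernel_dominated[OF p V]])
        show "AE y in lborel. snd y \<in> {-pi..pi} \<longrightarrow> paren_kernel V\<^sub>1 V\<^sub>2 p y = jker_at p y *
          (U\<^sub>1 (lam_of \<theta> (k_of \<theta> (fst y) p) (- xi_of \<theta> (fst y) p (snd y)), - xi_of \<theta> (fst y) p (snd y)) *
           U\<^sub>2 (lam_of \<theta> (k_of \<theta> (fst y) p + cvec (xi_of \<theta> (fst y) p (snd y))) (p + xi_of \<theta> (fst y) p (snd y)), p + xi_of \<theta> (fst y) p (snd y)))"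
          using elim(1)[rule_format, OF p] AE_circle_off_axis[OF p]
          by eventually_elim (auto simp: paren_kernel_def circle_product_def c cl UV)
      qed
    qed
  qed
qed

text \<open>In all three statements the exceptional set consists of values of p alone. This is what
  permits the substitution l = \<open>lam0 \<theta> \<gamma> p\<close> later.\<close>

lemma
  assumes U: "ess_wbounded \<mu> B\<^sub>1 U\<^sub>1" "ess_wbounded \<mu> B\<^sub>2 U\<^sub>2"
  shows I_op_bound: "AE p in lborel. \<forall>l. norm (I_op \<theta> U\<^sub>1 U\<^sub>2 (l, p)) \<le> c\<^sub>6 * B\<^sub>1 * B\<^sub>2 * wt \<mu> p"
    and I_op_at_infinity: "AE p in lborel. ((\<lambda>l. I_op \<theta> U\<^sub>1 U\<^sub>2 (l, p)) \<longlongrightarrow> 0) at_infinity"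
    and I_op_borel: "\<exists>J\<in>borel_measurable borel. AE p in lborel. \<forall>l. I_op \<theta> U\<^sub>1 U\<^sub>2 (l, p) = J (l, p)"
proof -
  have B: "B\<^sub>1 \<ge> 0" "B\<^sub>2 \<ge> 0"
    using U by (auto simp: ess_wbounded_def)
  obtain V\<^sub>1 where V1: "wbounded \<mu> B\<^sub>1 V\<^sub>1" "AE x in lborel. U\<^sub>1 x = V\<^sub>1 x"
    using U(1) by (rule wbounded_representative)
  obtain V\<^sub>2 where V2: "wbounded \<mu> B\<^sub>2 V\<^sub>2" "AE x in lborel. U\<^sub>2 x = V\<^sub>2 x"
    using U(2) by (rule wbounded_representative)
  note rep = I_op_eq_paren_kernel[OF V1(1) V2(1) V1(2) V2(2)]
  have "wnorm2 \<mu> \<nu> (I_op \<theta> U\<^sub>1 U\<^sub>2) \<le> ereal c\<^sub>6 * wnorm2 \<mu> \<nu> U\<^sub>1 * wnorm2 \<mu> \<nu> U\<^sub>2"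
    by (intro c6 ess_wbounded_Linf2[OF U(1)] ess_wbounded_Linf2[OF U(2)])
  also have "\<dots> \<le> ereal c\<^sub>6 * ereal B\<^sub>1 * ereal B\<^sub>2"
    using wnorm2_le[OF U(1)] wnorm2_le[OF U(2)] wnorm2_nonneg c6_pos B
    by (intro ereal_mult_mono mult_nonneg_nonneg) auto
  also have "\<dots> = ereal (c\<^sub>6 * B\<^sub>1 * B\<^sub>2)"
    by simp
  finally have "AE x in lborel. norm (I_op \<theta> U\<^sub>1 U\<^sub>2 x) \<le> c\<^sub>6 * B\<^sub>1 * B\<^sub>2 * wt \<mu> (snd x)"
    by (rule wnorm2_leD)
  from AE_prodD(2)[OF this] rep
  show "AE p in lborel. \<forall>l. norm (I_op \<theta> U\<^sub>1 U\<^sub>2 (l, p)) \<le> c\<^sub>6 * B\<^sub>1 * B\<^sub>2 * wt \<mu> p"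
  proof eventually_elim
    case (elim p)
    have sd: "strip_dominated (B\<^sub>1 * B\<^sub>2 * (1 + 1 / norm p)) (paren_kernel V\<^sub>1 V\<^sub>2 p)"
      using elim V1 V2 by (intro paren_kernel_dominated) auto
    have "continuous_on UNIV (cauchy_transform (paren_kernel V\<^sub>1 V\<^sub>2 p))"
      using isCont_cauchy_transform[OF sd] by (simp add: continuous_at_imp_continuous_on)
    moreover have "AE l in lborel. norm (cauchy_transform (paren_kernel V\<^sub>1 V\<^sub>2 p) l) \<le> c\<^sub>6 * B\<^sub>1 * B\<^sub>2 * wt \<mu> p"
      using elim by simp
    ultimately have "norm (cauchy_transform (paren_kernel V\<^sub>1 V\<^sub>2 p) l) \<le> c\<^sub>6 * B\<^sub>1 * B\<^sub>2 * wt \<mu> p" for l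
      by (intro AE_lborel_closed[of "\<lambda>l. norm (cauchy_transform (paren_kernel V\<^sub>1 V\<^sub>2 p) l)"] continuous_on_norm continuous_on_const)
    then show ?case
      using elim by simp
  qed
  show "AE p in lborel. ((\<lambda>l. I_op \<theta> U\<^sub>1 U\<^sub>2 (l, p)) \<longlongrightarrow> 0) at_infinity"
    using rep
  proof eventually_elim
    case (elim p)
    have sd: "strip_dominated (B\<^sub>1 * B\<^sub>2 * (1 + 1 / norm p)) (paren_kernel V\<^sub>1 V\<^sub>2 p)"
      using elim V1 V2 by (intro paren_kernel_dominated) auto
    show ?case
      using cauchy_transform_at_infinity[OF sd] elim by simp
  qed
  have [measurable]: "V\<^sub>1 \<in> borel_measurable borel" "V\<^sub>2 \<in> borel_measurable borel"
    using V1 V2 by (auto simp: wbounded_def)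
  have "(\<lambda>(x, y). paren_kernel V\<^sub>1 V\<^sub>2 (snd x) y / (fst y - fst x)) \<in> borel_measurable (borel \<Otimes>\<^sub>M borel :: ((complex \<times> (real^3)) \<times> complex \<times> real) measure)"
    unfolding paren_kernel_def by measurable
  then have "(\<lambda>x. cauchy_transform (paren_kernel V\<^sub>1 V\<^sub>2 (snd x)) (fst x)) \<in> borel_measurable (borel :: (complex \<times> (real^3)) measure)"
    unfolding cauchy_transform_def by (intro lborel.borel_measurable_lebesgue_integral) simp
  moreover have "AE p in lborel. \<forall>l. I_op \<theta> U\<^sub>1 U\<^sub>2 (l, p) = cauchy_transform (paren_kernel V\<^sub>1 V\<^sub>2 (snd (l, p))) (fst (l, p))"
    using rep by eventually_elim simp
  ultimately show "\<exists>J\<in>borel_measurable borel. AE p in lborel. \<forall>l. I_op \<theta> U\<^sub>1 U\<^sub>2 (l, p) = J (l, p)"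
    by (intro bexI[where x = "\<lambda>x. cauchy_transform (paren_kernel V\<^sub>1 V\<^sub>2 (snd x)) (fst x)"])
qed

text \<open>The kernels of the representatives are bilinear and their Cauchy integrals converge
  absolutely, so that additivity holds for almost every p and for every l.\<close>

lemma I_op_diff:
  assumes U: "ess_wbounded \<mu> B U" and U': "ess_wbounded \<mu> B' U'" and W: "ess_wbounded \<mu> D W"
  shows "AE p in lborel. \<forall>l. I_op \<theta> (\<lambda>x. U x - U' x) W (l, p) = I_op \<theta> U W (l, p) - I_op \<theta> U' W (l, p)"
    and "AE p in lborel. \<forall>l. I_op \<theta> W (\<lambda>x. U x - U' x) (l, p) = I_op \<theta> W U (l, p) - I_op \<theta> W U' (l, p)"
proof -
  obtain V where V: "wbounded \<mu> B V" "AE x in lborel. U x = V x"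
    using U by (rule wbounded_representative)
  obtain V' where V': "wbounded \<mu> B' V'" "AE x in lborel. U' x = V' x"
    using U' by (rule wbounded_representative)
  obtain Z where Z: "wbounded \<mu> D Z" "AE x in lborel. W x = Z x"
    using W by (rule wbounded_representative)
  have d: "wbounded \<mu> (B + B') (\<lambda>x. V x - V' x)" "AE x in lborel. U x - U' x = V x - V' x"
    using wbounded_diff[OF V(1) V'(1)] V(2) V'(2) by (auto elim: eventually_elim2)
  show "AE p in lborel. \<forall>l. I_op \<theta> (\<lambda>x. U x - U' x) W (l, p) = I_op \<theta> U W (l, p) - I_op \<theta> U' W (l, p)"
    using I_op_eq_paren_kernel[OF d(1) Z(1) d(2) Z(2)] I_op_eq_paren_kernel[OF V(1) Z(1) V(2) Z(2)] I_op_eq_paren_kernel[OF V'(1) Z(1) V'(2) Z(2)]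
  proof eventually_elim
    case (elim p)
    have "cauchy_transform (paren_kernel (\<lambda>x. V x - V' x) Z p) l = cauchy_transform (paren_kernel V Z p) l - cauchy_transform (paren_kernel V' Z p) l" for l
    proof -
      have "paren_kernel (\<lambda>x. V x - V' x) Z p y / (fst y - l) = paren_kernel V Z p y / (fst y - l) - paren_kernel V' Z p y / (fst y - l)" for y
        by (simp add: paren_kernel_def circle_product_def algebra_simps diff_divide_distrib)
      moreover have "integrable lborel (\<lambda>y. paren_kernel V Z p y / (fst y - l))" "integrable lborel (\<lambda>y. paren_kernel V' Z p y / (fst y - l))"
        using elim by (auto intro!: integrable_cauchy_transform[OF paren_kernel_dominated] V V' Z)
      ultimately show ?thesis
        unfolding cauchy_transform_def by simp
    qed
    then show ?case
      using elim by simp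
  qed
  show "AE p in lborel. \<forall>l. I_op \<theta> W (\<lambda>x. U x - U' x) (l, p) = I_op \<theta> W U (l, p) - I_op \<theta> W U' (l, p)"
    using I_op_eq_paren_kernel[OF Z(1) d(1) Z(2) d(2)] I_op_eq_paren_kernel[OF Z(1) V(1) Z(2) V(2)] I_op_eq_paren_kernel[OF Z(1) V'(1) Z(2) V'(2)]
  proof eventually_elim
    case (elim p)
    have "cauchy_transform (paren_kernel Z (\<lambda>x. V x - V' x) p) l = cauchy_transform (paren_kernel Z V p) l - cauchy_transform (paren_kernel Z V' p) l" for l
    proof -
      have "paren_kernel Z (\<lambda>x. V x - V' x) p y / (fst y - l) = paren_kernel Z V p y / (fst y - l) - paren_kernel Z V' p y / (fst y - l)" for y
        by (simp add: paren_kernel_def circle_product_def algebra_simps diff_divide_distrib)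
      moreover have "integrable lborel (\<lambda>y. paren_kernel Z V p y / (fst y - l))" "integrable lborel (\<lambda>y. paren_kernel Z V' p y / (fst y - l))"
        using elim by (auto intro!: integrable_cauchy_transform[OF paren_kernel_dominated] V V' Z)
      ultimately show ?thesis
        unfolding cauchy_transform_def by simp
    qed
    then show ?case
      using elim by simp
  qed
qed

text \<open>The difference of the squares is written as (U - U') U + U' (U - U'). Each of the two
  terms is bounded by means of \<open>c\<^sub>6\<close>, whence the factor 2.\<close>

lemma N_op_diff_bound:
  assumes U: "ess_wbounded \<mu> B U" and U': "ess_wbounded \<mu> B U'" and D: "ess_wbounded \<mu> D (\<lambda>x. U x - U' x)"
  shows "AE p in lborel. \<forall>l. norm (N_op \<theta> U (l, p) - N_op \<theta> U' (l, p)) \<le> 2 * c\<^sub>6 * B * D * wt \<mu> p"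
  using I_op_diff(1)[OF U U' U] I_op_diff(2)[OF U U' U'] I_op_bound[OF D U] I_op_bound[OF U' D]
proof eventually_elim
  case (elim p)
  show ?case
  proof
    fix l
    have "N_op \<theta> U (l, p) - N_op \<theta> U' (l, p) = I_op \<theta> (\<lambda>x. U x - U' x) U (l, p) + I_op \<theta> U' (\<lambda>x. U x - U' x) (l, p)"
      using elim(1,2) by (simp add: N_op_def)
    then have "norm (N_op \<theta> U (l, p) - N_op \<theta> U' (l, p)) \<le> norm (I_op \<theta> (\<lambda>x. U x - U' x) U (l, p)) + norm (I_op \<theta> U' (\<lambda>x. U x - U' x) (l, p))"
      by (simp add: norm_triangle_ineq)
    also have "\<dots> \<le> c\<^sub>6 * D * B * wt \<mu> p + c\<^sub>6 * B * D * wt \<mu> p"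
      using elim(3,4) by (intro add_mono) auto
    finally show "norm (N_op \<theta> U (l, p) - N_op \<theta> U' (l, p)) \<le> 2 * c\<^sub>6 * B * D * wt \<mu> p"
      by (simp add: mult_ac)
  qed
qed

section \<open>The right-hand side of the nonlinear equation for a given \<gamma>\<close>

context
  fixes \<gamma> :: "real^3 \<Rightarrow> real^3"
  assumes gamma_meas: "\<gamma> \<in> borel_measurable lebesgue"
begin

lemma lam0_measurable: "lam0 \<theta> \<gamma> \<in> borel_measurable lebesgue"
proof -
  note [measurable] = gamma_meas
  have id [measurable]: "(\<lambda>p::real^3. p) \<in> borel_measurable lebesgue"
    by (rule measurable_completion) simp
  have t [measurable]: "(\<lambda>p. th p) \<in> borel_measurable lebesgue"
    by (rule measurable_completion) simp
  have [measurable]: "(\<lambda>p. omega th p) \<in> borel_measurable lebesgue"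
    by (rule borel_measurable_omega[OF t id])
  have m: "lam0 th \<gamma> \<in> borel_measurable lebesgue"
    unfolding lam0_def[abs_def] theta_i_omega_def by measurable
  have "AE p in lebesgue. lam0 th \<gamma> p = lam0 \<theta> \<gamma> p"
  proof (rule AE_completion)
    show "AE p in lborel. lam0 th \<gamma> p = lam0 \<theta> \<gamma> p"
      using AE_not_axis[of \<nu>]
    proof eventually_elim
      case (elim p)
      then show ?case
        using coordinates_cong(2)[of \<theta> p th] th_eq[of p] by (simp add: lam0_def)
    qed
  qed
  with m show ?thesis
    by (rule borel_measurable_AE)
qed

text \<open>The graph of \<open>lam0\<close> is a null set, so measurability of N(U) as a class says
  nothing about it. The Borel function of \<open>I_op_borel\<close>, which agrees with N(U) for all
  l, is composed with a Borel representative of \<open>lam0\<close>.\<close>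

lemma N_lam0_measurable:
  assumes U: "ess_wbounded \<mu> B U"
  shows "(\<lambda>p. N_op \<theta> U (lam0 \<theta> \<gamma> p, p)) \<in> borel_measurable lebesgue"
    and "\<exists>f\<in>borel_measurable borel. AE p in lborel. N_op \<theta> U (lam0 \<theta> \<gamma> p, p) = f p"
proof -
  obtain J where J: "J \<in> borel_measurable borel" "AE p in lborel. \<forall>l. I_op \<theta> U U (l, p) = J (l, p)"
    by (rule bexE[OF I_op_borel[OF U U]])
  obtain a where a: "a \<in> borel_measurable borel" "AE p in lborel. lam0 \<theta> \<gamma> p = a p"
    by (rule lebesgue_borel_representative[OF lam0_measurable])
  have "(\<lambda>p. (a p, p)) \<in> borel_measurable borel"
    using a(1) by (intro borel_measurable_Pair) auto
  from measurable_compose[OF this J(1)] have m: "(\<lambda>p. J (a p, p)) \<in> borel_measurable borel" .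
  have ae: "AE p in lborel. N_op \<theta> U (lam0 \<theta> \<gamma> p, p) = J (a p, p)"
    using J(2) a(2) by eventually_elim (simp add: N_op_def)
  then show "\<exists>f\<in>borel_measurable borel. AE p in lborel. N_op \<theta> U (lam0 \<theta> \<gamma> p, p) = f p"
    using m by (intro bexI[where x = "\<lambda>p. J (a p, p)"])
  have "(\<lambda>p. J (a p, p)) \<in> borel_measurable lebesgue"
    using m by (intro measurable_completion) simp
  moreover have "AE p in lebesgue. J (a p, p) = N_op \<theta> U (lam0 \<theta> \<gamma> p, p)"
    by (rule AE_completion) (use ae in eventually_elim, simp)
  ultimately show "(\<lambda>p. N_op \<theta> U (lam0 \<theta> \<gamma> p, p)) \<in> borel_measurable lebesgue"
    by (rule borel_measurable_AE)
qed

lemma eq_rhs_measurable: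
  assumes R: "R \<in> borel_measurable lebesgue" and U: "ess_wbounded \<mu> B U"
  shows "eq_rhs \<theta> \<gamma> R U \<in> borel_measurable lebesgue"
proof -
  obtain J where J [measurable]: "J \<in> borel_measurable borel" and JI: "AE p in lborel. \<forall>l. I_op \<theta> U U (l, p) = J (l, p)"
    by (rule bexE[OF I_op_borel[OF U U]])
  obtain f where f [measurable]: "f \<in> borel_measurable borel" and fN: "AE p in lborel. N_op \<theta> U (lam0 \<theta> \<gamma> p, p) = f p"
    by (rule bexE[OF N_lam0_measurable(2)[OF U]])
  obtain g where g [measurable]: "g \<in> borel_measurable borel" and gR: "AE p in lborel. R p = g p"
    by (rule lebesgue_borel_representative[OF R])
  have "(\<lambda>x. g (snd x) + (J x - f (snd x))) \<in> borel_measurable (borel :: (complex \<times> (real^3)) measure)"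
    by measurable
  then have m: "(\<lambda>x. g (snd x) + (J x - f (snd x))) \<in> borel_measurable (lebesgue :: (complex \<times> (real^3)) measure)"
    by (intro measurable_completion) simp
  have "AE x in lborel. g (snd x) + (J x - f (snd x)) = eq_rhs \<theta> \<gamma> R U x"
  proof (rule AE_snd_I)
    show "AE p in lborel. \<forall>l. g (snd (l, p)) + (J (l, p) - f (snd (l, p))) = eq_rhs \<theta> \<gamma> R U (l, p)"
      using JI fN gR by eventually_elim (simp add: eq_rhs_def M_op_def N_op_def)
  qed
  then have "AE x in lebesgue. g (snd x) + (J x - f (snd x)) = eq_rhs \<theta> \<gamma> R U x"
    by (rule AE_completion)
  with m show ?thesis
    by (rule borel_measurable_AE)
qed

lemma eq_rhs_ess_wbounded:
  assumes R: "R \<in> borel_measurable lebesgue" "AE p in lborel. norm (R p) \<le> A * wt \<mu> p" and A: "A \<ge> 0" and U: "ess_wbounded \<mu> B U"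
  shows "ess_wbounded \<mu> (A + 2 * c\<^sub>6 * B\<^sup>2) (eq_rhs \<theta> \<gamma> R U)"
proof -
  have "AE x in lborel. norm (eq_rhs \<theta> \<gamma> R U x) \<le> (A + 2 * c\<^sub>6 * B\<^sup>2) * wt \<mu> (snd x)"
  proof (rule AE_snd_I)
    show "AE p in lborel. \<forall>l. norm (eq_rhs \<theta> \<gamma> R U (l, p)) \<le> (A + 2 * c\<^sub>6 * B\<^sup>2) * wt \<mu> (snd (l, p))"
      using R(2) I_op_bound[OF U U]
    proof eventually_elim
      case (elim p)
      show ?case
      proof
        fix l
        have "norm (eq_rhs \<theta> \<gamma> R U (l, p)) \<le> norm (R p) + (norm (N_op \<theta> U (l, p)) + norm (N_op \<theta> U (lam0 \<theta> \<gamma> p, p)))"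
          unfolding eq_rhs_def M_op_def by (simp add: norm_triangle_le norm_triangle_ineq4)
        also have "\<dots> \<le> A * wt \<mu> p + (c\<^sub>6 * B * B * wt \<mu> p + c\<^sub>6 * B * B * wt \<mu> p)"
          using elim by (intro add_mono) (auto simp: N_op_def)
        finally show "norm (eq_rhs \<theta> \<gamma> R U (l, p)) \<le> (A + 2 * c\<^sub>6 * B\<^sup>2) * wt \<mu> (snd (l, p))"
          by (simp add: algebra_simps power2_eq_square)
      qed
    qed
  qed
  then show ?thesis
    using A c6_pos eq_rhs_measurable[OF R(1) U] by (simp add: ess_wbounded_def)
qed

text \<open>The factor 4 is 2 from the splitting of the quadratic form times 2 from the two values
  of N in M.\<close>

lemma eq_rhs_diff:
  assumes R: "R \<in> borel_measurable lebesgue" and U: "ess_wbounded \<mu> B U" and U': "ess_wbounded \<mu> B U'" and D: "ess_wbounded \<mu> D (\<lambda>x. U x - U' x)"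
  shows "ess_wbounded \<mu> (4 * c\<^sub>6 * B * D) (\<lambda>x. eq_rhs \<theta> \<gamma> R U x - eq_rhs \<theta> \<gamma> R U' x)"
proof -
  have B: "B \<ge> 0" "D \<ge> 0"
    using U D by (auto simp: ess_wbounded_def)
  have "AE x in lborel. norm (eq_rhs \<theta> \<gamma> R U x - eq_rhs \<theta> \<gamma> R U' x) \<le> 4 * c\<^sub>6 * B * D * wt \<mu> (snd x)"
  proof (rule AE_snd_I)
    show "AE p in lborel. \<forall>l. norm (eq_rhs \<theta> \<gamma> R U (l, p) - eq_rhs \<theta> \<gamma> R U' (l, p)) \<le> 4 * c\<^sub>6 * B * D * wt \<mu> (snd (l, p))"
      using N_op_diff_bound[OF U U' D]
    proof eventually_elim
      case (elim p)
      show ?case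
      proof
        fix l
        have "eq_rhs \<theta> \<gamma> R U (l, p) - eq_rhs \<theta> \<gamma> R U' (l, p) = (N_op \<theta> U (l, p) - N_op \<theta> U' (l, p)) -
          (N_op \<theta> U (lam0 \<theta> \<gamma> p, p) - N_op \<theta> U' (lam0 \<theta> \<gamma> p, p))"
          by (simp add: eq_rhs_def M_op_def)
        then have "norm (eq_rhs \<theta> \<gamma> R U (l, p) - eq_rhs \<theta> \<gamma> R U' (l, p)) \<le> norm (N_op \<theta> U (l, p) - N_op \<theta> U' (l, p)) +
          norm (N_op \<theta> U (lam0 \<theta> \<gamma> p, p) - N_op \<theta> U' (lam0 \<theta> \<gamma> p, p))"
          by (simp add: norm_triangle_ineq4)
        also have "\<dots> \<le> 2 * c\<^sub>6 * B * D * wt \<mu> p + 2 * c\<^sub>6 * B * D * wt \<mu> p"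
          using elim by (intro add_mono) auto
        finally show "norm (eq_rhs \<theta> \<gamma> R U (l, p) - eq_rhs \<theta> \<gamma> R U' (l, p)) \<le> 4 * c\<^sub>6 * B * D * wt \<mu> (snd (l, p))"
          by (simp add: mult_ac)
      qed
    qed
  qed
  moreover have "(\<lambda>x. eq_rhs \<theta> \<gamma> R U x - eq_rhs \<theta> \<gamma> R U' x) \<in> borel_measurable lebesgue"
    using eq_rhs_measurable[OF R U] eq_rhs_measurable[OF R U'] by measurable
  ultimately show ?thesis
    using B c6_pos by (simp add: ess_wbounded_def)
qed

end

end

section \<open>The fixed point equation\<close>

lemma ess_wbounded_cong:
  assumes U: "ess_wbounded \<mu> B U" and eq: "AE x in lborel. U x = V x"
  shows "ess_wbounded \<mu> B V"
proof -
  have "U \<in> borel_measurable lebesgue"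
    using U by (simp add: ess_wbounded_def)
  moreover have "AE x in lebesgue. U x = V x"
    using eq by (rule AE_completion)
  ultimately have "V \<in> borel_measurable lebesgue"
    by (rule borel_measurable_AE)
  moreover have "AE x in lborel. norm (U x) \<le> B * wt \<mu> (snd x)"
    using U by (simp add: ess_wbounded_def)
  then have "AE x in lborel. norm (V x) \<le> B * wt \<mu> (snd x)"
    using eq by eventually_elim simp
  ultimately show ?thesis
    using U by (simp add: ess_wbounded_def)
qed

lemma ess_wbounded_limit:
  assumes U: "\<And>n. ess_wbounded \<mu> (B n) U" and B: "B \<longlonglongrightarrow> b"
  shows "ess_wbounded \<mu> b U"
proof -
  have "AE x in lborel. \<forall>n. norm (U x) \<le> B n * wt \<mu> (snd x)"
    using U by (simp add: AE_all_countable ess_wbounded_def)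
  then have "AE x in lborel. norm (U x) \<le> b * wt \<mu> (snd x)"
  proof eventually_elim
    case (elim x)
    have "(\<lambda>n. B n * wt \<mu> (snd x)) \<longlonglongrightarrow> b * wt \<mu> (snd x)"
      by (rule tendsto_mult_right[OF B])
    then show ?case
      by (rule LIMSEQ_le_const) (use elim in auto)
  qed
  moreover have "b \<ge> 0"
    by (rule LIMSEQ_le_const[OF B]) (use U in \<open>auto simp: ess_wbounded_def\<close>)
  ultimately show ?thesis
    using U by (auto simp: ess_wbounded_def)
qed

lemma ess_wbounded_zeroD: "ess_wbounded \<mu> 0 U \<Longrightarrow> AE x in lborel. U x = 0"
  by (simp add: ess_wbounded_def)

lemma geometric_tail:
  fixes f :: "nat \<Rightarrow> complex"
  assumes step: "\<And>n. norm (f (Suc n) - f n) \<le> q ^ n * c" and q: "0 \<le> q" "q < 1"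
  shows "convergent f" "norm (f n - lim f) \<le> q ^ n * c / (1 - q)"
proof -
  have sums: "(\<lambda>n. q ^ n * c) sums (c / (1 - q))"
    using sums_mult2[OF geometric_sums[of q], of c] q by simp
  have "summable (\<lambda>n. f (Suc n) - f n)"
    by (rule summable_comparison_test'[OF sums_summable[OF sums], of 0]) (rule step)
  then have "convergent (\<lambda>n. f n - f 0)"
    unfolding summable_iff_convergent sum_lessThan_telescope .
  from convergent_add[OF this convergent_const[of "f 0"]] have c: "convergent f"
    by simp
  show "convergent f" by fact
  have c0: "c \<ge> 0"
    using order_trans[OF norm_ge_zero step[of 0]] by simp
  have k: "norm (f (n + k) - f n) \<le> q ^ n * c * (\<Sum>i<k. q ^ i)" for k
  proof (induction k)
    case (Suc k)
    have "norm (f (n + Suc k) - f n) \<le> norm (f (n + Suc k) - f (n + k)) + norm (f (n + k) - f n)"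
      using norm_triangle_ineq[of "f (n + Suc k) - f (n + k)" "f (n + k) - f n"] by simp
    also have "\<dots> \<le> q ^ (n + k) * c + q ^ n * c * (\<Sum>i<k. q ^ i)"
      using step[of "n + k"] Suc by simp
    finally show ?case
      by (simp add: algebra_simps power_add)
  qed simp
  have "norm (f (n + k) - f n) \<le> q ^ n * c / (1 - q)" for k
  proof -
    have "(\<Sum>i<k. q ^ i) \<le> 1 / (1 - q)"
      using sum_le_suminf[of "\<lambda>i. q ^ i" "{..<k}"] q by (simp add: suminf_geometric summable_geometric)
    then have "q ^ n * c * (\<Sum>i<k. q ^ i) \<le> q ^ n * c * (1 / (1 - q))"
      using q c0 by (intro mult_left_mono) auto
    with k[of k] show ?thesis
      by simp
  qed
  moreover have "(\<lambda>k. norm (f (n + k) - f n)) \<longlonglongrightarrow> norm (lim f - f n)"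
    using LIMSEQ_ignore_initial_segment[OF convergent_LIMSEQ_iff[THEN iffD1, OF c], of n]
    by (intro tendsto_intros) (simp add: add.commute)
  ultimately have "norm (lim f - f n) \<le> q ^ n * c / (1 - q)"
    by (intro LIMSEQ_le_const2) auto
  then show "norm (f n - lim f) \<le> q ^ n * c / (1 - q)"
    by (simp add: norm_minus_commute)
qed

text \<open>A bounds the data and 2 A is the radius of the ball. No potential occurs here, so that
  arbitrary approximations of R are covered on the same footing as R itself.\<close>

locale inversion = reconstruction \<nu> \<theta> \<mu> c\<^sub>6 for \<nu> \<theta> \<mu> c\<^sub>6 +
  fixes \<gamma> :: "real^3 \<Rightarrow> real^3" and A :: real
  assumes gamma_meas: "\<gamma> \<in> borel_measurable lebesgue"
    and A_nonneg: "A \<ge> 0" and contraction: "8 * c\<^sub>6 * A < 1"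
begin

text \<open>The constant \<open>4 * c\<^sub>6 * B\<close> of \<open>eq_rhs_diff\<close> on the ball
  of radius B = 2 A.\<close>

definition q :: real
  where "q = 8 * c\<^sub>6 * A"

lemma q: "0 \<le> q" "q < 1"
  using A_nonneg c6_pos contraction by (auto simp: q_def)

definition datum :: "(real^3 \<Rightarrow> complex) \<Rightarrow> bool"
  where "datum R \<longleftrightarrow> R \<in> borel_measurable lebesgue \<and> (AE p in lborel. norm (R p) \<le> A * wt \<mu> p)"

definition fixed_point :: "(real^3 \<Rightarrow> complex) \<Rightarrow> (complex \<times> (real^3) \<Rightarrow> complex) \<Rightarrow> bool"
  where "fixed_point R U \<longleftrightarrow> ess_wbounded \<mu> (2 * A) U \<and> (AE x in lborel. U x = eq_rhs \<theta> \<gamma> R U x)"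

lemma is_solution_iff: "is_solution \<mu> \<nu> \<theta> \<gamma> (2 * A) R U \<longleftrightarrow> fixed_point R U"
  unfolding is_solution_def fixed_point_def AE_lebesgue_on_LP_dom
  using ess_wboundedI[of U \<mu> \<nu> "2 * A"] ess_wbounded_Linf2[of \<mu> "2 * A" U \<nu>] wnorm2_le[of \<mu> "2 * A" U \<nu>] by blast

lemma eq_rhs_bounded:
  assumes R: "datum R" and U: "ess_wbounded \<mu> (2 * A) U"
  shows "ess_wbounded \<mu> (2 * A) (eq_rhs \<theta> \<gamma> R U)"
proof (rule ess_wbounded_mono)
  show "ess_wbounded \<mu> (A + 2 * c\<^sub>6 * (2 * A)\<^sup>2) (eq_rhs \<theta> \<gamma> R U)"
    using R A_nonneg U by (intro eq_rhs_ess_wbounded gamma_meas) (auto simp: datum_def)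
  \<comment> \<open>The quadratic part of the bound, \<open>2 * c\<^sub>6 * (2 * A)\<^sup>2\<close>,
    is A q.\<close>
  have "A * q \<le> A * 1"
    using q A_nonneg by (intro mult_left_mono) auto
  then show "A + 2 * c\<^sub>6 * (2 * A)\<^sup>2 \<le> 2 * A"
    by (simp add: q_def power2_eq_square algebra_simps)
qed

lemma eq_rhs_contraction:
  assumes R: "datum R" and U: "ess_wbounded \<mu> (2 * A) U" and U': "ess_wbounded \<mu> (2 * A) U'" and D: "ess_wbounded \<mu> D (\<lambda>x. U x - U' x)"
  shows "ess_wbounded \<mu> (q * D) (\<lambda>x. eq_rhs \<theta> \<gamma> R U x - eq_rhs \<theta> \<gamma> R U' x)"
  using eq_rhs_diff[OF gamma_meas _ U U' D, of R] R by (simp add: datum_def q_def mult.assoc)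

abbreviation approx :: "(real^3 \<Rightarrow> complex) \<Rightarrow> nat \<Rightarrow> complex \<times> (real^3) \<Rightarrow> complex"
  where "approx R \<equiv> successive_approx \<theta> \<gamma> R"

lemma approx_Suc: "approx R (Suc n) = eq_rhs \<theta> \<gamma> R (approx R n)"
  by (simp add: successive_approx_def)

lemma approx_bounded:
  assumes R: "datum R"
  shows "ess_wbounded \<mu> (2 * A) (approx R n)"
proof (induction n)
  case 0
  then show ?case
    using A_nonneg by (simp add: successive_approx_def ess_wbounded_def)
next
  case (Suc n)
  then show ?case
    unfolding approx_Suc by (rule eq_rhs_bounded[OF R])
qed

lemma approx_step:
  assumes R: "datum R"
  shows "ess_wbounded \<mu> (q ^ n * (2 * A)) (\<lambda>x. approx R (Suc n) x - approx R n x)"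
proof (induction n)
  case 0
  have "approx R 0 = (\<lambda>_. 0)"
    by (simp add: successive_approx_def)
  then show ?case
    using approx_bounded[OF R, of "Suc 0"] by simp
next
  case (Suc n)
  from eq_rhs_contraction[OF R approx_bounded[OF R] approx_bounded[OF R] Suc] show ?case
    by (simp add: approx_Suc[symmetric] mult.assoc)
qed

lemma power_tendsto_zero: "(\<lambda>n. q ^ n * c) \<longlonglongrightarrow> 0"
  using tendsto_mult_left_zero[OF LIMSEQ_realpow_zero[OF q], of c] .

text \<open>The steps of the iteration are geometrically small almost everywhere, so the limit can
  be formed at the points by \<open>lim\<close>. Its bound and its equation are then read off from
  the tail estimates, by letting n tend to infinity in the constants.\<close>

lemma fixed_point_exists:
  assumes R: "datum R"
  obtains U where "fixed_point R U"
proof -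
  define U where "U x = lim (\<lambda>n. approx R n x)" for x
  have meas: "approx R n \<in> borel_measurable lebesgue" for n
    using approx_bounded[OF R, of n] by (simp add: ess_wbounded_def)
  have U_meas: "U \<in> borel_measurable lebesgue"
    unfolding U_def[abs_def] by (rule borel_measurable_lim_metric[OF meas])
  have steps: "AE x in lborel. \<forall>n. norm (approx R (Suc n) x - approx R n x) \<le> q ^ n * (2 * A) * wt \<mu> (snd x)"
    using approx_step[OF R] by (simp add: AE_all_countable ess_wbounded_def)
  then have tail: "AE x in lborel. \<forall>n. norm (approx R n x - U x) \<le> q ^ n * (2 * A / (1 - q)) * wt \<mu> (snd x)"
  proof eventually_elim
    case (elim x)
    have "norm (approx R n x - U x) \<le> q ^ n * (2 * A * wt \<mu> (snd x)) / (1 - q)" for n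
      unfolding U_def by (rule geometric_tail(2)) (use elim q in \<open>auto simp: mult.assoc\<close>)
    then show ?case
      by (simp add: mult_ac)
  qed
  have diff: "ess_wbounded \<mu> (q ^ n * (2 * A / (1 - q))) (\<lambda>x. approx R n x - U x)" for n
  proof -
    have "AE x in lborel. norm (approx R n x - U x) \<le> q ^ n * (2 * A / (1 - q)) * wt \<mu> (snd x)"
      using tail by eventually_elim (rule spec)
    moreover have "(\<lambda>x. approx R n x - U x) \<in> borel_measurable lebesgue"
      by (intro borel_measurable_diff meas U_meas)
    ultimately show ?thesis
      using q A_nonneg by (simp add: ess_wbounded_def)
  qed
  have U_bdd: "ess_wbounded \<mu> (2 * A) U"
  proof (rule ess_wbounded_limit)
    fix n
    from ess_wbounded_diff[OF approx_bounded[OF R] diff, of n n]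
    show "ess_wbounded \<mu> (2 * A + q ^ n * (2 * A / (1 - q))) U"
      by simp
    show "(\<lambda>n. 2 * A + q ^ n * (2 * A / (1 - q))) \<longlonglongrightarrow> 2 * A"
      using tendsto_add[OF tendsto_const power_tendsto_zero, of "2 * A" "2 * A / (1 - q)"] by simp
  qed
  have "ess_wbounded \<mu> 0 (\<lambda>x. U x - eq_rhs \<theta> \<gamma> R U x)"
  proof (rule ess_wbounded_limit)
    fix n
    have "ess_wbounded \<mu> (q * (q ^ n * (2 * A / (1 - q)))) (\<lambda>x. approx R (Suc n) x - eq_rhs \<theta> \<gamma> R U x)"
      unfolding approx_Suc by (rule eq_rhs_contraction[OF R approx_bounded[OF R] U_bdd diff])
    from ess_wbounded_diff[OF this diff[of "Suc n"]]
    have "ess_wbounded \<mu> (q ^ n * (2 * q * (2 * A / (1 - q)))) (\<lambda>x. U x - eq_rhs \<theta> \<gamma> R U x)"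
      by (simp add: mult_ac)
    then show "ess_wbounded \<mu> (q ^ n * (2 * q * (2 * A / (1 - q)))) (\<lambda>x. U x - eq_rhs \<theta> \<gamma> R U x)" .
  qed (rule power_tendsto_zero)
  then have "fixed_point R U"
    using ess_wbounded_zeroD[of \<mu> "\<lambda>x. U x - eq_rhs \<theta> \<gamma> R U x"] U_bdd by (simp add: fixed_point_def)
  then show thesis
    by (rule that)
qed

text \<open>Every fixed point in the ball attracts the same approximations at a geometric rate. This
  gives both the convergence and the uniqueness.\<close>

lemma approx_fixed_point_diff:
  assumes R: "datum R" and U: "fixed_point R U"
  shows "ess_wbounded \<mu> (q ^ n * (2 * A)) (\<lambda>x. approx R n x - U x)"
proof (induction n)
  case 0
  have "ess_wbounded \<mu> (0 + 2 * A) (\<lambda>x. 0 - U x)"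
    using U by (intro ess_wbounded_diff) (auto simp: fixed_point_def ess_wbounded_def)
  then show ?case
    by (simp add: successive_approx_def)
next
  case (Suc n)
  have "ess_wbounded \<mu> (q * (q ^ n * (2 * A))) (\<lambda>x. approx R (Suc n) x - eq_rhs \<theta> \<gamma> R U x)"
    unfolding approx_Suc by (rule eq_rhs_contraction[OF R approx_bounded[OF R] _ Suc]) (use U in \<open>simp add: fixed_point_def\<close>)
  moreover have "AE x in lborel. approx R (Suc n) x - eq_rhs \<theta> \<gamma> R U x = approx R (Suc n) x - U x"
    using U by (auto simp: fixed_point_def)
  ultimately have "ess_wbounded \<mu> (q * (q ^ n * (2 * A))) (\<lambda>x. approx R (Suc n) x - U x)"
    by (rule ess_wbounded_cong)
  then show ?case
    by (simp add: mult.assoc)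
qed

lemma fixed_point_unique:
  assumes R: "datum R" and U: "fixed_point R U" "fixed_point R V"
  shows "AE x in lborel. U x = V x"
proof -
  have "ess_wbounded \<mu> 0 (\<lambda>x. V x - U x)"
  proof (rule ess_wbounded_limit)
    fix n
    from ess_wbounded_diff[OF approx_fixed_point_diff[OF R U(1), of n] approx_fixed_point_diff[OF R U(2), of n]]
    show "ess_wbounded \<mu> (q ^ n * (4 * A)) (\<lambda>x. V x - U x)"
      by (simp add: mult_ac)
  qed (rule power_tendsto_zero)
  from ess_wbounded_zeroD[OF this] show ?thesis
    by eventually_elim simp
qed

lemma unique_solution:
  assumes R: "datum R" and U: "fixed_point R U"
  shows "is_unique_solution \<mu> \<nu> \<theta> \<gamma> (2 * A) R U"
  unfolding is_unique_solution_def is_solution_iff AE_lebesgue_on_LP_dom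
  by (intro conjI allI impI U fixed_point_unique[OF R _ U])

lemma approx_converges_fixed_point:
  assumes R: "datum R" and U: "fixed_point R U"
  shows "approx_converges \<mu> \<nu> \<theta> \<gamma> R U"
  unfolding approx_converges_def
proof (intro conjI allI)
  show "approx R n \<in> Linf2 \<mu> \<nu>" for n
    by (rule ess_wbounded_Linf2[OF approx_bounded[OF R]])
  have lim: "(\<lambda>n. ereal (q ^ n * (2 * A))) \<longlonglongrightarrow> 0"
    unfolding zero_ereal_def by (rule tendsto_ereal[OF power_tendsto_zero])
  have le: "wnorm2 \<mu> \<nu> (\<lambda>x. approx R n x - U x) \<le> ereal (q ^ n * (2 * A))" for n
    by (rule wnorm2_le[OF approx_fixed_point_diff[OF R U]])
  show "(\<lambda>n. wnorm2 \<mu> \<nu> (\<lambda>x. approx R n x - U x)) \<longlonglongrightarrow> 0"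
    by (rule tendsto_sandwich[OF _ _ tendsto_const[of 0] lim]) (simp_all add: wnorm2_nonneg le)
qed

text \<open>A bound D for the difference of the solutions can be improved to d + q D. Iterating this
  from the a priori bound 4 A leads to d / (1 - q). In \<open>v_rec\<close> only one value of N
  occurs, which contributes half as much as M, and d + (q / 2) d / (1 - q) <= d / (1 - q).\<close>

lemma fixed_point_stability:
  assumes R: "datum R" and U: "fixed_point R U" and R': "datum R'" and U': "fixed_point R' U'"
    and d: "d \<ge> 0" "AE p in lborel. norm (R p - R' p) \<le> d * wt \<mu> p"
  shows "AE p in lborel. norm (v_rec \<theta> \<gamma> R U p - v_rec \<theta> \<gamma> R' U' p) \<le> d / (1 - q) * wt \<mu> p"
proof -
  have bU: "ess_wbounded \<mu> (2 * A) U" "ess_wbounded \<mu> (2 * A) U'"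
    using U U' by (auto simp: fixed_point_def)
  have RR': "ess_wbounded \<mu> d (\<lambda>x. R (snd x) - R' (snd x))"
  proof -
    have m: "(\<lambda>x. f (snd x)) \<in> borel_measurable lebesgue" if f: "f \<in> borel_measurable lebesgue" for f :: "real^3 \<Rightarrow> complex"
    proof -
      obtain g where g: "g \<in> borel_measurable borel" "AE p in lborel. f p = g p"
        by (rule lebesgue_borel_representative[OF f])
      have "(\<lambda>x. g (snd x)) \<in> borel_measurable lebesgue"
        using g(1) by (intro measurable_completion) simp
      moreover have "AE x in lebesgue. g (snd x) = f (snd x)"
        by (intro AE_completion AE_snd_I) (use g(2) in \<open>eventually_elim, simp\<close>)
      ultimately show ?thesis
        by (rule borel_measurable_AE)
    qed
    have "AE x in lborel. norm (R (snd x) - R' (snd x)) \<le> d * wt \<mu> (snd x)"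
      by (rule AE_snd_I) (use d(2) in \<open>eventually_elim, simp\<close>)
    then show ?thesis
      using d(1) R R' by (auto simp: ess_wbounded_def datum_def intro!: borel_measurable_diff m)
  qed
  have improve: "ess_wbounded \<mu> (d + q * D) (\<lambda>x. U x - U' x)" if D: "ess_wbounded \<mu> D (\<lambda>x. U x - U' x)" for D
  proof -
    have e: "ess_wbounded \<mu> (q * D) (\<lambda>x. eq_rhs \<theta> \<gamma> R' U x - eq_rhs \<theta> \<gamma> R' U' x)"
      by (rule eq_rhs_contraction[OF R' bU D])
    have n: "ess_wbounded \<mu> B (\<lambda>x. - f x)" if "ess_wbounded \<mu> B f" for f B
      using that by (simp add: ess_wbounded_def)
    have "ess_wbounded \<mu> (d + q * D) (\<lambda>x. (R (snd x) - R' (snd x)) - - (eq_rhs \<theta> \<gamma> R' U x - eq_rhs \<theta> \<gamma> R' U' x))"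
      by (rule ess_wbounded_diff[OF RR' n[OF e]])
    moreover have "AE x in lborel. (R (snd x) - R' (snd x)) - - (eq_rhs \<theta> \<gamma> R' U x - eq_rhs \<theta> \<gamma> R' U' x) = U x - U' x"
    proof -
      have "AE x in lborel. U x = eq_rhs \<theta> \<gamma> R U x" "AE x in lborel. U' x = eq_rhs \<theta> \<gamma> R' U' x"
        using U U' by (auto simp: fixed_point_def)
      then show ?thesis
      proof eventually_elim
        case (elim x)
        have "R (snd x) + eq_rhs \<theta> \<gamma> R' U x = R' (snd x) + eq_rhs \<theta> \<gamma> R U x"
          by (simp add: eq_rhs_def case_prod_beta)
        with elim show ?case
          by (simp add: algebra_simps)
      qed
    qed
    ultimately show ?thesis
      by (rule ess_wbounded_cong)
  qed
  have iter: "ess_wbounded \<mu> (q ^ n * (4 * A) + d / (1 - q)) (\<lambda>x. U x - U' x)" for n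
  proof (induction n)
    case 0
    show ?case
      using ess_wbounded_mono[OF ess_wbounded_diff[OF bU]] d(1) q by simp
  next
    case (Suc n)
    have "d + q * (q ^ n * (4 * A) + d / (1 - q)) = q ^ Suc n * (4 * A) + d / (1 - q)"
      using q by (simp add: divide_simps) (simp add: algebra_simps)
    then show ?case
      using improve[OF Suc] by simp
  qed
  have D: "ess_wbounded \<mu> (d / (1 - q)) (\<lambda>x. U x - U' x)"
  proof (rule ess_wbounded_limit[OF iter])
    show "(\<lambda>n. q ^ n * (4 * A) + d / (1 - q)) \<longlonglongrightarrow> d / (1 - q)"
      using tendsto_add[OF power_tendsto_zero tendsto_const, of "4 * A" "d / (1 - q)"] by simp
  qed
  show ?thesis
    using N_op_diff_bound[OF bU D] d(2)
  proof eventually_elim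
    case (elim p)
    have "norm (v_rec \<theta> \<gamma> R U p - v_rec \<theta> \<gamma> R' U' p) =
      norm ((R p - R' p) - (N_op \<theta> U (lam0 \<theta> \<gamma> p, p) - N_op \<theta> U' (lam0 \<theta> \<gamma> p, p)))"
      by (simp add: v_rec_def algebra_simps)
    also have "\<dots> \<le> d * wt \<mu> p + 2 * c\<^sub>6 * (2 * A) * (d / (1 - q)) * wt \<mu> p"
      by (rule order_trans[OF norm_triangle_ineq4]) (use elim in \<open>intro add_mono, auto\<close>)
    also have "\<dots> = (d + q / 2 * (d / (1 - q))) * wt \<mu> p"
      by (simp add: q_def distrib_right)
    also have "\<dots> \<le> (d / (1 - q)) * wt \<mu> p"
    proof (rule mult_right_mono)
      have "q / 2 * (d / (1 - q)) \<le> q * (d / (1 - q))"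
        using q d(1) by (intro mult_right_mono) auto
      also have "d + q * (d / (1 - q)) = d / (1 - q)"
        using q by (simp add: divide_simps) (simp add: algebra_simps)
      finally show "d + q / 2 * (d / (1 - q)) \<le> d / (1 - q)"
        by simp
    qed simp
    finally show ?case .
  qed
qed

lemma v_rec_measurable:
  assumes "datum R" "fixed_point R U"
  shows "v_rec \<theta> \<gamma> R U \<in> borel_measurable lebesgue"
proof -
  have "ess_wbounded \<mu> (2 * A) U"
    using assms by (simp add: fixed_point_def)
  from N_lam0_measurable(1)[OF gamma_meas this] show ?thesis
    using assms unfolding v_rec_def[abs_def] by (intro borel_measurable_diff) (auto simp: datum_def)
qed

text \<open>The right-hand side of the equation has an ordinary limit, since N(U) tends to 0 at
  infinity. U agrees with it for almost every l only, which the second part of the filter takes into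
  account.\<close>

lemma ess_limit:
  assumes R: "datum R" and U: "fixed_point R U"
  shows "has_ess_limit U (v_rec \<theta> \<gamma> R U)"
proof -
  have bU: "ess_wbounded \<mu> (2 * A) U" and eq: "AE x in lborel. U x = eq_rhs \<theta> \<gamma> R U x"
    using U by (auto simp: fixed_point_def)
  have "AE p in lborel. ((\<lambda>l. U (l, p)) \<longlongrightarrow> v_rec \<theta> \<gamma> R U p) (inf at_infinity (ae_filter lebesgue))"
    using I_op_at_infinity[OF bU bU] AE_prodD(2)[OF eq]
  proof eventually_elim
    case (elim p)
    have "((\<lambda>l. R p + (I_op \<theta> U U (l, p) - N_op \<theta> U (lam0 \<theta> \<gamma> p, p))) \<longlongrightarrow> R p + (0 - N_op \<theta> U (lam0 \<theta> \<gamma> p, p))) at_infinity"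
      by (intro tendsto_add tendsto_diff tendsto_const elim)
    then have "((\<lambda>l. eq_rhs \<theta> \<gamma> R U (l, p)) \<longlongrightarrow> v_rec \<theta> \<gamma> R U p) at_infinity"
      by (simp add: eq_rhs_def M_op_def N_op_def v_rec_def)
    then have lim: "((\<lambda>l. eq_rhs \<theta> \<gamma> R U (l, p)) \<longlongrightarrow> v_rec \<theta> \<gamma> R U p) (inf at_infinity (ae_filter lebesgue))"
      by (rule tendsto_mono[OF inf_le1])
    have "AE l in lebesgue. eq_rhs \<theta> \<gamma> R U (l, p) = U (l, p)"
      by (rule AE_completion) (use elim(2) in eventually_elim, simp)
    then have "\<forall>\<^sub>F l in inf at_infinity (ae_filter lebesgue). eq_rhs \<theta> \<gamma> R U (l, p) = U (l, p)"
      by (rule filter_leD[OF inf_le2])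
    with lim show ?case
      by (rule Lim_transform_eventually)
  qed
  then show ?thesis
    unfolding has_ess_limit_def by (rule AE_completion)
qed

end

section \<open>Reconstruction\<close>

locale direct = reconstruction \<nu> \<theta> \<mu> c\<^sub>6 + F?: faddeev \<mu> C c\<^sub>1 v for \<nu> \<theta> \<mu> C c\<^sub>1 c\<^sub>6 v +
  fixes \<gamma> :: "real^3 \<Rightarrow> real^3"
  assumes gamma_meas: "\<gamma> \<in> borel_measurable lebesgue"
    and gamma: "\<And>p. norm (\<gamma> p) = 1 \<and> \<gamma> p \<bullet> p = 0"
    and C_less: "C < 1 / (c\<^sub>1 + 8 * c\<^sub>6)"
begin

abbreviation Hex :: "complex \<times> (real^3) \<Rightarrow> complex"
  where "Hex \<equiv> (\<lambda>(l, p). Faddeev \<mu> v (k_of \<theta> l p) p)"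

abbreviation Rex :: "real^3 \<Rightarrow> complex"
  where "Rex \<equiv> R_data \<mu> \<gamma> v"

definition k0 :: "real^3 \<Rightarrow> complex^3"
  where "k0 p = cvec ((1/2) *\<^sub>R p) + (\<i> * norm p / 2) *s cvec (\<gamma> p)"

lemma k0: "k0 p \<in> Sigma_var" "denom (k0 p) (- p) = 0"
proof -
  have i: "\<gamma> p \<bullet> \<gamma> p = 1" "\<gamma> p \<bullet> p = 0" "p \<bullet> \<gamma> p = 0"
    using gamma[of p] by (auto simp: norm_eq_1 inner_commute)
  have n: "complex_of_real (norm p) * complex_of_real (norm p) = complex_of_real (p \<bullet> p)"
    by (simp add: dot_square_norm power2_eq_square)
  have ii: "\<i> * a * (\<i> * a) = - (a * a)" for a
    by (simp add: complex_eq_iff)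
  show "k0 p \<in> Sigma_var" "denom (k0 p) (- p) = 0"
    by (simp_all add: Sigma_var_def denom_def k0_def scalar_product_simps cvec_simps i ii n)
qed

lemma Rex_eq: "Rex p = Hsum (k0 p) p"
  unfolding R_data_def k0_def[symmetric] Faddeev_eq_Hsum[OF k0(1)] ..

lemma Rex_measurable: "Rex \<in> borel_measurable lebesgue"
proof -
  note [measurable] = gamma_meas
  have id [measurable]: "(\<lambda>p::real^3. p) \<in> borel_measurable lebesgue"
    by (rule measurable_completion) simp
  have [measurable]: "k0 \<in> borel_measurable lebesgue"
    unfolding k0_def[abs_def] by measurable
  show ?thesis
    unfolding Rex_eq[abs_def] by measurable
qed

lemma Rex_bound: "norm (Rex p) \<le> Hbound * wt \<mu> p"
  unfolding Rex_eq by (rule Hsum_bound[OF k0(1)])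

text \<open>As p is orthogonal to \<theta> and \<omega>, only the part of \<open>k0\<close> along
  \<gamma> contributes to \<open>lam_of\<close>, and there the factor i |p| / 2 cancels. So R is H
  at the parameter \<open>lam0\<close>.\<close>

lemma lam0_coordinate:
  assumes p: "p \<notin> axis_line \<nu>"
  shows "lam0 \<theta> \<gamma> p \<noteq> 0" "k_of \<theta> (lam0 \<theta> \<gamma> p) p = k0 p"
proof -
  interpret F: frame \<theta> p
    using p by (rule frame)
  have "scalar_product (cvec p) (theta_i_omega \<theta> p) = 0"
    by (simp add: theta_i_omega_def scalar_product_simps F.frame_inner)
  then have "lam_of \<theta> (k0 p) p = lam0 \<theta> \<gamma> p"
    using F.norm_p_pos by (simp add: lam_of_def lam0_def k0_def scalar_product_simps cvec_simps)
  with F.lam_of_nonzero_k_of_lam_of[OF k0] show "lam0 \<theta> \<gamma> p \<noteq> 0" "k_of \<theta> (lam0 \<theta> \<gamma> p) p = k0 p"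
    by auto
qed

lemma Hex_eq:
  assumes "p \<notin> axis_line \<nu>" "l \<noteq> 0"
  shows "Hex (l, p) = Hsum (k_of \<theta> l p) p"
  using Faddeev_eq_Hsum[OF frame.k_of_in_Sigma[OF frame[OF assms(1)] assms(2)]] by simp

lemma Hex_lam_of:
  assumes s: "s \<notin> axis_line \<nu>" and k: "k \<in> Sigma_var" "denom k (- s) = 0"
  shows "Hex (lam_of \<theta> k s, s) = Hsum k s"
  using Hex_eq[OF s frame.lam_of_nonzero_k_of_lam_of(1)[OF frame[OF s] k]]
    frame.lam_of_nonzero_k_of_lam_of(2)[OF frame[OF s] k] by simp

text \<open>\<open>dbar_equation\<close> is used with \<eta> = p. Then (k, - \<xi>) and (k + \<xi>,
  p + \<xi>) both lie on \<Omega>, so \<open>lam_of\<close> leads back to k and k + \<xi>, and the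
  samples of H in the bilinear form are the two factors of \<open>prodh\<close>.\<close>

lemma Hex_equation:
  assumes p: "p \<notin> axis_line \<nu>"
  shows "l \<noteq> 0 \<Longrightarrow> Hex (l, p) = v p + N_op \<theta> Hex (l, p)"
    and "((\<lambda>l. Hex (l, p)) \<longlongrightarrow> v p) at_infinity"
proof -
  interpret G: faddeev_frame \<mu> C c\<^sub>1 v \<theta> p
    by (intro faddeev_frame.intro frame[OF p]) unfold_locales
  let ?K = "\<lambda>y. G.jker y * G.prodh p y"
  have Hb: "Hbound \<ge> 0"
    by (rule Hbound_nonneg)
  have K: "strip_dominated (Hbound * Hbound * G.pconst) ?K"
  proof (rule G.strip_dominated_jker_mult)
    fix y :: "complex \<times> real" assume y: "fst y \<noteq> 0"
    have "norm (Hsum (G.kk' y) (p + G.xi y)) \<le> Hbound * wt \<mu> (p + G.xi y)"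
      by (rule Hsum_bound[OF G.kk'_Sigma[OF y]])
    also have "\<dots> \<le> Hbound * 1"
      using mu Hb by (intro mult_left_mono wt_le_1) auto
    finally have b1: "norm (Hsum (G.kk' y) (p + G.xi y)) \<le> Hbound"
      by simp
    have "norm (Hsum (G.kk y) (- G.xi y)) \<le> Hbound * wt \<mu> (- G.xi y)"
      by (rule Hsum_bound[OF G.k_of_in_Sigma[OF y]])
    also have "\<dots> \<le> Hbound * (1 / (1 + norm (- G.xi y))\<^sup>2)"
      using mu Hb by (intro mult_left_mono wt_le_square) auto
    finally have b2: "norm (Hsum (G.kk y) (- G.xi y)) \<le> Hbound / (1 + norm (G.xi y))\<^sup>2"
      by simp
    have "norm (G.prodh p y) \<le> Hbound * (Hbound / (1 + norm (G.xi y))\<^sup>2)"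
      unfolding G.prodh_def norm_mult using Hb by (intro mult_mono b1 b2) auto
    then show "norm (G.prodh p y) \<le> Hbound * Hbound / (1 + norm (G.xi y))\<^sup>2"
      by simp
  next
    show "G.prodh p \<in> borel_measurable borel"
      unfolding G.prodh_def[abs_def] by measurable
  qed (use Hb in simp)
  have I: "I_op \<theta> Hex Hex (l, p) = cauchy_transform ?K l" for l
  proof (rule I_op_eq_cauchy_transform[OF p K])
    show "AE y in lborel. snd y \<in> {-pi..pi} \<longrightarrow> ?K y = jker_at p y *
      (Hex (lam_of \<theta> (G.kk y) (- G.xi y), - G.xi y) * Hex (lam_of \<theta> (G.kk' y) (p + G.xi y), p + G.xi y))"
      using AE_circle_off_axis[OF p] AE_fst_neq[of 0]
    proof eventually_elim
      case (elim y)
      note k = G.k_of_in_Sigma[OF elim(2)] G.denom_xi[OF elim(2)] G.denom_k_of_uminus_p[of "fst y"]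
      show ?case
      proof
        assume "snd y \<in> {-pi..pi}"
        then have off: "- G.xi y \<notin> axis_line \<nu>" "p + G.xi y \<notin> axis_line \<nu>"
          using elim(1) by auto
        have "Hex (lam_of \<theta> (G.kk y) (- G.xi y), - G.xi y) = Hsum (G.kk y) (- G.xi y)"
          by (rule Hex_lam_of[OF off(1) k(1)]) (simp add: k(2))
        moreover have "Hex (lam_of \<theta> (G.kk' y) (p + G.xi y), p + G.xi y) = Hsum (G.kk' y) (p + G.xi y)"
          by (rule Hex_lam_of[OF off(2) Sigma_var_add_cvec[OF k(1,2)] denom_shift_variety[OF k(2,3)]])
        ultimately show "?K y = jker_at p y *
          (Hex (lam_of \<theta> (G.kk y) (- G.xi y), - G.xi y) * Hex (lam_of \<theta> (G.kk' y) (p + G.xi y), p + G.xi y))"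
          by (simp only: G.prodh_def G.jker_eq_jker_at mult.commute)
      qed
    qed
  qed
  have eq: "Hex (l, p) = v p + cauchy_transform ?K l" if "l \<noteq> 0" for l
    using Hex_eq[OF p that] G.dbar_equation[OF that, of p] by simp
  then show "l \<noteq> 0 \<Longrightarrow> Hex (l, p) = v p + N_op \<theta> Hex (l, p)"
    by (simp add: N_op_def I)
  have "((\<lambda>l. v p + cauchy_transform ?K l) \<longlongrightarrow> v p + 0) at_infinity"
    by (rule tendsto_add[OF tendsto_const cauchy_transform_at_infinity[OF K]])
  then have "((\<lambda>l. v p + cauchy_transform ?K l) \<longlongrightarrow> v p) at_infinity"
    by simp
  moreover have "\<forall>\<^sub>F l::complex in at_infinity. v p + cauchy_transform ?K l = Hex (l, p)"
    using eventually_not_equal_at_infinity[of "0::complex"] by eventually_elim (rule eq[symmetric])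
  ultimately show "((\<lambda>l. Hex (l, p)) \<longlongrightarrow> v p) at_infinity"
    by (rule Lim_transform_eventually)
qed

text \<open>The equation is evaluated at the single parameter \<lambda> =
  \<open>lam0 \<theta> \<gamma> p\<close>, where k is the point \<open>k0\<close> that defines R.
  This is possible because it holds at every nonzero \<lambda>.\<close>

lemma v_eq_v_rec:
  assumes p: "p \<notin> axis_line \<nu>"
  shows "v p = v_rec \<theta> \<gamma> Rex Hex p"
proof -
  have "Rex p = v p + N_op \<theta> Hex (lam0 \<theta> \<gamma> p, p)"
    using Hex_equation(1)[OF p lam0_coordinate(1)[OF p]] Hex_eq[OF p lam0_coordinate(1)[OF p]]
    unfolding lam0_coordinate(2)[OF p] Rex_eq by simp
  then show ?thesis
    by (simp add: v_rec_def)
qed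

lemma Hex_ess_wbounded: "ess_wbounded \<mu> Hbound Hex"
proof -
  have ae: "AE x in lborel. snd x \<notin> axis_line \<nu> \<and> fst x \<noteq> (0::complex)"
    using AE_LP_dom[of \<nu>] by eventually_elim (auto simp: LP_dom_def)
  have "(\<lambda>x. Hsum (k_of th (fst x) (snd x)) (snd x)) \<in> borel_measurable borel"
    by measurable
  then have m: "(\<lambda>x. Hsum (k_of th (fst x) (snd x)) (snd x)) \<in> borel_measurable (lebesgue :: (complex \<times> (real^3)) measure)"
    by (intro measurable_completion) simp
  have eq: "AE x in lebesgue. Hsum (k_of th (fst x) (snd x)) (snd x) = Hex x"
  proof (rule AE_completion)
    show "AE x in lborel. Hsum (k_of th (fst x) (snd x)) (snd x) = Hex x"
      using ae
    proof eventually_elim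
      case (elim x)
      then show ?case
        using Hex_eq[of "snd x" "fst x"] coordinates_cong(3)[of \<theta> "snd x" th] th_eq[of "snd x"] by simp
    qed
  qed
  have "AE x in lborel. norm (Hex x) \<le> Hbound * wt \<mu> (snd x)"
    using ae
  proof eventually_elim
    case (elim x)
    have "norm (Hsum (k_of \<theta> (fst x) (snd x)) (snd x)) \<le> Hbound * wt \<mu> (snd x)"
      using elim by (intro Hsum_bound frame.k_of_in_Sigma frame) auto
    then show ?case
      using Hex_eq[of "snd x" "fst x"] elim by simp
  qed
  with borel_measurable_AE[OF m eq] Hbound_nonneg show ?thesis
    by (simp add: ess_wbounded_def)
qed

text \<open>Since \<open>1 - c\<^sub>1 * C\<close> is positive, this is the smallness condition
  \<open>C * (c\<^sub>1 + 8 * c\<^sub>6) < 1\<close> rearranged.\<close>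

lemma contraction: "8 * c\<^sub>6 * Hbound < 1"
proof -
  have "C * (c\<^sub>1 + 8 * c\<^sub>6) < 1"
    using C_less c1_pos c6_pos by (simp add: pos_less_divide_eq)
  then show ?thesis
    using small by (simp add: Hbound_def algebra_simps)
qed

sublocale inv: inversion \<nu> \<theta> \<mu> c\<^sub>6 \<gamma> Hbound
  by unfold_locales (use gamma_meas Hbound_nonneg contraction in auto)

lemma datum_Rex: "inv.datum Rex"
  unfolding inv.datum_def using Rex_measurable Rex_bound by simp

lemma fixed_point_Hex: "inv.fixed_point Rex Hex"
proof -
  have "AE x in lborel. Hex x = eq_rhs \<theta> \<gamma> Rex Hex x"
    using AE_LP_dom[of \<nu>]
  proof eventually_elim
    case (elim x)
    show ?case
    proof (cases x)
      case (Pair l p)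
      with elim have x: "l \<noteq> 0" "p \<notin> axis_line \<nu>"
        by (auto simp: LP_dom_def)
      show ?thesis
        using Hex_equation(1)[OF x(2,1)] v_eq_v_rec[OF x(2)] by (simp add: Pair eq_rhs_def M_op_def v_rec_def)
    qed
  qed
  then show ?thesis
    using ess_wbounded_mono[OF Hex_ess_wbounded, of "2 * Hbound"] Hbound_nonneg by (simp add: inv.fixed_point_def)
qed

lemma inverse_contraction_constant: "1 / (1 - inv.q) = (1 - c\<^sub>1 * C) / (1 - (c\<^sub>1 + 8 * c\<^sub>6) * C)"
proof -
  have "C * (c\<^sub>1 + 8 * c\<^sub>6) < 1"
    using C_less c1_pos c6_pos by (simp add: pos_less_divide_eq)
  then have "1 - c\<^sub>1 * C \<noteq> 0" "1 - (c\<^sub>1 + 8 * c\<^sub>6) * C \<noteq> 0"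
    using small by (auto simp: mult.commute)
  moreover have "1 - inv.q = (1 - (c\<^sub>1 + 8 * c\<^sub>6) * C) / (1 - c\<^sub>1 * C)"
    using \<open>1 - c\<^sub>1 * C \<noteq> 0\<close> unfolding inv.q_def unfolding Hbound_def by (simp add: divide_simps) (simp add: algebra_simps)
  ultimately show ?thesis
    by simp
qed

lemma stability_v:
  assumes R: "inv.datum R'" and U: "inv.fixed_point R' U" and d: "d \<ge> 0" "AE p in lborel. norm (Rex p - R' p) \<le> d * wt \<mu> p"
  shows "AE p in lborel. norm (v p - v_rec \<theta> \<gamma> R' U p) \<le> (1 - c\<^sub>1 * C) / (1 - (c\<^sub>1 + 8 * c\<^sub>6) * C) * d * wt \<mu> p"
  using inv.fixed_point_stability[OF datum_Rex fixed_point_Hex R U d] AE_not_axis[of \<nu>]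
proof eventually_elim
  case (elim p)
  have "d / (1 - inv.q) = (1 - c\<^sub>1 * C) / (1 - (c\<^sub>1 + 8 * c\<^sub>6) * C) * d"
    unfolding inverse_contraction_constant[symmetric] by simp
  then show ?case
    using elim v_eq_v_rec[of p] by simp
qed

end

theorem theorem2p1:
  fixes \<mu> C c\<^sub>1 c\<^sub>6 r :: real
    and \<nu> :: "real^3"
    and \<theta> \<gamma> :: "real^3 \<Rightarrow> real^3"
    and v R :: "real^3 \<Rightarrow> complex"
    and H :: "complex \<times> (real^3) \<Rightarrow> complex"
  assumes mu: "\<mu> \<ge> 2"
    and nu: "norm \<nu> = 1"
    and theta_smooth: "smooth_map_on \<theta> (UNIV - axis_line \<nu>)"
    and theta: "\<And>p. p \<notin> axis_line \<nu> \<Longrightarrow> norm (\<theta> p) = 1 \<and> \<theta> p \<bullet> p = 0"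
    and c1_pos: "c\<^sub>1 > 0"
    and c1: "\<And>k w U. k \<in> Sigma_var \<Longrightarrow> w \<in> Linf \<mu> \<Longrightarrow> U \<in> Linf \<mu> \<Longrightarrow>
               wnorm \<mu> (A_op w k U) \<le> ereal c\<^sub>1 * wnorm \<mu> w * wnorm \<mu> U"
    and c6_pos: "c\<^sub>6 > 0"
    and c6: "\<And>U\<^sub>1 U\<^sub>2. U\<^sub>1 \<in> Linf2 \<mu> \<nu> \<Longrightarrow> U\<^sub>2 \<in> Linf2 \<mu> \<nu> \<Longrightarrow>
               wnorm2 \<mu> \<nu> (I_op \<theta> U\<^sub>1 U\<^sub>2) \<le> ereal c\<^sub>6 * wnorm2 \<mu> \<nu> U\<^sub>1 * wnorm2 \<mu> \<nu> U\<^sub>2"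
    and v_Linf: "v \<in> Linf \<mu>"
    and v_norm: "wnorm \<mu> v \<le> ereal C"
    and C_less: "C < 1 / (c\<^sub>1 + 8 * c\<^sub>6)"
    and v_cont: "continuous_on UNIV v"
    and gamma_meas: "\<gamma> \<in> borel_measurable lebesgue"
    and gamma: "\<And>p. norm (\<gamma> p) = 1 \<and> \<gamma> p \<bullet> p = 0"
    and R_def: "R = R_data \<mu> \<gamma> v"
    and H_def: "H = (\<lambda>(l::complex, p::real^3). Faddeev \<mu> v (k_of \<theta> l p) p)"
    and r_def: "r = 2 * C / (1 - c\<^sub>1 * C)"
  shows
    "R \<in> Linf \<mu> \<and> wnorm \<mu> R \<le> ereal (C / (1 - c\<^sub>1 * C))
     \<and> is_unique_solution \<mu> \<nu> \<theta> \<gamma> r R H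
     \<and> approx_converges \<mu> \<nu> \<theta> \<gamma> R H
     \<and> (\<forall>p. p \<notin> axis_line \<nu> \<longrightarrow>
           ((\<lambda>l::complex. H (l, p)) \<longlongrightarrow> v p) at_infinity \<and> v p = v_rec \<theta> \<gamma> R H p)
     \<and> (\<forall>w. w \<in> Linf \<mu> \<and> wnorm \<mu> w \<le> ereal C \<and> continuous_on UNIV w \<and>
             (AE p in lebesgue. R_data \<mu> \<gamma> w p = R p) \<longrightarrow> w = v)
     \<and> (\<forall>R\<^sub>a. R\<^sub>a \<in> Linf \<mu> \<and> wnorm \<mu> R\<^sub>a \<le> ereal (C / (1 - c\<^sub>1 * C)) \<longrightarrow>
           (\<exists>H\<^sub>a. is_unique_solution \<mu> \<nu> \<theta> \<gamma> r R\<^sub>a H\<^sub>a \<and> approx_converges \<mu> \<nu> \<theta> \<gamma> R\<^sub>a H\<^sub>a) \<and>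
           (\<forall>H\<^sub>a. is_solution \<mu> \<nu> \<theta> \<gamma> r R\<^sub>a H\<^sub>a \<longrightarrow>
              has_ess_limit H\<^sub>a (v_rec \<theta> \<gamma> R\<^sub>a H\<^sub>a) \<and>
              wnorm \<mu> (\<lambda>p. v p - v_rec \<theta> \<gamma> R\<^sub>a H\<^sub>a p)
                \<le> ereal ((1 - c\<^sub>1 * C) / (1 - (c\<^sub>1 + 8 * c\<^sub>6) * C)) * wnorm \<mu> (\<lambda>p. R p - R\<^sub>a p)))"
proof -
  have C0: "0 \<le> C"
    using order_trans[OF wnorm_nonneg v_norm] by simp
  have "C * (c\<^sub>1 + 8 * c\<^sub>6) < 1"
    using C_less c1_pos c6_pos by (simp add: pos_less_divide_eq)
  moreover have "0 \<le> C * (8 * c\<^sub>6)"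
    using C0 c6_pos by simp
  ultimately have c1C: "c\<^sub>1 * C < 1"
    by (simp add: algebra_simps)
  have cont: "continuous_on (UNIV - axis_line \<nu>) \<theta>"
    using theta_smooth unfolding smooth_map_on_def by (metis times_diff_on.simps(1))
  \<comment> \<open>Stated for arbitrary w, since the uniqueness of the potential compares two
    instances.\<close>
  have direct: "direct \<nu> \<theta> \<mu> C c\<^sub>1 c\<^sub>6 w \<gamma>" if "wnorm \<mu> w \<le> ereal C" "continuous_on UNIV w" for w
    by unfold_locales fact+
  interpret D: direct \<nu> \<theta> \<mu> C c\<^sub>1 c\<^sub>6 v \<gamma>
    by (rule direct[OF v_norm v_cont])
  have R: "R = D.Rex" and H: "H = D.Hex" and r: "r = 2 * D.Hbound"
    unfolding R_def H_def r_def D.Hbound_def by auto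
  have bound: "C / (1 - c\<^sub>1 * C) = D.Hbound"
    by (simp add: D.Hbound_def)
  have datum: "D.inv.datum R'" if "R' \<in> Linf \<mu>" "wnorm \<mu> R' \<le> ereal (C / (1 - c\<^sub>1 * C))" for R'
    using that wnorm_leD[OF that(2)] unfolding D.inv.datum_def bound by (simp add: Linf_def)
  have R_Linf: "R \<in> Linf \<mu>"
    unfolding R by (rule LinfI[OF D.Rex_measurable, of D.Hbound]) (use D.Rex_bound in simp)
  have "wnorm \<mu> R \<le> ereal (C / (1 - c\<^sub>1 * C))"
    unfolding R bound by (rule wnorm_le[OF D.Rex_measurable]) (use D.Rex_bound in simp)
  moreover have "is_unique_solution \<mu> \<nu> \<theta> \<gamma> r R H" "approx_converges \<mu> \<nu> \<theta> \<gamma> R H"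
    unfolding R H r
    by (intro D.inv.unique_solution D.inv.approx_converges_fixed_point D.datum_Rex D.fixed_point_Hex)+
  moreover have "\<forall>p. p \<notin> axis_line \<nu> \<longrightarrow>
           ((\<lambda>l::complex. H (l, p)) \<longlongrightarrow> v p) at_infinity \<and> v p = v_rec \<theta> \<gamma> R H p"
    unfolding R H using D.Hex_equation(2) D.v_eq_v_rec by blast
  \<comment> \<open>The Faddeev function of w solves the equation with the data of w, which are
    those of v. The stability estimate with d = 0 gives v = w almost everywhere, and continuity
    gives it everywhere.\<close>
  moreover have "w = v" if w: "wnorm \<mu> w \<le> ereal C" "continuous_on UNIV w" and eq: "AE p in lebesgue. R_data \<mu> \<gamma> w p = R p" for w
  proof
    fix p
    interpret W: direct \<nu> \<theta> \<mu> C c\<^sub>1 c\<^sub>6 w \<gamma>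
      by (rule direct[OF w])
    have "AE p in lborel. norm (D.Rex p - W.Rex p) \<le> 0 * wt \<mu> p"
      using AE_completion_iff[THEN iffD1, OF eq] unfolding R by eventually_elim simp
    \<comment> \<open>Data and fixed points refer to the potential only through the bound
      \<open>Hbound\<close>, which is the same for v and w.\<close>
    moreover have "D.inv.datum W.Rex" "D.inv.fixed_point W.Rex W.Hex"
      using W.datum_Rex W.fixed_point_Hex by (simp_all add: D.Hbound_def W.Hbound_def)
    ultimately have "AE p in lborel. norm (v p - v_rec \<theta> \<gamma> W.Rex W.Hex p) \<le> (1 - c\<^sub>1 * C) / (1 - (c\<^sub>1 + 8 * c\<^sub>6) * C) * 0 * wt \<mu> p"
      by (intro D.stability_v) auto
    then have "AE p in lborel. norm (v p - w p) \<le> 0"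
      using AE_not_axis[of \<nu>] by eventually_elim (use W.v_eq_v_rec in auto)
    then have "norm (v p - w p) \<le> 0"
      by (rule AE_lborel_closed) (intro continuous_intros v_cont w(2))+
    then show "w p = v p"
      by simp
  qed
  moreover have "\<exists>H\<^sub>a. is_unique_solution \<mu> \<nu> \<theta> \<gamma> r R\<^sub>a H\<^sub>a \<and> approx_converges \<mu> \<nu> \<theta> \<gamma> R\<^sub>a H\<^sub>a"
    if R\<^sub>a: "R\<^sub>a \<in> Linf \<mu>" "wnorm \<mu> R\<^sub>a \<le> ereal (C / (1 - c\<^sub>1 * C))" for R\<^sub>a
  proof -
    obtain U where "D.inv.fixed_point R\<^sub>a U"
      by (rule D.inv.fixed_point_exists[OF datum[OF R\<^sub>a]])
    then show ?thesis
      unfolding r using D.inv.unique_solution[OF datum[OF R\<^sub>a]] D.inv.approx_converges_fixed_point[OF datum[OF R\<^sub>a]] by blast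
  qed
  moreover have "has_ess_limit H\<^sub>a (v_rec \<theta> \<gamma> R\<^sub>a H\<^sub>a)"
    "wnorm \<mu> (\<lambda>p. v p - v_rec \<theta> \<gamma> R\<^sub>a H\<^sub>a p)
       \<le> ereal ((1 - c\<^sub>1 * C) / (1 - (c\<^sub>1 + 8 * c\<^sub>6) * C)) * wnorm \<mu> (\<lambda>p. R p - R\<^sub>a p)"
    if R\<^sub>a: "R\<^sub>a \<in> Linf \<mu>" "wnorm \<mu> R\<^sub>a \<le> ereal (C / (1 - c\<^sub>1 * C))" and sol: "is_solution \<mu> \<nu> \<theta> \<gamma> r R\<^sub>a H\<^sub>a" for R\<^sub>a H\<^sub>a
  proof -
    have da: "D.inv.datum R\<^sub>a"
      by (rule datum[OF R\<^sub>a])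
    have fp: "D.inv.fixed_point R\<^sub>a H\<^sub>a"
      using sol unfolding r D.inv.is_solution_iff .
    show "has_ess_limit H\<^sub>a (v_rec \<theta> \<gamma> R\<^sub>a H\<^sub>a)"
      by (rule D.inv.ess_limit[OF da fp])
    have Rm: "R \<in> borel_measurable lebesgue" "R\<^sub>a \<in> borel_measurable lebesgue"
      using R_Linf R\<^sub>a by (auto simp: Linf_def)
    have ae: "AE p in lborel. norm (R p) \<le> D.Hbound * wt \<mu> p" "AE p in lborel. norm (R\<^sub>a p) \<le> D.Hbound * wt \<mu> p"
      using D.datum_Rex da unfolding R D.inv.datum_def by auto
    have "AE p in lborel. norm (R p - R\<^sub>a p) \<le> (D.Hbound + D.Hbound) * wt \<mu> p"
      using ae by eventually_elim (simp add: distrib_right norm_triangle_le_diff)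
    then have "(\<lambda>p. R p - R\<^sub>a p) \<in> Linf \<mu>"
      by (intro LinfI borel_measurable_diff Rm)
    then obtain d where d: "d \<ge> 0" "wnorm \<mu> (\<lambda>p. R p - R\<^sub>a p) = ereal d"
      by (rule LinfE)
    have "AE p in lborel. norm (R p - R\<^sub>a p) \<le> d * wt \<mu> p"
      by (rule wnorm_leD) (simp add: d)
    then have st: "AE p in lborel. norm (v p - v_rec \<theta> \<gamma> R\<^sub>a H\<^sub>a p) \<le> (1 - c\<^sub>1 * C) / (1 - (c\<^sub>1 + 8 * c\<^sub>6) * C) * d * wt \<mu> p"
      unfolding R by (rule D.stability_v[OF da fp d(1)])
    have "v \<in> borel_measurable lebesgue"
      using v_Linf by (simp add: Linf_def)
    then have "wnorm \<mu> (\<lambda>p. v p - v_rec \<theta> \<gamma> R\<^sub>a H\<^sub>a p) \<le> ereal ((1 - c\<^sub>1 * C) / (1 - (c\<^sub>1 + 8 * c\<^sub>6) * C) * d)"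
      by (intro wnorm_le st borel_measurable_diff D.inv.v_rec_measurable[OF da fp])
    then show "wnorm \<mu> (\<lambda>p. v p - v_rec \<theta> \<gamma> R\<^sub>a H\<^sub>a p)
       \<le> ereal ((1 - c\<^sub>1 * C) / (1 - (c\<^sub>1 + 8 * c\<^sub>6) * C)) * wnorm \<mu> (\<lambda>p. R p - R\<^sub>a p)"
      by (simp add: d)
  qed
  ultimately show ?thesis
    using R_Linf by (intro conjI allI impI) blast+
qed

end
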